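(* Let the jump function $\xi$ satisfy the standing assumptions in the context, let $\rho>0$, and let $\alpha_j=\gamma\log j$ for $j\ge1$, with $\gamma>0$. Let $\rho_{\rm c}=\sum_{j\ge1}e^{-\alpha_j}\int_{\mathbb{R}^d}e^{-j\varepsilon(k)}\,dk$ be the critical density. Then: (a) the fraction of points in infinite cycles is $\nu=\max\bigl(0,\,1-\frac{\rho_{\rm c}}{\rho}\bigr)$; (b) when $\nu>0$, i.e. when $\rho>\rho_{\rm c}$, there is a single giant cycle that contains almost all points in infinite cycles: in the thermodynamic limit $|\Lambda|,N\to\infty$ with $N/|\Lambda|=\rho$, $$\frac{\ell^{(1)}}{\nu N}\Rightarrow 1 .$$
   Context: **Jump function.** Let $d\ge1$ and $\xi:\mathbb{R}^d\to\mathbb{R}\cup\{+\infty\}$ be such that $e^{-\xi}$ is continuous, $\int_{\mathbb{R}^d}e^{-\xi(x)}dx=1$, and the Fourier transform of $e^{-\xi}$ is positive. Define $\varepsilon(k)$, $k\in\mathbb{R}^d$, by $e^{-\varepsilon(k)}=\int_{\mathbb{R}^d}e^{-2\pi i k\cdot x}e^{-\xi(x)}dx$. Assume $e^{-\varepsilon(k)}$ is uniformly continuous on $\mathbb{R}^d$, and that there are $a>0$ and $\eta<d$ with $\varepsilon(k)\ge a\|k\|^\eta$ for all sufficiently small $k$. For $L>0$ let $\Lambda\subset\mathbb{R}^d$ be a cubic box of side length $L$, $|\Lambda|=L^d$, $\Lambda^*=\frac1L\mathbb{Z}^d$, and define $\xi_\Lambda$ by $e^{-\xi_\Lambda(x)}=\sum_{z\in\mathbb{Z}^d}e^{-\xi(x-Lz)}$.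 Assume moreover that $e^{-\xi_\Lambda}$ is a continuous function for all $L$ large enough, and that $\lim_{L\to\infty}\frac1{|\Lambda|}\sum_{k\in\Lambda^*}e^{-\varepsilon(k)}=\int_{\mathbb{R}^d}e^{-\varepsilon(k)}dk$. **Spatial random permutations.** Let $\mathcal{S}_N$ be the symmetric group on $\{1,\dots,N\}$ and $r_\ell(\pi)$ the number of cycles of length $\ell$ of $\pi\in\mathcal{S}_N$. On $\Lambda^N\times\mathcal{S}_N$ set $H_\Lambda(\boldsymbol{x},\pi)=\sum_{i=1}^N\xi_\Lambda(x_i-x_{\pi(i)})+\sum_{\ell\ge1}\alpha_\ell r_\ell(\pi)$ and consider the probability measure $\mathrm{Prob}(d\boldsymbol{x},\pi)=\frac1{N!\,Y}e^{-H_\Lambda(\boldsymbol{x},\pi)}d\boldsymbol{x}$, with $d\boldsymbol{x}$ Lebesgue measure on $\Lambda^N$ and $Y=\frac1{N!}\sum_{\pi\in\mathcal{S}_N}\int_{\Lambda^N}e^{-H_\Lambda(\boldsymbol{x},\pi)}d\boldsymbol{x}$; $E$ denotes its expectation. Let $\ell^{(1)}(\pi)\ge\ell^{(2)}(\pi)\ge\cdots$ be the cycle lengths of $\pi$ in non-increasing order, repeated with multiplicities. **Thermodynamic limit.** $|\Lambda|,N\to\infty$ means that both go to infinity with $N/|\Lambda|=\rho$ fixed. **Fraction in infinite cycles.** $\nu_K=\liminf_{|\Lambda|,N\to\infty}E\bigl(\frac1N\sum_{i:\ell^{(i)}>K}\ell^{(i)}\bigr)$ and $\nu=\lim_{K\to\infty}\nu_K$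 (the limit exists since $\nu_K$ is non-increasing in $K$ and bounded). The symbol $\Rightarrow$ denotes convergence in distribution. *)

theory Defs
  imports "HOL-Probability.Probability" "HOL-Combinatorics.Orbits"
begin

text \<open>
  Exponential on the extended reals. Energies take values in \<open>ereal\<close>, Boltzmann weights in
  \<open>ennreal\<close>, so that no value of the energy has to be excluded by convention.
\<close>

definition exp_ereal :: "ereal \<Rightarrow> ennreal" where
  "exp_ereal x = (if x = \<infinity> then \<infinity> else if x = -\<infinity> then 0 else ennreal (exp (real_of_ereal x)))"

lemma exp_ereal_simps [simp]:
  "exp_ereal (ereal r) = ennreal (exp r)" "exp_ereal \<infinity> = \<infinity>" "exp_ereal (-\<infinity>) = 0"
  by (simp_all add: exp_ereal_def)

lemma bij_exp_ereal: "bij exp_ereal"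
proof (rule bijI)
  show "inj exp_ereal"
  proof (rule injI)
    fix x y assume "exp_ereal x = exp_ereal y"
    then show "x = y"
      by (cases x; cases y) (simp_all add: ennreal_eq_0_iff not_le)
  qed
  have "\<exists>x. y = exp_ereal x" for y
  proof (cases y)
    case (real r)
    then have "y = exp_ereal (if r = 0 then -\<infinity> else ereal (ln r))" by simp
    then show ?thesis ..
  next
    case top
    then show ?thesis by (intro exI[of _ \<infinity>]) simp
  qed
  then show "surj exp_ereal" by (auto simp: surj_def)
qed

definition int_lattice :: "(real ^ 'd) set" where
  "int_lattice = {z. \<forall>i. z $ i \<in> \<int>}"

definition dual_lattice :: "real \<Rightarrow> (real ^ 'd) set" where
  "dual_lattice L = (\<lambda>z. (1 / L) *\<^sub>R z) ` int_lattice"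

text \<open>The cubic box of side length \<open>L\<close> whose lower corner is \<open>c\<close>.\<close>

definition box_at :: "real ^ 'd \<Rightarrow> real \<Rightarrow> (real ^ 'd) set" where
  "box_at c L = {x. \<forall>i. c $ i \<le> x $ i \<and> x $ i \<le> c $ i + L}"

definition fourier_weight :: "(real ^ 'd \<Rightarrow> ereal) \<Rightarrow> real ^ 'd \<Rightarrow> complex" where
  "fourier_weight \<xi> k =
     (LINT x|lborel. exp (- (2 * pi * \<i> * (k \<bullet> x))) * of_real (enn2real (exp_ereal (- \<xi> x))))"

text \<open>
  The function \<open>\<epsilon>\<close>, defined by \<open>exp (- \<epsilon> k) = fourier_weight \<xi> k\<close>; it is only used when the
  transform is real and strictly positive.
\<close>

definition dispersion :: "(real ^ 'd \<Rightarrow> ereal) \<Rightarrow> real ^ 'd \<Rightarrow> real" where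
  "dispersion \<xi> k = - ln (Re (fourier_weight \<xi> k))"

definition periodized :: "(real ^ 'd \<Rightarrow> ereal) \<Rightarrow> real \<Rightarrow> real ^ 'd \<Rightarrow> ereal" where
  "periodized \<xi> L x =
     (THE y. exp_ereal (- y) = (\<Sum>\<^sub>\<infinity>z\<in>int_lattice. exp_ereal (- \<xi> (x - L *\<^sub>R z))))"

lemma exp_ereal_periodized:
  "exp_ereal (- periodized \<xi> L x) = (\<Sum>\<^sub>\<infinity>z\<in>int_lattice. exp_ereal (- \<xi> (x - L *\<^sub>R z)))"
proof -
  obtain w where w: "(\<Sum>\<^sub>\<infinity>z\<in>int_lattice. exp_ereal (- \<xi> (x - L *\<^sub>R z))) = exp_ereal w"
    using bij_is_surj[OF bij_exp_ereal] by (rule surjE)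
  have eq: "exp_ereal (- y) = exp_ereal w \<longleftrightarrow> y = - w" for y
    unfolding inj_eq[OF bij_is_inj[OF bij_exp_ereal]] by (cases y; cases w) auto
  have "periodized \<xi> L x = - w"
    unfolding periodized_def w eq by simp
  then show ?thesis by (simp add: w)
qed

text \<open>
  Standing assumptions on the jump function. The dimension is \<open>CARD('d)\<close>. Continuity of the
  \<open>ennreal\<close>-valued weights together with their finiteness is continuity as real functions.
\<close>

definition jump_function :: "(real ^ 'd \<Rightarrow> ereal) \<Rightarrow> bool" where
  "jump_function \<xi> \<longleftrightarrow>
     (\<forall>x. \<xi> x \<noteq> -\<infinity>) \<and>
     continuous_on UNIV (\<lambda>x. exp_ereal (- \<xi> x)) \<and>
     (\<integral>\<^sup>+x. exp_ereal (- \<xi> x) \<partial>lborel) = 1 \<and>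
     (\<forall>k. fourier_weight \<xi> k \<in> \<real> \<and> 0 < Re (fourier_weight \<xi> k)) \<and>
     uniformly_continuous_on UNIV (\<lambda>k. exp (- dispersion \<xi> k)) \<and>
     (\<exists>a>0. \<exists>\<eta><real CARD('d). \<exists>\<delta>>0. \<forall>k. norm k < \<delta> \<longrightarrow> a * norm k powr \<eta> \<le> dispersion \<xi> k) \<and>
     (\<forall>\<^sub>F L in at_top.
        (\<forall>x. periodized \<xi> L x \<noteq> -\<infinity>) \<and>
        continuous_on UNIV (\<lambda>x. exp_ereal (- periodized \<xi> L x))) \<and>
     ((\<lambda>L. (\<Sum>\<^sub>\<infinity>k\<in>dual_lattice L. exp (- dispersion \<xi> k)) / L ^ CARD('d))
        \<longlongrightarrow> (LINT k|lborel. exp (- dispersion \<xi> k))) at_top"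

text \<open>The orbit of a fixed point is a singleton, so fixed points are cycles of length one.\<close>

definition cycles_of :: "nat \<Rightarrow> (nat \<Rightarrow> nat) \<Rightarrow> nat set set" where
  "cycles_of N \<pi> = orbit \<pi> ` {1..N}"

definition cycle_count :: "nat \<Rightarrow> (nat \<Rightarrow> nat) \<Rightarrow> nat \<Rightarrow> nat" where
  "cycle_count N \<pi> l = card {C \<in> cycles_of N \<pi>. card C = l}"

text \<open>
  Cycle lengths in non-increasing order, with multiplicities. List indices start at zero, so
  the \<open>i\<close>-th longest cycle has length \<open>cycle_lengths N \<pi> ! (i - 1)\<close>.
\<close>

definition cycle_lengths :: "nat \<Rightarrow> (nat \<Rightarrow> nat) \<Rightarrow> nat list" where
  "cycle_lengths N \<pi> = rev (sorted_list_of_multiset (image_mset card (mset_set (cycles_of N \<pi>))))"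

definition longest_cycle :: "nat \<Rightarrow> (nat \<Rightarrow> nat) \<Rightarrow> nat" where
  "longest_cycle N \<pi> = cycle_lengths N \<pi> ! 0"

definition points_in_long_cycles :: "nat \<Rightarrow> (nat \<Rightarrow> nat) \<Rightarrow> nat \<Rightarrow> nat" where
  "points_in_long_cycles N \<pi> K =
     (\<Sum>i | i < length (cycle_lengths N \<pi>) \<and> cycle_lengths N \<pi> ! i > K. cycle_lengths N \<pi> ! i)"

text \<open>Cycles of a permutation of \<open>{1..N}\<close> have length at most \<open>N\<close>, whence the range of \<open>l\<close>.\<close>

definition hamiltonian ::
  "(real ^ 'd \<Rightarrow> ereal) \<Rightarrow> (nat \<Rightarrow> real) \<Rightarrow> real \<Rightarrow> nat \<Rightarrow> (nat \<Rightarrow> real ^ 'd) \<Rightarrow> (nat \<Rightarrow> nat) \<Rightarrow> ereal"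
where
  "hamiltonian \<xi> \<alpha> L N x \<pi> =
     (\<Sum>i=1..N. periodized \<xi> L (x i - x (\<pi> i))) + ereal (\<Sum>l=1..N. \<alpha> l * real (cycle_count N \<pi> l))"

definition position_space :: "real ^ 'd \<Rightarrow> real \<Rightarrow> nat \<Rightarrow> (nat \<Rightarrow> real ^ 'd) measure" where
  "position_space c L N = (\<Pi>\<^sub>M i\<in>{1..N}. restrict_space lborel (box_at c L))"

definition partition_function ::
  "(real ^ 'd \<Rightarrow> ereal) \<Rightarrow> (nat \<Rightarrow> real) \<Rightarrow> real ^ 'd \<Rightarrow> real \<Rightarrow> nat \<Rightarrow> ennreal" where
  "partition_function \<xi> \<alpha> c L N =
     (\<Sum>\<pi> | \<pi> permutes {1..N}.
        \<integral>\<^sup>+x. exp_ereal (- hamiltonian \<xi> \<alpha> L N x \<pi>) \<partial>position_space c L N) / fact N"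

definition spatial_permutation ::
  "(real ^ 'd \<Rightarrow> ereal) \<Rightarrow> (nat \<Rightarrow> real) \<Rightarrow> real ^ 'd \<Rightarrow> real \<Rightarrow> nat
     \<Rightarrow> ((nat \<Rightarrow> real ^ 'd) \<times> (nat \<Rightarrow> nat)) measure" where
  "spatial_permutation \<xi> \<alpha> c L N =
     density (position_space c L N \<Otimes>\<^sub>M count_space {\<pi>. \<pi> permutes {1..N}})
       (\<lambda>(x, \<pi>). exp_ereal (- hamiltonian \<xi> \<alpha> L N x \<pi>) / (fact N * partition_function \<xi> \<alpha> c L N))"

text \<open>
  Fixing \<open>N / L ^ CARD('d) = \<rho>\<close> determines \<open>L\<close> from \<open>N\<close>; the thermodynamic limit is then
  \<open>N \<rightarrow> \<infinity>\<close>. The position of the box is arbitrary: \<open>c L\<close> is the corner of the box of side \<open>L\<close>.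
\<close>

definition thermo_measure ::
  "(real ^ 'd \<Rightarrow> ereal) \<Rightarrow> (nat \<Rightarrow> real) \<Rightarrow> (real \<Rightarrow> real ^ 'd) \<Rightarrow> real \<Rightarrow> nat
     \<Rightarrow> ((nat \<Rightarrow> real ^ 'd) \<times> (nat \<Rightarrow> nat)) measure" where
  "thermo_measure \<xi> \<alpha> c \<rho> N =
     (let L = root CARD('d) (real N / \<rho>) in spatial_permutation \<xi> \<alpha> (c L) L N)"

definition fraction_above ::
  "(real ^ 'd \<Rightarrow> ereal) \<Rightarrow> (nat \<Rightarrow> real) \<Rightarrow> (real \<Rightarrow> real ^ 'd) \<Rightarrow> real \<Rightarrow> nat \<Rightarrow> ereal" where
  "fraction_above \<xi> \<alpha> c \<rho> K =
     liminf (\<lambda>N. ereal (LINT (x, \<pi>)|thermo_measure \<xi> \<alpha> c \<rho> N.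
                          real (points_in_long_cycles N \<pi> K) / real N))"

definition fraction_infinite ::
  "(real ^ 'd \<Rightarrow> ereal) \<Rightarrow> (nat \<Rightarrow> real) \<Rightarrow> (real \<Rightarrow> real ^ 'd) \<Rightarrow> real \<Rightarrow> ereal" where
  "fraction_infinite \<xi> \<alpha> c \<rho> = lim (fraction_above \<xi> \<alpha> c \<rho>)"

definition critical_density :: "(real ^ 'd \<Rightarrow> ereal) \<Rightarrow> (nat \<Rightarrow> real) \<Rightarrow> real" where
  "critical_density \<xi> \<alpha> =
     (\<Sum>j. exp (- \<alpha> (Suc j)) * (LINT k|lborel. exp (- (real (Suc j) * dispersion \<xi> k))))"

end

theory Submission
  imports Defs "HOL-Computational_Algebra.Formal_Power_Series" "HOL-Real_Asymp.Real_Asymp"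
begin

text \<open>
  The weights \<open>exp (- \<xi>\<^sub>\<Lambda>)\<close> are continuous on the torus with nonnegative Fourier coefficients
  \<open>exp (- \<epsilon> k)\<close>, so integrating out the positions along a cycle of length \<open>l\<close> gives the trace
  \<open>\<Sum>k. exp (- l \<epsilon> k)\<close>, and the permutation is distributed proportionally to the product over its
  cycles of \<open>\<theta> l = l powr - \<gamma> * (\<Sum>k. exp (- l \<epsilon> k))\<close>. The normalisation \<open>h N\<close> satisfies
  \<open>N h N = (\<Sum>l=1..N. \<theta> l * h (N - l))\<close> and has generating function \<open>exp (\<Sum>l. \<theta> l * z ^ l / l)\<close>.

  The zero mode contributes \<open>l powr - \<gamma>\<close> to \<open>\<theta> l\<close>; all other modes decay exponentially for
  \<open>l\<close> of order \<open>N\<close> and carry the critical density. Putting the mass left over by the nonzero modes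
  into one cycle of the zero mode bounds \<open>h N\<close> from below, at a cost that is only polynomial in \<open>N\<close>
  (for \<open>\<rho> \<le> \<rho>\<^sub>c\<close> after tilting by a fugacity \<open>z < 1\<close>). Against this bound, Chernoff estimates
  show that the short cycles cannot hold less than their expected mass. For \<open>\<rho> > \<rho>\<^sub>c\<close> a Chernoff
  estimate with parameter \<open>log N / N\<close> excludes that all cycles are shorter than \<open>\<eta> N\<close>, and a first
  moment bound excludes a longest cycle between \<open>\<eta> N\<close> and \<open>(\<nu> - \<delta>) N\<close>: a cycle of macroscopic
  length \<open>l\<close> has weight of the same order as the lower bound for \<open>h N\<close>, and the remaining \<open>N - l\<close>
  points would have to exceed the critical density.
\<close>

section \<open>Orbits and cycle weights\<close>

text \<open>The normalisation is bounded from below only up to a power of N and, at or below the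
  critical density, a small exponential factor; every event is compared with it through the common
  factor \<open>exp (Lam N z)\<close>, which cancels. Since \<gamma> > 0 makes the sum of
  \<open>l powr (- \<gamma> - 1)\<close> finite, the zero mode changes that factor only by a
  constant. The one case without room is a longest cycle of macroscopic but too small length: its
  weight has the same power of N as the lower bound, and smallness comes from a tilt
  \<open>\<tau> / N\<close> with \<tau> fixed large before N tends to infinity.

  On the analytic side the hypotheses control the lattice sums for the exponent 1 only. Positivity
  upgrades this: nonnegative coefficients turn continuity of the convolution powers into the trace
  formula, and convergence of the total mass is what Scheffe's lemma needs to reach every exponent.
  The bound \<epsilon>(k) \<ge> a |k|^\<eta> with \<eta> < d enters twice: it bounds the sum over
  all lengths linearly in the volume, and it gives a gap of order N^(-\<eta>/d), far above 1/N, so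
  that only k = 0 can carry a macroscopic cycle.\<close>

lemma orbit_transpose_comp:
  assumes p: "p permutes A" and a: "a \<notin> A" and "finite A" "b \<in> A" and z: "z \<in> A"
  shows "orbit (Transposition.transpose a b \<circ> p) z = (if b \<in> orbit p z then insert a (orbit p z) else orbit p z)"
proof -
  define q where "q = Transposition.transpose a b \<circ> p"
  have pz: "permutation p" using p \<open>finite A\<close> by (rule permutes_imp_permutation[rotated])
  have sub: "orbit p z \<subseteq> A" using permutes_orbit_subset[OF p z] .
  have pa: "p a = a" using p a by (simp add: permutes_def)
  have "orbit q z = (if b \<in> orbit p z then insert a (orbit p z) else orbit p z)"
  proof (cases "b \<in> orbit p z")
    case False
    have "orbit q z = orbit p z"
    proof (rule orbit_cong)
      show "z \<in> orbit p z" by (rule permutation_self_in_orbit[OF pz])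
      fix s assume "s \<in> orbit p z"
      then have "p s \<in> orbit p z" by (rule orbit.step)
      then show "q s = p s" using False sub a by (auto simp: q_def Transposition.transpose_def)
    qed
    then show ?thesis using False by simp
  next
    case True
    have q1: "q s = p s" if "p s \<noteq> b" "p s \<noteq> a" for s using that by (auto simp: q_def Transposition.transpose_def)
    have q2: "q s = a" if "p s = b" for s using that by (auto simp: q_def Transposition.transpose_def)
    have q3: "q a = b" using pa by (auto simp: q_def Transposition.transpose_def)
    \<comment> \<open>The composite replaces the arrow into \<open>b\<close> by a detour: the
      predecessor of \<open>b\<close> goes to \<open>a\<close>, and \<open>a\<close> goes to
      \<open>b\<close>. Hence each step of \<open>p\<close> is one or two steps of
      \<open>q\<close>.\<close>
    have pre: "p s \<in> orbit q z" if "q s \<in> orbit q z" "p s \<in> orbit p z" for s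
    proof (cases "p s = b")
      case True
      then have "q (q s) \<in> orbit q z" using that by (blast intro: orbit.step)
      then show ?thesis using q2[OF True] q3 True by simp
    next
      case False
      moreover have "p s \<noteq> a" using that(2) sub a by blast
      ultimately have "q s = p s" by (rule q1)
      then show ?thesis using that(1) by (simp only:)
    qed
    have 1: "y \<in> orbit q z" if "y \<in> orbit p z" for y
      using that
    proof induction
      case base show ?case by (rule pre) (auto intro: orbit.base)
    next
      case (step y) show ?case by (rule pre) (use step in \<open>auto intro: orbit.intros\<close>)
    qed
    have 2: "a \<in> orbit q z"
    proof -
      have "\<exists>y\<in>orbit p z. p y = b"
        using True permutation_self_in_orbit[OF pz, of z] by (auto elim: orbit.cases)
      then obtain y where "y \<in> orbit p z" "p y = b" by blast
      then have "q y \<in> orbit q z" using 1 by (blast intro: orbit.step)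
      then show ?thesis using q2[OF \<open>p y = b\<close>] by simp
    qed
    have inv: "q s \<in> insert a (orbit p z)" if "s \<in> insert a (orbit p z)" for s
    proof (cases "s = a")
      case True
      then show ?thesis using q3 \<open>b \<in> orbit p z\<close> by simp
    next
      case False
      then have *: "p s \<in> orbit p z" using that by (blast intro: orbit.step)
      then have "p s \<noteq> a" using sub a by blast
      then show ?thesis using q1[of s] q2[of s] * by (cases "p s = b") auto
    qed
    have 3: "y \<in> insert a (orbit p z)" if "y \<in> orbit q z" for y
      using that
    proof induction
      case base show ?case by (rule inv) (simp add: permutation_self_in_orbit[OF pz])
    next
      case (step y) show ?case by (rule inv[OF step.IH])
    qed
    show ?thesis using True 1 2 3 by auto
  qed
  then show ?thesis unfolding q_def .
qed

lemma orbit_eq_orbit: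
  assumes "permutation f" "y \<in> orbit f x" shows "orbit f y = orbit f x"
  using orbit_cyclic_eq3[OF cyclic_on_orbit'[OF assms(1)] assms(2)] .

lemma
  assumes p: "p permutes A" and a: "a \<notin> A" and fin: "finite A" and b: "b \<in> A"
  shows orbit_transpose_comp_new: "orbit (Transposition.transpose a b \<circ> p) a = insert a (orbit p b)"
    and orbits_transpose_comp: "orbit (Transposition.transpose a b \<circ> p) ` insert a A
        = (\<lambda>C. if b \<in> C then insert a C else C) ` (orbit p ` A)"
proof -
  let ?q = "Transposition.transpose a b \<circ> p"
  have pp: "permutation p" using p fin by (rule permutes_imp_permutation[rotated])
  have qp: "permutation ?q" using pp by (simp add: permutation_compose permutation_swap_id)
  have *: "orbit ?q b = insert a (orbit p b)"
    using orbit_transpose_comp[OF p a fin b b] permutation_self_in_orbit[OF pp, of b] by simp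
  then have "orbit ?q a = orbit ?q b" by (intro orbit_eq_orbit[OF qp]) simp
  then show 1: "orbit ?q a = insert a (orbit p b)" using * by simp
  have "orbit ?q ` A = (\<lambda>C. if b \<in> C then insert a C else C) ` (orbit p ` A)"
    unfolding image_image by (rule image_cong[OF refl]) (rule orbit_transpose_comp[OF p a fin b])
  moreover have "orbit ?q a \<in> orbit ?q ` A" using \<open>orbit ?q a = orbit ?q b\<close> b by blast
  ultimately show "orbit ?q ` insert a A = (\<lambda>C. if b \<in> C then insert a C else C) ` (orbit p ` A)"
    by (simp add: insert_absorb)
qed

lemma inj_on_insert_fresh:
  assumes "\<And>C. C \<in> X \<Longrightarrow> a \<notin> C"
  shows "inj_on (\<lambda>C. if b \<in> C then insert a C else C) X"
proof (rule inj_onI)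
  fix C D assume CD: "C \<in> X" "D \<in> X" and eq: "(if b \<in> C then insert a C else C) = (if b \<in> D then insert a D else D)"
  have a: "a \<notin> C" "a \<notin> D" using assms CD by auto
  have "b \<in> C \<longleftrightarrow> b \<in> D" using eq a by (metis insert_iff)
  then have "insert a C = insert a D \<or> C = D" using eq by metis
  then show "C = D" using a by (metis insert_ident)
qed

lemma
  assumes p: "p permutes A" and a: "a \<notin> A" and fin: "finite A"
  shows orbit_fresh: "orbit p a = {a}"
    and orbits_fresh: "{a} \<notin> orbit p ` A" "orbit p ` insert a A = insert {a} (orbit p ` A)"
proof -
  have "p a = a" using p a by (simp add: permutes_def)
  then show 1: "orbit p a = {a}" by (simp add: orbit_eq_singleton_iff)
  show "{a} \<notin> orbit p ` A" using permutes_orbit_subset[OF p] a by fastforce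
  show "orbit p ` insert a A = insert {a} (orbit p ` A)" using 1 by simp
qed

lemma finite_orbit_permutes:
  assumes "p permutes A" "finite A" shows "finite (orbit p z)"
  using finite_orbit[OF permutation_self_in_orbit[OF permutes_imp_permutation[OF assms(2,1)]]] .

text \<open>Inserting a fresh point lengthens one cycle by one and leaves all others alone. Read
  forwards this drives the recursion for cycle sums, read backwards the removal of one position from
  the integral.\<close>

lemma
  assumes p: "p permutes A" and a: "a \<notin> A" and fin: "finite A" and b: "b \<in> A"
  shows orbits_transpose_comp_other:
      "orbit (Transposition.transpose a b \<circ> p) ` insert a A - {orbit (Transposition.transpose a b \<circ> p) a}
        = orbit p ` A - {orbit p b}"
    and card_orbit_transpose_comp: "card (orbit (Transposition.transpose a b \<circ> p) a) = Suc (card (orbit p b))"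
proof -
  let ?q = "Transposition.transpose a b \<circ> p" and ?F = "\<lambda>C. if b \<in> C then insert a C else C"
  have sub: "C \<subseteq> A" if "C \<in> orbit p ` A" for C using permutes_orbit_subset[OF p] that by blast
  have pp: "permutation p" using p fin by (rule permutes_imp_permutation[rotated])
  have inj: "inj_on ?F (orbit p ` A)" by (rule inj_on_insert_fresh) (use sub a in blast)
  have oq: "orbit ?q a = ?F (orbit p b)"
    using orbit_transpose_comp_new[OF p a fin b] permutation_self_in_orbit[OF pp, of b] by simp
  have nb: "b \<notin> C" if "C \<in> orbit p ` A - {orbit p b}" for C
    using that orbit_eq_orbit[OF pp] by auto
  have "orbit ?q ` insert a A - {orbit ?q a} = ?F ` (orbit p ` A) - ?F ` {orbit p b}"
    unfolding orbits_transpose_comp[OF p a fin b] oq by simp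
  also have "\<dots> = ?F ` (orbit p ` A - {orbit p b})"
    using inj_on_image_set_diff[OF inj, of "orbit p ` A" "{orbit p b}"] b by auto
  also have "\<dots> = orbit p ` A - {orbit p b}" using nb by force
  finally show "orbit ?q ` insert a A - {orbit ?q a} = orbit p ` A - {orbit p b}" .
  show "card (orbit ?q a) = Suc (card (orbit p b))"
    using orbit_transpose_comp_new[OF p a fin b] sub[of "orbit p b"] a b
      finite_orbit_permutes[OF p fin, of b] by (metis card_insert_disjoint image_eqI subsetD)
qed

text \<open>This is the coefficient of \<open>z ^ n\<close> in the exponential of the sum of
  \<open>\<theta> l * z ^ l / l\<close>. The recursion is what differentiating that exponential
  gives; taking it as the definition keeps the algebra free of convergence.\<close>

function cyc_coeff :: "(nat \<Rightarrow> real) \<Rightarrow> nat \<Rightarrow> real" where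
  "cyc_coeff \<theta> n = (if n = 0 then 1 else (\<Sum>l=1..n. \<theta> l * cyc_coeff \<theta> (n - l)) / real n)"
  by auto
termination by (relation "Wellfounded.measure snd") auto

declare cyc_coeff.simps [simp del]

lemma cyc_coeff_0 [simp]: "cyc_coeff \<theta> 0 = 1"
  by (simp add: cyc_coeff.simps)

lemma cyc_coeff_rec: "real n * cyc_coeff \<theta> n = (\<Sum>l=1..n. \<theta> l * cyc_coeff \<theta> (n - l))"
  by (cases "n = 0") (simp_all add: cyc_coeff.simps[of \<theta> n])

text \<open>Delete the marked point \<open>x\<close>. Either it was fixed, or it was inserted before
  some \<open>b\<close>, and then the cycle of \<open>b\<close> becomes the marked one, shorter by
  one. The separate weight \<open>u\<close> for the marked cycle lets the induction close: the
  deletion shifts \<open>u\<close> and leaves \<open>\<theta>\<close> unchanged.\<close>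

lemma sum_permutes_marked_cycle:
  fixes u \<theta> :: "nat \<Rightarrow> real" and A :: "'a set"
  assumes "finite A" "x \<in> A"
  shows "(\<Sum>\<pi> | \<pi> permutes A. u (card (orbit \<pi> x)) * (\<Prod>C\<in>orbit \<pi> ` A - {orbit \<pi> x}. \<theta> (card C)))
    = fact (card A - 1) * (\<Sum>l=1..card A. u l * cyc_coeff \<theta> (card A - l))"
  using assms
proof (induction "card A" arbitrary: A x u)
  case 0 then show ?case by simp
next
  case (Suc n A x u)
  define B where "B = A - {x}"
  have fB: "finite B" and xB: "x \<notin> B" and A: "A = insert x B" and cB: "card B = n"
    using Suc.prems Suc.hyps(2) by (auto simp: B_def)
  \<comment> \<open>Without a mark, choose any point and use \<open>u = \<theta>\<close>; the
    recursion of \<open>cyc_coeff\<close> then collapses the sum over the marked length.\<close>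
  have W: "(\<Sum>p | p permutes B. \<Prod>C\<in>orbit p ` B. \<theta> (card C)) = fact n * cyc_coeff \<theta> n"
  proof (cases "B = {}")
    case True then show ?thesis using cB by auto
  next
    case False
    then obtain y where y: "y \<in> B" by blast
    then have n: "n > 0" using cB fB card_gt_0_iff by blast
    have "(\<Sum>p | p permutes B. \<Prod>C\<in>orbit p ` B. \<theta> (card C)) =
      (\<Sum>p | p permutes B. \<theta> (card (orbit p y)) * (\<Prod>C\<in>orbit p ` B - {orbit p y}. \<theta> (card C)))"
      by (intro sum.cong refl prod.remove) (use fB y in auto)
    also have "\<dots> = fact (n - 1) * (\<Sum>l=1..n. \<theta> l * cyc_coeff \<theta> (n - l))"
      using Suc.hyps(1)[of B y \<theta>] cB fB y by simp
    also have "\<dots> = (real n * fact (n - 1)) * cyc_coeff \<theta> n"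
      using cyc_coeff_rec[of n \<theta>] by simp
    also have "real n * fact (n - 1) = fact n" using n by (simp add: fact_reduce)
    finally show ?thesis .
  qed
  let ?f = "\<lambda>\<pi>. u (card (orbit \<pi> x)) * (\<Prod>C\<in>orbit \<pi> ` A - {orbit \<pi> x}. \<theta> (card C))"
  have new: "?f (Transposition.transpose x b \<circ> p) =
      u (Suc (card (orbit p b))) * (\<Prod>C\<in>orbit p ` B - {orbit p b}. \<theta> (card C))"
    if p: "p permutes B" and b: "b \<in> B" for p b
  proof -
    note orbits_transpose_comp_other[OF p xB fB b] card_orbit_transpose_comp[OF p xB fB b]
    then show ?thesis unfolding A by simp
  qed
  have old: "?f p = u 1 * (\<Prod>C\<in>orbit p ` B. \<theta> (card C))" if p: "p permutes B" for p
    using orbits_fresh[OF p xB fB] orbit_fresh[OF p xB fB] unfolding A by simp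
  have "(\<Sum>\<pi> | \<pi> permutes A. ?f \<pi>) = (\<Sum>b\<in>insert x B. \<Sum>p | p permutes B. ?f (Transposition.transpose x b \<circ> p))"
    unfolding A using sum_over_permutations_insert[OF fB xB] by blast
  also have "\<dots> = (\<Sum>p | p permutes B. ?f p) + (\<Sum>b\<in>B. \<Sum>p | p permutes B. ?f (Transposition.transpose x b \<circ> p))"
    using fB xB by simp
  also have "(\<Sum>p | p permutes B. ?f p) = u 1 * (fact n * cyc_coeff \<theta> n)"
    unfolding W[symmetric] sum_distrib_left by (intro sum.cong refl old) simp
  also have "(\<Sum>b\<in>B. \<Sum>p | p permutes B. ?f (Transposition.transpose x b \<circ> p)) =
      (\<Sum>b\<in>B. fact (n - 1) * (\<Sum>l=1..n. u (Suc l) * cyc_coeff \<theta> (n - l)))"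
  proof (intro sum.cong refl)
    fix b assume b: "b \<in> B"
    have "(\<Sum>p | p permutes B. ?f (Transposition.transpose x b \<circ> p)) =
      (\<Sum>p | p permutes B. u (Suc (card (orbit p b))) * (\<Prod>C\<in>orbit p ` B - {orbit p b}. \<theta> (card C)))"
      by (intro sum.cong refl new) (use b in auto)
    also have "\<dots> = fact (n - 1) * (\<Sum>l=1..n. u (Suc l) * cyc_coeff \<theta> (n - l))"
      using Suc.hyps(1)[of B b "\<lambda>l. u (Suc l)"] cB fB b by simp
    finally show "(\<Sum>p | p permutes B. ?f (Transposition.transpose x b \<circ> p)) =
      fact (n - 1) * (\<Sum>l=1..n. u (Suc l) * cyc_coeff \<theta> (n - l))" .
  qed
  also have "\<dots> = fact n * (\<Sum>l=1..n. u (Suc l) * cyc_coeff \<theta> (n - l))"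
  proof (cases "n = 0")
    case False
    then show ?thesis using cB by (simp add: fact_reduce)
  qed simp
  also have "(\<Sum>l=1..n. u (Suc l) * cyc_coeff \<theta> (n - l)) = (\<Sum>l=2..Suc n. u l * cyc_coeff \<theta> (Suc n - l))"
    using sum.shift_bounds_cl_Suc_ivl[of "\<lambda>l. u l * cyc_coeff \<theta> (Suc n - l)" 1 n]
    by (simp add: numeral_2_eq_2)
  also have "u 1 * (fact n * cyc_coeff \<theta> n) + fact n * (\<Sum>l=2..Suc n. u l * cyc_coeff \<theta> (Suc n - l)) =
      fact n * (\<Sum>l=1..Suc n. u l * cyc_coeff \<theta> (Suc n - l))"
    by (subst (2) sum.atLeast_Suc_atMost) (simp_all add: algebra_simps numeral_2_eq_2 del: sum.cl_ivl_Suc)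
  finally show ?case by (simp add: Suc.hyps(2)[symmetric])
qed

lemma sum_permutes_cycle_prod:
  fixes \<theta> :: "nat \<Rightarrow> real"
  assumes "finite A"
  shows "(\<Sum>\<pi> | \<pi> permutes A. \<Prod>C\<in>orbit \<pi> ` A. \<theta> (card C)) = fact (card A) * cyc_coeff \<theta> (card A)"
proof (cases "A = {}")
  case False
  then obtain x where x: "x \<in> A" by blast
  then have n: "card A > 0" using assms card_gt_0_iff by blast
  have "(\<Sum>\<pi> | \<pi> permutes A. \<Prod>C\<in>orbit \<pi> ` A. \<theta> (card C)) =
    (\<Sum>\<pi> | \<pi> permutes A. \<theta> (card (orbit \<pi> x)) * (\<Prod>C\<in>orbit \<pi> ` A - {orbit \<pi> x}. \<theta> (card C)))"
    by (intro sum.cong refl prod.remove) (use assms x in auto)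
  also have "\<dots> = (real (card A) * fact (card A - 1)) * cyc_coeff \<theta> (card A)"
    using sum_permutes_marked_cycle[OF assms x, of \<theta> \<theta>] cyc_coeff_rec[of "card A" \<theta>] by simp
  also have "real (card A) * fact (card A - 1) = fact (card A)" using n by (simp add: fact_reduce)
  finally show ?thesis .
qed auto

lemma cyc_coeff_nonneg:
  assumes "\<And>l. l \<ge> 1 \<Longrightarrow> 0 \<le> \<theta> l" shows "0 \<le> cyc_coeff \<theta> n"
proof (induction n rule: less_induct)
  case (less n)
  show ?case
  proof (cases "n = 0")
    case False
    have "0 \<le> (\<Sum>l=1..n. \<theta> l * cyc_coeff \<theta> (n - l))"
      by (intro sum_nonneg mult_nonneg_nonneg) (use assms less in auto)
    then show ?thesis using cyc_coeff_rec[of n \<theta>] False by (metis of_nat_0_less_iff neq0_conv zero_le_mult_iff not_less)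
  qed simp
qed

lemma cyc_coeff_cong:
  assumes "\<And>l. 1 \<le> l \<Longrightarrow> l \<le> n \<Longrightarrow> \<theta> l = \<theta>' l" shows "cyc_coeff \<theta> n = cyc_coeff \<theta>' n"
  using assms
proof (induction n rule: less_induct)
  case (less n)
  have "(\<Sum>l=1..n. \<theta> l * cyc_coeff \<theta> (n - l)) = (\<Sum>l=1..n. \<theta>' l * cyc_coeff \<theta>' (n - l))"
    by (intro sum.cong refl arg_cong2[where f = "(*)"] less) (use less.prems in auto)
  then show ?case by (simp add: cyc_coeff.simps[of \<theta> n] cyc_coeff.simps[of \<theta>' n])
qed

text \<open>The recursion read as a linear differential equation. Its solution with constant term 1
  is unique, so identities between exponentials are obtained by checking the equation.\<close>

lemma fps_deriv_cyc_coeff: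
  "fps_deriv (Abs_fps (cyc_coeff \<theta>)) = Abs_fps (\<lambda>n. \<theta> (Suc n)) * Abs_fps (cyc_coeff \<theta>)"
proof (rule fps_ext)
  fix n
  have "real (Suc n) * cyc_coeff \<theta> (Suc n) = (\<Sum>i=0..n. \<theta> (Suc i) * cyc_coeff \<theta> (n - i))"
    using cyc_coeff_rec[of "Suc n" \<theta>]
      sum.shift_bounds_cl_Suc_ivl[of "\<lambda>l. \<theta> l * cyc_coeff \<theta> (Suc n - l)" 0 n] by simp
  then show "fps_nth (fps_deriv (Abs_fps (cyc_coeff \<theta>))) n = fps_nth (Abs_fps (\<lambda>n. \<theta> (Suc n)) * Abs_fps (cyc_coeff \<theta>)) n"
    by (simp add: fps_mult_nth)
qed

lemma cyc_coeff_fps_unique: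
  fixes F :: "real fps"
  assumes F: "fps_deriv F = Abs_fps (\<lambda>n. \<theta> (Suc n)) * F" and F0: "fps_nth F 0 = 1"
  shows "fps_nth F n = cyc_coeff \<theta> n"
proof (induction n rule: less_induct)
  case (less n)
  show ?case
  proof (cases n)
    case 0 then show ?thesis using F0 by simp
  next
    case (Suc m)
    have "real (Suc m) * fps_nth F (Suc m) = (\<Sum>i=0..m. \<theta> (Suc i) * fps_nth F (m - i))"
      using arg_cong[OF F, of "\<lambda>X. fps_nth X m"] by (simp add: fps_mult_nth)
    also have "\<dots> = (\<Sum>i=0..m. \<theta> (Suc i) * cyc_coeff \<theta> (m - i))"
      by (intro sum.cong refl arg_cong2[where f = "(*)"] less) (use Suc in auto)
    also have "\<dots> = real (Suc m) * cyc_coeff \<theta> (Suc m)"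
      using arg_cong[OF fps_deriv_cyc_coeff[of \<theta>], of "\<lambda>X. fps_nth X m"] by (simp add: fps_mult_nth)
    finally show ?thesis using Suc by (simp only: mult_cancel_left of_nat_eq_0_iff) simp
  qed
qed

text \<open>The exponential of a sum is the product of the exponentials: both sides solve the same
  differential equation. This separates the zero mode from all the others.\<close>

lemma cyc_coeff_add:
  "cyc_coeff (\<lambda>l. a l + b l) n = (\<Sum>m=0..n. cyc_coeff a m * cyc_coeff b (n - m))"
proof -
  let ?A = "Abs_fps (cyc_coeff a)" and ?B = "Abs_fps (cyc_coeff b)"
  have "fps_nth (?A * ?B) n = cyc_coeff (\<lambda>l. a l + b l) n"
  proof (rule cyc_coeff_fps_unique)
    have "Abs_fps (\<lambda>n. a (Suc n) + b (Suc n)) = Abs_fps (\<lambda>n. a (Suc n)) + Abs_fps (\<lambda>n. b (Suc n))"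
      by (rule fps_ext) simp
    then show "fps_deriv (?A * ?B) = Abs_fps (\<lambda>n. a (Suc n) + b (Suc n)) * (?A * ?B)"
      by (simp add: fps_deriv_cyc_coeff algebra_simps)
  qed (simp add: fps_mult_nth)
  then show ?thesis by (simp add: fps_mult_nth)
qed

text \<open>With a single admissible length the series is \<open>exp (c * z ^ L / L)\<close>, whose
  coefficients are explicit; it is the building block for finitely many lengths.\<close>

lemma cyc_coeff_single:
  assumes "L \<ge> 1"
  shows "cyc_coeff (\<lambda>l. if l = L then c else 0) n
    = (if L dvd n then (c / L) ^ (n div L) / fact (n div L) else 0)"
proof (induction n rule: less_induct)
  case (less n)
  let ?h = "cyc_coeff (\<lambda>l. if l = L then c else 0)"
  show ?case
  proof (cases "n = 0")
    case False
    have "real n * ?h n = (\<Sum>l=1..n. if l = L then c * ?h (n - L) else 0)"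
      unfolding cyc_coeff_rec by (intro sum.cong) auto
    also have "\<dots> = (if L \<le> n then c * ?h (n - L) else 0)" using assms by simp
    finally have *: "real n * ?h n = (if L \<le> n then c * ?h (n - L) else 0)" .
    show ?thesis
    proof (cases "L \<le> n")
      case True
      have IH: "?h (n - L) = (if L dvd n - L then (c / L) ^ ((n - L) div L) / fact ((n - L) div L) else 0)"
        by (rule less) (use False assms in simp)
      show ?thesis
      proof (cases "L dvd n")
        case dvd: True
        then obtain q where q: "n = L * q" by (elim dvdE)
        then obtain r where r: "q = Suc r" using False by (cases q) auto
        have "n - L = L * r" using q r by simp
        then have "real n * ?h n = c * ((c / L) ^ r / fact r)" using * IH True assms by simp
        moreover have "real n = real L * real (Suc r)" using q r by (simp add: algebra_simps)
        ultimately have "(real L * real (Suc r)) * ?h n = c * ((c / L) ^ r / fact r)" by (simp only:)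
        then have "?h n = c * ((c / L) ^ r / fact r) / (real L * real (Suc r))"
          using assms by (subst nonzero_eq_divide_eq) (simp_all only: mult.commute, simp)
        also have "\<dots> = c / (real L * real (Suc r)) * ((c / L) ^ r / fact r)" by simp
        also have "\<dots> = (c / L) ^ Suc r / fact (Suc r)" by simp
        finally show ?thesis using dvd q r assms by simp
      next
        case ndvd: False
        have "\<not> L dvd n - L"
        proof
          assume "L dvd n - L"
          then have "L dvd (n - L) + L" by simp
          then show False using True ndvd by simp
        qed
        then have "?h (n - L) = 0" using IH by simp
        then have "real n * ?h n = 0" using * by simp
        then show ?thesis using False ndvd by simp
      qed
    next
      case nle: False
      then have "\<not> L dvd n" using False by (auto dest: dvd_imp_le)
      moreover have "real n * ?h n = 0" using * nle by simp
      ultimately show ?thesis using False by simp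
    qed
  qed simp
qed

lemma cyc_coeff_single_sums:
  assumes "L \<ge> 1"
  shows "(\<lambda>n. cyc_coeff (\<lambda>l. if l = L then c else 0) n * y ^ n) sums exp (c * y ^ L / L)"
proof -
  have "(\<lambda>q. (\<lambda>n. cyc_coeff (\<lambda>l. if l = L then c else 0) n * y ^ n) (L * q)) sums exp (c * y ^ L / L)"
  proof -
    have [simp]: "(y ^ q) ^ L = (y ^ L) ^ q" for q by (simp add: power_mult[symmetric] mult.commute)
    have "(\<lambda>q. cyc_coeff (\<lambda>l. if l = L then c else 0) (L * q) * y ^ (L * q)) = (\<lambda>q. (c * y ^ L / L) ^ q /\<^sub>R fact q)"
      using assms by (intro ext) (simp add: cyc_coeff_single power_mult power_mult_distrib power_divide field_simps)
    then show ?thesis using exp_converges[of "c * y ^ L / L"] by simp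
  qed
  moreover have "strict_mono (\<lambda>q. L * q)" using assms by (simp add: strict_mono_def)
  moreover have "cyc_coeff (\<lambda>l. if l = L then c else 0) n * y ^ n = 0" if "n \<notin> range (\<lambda>q. L * q)" for n
  proof -
    have "\<not> L dvd n" using that by (auto elim!: dvdE)
    then show ?thesis using assms by (simp add: cyc_coeff_single)
  qed
  ultimately show ?thesis
    using sums_mono_reindex[of "\<lambda>q. L * q" "\<lambda>n. cyc_coeff (\<lambda>l. if l = L then c else 0) n * y ^ n"] by simp
qed

text \<open>After truncation the exponent is a polynomial, so the series converges for every
  \<open>y \<ge> 0\<close>. The proof admits one more length at a time and multiplies absolutely
  convergent series.\<close>

lemma cyc_coeff_trunc_sums:
  assumes nn: "\<And>l. l \<ge> 1 \<Longrightarrow> 0 \<le> \<theta> l" and y: "0 \<le> (y::real)"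
  shows "(\<lambda>n. cyc_coeff (\<lambda>l. if l \<le> M then \<theta> l else 0) n * y ^ n) sums exp (\<Sum>l=1..M. \<theta> l * y ^ l / l)"
proof (induction M)
  case 0
  have "cyc_coeff (\<lambda>l. if l \<le> 0 then \<theta> l else 0) n * y ^ n = (if n = 0 then 1 else 0)" for n
  proof (cases "n = 0")
    case False
    have "real n * cyc_coeff (\<lambda>l. if l \<le> 0 then \<theta> l else 0) n = 0"
      unfolding cyc_coeff_rec by (intro sum.neutral) auto
    then show ?thesis using False by simp
  qed simp
  then show ?case using sums_single[of 0 "\<lambda>_. 1::real"] by (simp add: eq_commute)
next
  case (Suc M)
  let ?a = "\<lambda>l. if l \<le> M then \<theta> l else 0" and ?b = "\<lambda>l. if l = Suc M then \<theta> (Suc M) else 0"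
  have ab: "(\<lambda>l. if l \<le> Suc M then \<theta> l else 0) = (\<lambda>l. ?a l + ?b l)" by (auto simp: fun_eq_iff)
  have an: "0 \<le> cyc_coeff ?a n * y ^ n" for n by (intro mult_nonneg_nonneg cyc_coeff_nonneg) (use nn y in auto)
  have bn: "0 \<le> cyc_coeff ?b n * y ^ n" for n by (intro mult_nonneg_nonneg cyc_coeff_nonneg) (use nn y in auto)
  have bs: "(\<lambda>n. cyc_coeff ?b n * y ^ n) sums exp (\<theta> (Suc M) * y ^ Suc M / Suc M)"
    by (rule cyc_coeff_single_sums) simp
  have "(\<lambda>k. \<Sum>i\<le>k. (cyc_coeff ?a i * y ^ i) * (cyc_coeff ?b (k - i) * y ^ (k - i))) sums
      ((\<Sum>k. cyc_coeff ?a k * y ^ k) * (\<Sum>k. cyc_coeff ?b k * y ^ k))"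
    by (rule Cauchy_product_sums) (use an bn Suc bs in \<open>auto simp: sums_iff\<close>)
  moreover have "(\<Sum>i\<le>k. (cyc_coeff ?a i * y ^ i) * (cyc_coeff ?b (k - i) * y ^ (k - i))) =
      cyc_coeff (\<lambda>l. ?a l + ?b l) k * y ^ k" for k
  proof -
    have "(\<Sum>i\<le>k. (cyc_coeff ?a i * y ^ i) * (cyc_coeff ?b (k - i) * y ^ (k - i))) =
      (\<Sum>i\<le>k. (cyc_coeff ?a i * cyc_coeff ?b (k - i)) * y ^ k)"
    proof (intro sum.cong refl)
      fix i assume "i \<in> {..k}"
      then have "y ^ k = y ^ i * y ^ (k - i)" by (simp add: power_add[symmetric])
      then show "(cyc_coeff ?a i * y ^ i) * (cyc_coeff ?b (k - i) * y ^ (k - i)) = (cyc_coeff ?a i * cyc_coeff ?b (k - i)) * y ^ k"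
        by simp
    qed
    then show ?thesis unfolding cyc_coeff_add by (simp add: sum_distrib_right atLeast0AtMost)
  qed
  moreover have "(\<Sum>k. cyc_coeff ?a k * y ^ k) * (\<Sum>k. cyc_coeff ?b k * y ^ k) = exp (\<Sum>l=1..Suc M. \<theta> l * y ^ l / l)"
    using Suc bs by (simp add: sums_iff exp_add)
  ultimately show ?case unfolding ab by simp
qed

text \<open>Coefficients up to index \<open>n\<close> see only lengths up to \<open>n\<close>, so
  truncating at \<open>n\<close> changes none of them. The resulting Chernoff-type bound holds for
  all \<open>y \<ge> 0\<close>, including \<open>y > 1\<close>, which the upper-tail estimates
  use.\<close>

lemma sum_cyc_coeff_le_exp:
  assumes nn: "\<And>l. l \<ge> 1 \<Longrightarrow> 0 \<le> \<theta> l" and y: "0 \<le> (y::real)" and F: "F \<subseteq> {..n}"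
  shows "(\<Sum>m\<in>F. cyc_coeff \<theta> m * y ^ m) \<le> exp (\<Sum>l=1..n. \<theta> l * y ^ l / l)"
proof -
  let ?a = "\<lambda>l. if l \<le> n then \<theta> l else 0"
  have s: "(\<lambda>m. cyc_coeff ?a m * y ^ m) sums exp (\<Sum>l=1..n. \<theta> l * y ^ l / l)"
    by (rule cyc_coeff_trunc_sums[OF nn y])
  have "(\<Sum>m\<in>F. cyc_coeff \<theta> m * y ^ m) = (\<Sum>m\<in>F. cyc_coeff ?a m * y ^ m)"
    by (intro sum.cong refl arg_cong2[where f = "(*)"] cyc_coeff_cong) (use F in auto)
  also have "\<dots> \<le> (\<Sum>m. cyc_coeff ?a m * y ^ m)"
    using F by (intro sum_le_suminf) (use s finite_subset[of F "{..n}"] nn y in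
      \<open>auto simp: sums_iff intro!: mult_nonneg_nonneg cyc_coeff_nonneg\<close>)
  finally show ?thesis using s by (simp add: sums_iff)
qed

section \<open>Cycle statistics\<close>

definition cycle_weight :: "(nat \<Rightarrow> real) \<Rightarrow> nat \<Rightarrow> (nat \<Rightarrow> nat) \<Rightarrow> real" where
  "cycle_weight \<theta> N \<pi> = (\<Prod>C\<in>cycles_of N \<pi>. \<theta> (card C))"

lemma finite_cycles_of [simp]: "finite (cycles_of N \<pi>)"
  by (simp add: cycles_of_def)

lemma card_cycle_ge_1:
  assumes "\<pi> permutes {1..N}" "C \<in> cycles_of N \<pi>" shows "1 \<le> card C"
proof -
  have "finite C" using assms finite_orbit_permutes[OF assms(1)] by (auto simp: cycles_of_def)
  moreover have "C \<noteq> {}" using assms by (auto simp: cycles_of_def orbit_nonempty)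
  ultimately show ?thesis by (simp add: Suc_le_eq card_gt_0_iff)
qed

lemma cycle_weight_nonneg:
  assumes "\<And>l. l \<ge> 1 \<Longrightarrow> 0 \<le> \<theta> l" "\<pi> permutes {1..N}" shows "0 \<le> cycle_weight \<theta> N \<pi>"
  unfolding cycle_weight_def by (intro prod_nonneg ballI assms(1) card_cycle_ge_1[OF assms(2)])

lemma sum_cycle_weight:
  "(\<Sum>\<pi> | \<pi> permutes {1..N}. cycle_weight \<theta> N \<pi>) = fact N * cyc_coeff \<theta> N"
  using sum_permutes_cycle_prod[of "{1..N}" \<theta>] by (simp add: cycle_weight_def cycles_of_def)

lemma sum_card_cycles:
  assumes "\<pi> permutes {1..N}" shows "(\<Sum>C\<in>cycles_of N \<pi>. card C) = N"
proof -
  have pp: "permutation \<pi>" using assms by (rule permutes_imp_permutation[rotated]) simp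
  have sub: "C \<subseteq> {1..N}" if "C \<in> cycles_of N \<pi>" for C
    using that permutes_orbit_subset[OF assms] by (fastforce simp: cycles_of_def)
  have "card (\<Union>(cycles_of N \<pi>)) = (\<Sum>C\<in>cycles_of N \<pi>. card C)"
  proof (rule card_Union_disjoint)
    show "pairwise disjnt (cycles_of N \<pi>)"
    proof (clarsimp simp: pairwise_def disjnt_iff cycles_of_def)
      fix x y z assume *: "orbit \<pi> x \<noteq> orbit \<pi> y" "z \<in> orbit \<pi> x" "z \<in> orbit \<pi> y"
      show False using orbit_eq_orbit[OF pp *(2)] orbit_eq_orbit[OF pp *(3)] *(1) by simp
    qed
  qed (use sub finite_subset in blast)
  moreover have "\<Union>(cycles_of N \<pi>) = {1..N}"
    using sub permutation_self_in_orbit[OF pp] by (fastforce simp: cycles_of_def)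
  ultimately show ?thesis by simp
qed

lemma mset_cycle_lengths: "mset (cycle_lengths N \<pi>) = image_mset card (mset_set (cycles_of N \<pi>))"
  by (simp add: cycle_lengths_def)

lemma set_cycle_lengths: "set (cycle_lengths N \<pi>) = card ` cycles_of N \<pi>"
  using arg_cong[OF mset_cycle_lengths, of set_mset] by simp

lemma points_in_long_cycles_eq:
  "points_in_long_cycles N \<pi> K = (\<Sum>C | C \<in> cycles_of N \<pi> \<and> K < card C. card C)"
proof -
  let ?xs = "cycle_lengths N \<pi>"
  have "points_in_long_cycles N \<pi> K = (\<Sum>i\<in>{0..<length ?xs}. if ?xs ! i > K then ?xs ! i else 0)"
    unfolding points_in_long_cycles_def by (subst sum.inter_filter[symmetric]) (auto intro!: sum.cong)
  also have "\<dots> = sum_list (map (\<lambda>x. if x > K then x else 0) ?xs)"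
    by (simp add: sum_list_sum_nth)
  also have "\<dots> = sum_mset (image_mset (\<lambda>x. if x > K then x else 0) (mset ?xs))"
    by (simp flip: sum_mset_sum_list)
  also have "\<dots> = (\<Sum>C\<in>cycles_of N \<pi>. if card C > K then card C else 0)"
    unfolding mset_cycle_lengths by (simp add: image_mset.compositionality o_def sum_unfold_sum_mset)
  finally show ?thesis by (simp add: sum.inter_filter[symmetric] conj_commute)
qed

lemma
  assumes p: "\<pi> permutes {1..N}" and N: "N \<ge> 1"
  shows longest_cycle_in: "longest_cycle N \<pi> \<in> card ` cycles_of N \<pi>"
    and longest_cycle_ge: "C \<in> cycles_of N \<pi> \<Longrightarrow> card C \<le> longest_cycle N \<pi>"
proof -
  let ?xs = "cycle_lengths N \<pi>"
  have "cycles_of N \<pi> \<noteq> {}" using N by (auto simp: cycles_of_def)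
  then have ne: "?xs \<noteq> []" using set_cycle_lengths[of N \<pi>] by force
  then show "longest_cycle N \<pi> \<in> card ` cycles_of N \<pi>"
    unfolding longest_cycle_def set_cycle_lengths[symmetric] by (intro nth_mem) simp
  have srt: "sorted_wrt (\<ge>) ?xs"
    unfolding cycle_lengths_def sorted_wrt_rev by simp
  show "card C \<le> longest_cycle N \<pi>" if "C \<in> cycles_of N \<pi>"
  proof -
    have "card C \<in> set ?xs" using that set_cycle_lengths by blast
    then obtain i where i: "i < length ?xs" "?xs ! i = card C" by (auto simp: in_set_conv_nth)
    then show ?thesis using sorted_wrt_nth_less[OF srt, of 0 i] unfolding longest_cycle_def
      by (cases "i = 0") auto
  qed
qed

lemma longest_cycle_le_points_in_long_cycles:
  assumes "\<pi> permutes {1..N}" "N \<ge> 1" "K < longest_cycle N \<pi>"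
  shows "longest_cycle N \<pi> \<le> points_in_long_cycles N \<pi> K"
proof -
  obtain C where C: "C \<in> cycles_of N \<pi>" "card C = longest_cycle N \<pi>"
    using longest_cycle_in[OF assms(1,2)] by auto
  have "card C \<le> (\<Sum>C | C \<in> cycles_of N \<pi> \<and> K < card C. card C)"
    by (rule member_le_sum) (use C assms(3) in auto)
  then show ?thesis using C by (simp add: points_in_long_cycles_eq)
qed

lemma points_in_long_plus_short:
  assumes "\<pi> permutes {1..N}"
  shows "points_in_long_cycles N \<pi> K + (\<Sum>C | C \<in> cycles_of N \<pi> \<and> card C \<le> K. card C) = N"
proof -
  have "(\<Sum>C\<in>cycles_of N \<pi>. card C) = (\<Sum>C\<in>{C \<in> cycles_of N \<pi>. K < card C} \<union> {C \<in> cycles_of N \<pi>. card C \<le> K}. card C)"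
    by (intro sum.cong) auto
  also have "\<dots> = points_in_long_cycles N \<pi> K + (\<Sum>C | C \<in> cycles_of N \<pi> \<and> card C \<le> K. card C)"
    unfolding points_in_long_cycles_eq by (intro sum.union_disjoint) auto
  finally show ?thesis using sum_card_cycles[OF assms] by simp
qed

lemma points_in_long_cycles_le: "\<pi> permutes {1..N} \<Longrightarrow> points_in_long_cycles N \<pi> K \<le> N"
  using points_in_long_plus_short[of \<pi> N K] by linarith

text \<open>On this event no cycle notices the truncation; off the event the truncated weights are
  nonnegative.\<close>

lemma sum_cycle_weight_longest_le:
  assumes nn: "\<And>l. l \<ge> 1 \<Longrightarrow> 0 \<le> \<theta> l" and N: "N \<ge> 1"
  shows "(\<Sum>\<pi> | \<pi> permutes {1..N} \<and> longest_cycle N \<pi> \<le> M. cycle_weight \<theta> N \<pi>)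
    \<le> fact N * cyc_coeff (\<lambda>l. if l \<le> M then \<theta> l else 0) N"
proof -
  let ?t = "\<lambda>l. if l \<le> M then \<theta> l else 0"
  have "(\<Sum>\<pi> | \<pi> permutes {1..N} \<and> longest_cycle N \<pi> \<le> M. cycle_weight \<theta> N \<pi>) =
    (\<Sum>\<pi> | \<pi> permutes {1..N} \<and> longest_cycle N \<pi> \<le> M. cycle_weight ?t N \<pi>)"
    unfolding cycle_weight_def
    by (intro sum.cong prod.cong refl) (use longest_cycle_ge N in force)
  also have "\<dots> \<le> (\<Sum>\<pi> | \<pi> permutes {1..N}. cycle_weight ?t N \<pi>)"
    by (intro sum_mono2 finite_permutations) (use nn in \<open>auto intro!: cycle_weight_nonneg\<close>)
  finally show ?thesis unfolding sum_cycle_weight .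
qed

text \<open>A first moment bound: count the cycles with length in \<open>J\<close>. Each cycle is
  counted through its points, and the factor \<open>1 / l\<close> in \<open>u\<close> makes the
  total one per cycle. \<open>sum_permutes_marked_cycle\<close> then evaluates the sum for each
  point.\<close>

lemma sum_cycle_weight_longest_in_le:
  assumes nn: "\<And>l. l \<ge> 1 \<Longrightarrow> 0 \<le> \<theta> l" and N: "N \<ge> 1"
  shows "(\<Sum>\<pi> | \<pi> permutes {1..N} \<and> longest_cycle N \<pi> \<in> J. cycle_weight \<theta> N \<pi>)
    \<le> fact N * (\<Sum>l\<in>{1..N} \<inter> J. \<theta> l / l * cyc_coeff \<theta> (N - l))"
proof -
  let ?u = "\<lambda>l. if l \<in> J then \<theta> l / l else 0"
  let ?w = "\<lambda>\<pi> x. ?u (card (orbit \<pi> x)) * (\<Prod>C\<in>orbit \<pi> ` {1..N} - {orbit \<pi> x}. \<theta> (card C))"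
  have wnn: "0 \<le> ?w \<pi> x" if "\<pi> permutes {1..N}" "x \<in> {1..N}" for \<pi> x
    using that by (intro mult_nonneg_nonneg prod_nonneg)
      (auto intro!: nn divide_nonneg_nonneg card_cycle_ge_1[of \<pi> N] simp: cycles_of_def)
  have le: "cycle_weight \<theta> N \<pi> \<le> (\<Sum>x\<in>{1..N}. ?w \<pi> x)"
    if p: "\<pi> permutes {1..N}" and l: "longest_cycle N \<pi> \<in> J" for \<pi>
  proof -
    have pp: "permutation \<pi>" using p by (rule permutes_imp_permutation[rotated]) simp
    obtain C where C: "C \<in> cycles_of N \<pi>" "card C = longest_cycle N \<pi>"
      using longest_cycle_in[OF p N] by auto
    then obtain z where z: "z \<in> {1..N}" "C = orbit \<pi> z" by (auto simp: cycles_of_def)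
    have sub: "C \<subseteq> {1..N}" using permutes_orbit_subset[OF p] z by blast
    have c1: "1 \<le> card C" by (rule card_cycle_ge_1[OF p C(1)])
    \<comment> \<open>Every point of the longest cycle returns the full weight divided by the
      length, so summing over that cycle alone already recovers the weight of the
      permutation.\<close>
    have eq: "?w \<pi> x = cycle_weight \<theta> N \<pi> / card C" if "x \<in> C" for x
    proof -
      have ox: "orbit \<pi> x = C" using orbit_eq_orbit[OF pp, of x z] that z by simp
      have "cycle_weight \<theta> N \<pi> = \<theta> (card C) * (\<Prod>C\<in>orbit \<pi> ` {1..N} - {C}. \<theta> (card C))"
        unfolding cycle_weight_def cycles_of_def by (rule prod.remove) (use C in \<open>auto simp: cycles_of_def\<close>)
      then show ?thesis using l C by (simp add: ox)
    qed
    have "(\<Sum>x\<in>C. ?w \<pi> x) = (\<Sum>x\<in>C. cycle_weight \<theta> N \<pi> / card C)" by (intro sum.cong refl eq)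
    then have "cycle_weight \<theta> N \<pi> = (\<Sum>x\<in>C. ?w \<pi> x)" using c1 by simp
    also have "\<dots> \<le> (\<Sum>x\<in>{1..N}. ?w \<pi> x)" by (intro sum_mono2) (use sub wnn[OF p] in auto)
    finally show ?thesis .
  qed
  have "(\<Sum>\<pi> | \<pi> permutes {1..N} \<and> longest_cycle N \<pi> \<in> J. cycle_weight \<theta> N \<pi>)
    \<le> (\<Sum>\<pi> | \<pi> permutes {1..N} \<and> longest_cycle N \<pi> \<in> J. \<Sum>x\<in>{1..N}. ?w \<pi> x)"
    by (intro sum_mono) (use le in auto)
  also have "\<dots> \<le> (\<Sum>\<pi> | \<pi> permutes {1..N}. \<Sum>x\<in>{1..N}. ?w \<pi> x)"
    by (intro sum_mono2 finite_permutations) (use wnn in \<open>auto intro!: sum_nonneg\<close>)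
  also have "\<dots> = (\<Sum>x\<in>{1..N}. \<Sum>\<pi> | \<pi> permutes {1..N}. ?w \<pi> x)" by (rule sum.swap)
  also have "\<dots> = (\<Sum>x\<in>{1..N}. fact (N - 1) * (\<Sum>l=1..N. ?u l * cyc_coeff \<theta> (N - l)))"
  proof (intro sum.cong refl)
    fix x assume "x \<in> {1..N}"
    then show "(\<Sum>\<pi> | \<pi> permutes {1..N}. ?w \<pi> x) = fact (N - 1) * (\<Sum>l=1..N. ?u l * cyc_coeff \<theta> (N - l))"
      using sum_permutes_marked_cycle[of "{1..N}" x ?u \<theta>] by simp
  qed
  also have "\<dots> = fact N * (\<Sum>l=1..N. ?u l * cyc_coeff \<theta> (N - l))"
    using N by (simp add: fact_reduce[of N])
  also have "(\<Sum>l=1..N. ?u l * cyc_coeff \<theta> (N - l)) = (\<Sum>l\<in>{1..N} \<inter> J. \<theta> l / l * cyc_coeff \<theta> (N - l))"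
    by (simp add: sum.inter_restrict) (intro sum.cong, auto)
  finally show ?thesis .
qed

text \<open>Exponential Markov inequality. Damping \<open>\<theta> l\<close> by
  \<open>exp (- t * l)\<close> for \<open>l \<le> K\<close> multiplies the weight of a permutation
  by \<open>exp (- t * S)\<close>, where \<open>S\<close> is the number of points in cycles of
  length at most \<open>K\<close>.\<close>

lemma sum_cycle_weight_short_le:
  assumes nn: "\<And>l. l \<ge> 1 \<Longrightarrow> 0 \<le> \<theta> l" and t: "t \<ge> 0"
  shows "(\<Sum>\<pi> | \<pi> permutes {1..N} \<and> real N - real (points_in_long_cycles N \<pi> K) \<le> y. cycle_weight \<theta> N \<pi>)
    \<le> exp (t * y) * (fact N * cyc_coeff (\<lambda>l. if l \<le> K then \<theta> l * exp (- (t * l)) else \<theta> l) N)"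
proof -
  let ?t = "\<lambda>l. if l \<le> K then \<theta> l * exp (- (t * real l)) else \<theta> l"
  have nt: "0 \<le> ?t l" if "l \<ge> 1" for l using nn that by simp
  have eq: "cycle_weight ?t N \<pi> = exp (- (t * (real N - real (points_in_long_cycles N \<pi> K)))) * cycle_weight \<theta> N \<pi>"
    if p: "\<pi> permutes {1..N}" for \<pi>
  proof -
    have "cycle_weight ?t N \<pi> = (\<Prod>C\<in>cycles_of N \<pi>. exp (- t * (if card C \<le> K then real (card C) else 0)) * \<theta> (card C))"
      unfolding cycle_weight_def by (intro prod.cong) auto
    also have "\<dots> = exp (\<Sum>C\<in>cycles_of N \<pi>. - t * (if card C \<le> K then real (card C) else 0)) * cycle_weight \<theta> N \<pi>"
      by (simp add: prod.distrib exp_sum cycle_weight_def)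
    also have "(\<Sum>C\<in>cycles_of N \<pi>. - t * (if card C \<le> K then real (card C) else 0)) =
        - t * (\<Sum>C | C \<in> cycles_of N \<pi> \<and> card C \<le> K. real (card C))"
      by (simp only: sum_distrib_left[symmetric] sum.inter_filter[OF finite_cycles_of])
    also have "(\<Sum>C | C \<in> cycles_of N \<pi> \<and> card C \<le> K. real (card C)) = real N - real (points_in_long_cycles N \<pi> K)"
      using arg_cong[OF points_in_long_plus_short[OF p, of K], of real] by simp
    finally show ?thesis by simp
  qed
  have "(\<Sum>\<pi> | \<pi> permutes {1..N} \<and> real N - real (points_in_long_cycles N \<pi> K) \<le> y. cycle_weight \<theta> N \<pi>)
    \<le> (\<Sum>\<pi> | \<pi> permutes {1..N} \<and> real N - real (points_in_long_cycles N \<pi> K) \<le> y. exp (t * y) * cycle_weight ?t N \<pi>)"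
  proof (intro sum_mono)
    fix \<pi> assume "\<pi> \<in> {\<pi>. \<pi> permutes {1..N} \<and> real N - real (points_in_long_cycles N \<pi> K) \<le> y}"
    then have p: "\<pi> permutes {1..N}" and le: "real N - real (points_in_long_cycles N \<pi> K) \<le> y" by auto
    have "1 \<le> exp (t * y + - (t * (real N - real (points_in_long_cycles N \<pi> K))))"
      using mult_left_mono[OF le t] by simp
    then have "1 * cycle_weight \<theta> N \<pi> \<le> exp (t * y + - (t * (real N - real (points_in_long_cycles N \<pi> K)))) * cycle_weight \<theta> N \<pi>"
      by (intro mult_right_mono cycle_weight_nonneg nn p)
    then show "cycle_weight \<theta> N \<pi> \<le> exp (t * y) * cycle_weight ?t N \<pi>"
      unfolding eq[OF p] exp_add by (simp add: mult.assoc)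
  qed
  also have "\<dots> \<le> (\<Sum>\<pi> | \<pi> permutes {1..N}. exp (t * y) * cycle_weight ?t N \<pi>)"
    by (intro sum_mono2 finite_permutations finite_atLeastAtMost subsetI mult_nonneg_nonneg exp_ge_zero cycle_weight_nonneg nt) auto
  finally show ?thesis unfolding sum_distrib_left[symmetric] sum_cycle_weight .
qed

section \<open>Integration on the torus\<close>

text \<open>Lattice sums become integrals over counting measure, so that Tonelli and changes of
  variables apply to them.\<close>

lemma infsum_ennreal_eq_nn_integral:
  fixes f :: "'a \<Rightarrow> ennreal"
  assumes "countable A"
  shows "(\<Sum>\<^sub>\<infinity>x\<in>A. f x) = (\<integral>\<^sup>+x. f x \<partial>count_space A)"
proof -
  have S: "(\<Sum>\<^sub>\<infinity>x\<in>A. f x) = (SUP F\<in>{F. finite F \<and> F \<subseteq> A}. sum f F)"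
    by (rule nonneg_infsum_complete) simp
  have "sum f F \<le> (\<integral>\<^sup>+x. f x \<partial>count_space A)" if "finite F" "F \<subseteq> A" for F
  proof -
    have "sum f F = (\<integral>\<^sup>+x. f x * indicator F x \<partial>count_space A)"
      using that by (subst nn_integral_count_space'[of F]) (auto intro!: sum.cong)
    also have "\<dots> \<le> (\<integral>\<^sup>+x. f x \<partial>count_space A)"
      by (intro nn_integral_mono) (auto split: split_indicator)
    finally show ?thesis .
  qed
  then have 1: "(\<Sum>\<^sub>\<infinity>x\<in>A. f x) \<le> (\<integral>\<^sup>+x. f x \<partial>count_space A)"
    unfolding S by (intro SUP_least) auto
  have 2: "(\<integral>\<^sup>+x. f x \<partial>count_space A) \<le> (SUP F\<in>{F. finite F \<and> F \<subseteq> A}. sum f F)"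
  proof (cases "finite A")
    case True
    then show ?thesis by (intro SUP_upper2[of A]) (auto simp: nn_integral_count_space_finite)
  next
    case False
    let ?e = "from_nat_into A"
    have b: "bij_betw ?e UNIV A" using False assms by (rule bij_betw_from_nat_into[rotated])
    have "(\<integral>\<^sup>+x. f x \<partial>count_space A) = (\<Sum>i. f (?e i))"
      using nn_integral_bij_count_space[OF b, of f] by (simp add: nn_integral_count_space_nat)
    also have "\<dots> = (SUP n. \<Sum>i<n. f (?e i))" by (rule suminf_eq_SUP)
    also have "\<dots> \<le> (SUP F\<in>{F. finite F \<and> F \<subseteq> A}. sum f F)"
    proof (rule SUP_least)
      fix n
      have "(\<Sum>i<n. f (?e i)) = sum f (?e ` {..<n})"
        using b by (subst sum.reindex) (auto simp: bij_betw_def intro: inj_on_subset)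
      then show "(\<Sum>i<n. f (?e i)) \<le> (SUP F\<in>{F. finite F \<and> F \<subseteq> A}. sum f F)"
        using b by (intro SUP_upper2[of "?e ` {..<n}"]) (auto simp: bij_betw_def)
    qed
    finally show ?thesis .
  qed
  show ?thesis using 1 2 unfolding S by (rule antisym)
qed

lemma
  fixes f :: "'a \<Rightarrow> real"
  assumes A: "countable A" and nn: "\<And>x. x \<in> A \<Longrightarrow> 0 \<le> f x"
  shows summable_on_iff_nn_integral: "f summable_on A \<longleftrightarrow> (\<integral>\<^sup>+x. f x \<partial>count_space A) < \<infinity>"
    and infsum_eq_enn2real_nn_integral: "(\<Sum>\<^sub>\<infinity>x\<in>A. f x) = enn2real (\<integral>\<^sup>+x. f x \<partial>count_space A)"
proof -
  have SUP: "(\<integral>\<^sup>+x. f x \<partial>count_space A) = (SUP F\<in>{F. finite F \<and> F \<subseteq> A}. \<Sum>x\<in>F. ennreal (f x))"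
    unfolding infsum_ennreal_eq_nn_integral[OF A, symmetric] by (rule nonneg_infsum_complete) simp
  have sumF: "(\<Sum>x\<in>F. ennreal (f x)) = ennreal (sum f F)" if "F \<subseteq> A" for F
    using that nn by (intro sum_ennreal) auto
  have eq: "ennreal (\<Sum>\<^sub>\<infinity>x\<in>A. f x) = (\<integral>\<^sup>+x. f x \<partial>count_space A)" if "f summable_on A"
  proof -
    have "ennreal (\<Sum>\<^sub>\<infinity>x\<in>A. f x) = (SUP F\<in>{F. finite F \<and> F \<subseteq> A}. ennreal (sum f F))"
      by (rule infsum_nonneg_is_SUPREMUM_ennreal[OF that nn])
    also have "\<dots> = (SUP F\<in>{F. finite F \<and> F \<subseteq> A}. \<Sum>x\<in>F. ennreal (f x))"
      by (rule SUP_cong) (auto simp: sumF)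
    finally show ?thesis unfolding SUP .
  qed
  show iff: "f summable_on A \<longleftrightarrow> (\<integral>\<^sup>+x. f x \<partial>count_space A) < \<infinity>"
  proof
    assume "f summable_on A"
    then show "(\<integral>\<^sup>+x. f x \<partial>count_space A) < \<infinity>" using eq by (metis ennreal_less_top infinity_ennreal_def)
  next
    assume fin: "(\<integral>\<^sup>+x. f x \<partial>count_space A) < \<infinity>"
    show "f summable_on A"
    proof (rule nonneg_bdd_above_summable_on)
      show "bdd_above (sum f ` {F. F \<subseteq> A \<and> finite F})"
      proof (intro bdd_aboveI2)
        fix F assume F: "F \<in> {F. F \<subseteq> A \<and> finite F}"
        then have "ennreal (sum f F) \<le> (\<integral>\<^sup>+x. f x \<partial>count_space A)"
          unfolding SUP by (intro SUP_upper2[of F]) (auto simp: sumF)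
        then show "sum f F \<le> enn2real (\<integral>\<^sup>+x. f x \<partial>count_space A)"
          using fin F nn enn2real_mono[of "ennreal (sum f F)"] by (auto simp: sum_nonneg subset_iff enn2real_ennreal)
      qed
    qed (use nn in auto)
  qed
  show "(\<Sum>\<^sub>\<infinity>x\<in>A. f x) = enn2real (\<integral>\<^sup>+x. f x \<partial>count_space A)"
  proof (cases "f summable_on A")
    case True
    then show ?thesis using eq[OF True] nn infsum_nonneg[of A f] by (metis enn2real_ennreal)
  next
    case False
    \<comment> \<open>Without summability both sides take their default value 0:
      \<open>infsum\<close> by convention, and \<open>enn2real\<close> at
      \<open>top\<close>.\<close>
    then have "(\<integral>\<^sup>+x. f x \<partial>count_space A) = top" using iff by (metis infinity_ennreal_def top.not_eq_extremum)
    then show ?thesis using False by (simp add: infsum_not_exists)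
  qed
qed

section \<open>The integer lattice and its fundamental domains\<close>

lemma countable_int_lattice [simp]: "countable (int_lattice :: (real ^ 'd) set)"
proof -
  have "(int_lattice :: (real ^ 'd) set) \<subseteq> range (\<lambda>w :: int ^ 'd. \<chi> i. of_int (w $ i))"
  proof
    fix z :: "real ^ 'd" assume "z \<in> int_lattice"
    then have "\<forall>i. \<exists>n. z $ i = of_int n" by (auto simp: int_lattice_def elim: Ints_cases)
    then obtain n where "\<And>i. z $ i = of_int (n i)" by metis
    then have "z = (\<chi> i. of_int ((\<chi> i. n i) $ i))" by (simp add: vec_eq_iff)
    then show "z \<in> range (\<lambda>w :: int ^ 'd. \<chi> i. of_int (w $ i))" by blast
  qed
  then show ?thesis by (rule countable_subset) simp
qed

lemma int_lattice_uminus: "z \<in> int_lattice \<Longrightarrow> - z \<in> int_lattice"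
  by (simp add: int_lattice_def)

lemma zero_int_lattice [simp]: "0 \<in> int_lattice"
  by (simp add: int_lattice_def)

lemma bij_uminus_int_lattice: "bij_betw uminus int_lattice int_lattice"
  by (rule bij_betwI[where g = uminus]) (auto simp: int_lattice_uminus)

text \<open>Translates of a half-open box tile the space exactly, whereas those of the closed
  \<open>box_at\<close> overlap on faces. The two boxes differ by a null set.\<close>

definition half_box :: "real ^ 'd \<Rightarrow> real \<Rightarrow> (real ^ 'd) set" where
  "half_box c L = {x. \<forall>i. c $ i \<le> x $ i \<and> x $ i < c $ i + L}"

lemma measurable_half_box [measurable]: "half_box c L \<in> sets borel"
  unfolding half_box_def by measurable

lemma measurable_box_at [measurable]: "box_at c L \<in> sets borel"
  unfolding box_at_def by measurable

lemma ex1_half_box: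
  fixes x :: "real ^ 'd" assumes L: "L > 0"
  shows "\<exists>!z. z \<in> int_lattice \<and> x - L *\<^sub>R z \<in> half_box c L"
proof
  let ?z = "(\<chi> i. of_int \<lfloor>(x $ i - c $ i) / L\<rfloor>) :: real ^ 'd"
  have "c $ i \<le> x $ i - L * of_int \<lfloor>(x $ i - c $ i) / L\<rfloor>" "x $ i - L * of_int \<lfloor>(x $ i - c $ i) / L\<rfloor> < c $ i + L" for i
  proof -
    define q where "q = (x $ i - c $ i) / L"
    have x: "x $ i = c $ i + L * q" using L by (simp add: q_def)
    have "L * of_int \<lfloor>q\<rfloor> \<le> L * q" using L by (intro mult_left_mono) auto
    moreover have "L * q < L * (of_int \<lfloor>q\<rfloor> + 1)" using L by (intro mult_strict_left_mono) linarith+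
    ultimately show "c $ i \<le> x $ i - L * of_int \<lfloor>(x $ i - c $ i) / L\<rfloor>"
      "x $ i - L * of_int \<lfloor>(x $ i - c $ i) / L\<rfloor> < c $ i + L"
      unfolding q_def[symmetric] x by (simp_all add: algebra_simps)
  qed
  then show "?z \<in> int_lattice \<and> x - L *\<^sub>R ?z \<in> half_box c L"
    by (simp add: int_lattice_def half_box_def)
  fix z assume z: "z \<in> int_lattice \<and> x - L *\<^sub>R z \<in> half_box c L"
  show "z = ?z"
  proof (simp add: vec_eq_iff, intro allI)
    fix i
    obtain n where n: "z $ i = of_int n" using z by (auto simp: int_lattice_def elim: Ints_cases)
    have "c $ i \<le> x $ i - L * of_int n \<and> x $ i - L * of_int n < c $ i + L"
      using z n by (simp add: half_box_def) metis
    then have "of_int n \<le> (x $ i - c $ i) / L \<and> (x $ i - c $ i) / L < of_int n + 1"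
      using L by (simp add: field_simps)
    then have "\<lfloor>(x $ i - c $ i) / L\<rfloor> = n" by (intro floor_unique) auto
    then show "z $ i = of_int \<lfloor>(x $ i - c $ i) / L\<rfloor>" using n by simp
  qed
qed

lemma box_at_eq_cbox: "box_at c L = cbox c (c + (\<chi> i. L))"
  by (auto simp: box_at_def mem_box_cart)

lemma emeasure_box_at:
  fixes c :: "real ^ 'd" assumes "L \<ge> 0"
  shows "emeasure lborel (box_at c L) = ennreal (L ^ CARD('d))"
    and "emeasure lborel (box c (c + (\<chi> i. L))) = ennreal (L ^ CARD('d))"
proof -
  have le: "c \<bullet> b \<le> (c + (\<chi> i. L)) \<bullet> b" and eq: "((c + (\<chi> i. L)) - c) \<bullet> b = L" if "b \<in> Basis" for b :: "real ^ 'd"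
    using that assms by (auto simp: Basis_vec_def inner_axis inner_add_left)
  have P: "(\<Prod>b\<in>Basis. ((c + (\<chi> i. L)) - c) \<bullet> b) = L ^ CARD('d)"
    by (subst prod.cong[OF refl eq]) simp_all
  show "emeasure lborel (box_at c L) = ennreal (L ^ CARD('d))"
    unfolding box_at_eq_cbox emeasure_lborel_cbox_eq P using le by (simp del: add_diff_cancel_left')
  show "emeasure lborel (box c (c + (\<chi> i. L))) = ennreal (L ^ CARD('d))"
    unfolding emeasure_lborel_box_eq P using le by (simp del: add_diff_cancel_left')
qed

lemma AE_half_box:
  fixes c :: "real ^ 'd" assumes "L \<ge> 0"
  shows "AE x in lborel. x \<in> box_at c L \<longleftrightarrow> x \<in> half_box c L"
proof (rule AE_I')
  let ?b = "box c (c + (\<chi> i. L))"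
  have sub: "?b \<subseteq> box_at c L" by (auto simp: box_at_def mem_box_cart less_imp_le)
  have "emeasure lborel (box_at c L - ?b) = 0"
    using sub by (subst emeasure_Diff) (auto simp: emeasure_box_at[OF assms])
  then show "box_at c L - ?b \<in> null_sets lborel" by (intro null_setsI) auto
  show "{x \<in> space lborel. \<not> (x \<in> box_at c L \<longleftrightarrow> x \<in> half_box c L)} \<subseteq> box_at c L - ?b"
    by (auto simp: box_at_def half_box_def mem_box_cart less_imp_le)
qed

lemma nn_integral_lborel_shift:
  fixes c :: "'a::euclidean_space"
  assumes [measurable]: "f \<in> borel_measurable borel"
  shows "(\<integral>\<^sup>+x. f (x + c) \<partial>lborel) = (\<integral>\<^sup>+x. f x \<partial>lborel)"
proof -
  have "(\<integral>\<^sup>+x. f x \<partial>lborel) = (\<integral>\<^sup>+x. f x \<partial>distr lborel borel ((+) c))" by (simp add: lborel_distr_plus)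
  also have "\<dots> = (\<integral>\<^sup>+x. f (x + c) \<partial>lborel)" by (subst nn_integral_distr) (auto simp: add.commute)
  finally show ?thesis by simp
qed

lemma nn_integral_torus_half_box:
  fixes c :: "real ^ 'd" assumes "L \<ge> 0" and [measurable]: "f \<in> borel_measurable borel"
  shows "(\<integral>\<^sup>+x. f x \<partial>restrict_space lborel (box_at c L)) = (\<integral>\<^sup>+x. f x * indicator (half_box c L) x \<partial>lborel)"
proof -
  have "(\<integral>\<^sup>+x. f x \<partial>restrict_space lborel (box_at c L)) = (\<integral>\<^sup>+x. f x * indicator (box_at c L) x \<partial>lborel)"
    by (subst nn_integral_restrict_space) auto
  also have "\<dots> = (\<integral>\<^sup>+x. f x * indicator (half_box c L) x \<partial>lborel)"
    by (intro nn_integral_cong_AE) (use AE_half_box[OF assms(1), of c] in \<open>auto split: split_indicator\<close>)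
  finally show ?thesis .
qed

lemma nn_integral_indicator_half_box:
  fixes x c :: "real ^ 'd"
  assumes L: "L > 0"
  shows "(\<integral>\<^sup>+z. a * indicator (half_box c L) (x - L *\<^sub>R z) \<partial>count_space int_lattice) = a"
proof -
  let ?D = "half_box c L"
    obtain z where z: "(z \<in> int_lattice \<and> x - L *\<^sub>R z \<in> ?D) \<and>
        (\<forall>w. w \<in> int_lattice \<and> x - L *\<^sub>R w \<in> ?D \<longrightarrow> w = z)"
      using ex1_half_box[OF L, of x c] unfolding Ex1_def ..
    show ?thesis
      by (subst nn_integral_count_space'[of "{z}"]) (use z in \<open>auto split: split_indicator\<close>)
qed

text \<open>Unfolding: the translates of a half-open box tile the space.\<close>

lemma nn_integral_unfold_torus:
  fixes c :: "real ^ 'd" assumes L: "L > 0" and [measurable]: "h \<in> borel_measurable borel"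
  shows "(\<integral>\<^sup>+x. h x \<partial>lborel) =
    (\<integral>\<^sup>+x. (\<integral>\<^sup>+z. h (x - L *\<^sub>R z) \<partial>count_space int_lattice) \<partial>restrict_space lborel (box_at c L))"
proof -
  let ?D = "half_box c L"
  have "(\<integral>\<^sup>+x. h x \<partial>lborel) = (\<integral>\<^sup>+x. (\<integral>\<^sup>+z. h x * indicator ?D (x - L *\<^sub>R z) \<partial>count_space int_lattice) \<partial>lborel)"
    by (simp add: nn_integral_indicator_half_box[OF L])
  also have "\<dots> = (\<integral>\<^sup>+z. (\<integral>\<^sup>+x. h x * indicator ?D (x - L *\<^sub>R z) \<partial>lborel) \<partial>count_space int_lattice)"
    by (rule nn_integral_count_space_nn_integral[OF countable_int_lattice]) measurable
  also have "\<dots> = (\<integral>\<^sup>+z. (\<integral>\<^sup>+x. h (x + L *\<^sub>R z) * indicator ?D x \<partial>lborel) \<partial>count_space int_lattice)"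
  proof (rule nn_integral_cong)
    fix z :: "real ^ 'd"
    show "(\<integral>\<^sup>+x. h x * indicator ?D (x - L *\<^sub>R z) \<partial>lborel) = (\<integral>\<^sup>+x. h (x + L *\<^sub>R z) * indicator ?D x \<partial>lborel)"
      using nn_integral_lborel_shift[of "\<lambda>x. h x * indicator ?D (x - L *\<^sub>R z)" "L *\<^sub>R z"] by simp
  qed
  also have "\<dots> = (\<integral>\<^sup>+z. (\<integral>\<^sup>+x. h (x - L *\<^sub>R z) * indicator ?D x \<partial>lborel) \<partial>count_space int_lattice)"
    using nn_integral_bij_count_space[OF bij_uminus_int_lattice,
        of "\<lambda>z. \<integral>\<^sup>+x. h (x + L *\<^sub>R z) * indicator ?D x \<partial>lborel"] by simp
  also have "\<dots> = (\<integral>\<^sup>+x. (\<integral>\<^sup>+z. h (x - L *\<^sub>R z) * indicator ?D x \<partial>count_space int_lattice) \<partial>lborel)"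
    by (rule nn_integral_count_space_nn_integral[OF countable_int_lattice, symmetric]) measurable
  also have "\<dots> = (\<integral>\<^sup>+x. (\<integral>\<^sup>+z. h (x - L *\<^sub>R z) \<partial>count_space int_lattice) * indicator ?D x \<partial>lborel)"
    by (intro nn_integral_cong nn_integral_multc) auto
  also have "\<dots> = (\<integral>\<^sup>+x. (\<integral>\<^sup>+z. h (x - L *\<^sub>R z) \<partial>count_space int_lattice) \<partial>restrict_space lborel (box_at c L))"
  proof (rule nn_integral_torus_half_box[symmetric])
    show "(\<lambda>x. \<integral>\<^sup>+z. h (x - L *\<^sub>R z) \<partial>count_space int_lattice) \<in> borel_measurable borel"
      by (rule sigma_finite_measure.borel_measurable_nn_integral[OF sigma_finite_measure_count_space_countable])
        (auto simp: measurable_split_conv intro!: measurable_compose_countable'[where g = snd and I = int_lattice and f = "\<lambda>z p. h (fst p - L *\<^sub>R z)"])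
  qed (use L in simp)
  finally show ?thesis .
qed

section \<open>Integrals of periodic functions over a box\<close>

abbreviation torus :: "real ^ 'd \<Rightarrow> real \<Rightarrow> (real ^ 'd) measure" where
  "torus c L \<equiv> restrict_space lborel (box_at c L)"

lemma borel_measurable_torus: "f \<in> borel_measurable borel \<Longrightarrow> f \<in> borel_measurable (torus c L)"
  by (rule measurable_restrict_space1) simp

lemma space_torus [simp]: "space (torus c L) = box_at c L"
  by (simp add: space_restrict_space)

lemma
  fixes c :: "real ^ 'd" assumes "L \<ge> 0"
  shows emeasure_torus: "emeasure (torus c L) (box_at c L) = ennreal (L ^ CARD('d))"
    and finite_measure_torus: "finite_measure (torus c L)"
    and measure_torus: "measure (torus c L) (box_at c L) = L ^ CARD('d)"
proof -
  show *: "emeasure (torus c L) (box_at c L) = ennreal (L ^ CARD('d))"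
    by (subst emeasure_restrict_space) (auto simp: emeasure_box_at[OF assms])
  show "finite_measure (torus c L)"
    by (rule finite_measureI) (simp add: *)
  show "measure (torus c L) (box_at c L) = L ^ CARD('d)"
    using assms by (simp add: measure_def *)
qed

lemma integrable_torus:
  fixes f :: "real ^ 'd \<Rightarrow> 'b::{banach, second_countable_topology}"
  assumes L: "L \<ge> 0" and f: "continuous_on UNIV f"
  shows "integrable (torus c L) f"
proof -
  interpret finite_measure "torus c L" using finite_measure_torus[OF L] .
  have "compact (f ` box_at c L)"
    unfolding box_at_eq_cbox by (rule compact_continuous_image[OF continuous_on_subset[OF f]]) auto
  then have "bounded (f ` box_at c L)" by (rule compact_imp_bounded)
  then obtain B where B: "\<forall>y\<in>f ` box_at c L. norm y \<le> B"
    unfolding bounded_iff ..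
  show ?thesis
    by (rule integrable_const_bound[of _ B])
      (use B f in \<open>auto intro!: borel_measurable_torus borel_measurable_continuous_onI\<close>)
qed

definition periodic :: "real \<Rightarrow> (real ^ 'd \<Rightarrow> 'b) \<Rightarrow> bool" where
  "periodic L f \<longleftrightarrow> (\<forall>x. \<forall>z\<in>int_lattice. f (x - L *\<^sub>R z) = f x)"

lemma periodicD: "periodic L f \<Longrightarrow> z \<in> int_lattice \<Longrightarrow> f (x - L *\<^sub>R z) = f x"
  by (simp add: periodic_def)

text \<open>Unfold the function cut off to the other box: periodicity takes it out of the lattice
  sum, and the translated indicators add up to one.\<close>

lemma nn_integral_torus_corner:
  fixes c c' :: "real ^ 'd"
  assumes L: "L > 0" and [measurable]: "f \<in> borel_measurable borel" and per: "periodic L f"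
  shows "(\<integral>\<^sup>+x. f x \<partial>torus c L) = (\<integral>\<^sup>+x. f x \<partial>torus c' L)"
proof -
  have "(\<integral>\<^sup>+x. f x \<partial>torus c' L) = (\<integral>\<^sup>+x. f x * indicator (half_box c' L) x \<partial>lborel)"
    using L by (intro nn_integral_torus_half_box) auto
  also have "\<dots> = (\<integral>\<^sup>+x. (\<integral>\<^sup>+z. f (x - L *\<^sub>R z) * indicator (half_box c' L) (x - L *\<^sub>R z) \<partial>count_space int_lattice) \<partial>torus c L)"
    by (rule nn_integral_unfold_torus[OF L]) measurable
  also have "\<dots> = (\<integral>\<^sup>+x. (\<integral>\<^sup>+z. f x * indicator (half_box c' L) (x - L *\<^sub>R z) \<partial>count_space int_lattice) \<partial>torus c L)"
    by (intro nn_integral_cong) (simp add: periodicD[OF per])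
  also have "\<dots> = (\<integral>\<^sup>+x. f x \<partial>torus c L)"
    by (simp add: nn_integral_indicator_half_box[OF L])
  finally show ?thesis by simp
qed

lemma nn_integral_torus_shift:
  fixes c c' :: "real ^ 'd"
  assumes L: "L > 0" and f[measurable]: "f \<in> borel_measurable borel" and per: "periodic L f"
  shows "(\<integral>\<^sup>+x. f (x - y) \<partial>torus c L) = (\<integral>\<^sup>+x. f x \<partial>torus c' L)"
proof -
  have "(\<integral>\<^sup>+x. f (x - y) \<partial>torus c L) = (\<integral>\<^sup>+x. f (x - y) * indicator (half_box c L) x \<partial>lborel)"
    using L by (intro nn_integral_torus_half_box) auto
  also have "\<dots> = (\<integral>\<^sup>+x. f x * indicator (half_box c L) (x + y) \<partial>lborel)"
    using nn_integral_lborel_shift[of "\<lambda>x. f (x - y) * indicator (half_box c L) x" y] by simp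
  also have "(\<lambda>x. indicator (half_box c L) (x + y) :: ennreal) = indicator (half_box (c - y) L)"
    by (auto simp: fun_eq_iff half_box_def algebra_simps split: split_indicator)
  then have "(\<integral>\<^sup>+x. f x * indicator (half_box c L) (x + y) \<partial>lborel) = (\<integral>\<^sup>+x. f x * indicator (half_box (c - y) L) x \<partial>lborel)"
    by (metis (no_types, lifting))
  also have "\<dots> = (\<integral>\<^sup>+x. f x \<partial>torus (c - y) L)"
    using L by (intro nn_integral_torus_half_box[symmetric]) auto
  also have "\<dots> = (\<integral>\<^sup>+x. f x \<partial>torus c' L)" by (rule nn_integral_torus_corner[OF L f per])
  finally show ?thesis .
qed

text \<open>Writing \<open>f\<close> as \<open>(\<bar>f\<bar> + f) - \<bar>f\<bar>\<close> reduces
  the signed case to nonnegative integrands.\<close>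

lemma integral_torus_shift_real:
  fixes c c' :: "real ^ 'd" and f :: "real ^ 'd \<Rightarrow> real"
  assumes L: "L > 0" and f: "continuous_on UNIV f" and per: "periodic L f"
  shows "(LINT x|torus c L. f (x - y)) = (LINT x|torus c' L. f x)"
proof -
  have *: "(LINT x|torus c L. g (x - y)) = (LINT x|torus c' L. g x)"
    if g: "continuous_on UNIV g" "periodic L g" "\<And>x. 0 \<le> g x" for g :: "real ^ 'd \<Rightarrow> real"
  proof -
    have gm: "g \<in> borel_measurable borel" by (rule borel_measurable_continuous_onI[OF g(1)])
    have "(LINT x|torus c L. g (x - y)) = enn2real (\<integral>\<^sup>+x. ennreal (g (x - y)) \<partial>torus c L)"
      by (rule integral_eq_nn_integral) (use g gm in \<open>auto intro!: borel_measurable_torus\<close>)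
    also have "\<dots> = enn2real (\<integral>\<^sup>+x. ennreal (g x) \<partial>torus c' L)"
      using g gm by (subst nn_integral_torus_shift[OF L, where c' = c']) (auto simp: periodic_def)
    also have "\<dots> = (LINT x|torus c' L. g x)"
      by (rule integral_eq_nn_integral[symmetric]) (use g gm in \<open>auto intro!: borel_measurable_torus\<close>)
    finally show ?thesis .
  qed
  have abs: "(LINT x|torus c L. \<bar>f (x - y)\<bar>) = (LINT x|torus c' L. \<bar>f x\<bar>)"
    by (rule *) (use f per in \<open>auto simp: periodic_def intro!: continuous_intros\<close>)
  have pos: "(LINT x|torus c L. (\<bar>f (x - y)\<bar> + f (x - y))) = (LINT x|torus c' L. (\<bar>f x\<bar> + f x))"
    by (rule *) (use f per in \<open>auto simp: periodic_def intro!: continuous_intros\<close>)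
  have c: "continuous_on UNIV (\<lambda>x. f (x - y))"
    by (rule continuous_on_compose2[OF f]) (auto intro!: continuous_intros)
  have i: "integrable (torus c L) (\<lambda>x. f (x - y))" "integrable (torus c' L) f"
    using L c f by (auto intro!: integrable_torus)
  show ?thesis using pos abs i by simp
qed

lemma integral_torus_shift:
  fixes c c' :: "real ^ 'd" and f :: "real ^ 'd \<Rightarrow> complex"
  assumes L: "L > 0" and f: "continuous_on UNIV f" and per: "periodic L f"
  shows "(LINT x|torus c L. f (x - y)) = (LINT x|torus c' L. f x)"
proof -
  have c: "continuous_on UNIV (\<lambda>x. f (x - y))"
    by (rule continuous_on_compose2[OF f]) (auto intro!: continuous_intros)
  have i: "integrable (torus c L) (\<lambda>x. f (x - y))" "integrable (torus c' L) f"
    using L c f by (auto intro!: integrable_torus)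
  have "(LINT x|torus c L. Re (f (x - y))) = (LINT x|torus c' L. Re (f x))"
    by (rule integral_torus_shift_real[OF L]) (use f per in \<open>auto simp: periodic_def intro!: continuous_intros\<close>)
  moreover have "(LINT x|torus c L. Im (f (x - y))) = (LINT x|torus c' L. Im (f x))"
    by (rule integral_torus_shift_real[OF L]) (use f per in \<open>auto simp: periodic_def intro!: continuous_intros\<close>)
  ultimately show ?thesis using i by (intro complex_eqI) simp_all
qed

section \<open>Plane waves with frequencies in the dual lattice\<close>

definition wave :: "real ^ 'd \<Rightarrow> real ^ 'd \<Rightarrow> complex" where
  "wave k x = exp (- (2 * pi * \<i> * (k \<bullet> x)))"

lemma wave_cis: "wave k x = cis (- (2 * pi * (k \<bullet> x)))"
  by (simp add: wave_def cis_conv_exp algebra_simps)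

lemma norm_wave [simp]: "norm (wave k x) = 1"
  by (simp add: wave_cis)

lemma wave_add: "wave k (x + y) = wave k x * wave k y"
  by (simp add: wave_cis cis_mult inner_add_right algebra_simps)

lemma wave_add_left: "wave (k + k') x = wave k x * wave k' x"
  by (simp add: wave_cis cis_mult inner_add_left algebra_simps)

lemma wave_0 [simp]: "wave 0 x = 1" "wave k 0 = 1"
  by (simp_all add: wave_cis)

lemma continuous_on_wave [continuous_intros]:
  "continuous_on S f \<Longrightarrow> continuous_on S (\<lambda>x. wave k (f x))"
  unfolding wave_def by (intro continuous_intros)

lemma countable_dual_lattice [simp]: "countable (dual_lattice L)"
  by (simp add: dual_lattice_def)

lemma zero_dual_lattice [simp]: "0 \<in> dual_lattice L"
  unfolding dual_lattice_def by (rule image_eqI[of _ _ 0]) auto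

lemma dual_lattice_add: "k \<in> dual_lattice L \<Longrightarrow> k' \<in> dual_lattice L \<Longrightarrow> k + k' \<in> dual_lattice L"
  unfolding dual_lattice_def by (auto simp: int_lattice_def simp flip: scaleR_add_right)

lemma dual_lattice_uminus: "k \<in> dual_lattice L \<Longrightarrow> - k \<in> dual_lattice L"
  unfolding dual_lattice_def by (auto simp: int_lattice_def simp flip: scaleR_minus_right)

lemma periodic_wave:
  fixes k :: "real ^ 'd"
  assumes L: "L > 0" and k: "k \<in> dual_lattice L" shows "periodic L (wave k)"
  unfolding periodic_def
proof (intro allI ballI)
  fix x z :: "real ^ 'd" assume z: "z \<in> int_lattice"
  obtain w where w: "w \<in> int_lattice" "k = (1 / L) *\<^sub>R w" using k by (auto simp: dual_lattice_def)
  have "k \<bullet> (L *\<^sub>R z) = w \<bullet> z" using w L by simp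
  also have "\<dots> \<in> \<int>" using w z unfolding inner_vec_def by (auto simp: int_lattice_def intro!: Ints_sum Ints_mult)
  finally obtain n where n: "k \<bullet> (L *\<^sub>R z) = of_int n" by (auto elim: Ints_cases)
  have "wave k (- (L *\<^sub>R z)) = cis (2 * pi * of_int n)" using n by (simp add: wave_cis)
  also have "\<dots> = 1" by (rule cis_multiple_2pi) simp
  finally show "wave k (x - L *\<^sub>R z) = wave k x" using wave_add[of k x "- (L *\<^sub>R z)"] by simp
qed

lemma integral_wave:
  fixes k :: "real ^ 'd"
  assumes L: "L > 0" and k: "k \<in> dual_lattice L"
  shows "(LINT x|torus c L. wave k x) = (if k = 0 then of_real (L ^ CARD('d)) else 0)"
proof (cases "k = 0")
  case True
  then show ?thesis using L by (simp add: measure_torus scaleR_conv_of_real)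
next
  case False
  \<comment> \<open>Half a period in the direction of \<open>k\<close>: the inner product of
    \<open>k\<close> with \<open>- y\<close> is 1/2, so the translation changes the sign of the wave
    while leaving the integral unchanged.\<close>
  define y where "y = - ((1 / (2 * (k \<bullet> k))) *\<^sub>R k)"
  have "wave k (- y) = cis (- pi)" using False by (simp add: wave_cis y_def)
  then have "wave k (x - y) = - wave k x" for x using wave_add[of k x "- y"] by (simp add: complex_eq_iff)
  moreover have "(LINT x|torus c L. wave k (x - y)) = (LINT x|torus c L. wave k x)"
    by (rule integral_torus_shift[OF L _ periodic_wave[OF L k]]) (intro continuous_intros)
  ultimately show ?thesis using False by simp
qed

section \<open>Fourier coefficients\<close>

text \<open>Nonnegativity of the coefficients is the essential clause: it survives products and
  makes the test kernels comparable with the nonnegative Fourier coefficients of the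
  density.\<close>

definition trig_poly :: "real \<Rightarrow> (real ^ 'd \<Rightarrow> complex) \<Rightarrow> bool" where
  "trig_poly L f \<longleftrightarrow> (\<exists>F a. finite F \<and> F \<subseteq> dual_lattice L \<and> (\<forall>k. 0 \<le> a k) \<and>
     f = (\<lambda>x. \<Sum>k\<in>F. of_real (a k) * wave k x))"

lemma trig_poly_mult:
  assumes "trig_poly L f" "trig_poly L g" shows "trig_poly L (\<lambda>x. f x * g x)"
proof -
  obtain F a where F: "finite F" "F \<subseteq> dual_lattice L" "\<forall>k. 0 \<le> a k" and f: "f = (\<lambda>x. \<Sum>k\<in>F. of_real (a k) * wave k x)"
    using assms(1) unfolding trig_poly_def by (elim exE conjE)
  obtain G b where G: "finite G" "G \<subseteq> dual_lattice L" "\<forall>k. 0 \<le> b k" and g: "g = (\<lambda>x. \<Sum>k\<in>G. of_real (b k) * wave k x)"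
    using assms(2) unfolding trig_poly_def by (elim exE conjE)
  let ?s = "\<lambda>p. fst p + snd p"
  let ?c = "\<lambda>m. \<Sum>p\<in>{p \<in> F \<times> G. ?s p = m}. a (fst p) * b (snd p)"
  have "f x * g x = (\<Sum>m\<in>?s ` (F \<times> G). of_real (?c m) * wave m x)" for x
  proof -
    have "f x * g x = (\<Sum>p\<in>F \<times> G. of_real (a (fst p) * b (snd p)) * wave (?s p) x)"
      unfolding f g sum_product sum.cartesian_product
      by (intro sum.cong) (auto simp: wave_add_left)
    also have "\<dots> = (\<Sum>m\<in>?s ` (F \<times> G). \<Sum>p\<in>{p \<in> F \<times> G. ?s p = m}. of_real (a (fst p) * b (snd p)) * wave (?s p) x)"
      by (rule sum.image_gen) (use F G in simp)
    also have "\<dots> = (\<Sum>m\<in>?s ` (F \<times> G). of_real (?c m) * wave m x)"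
      unfolding of_real_sum sum_distrib_right by (intro sum.cong refl) simp
    finally show ?thesis .
  qed
  moreover have "?s ` (F \<times> G) \<subseteq> dual_lattice L" using F G by (auto intro!: dual_lattice_add)
  moreover have "0 \<le> ?c m" for m using F G by (intro sum_nonneg mult_nonneg_nonneg) auto
  moreover have "finite (?s ` (F \<times> G))" using F G by simp
  ultimately show ?thesis unfolding trig_poly_def fun_eq_iff
    by (intro exI[of _ "?s ` (F \<times> G)"] exI[of _ ?c]) (intro conjI allI; assumption)
qed

lemma trig_poly_1: "trig_poly L (\<lambda>x. 1)"
  unfolding trig_poly_def by (intro exI[of _ "{0}"] exI[of _ "\<lambda>_. 1"]) auto

lemma trig_poly_power: "trig_poly L f \<Longrightarrow> trig_poly L (\<lambda>x. f x ^ n)"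
  by (induction n) (auto intro: trig_poly_1 trig_poly_mult)

lemma trig_poly_prod: "finite I \<Longrightarrow> (\<And>i. i \<in> I \<Longrightarrow> trig_poly L (f i)) \<Longrightarrow> trig_poly L (\<lambda>x. \<Prod>i\<in>I. f i x)"
  by (induction I rule: finite_induct) (auto intro: trig_poly_1 trig_poly_mult)

lemma trig_poly_axis:
  fixes i :: "'d::finite"
  assumes L: "L > 0"
  shows "trig_poly L (\<lambda>x :: real ^ 'd. of_real ((1 + cos (2 * pi * (x $ i) / L)) / 2))"
proof -
  let ?d = "axis i (1 / L) :: real ^ 'd"
  have dl: "?d \<in> dual_lattice L"
    unfolding dual_lattice_def
    by (rule image_eqI[of _ _ "axis i 1"]) (auto simp: int_lattice_def axis_def vec_eq_iff)
  \<comment> \<open>The three frequencies must differ for the sum over the set to have three terms: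
    the constant 1/2 and the two exponentials of the cosine with coefficient 1/4 each.\<close>
  have ne: "?d \<noteq> 0" "- ?d \<noteq> 0" "?d \<noteq> - ?d"
    using L by (auto simp: vec_eq_iff axis_def intro!: exI[of _ i])
  have ip: "?d \<bullet> x = x $ i / L" for x by (simp add: inner_axis' )
  have "of_real ((1 + cos (2 * pi * (x $ i) / L)) / 2)
      = (\<Sum>k\<in>{0, ?d, - ?d}. of_real (if k = 0 then 1 / 2 else 1 / 4) * wave k x)" for x
    using ne by (simp add: wave_cis ip complex_eq_iff)
  then show ?thesis unfolding trig_poly_def
    by (intro exI[of _ "{0, ?d, - ?d}"] exI[of _ "\<lambda>k. if k = 0 then 1 / 2 else 1 / 4"])
      (auto simp: dl dual_lattice_uminus)
qed

text \<open>Each factor is a trigonometric polynomial with values in [0, 1] which equals 1 only at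
  multiples of \<open>L\<close>. Normalised powers of the product therefore concentrate at the
  lattice points and keep nonnegative coefficients.\<close>

definition bump :: "real \<Rightarrow> real ^ 'd \<Rightarrow> real" where
  "bump L x = (\<Prod>i\<in>UNIV. (1 + cos (2 * pi * (x $ i) / L)) / 2)"

lemma trig_poly_bump: "L > 0 \<Longrightarrow> trig_poly L (\<lambda>x. of_real (bump L x ^ n))"
  unfolding bump_def of_real_power of_real_prod
  by (intro trig_poly_power trig_poly_prod trig_poly_axis) auto

lemma continuous_on_bump: "continuous_on S (bump L)"
  unfolding bump_def by (cases "L = 0") (auto intro!: continuous_intros)

lemma bump_nonneg: "0 \<le> bump L x"
  unfolding bump_def
proof (rule prod_nonneg)
  fix i
  have "0 \<le> 1 + cos (2 * pi * (x $ i) / L)" using cos_ge_minus_one[of "2 * pi * (x $ i) / L"] by linarith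
  then show "0 \<le> (1 + cos (2 * pi * (x $ i) / L)) / 2" by simp
qed

lemma bump_0: "bump L 0 = 1"
  by (simp add: bump_def)

text \<open>In this box the maximum of \<open>bump L\<close> is attained at the interior point 0
  only; with corner 0 it would be attained at every corner.\<close>

abbreviation centered :: "real \<Rightarrow> (real ^ 'd) measure" where
  "centered L \<equiv> torus (\<chi> i. - (L / 2)) L"

lemma bump_less_1:
  fixes x :: "real ^ 'd"
  assumes L: "L > 0" and x: "x \<in> box_at (\<chi> i. - (L / 2)) L" and ne: "x \<noteq> 0"
  shows "bump L x < 1"
proof -
  obtain i where i: "x $ i \<noteq> 0" using ne by (auto simp: vec_eq_iff)
  let ?t = "2 * pi * (x $ i) / L"
  have "\<bar>x $ i\<bar> \<le> L / 2" using x by (auto simp: box_at_def abs_le_iff minus_le_iff dest!: spec[of _ i])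
  then have "\<bar>?t\<bar> \<le> pi" using L by (simp add: abs_mult field_simps)
  moreover have "0 < \<bar>?t\<bar>" using i L by simp
  ultimately have "cos \<bar>?t\<bar> < cos 0" by (intro cos_monotone_0_pi) auto
  then have "cos ?t < 1" by (simp only: cos_abs_real cos_zero)
  then have c: "(1 + cos ?t) / 2 < 1" by simp
  have b: "0 \<le> (1 + cos t) / 2 \<and> (1 + cos t) / 2 \<le> 1" for t :: real
  proof -
    have "0 \<le> 1 + cos t" "1 + cos t \<le> 2" using cos_ge_minus_one[of t] cos_le_one[of t] by linarith+
    then show ?thesis by simp
  qed
  have "bump L x = (1 + cos ?t) / 2 * (\<Prod>j\<in>UNIV - {i}. (1 + cos (2 * pi * (x $ j) / L)) / 2)"
    unfolding bump_def by (rule prod.remove) auto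
  also have "\<dots> \<le> (1 + cos ?t) / 2 * 1"
    using b by (intro mult_left_mono prod_le_1) auto
  finally show ?thesis using c by simp
qed

text \<open>Laplace's method. Near 0 the kernel exceeds any \<open>s' < 1\<close> on a set of
  positive measure, so its mass is at least of order \<open>s' ^ n\<close>; away from 0 compactness
  gives a bound \<open>s ^ n\<close> with \<open>s < 1\<close>. Taking \<open>s'\<close> above
  \<open>s\<close> makes the outside contribution negligible.\<close>

lemma bump_approx_identity:
  fixes g :: "real ^ 'd \<Rightarrow> complex"
  assumes L: "L > 0" and cont: "continuous_on UNIV g"
  defines "M \<equiv> centered L"
  shows "\<And>n. 0 < (LINT x|M. bump L x ^ n)"
    and "(\<lambda>n. (LINT x|M. g x * of_real (bump L x ^ n)) / of_real (LINT x|M. bump L x ^ n)) \<longlonglongrightarrow> g 0"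
proof -
  define K where "K = (box_at (\<chi> i. - (L / 2)) L :: (real ^ 'd) set)"
  interpret finite_measure M unfolding M_def by (rule finite_measure_torus) (use L in simp)
  have sp: "space M = K" by (simp add: M_def K_def)
  have cK: "compact K" unfolding K_def box_at_eq_cbox by simp
  have int: "integrable M f" if "continuous_on UNIV f" for f :: "real ^ 'd \<Rightarrow> 'b::{banach, second_countable_topology}"
    unfolding M_def by (rule integrable_torus) (use L that in auto)
  have cb: "continuous_on UNIV (bump L :: real ^ 'd \<Rightarrow> real)" by (rule continuous_on_bump)
  have ball_K: "ball 0 (L / 2) \<subseteq> K"
  proof
    fix x :: "real ^ 'd" assume "x \<in> ball 0 (L / 2)"
    then have "\<bar>x $ i\<bar> < L / 2" for i using component_le_norm_cart[of x i] by simp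
    then show "x \<in> K" unfolding K_def box_at_def by (auto simp: abs_less_iff) (smt (verit) field_sum_of_halves)+
  qed
  \<comment> \<open>Continuity at 0 gives a ball inside the box on which \<open>bump L\<close>
    exceeds \<open>s\<close>; the measure of that ball serves as \<open>m\<close>.\<close>
  have lower: "\<exists>m>0. \<forall>n. m * s ^ n \<le> (LINT x|M. bump L x ^ n)" if s: "0 \<le> s" "s < 1" for s
  proof -
    have "isCont (bump L) (0 :: real ^ 'd)" using cb by (simp add: continuous_on_eq_continuous_at)
    then have "\<forall>\<^sub>F x in nhds (0 :: real ^ 'd). s < bump L x"
      using s unfolding isCont_def tendsto_at_iff_tendsto_nhds by (intro order_tendstoD(1)) (auto simp: bump_0)
    then obtain r where r: "r > 0" "\<And>x :: real ^ 'd. norm x < r \<Longrightarrow> s < bump L x"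
      unfolding eventually_nhds_metric by auto
    define B where "B = (ball 0 (min r (L / 2)) :: (real ^ 'd) set)"
    have BK: "B \<subseteq> K" using ball_K by (auto simp: B_def)
    have Bs: "B \<in> sets M" unfolding M_def using BK by (subst sets_restrict_space_iff) (auto simp: K_def B_def)
    have "measure M B = measure lborel B" unfolding M_def using BK
      by (subst measure_restrict_space) (auto simp: K_def)
    also have "\<dots> > 0" unfolding B_def using content_ball_pos[of "min r (L / 2)" "0 :: real ^ 'd"] r L by simp
    finally have m: "measure M B > 0" .
    have "measure M B * s ^ n \<le> (LINT x|M. bump L x ^ n)" for n
    proof -
      have "measure M B * s ^ n = (LINT x|M. s ^ n * indicator B x)"
        using Bs sets.sets_into_space[OF Bs] by (simp add: Int_absorb2 mult.commute)
      also have "\<dots> \<le> (LINT x|M. bump L x ^ n)"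
      proof (rule integral_mono)
        show "integrable M (\<lambda>x. s ^ n * indicator B x)" using Bs by (intro integrable_mult_right integrable_real_indicator) (auto simp: less_top[symmetric])
        show "integrable M (\<lambda>x. bump L x ^ n)" by (intro int continuous_intros cb)
        show "s ^ n * indicator B x \<le> bump L x ^ n" for x
          using r(2)[of x] s by (auto simp: B_def bump_nonneg split: split_indicator intro!: power_mono)
      qed
      finally show ?thesis .
    qed
    then show ?thesis using m by blast
  qed
  show J: "0 < (LINT x|M. bump L x ^ n)" for n
  proof -
    obtain m where m: "m > 0" "\<forall>n. m * (1 / 2) ^ n \<le> (LINT x|M. bump L x ^ n)" using lower[of "1/2"] by auto
    have "0 < m * (1 / 2) ^ n" using m by simp
    then show ?thesis using m(2) by (rule_tac less_le_trans) auto
  qed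
  let ?J = "\<lambda>n. LINT x|M. bump L x ^ n"
  have "compact ((\<lambda>x. g x - g 0) ` K)"
    by (intro compact_continuous_image cK continuous_intros continuous_on_subset[OF cont]) simp
  then have "bounded ((\<lambda>x. g x - g 0) ` K)" by (rule compact_imp_bounded)
  then obtain C where C: "\<And>x. x \<in> K \<Longrightarrow> norm (g x - g 0) \<le> C" unfolding bounded_iff by auto
  have "0 \<in> K" using ball_K L by auto
  then have C0: "C \<ge> 0" using C[of 0] by simp
  show "(\<lambda>n. (LINT x|M. g x * of_real (bump L x ^ n)) / of_real (?J n)) \<longlonglongrightarrow> g 0"
  proof (rule LIMSEQ_I)
    fix e :: real assume e: "e > 0"
    have "isCont g 0" using cont by (simp add: continuous_on_eq_continuous_at)
    then obtain \<delta> where \<delta>: "\<delta> > 0" "\<And>x. norm x < \<delta> \<Longrightarrow> norm (g x - g 0) < e / 2"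
      unfolding continuous_at_eps_delta dist_norm using e by (metis diff_zero half_gt_zero)
    define S where "S = K - ball 0 \<delta>"
    have "\<exists>s\<ge>0. s < 1 \<and> (\<forall>x\<in>S. bump L x \<le> s)"
    proof (cases "S = {}")
      case True then show ?thesis by (intro exI[of _ 0]) simp
    next
      case False
      have "compact S" unfolding S_def by (rule compact_diff[OF cK]) simp
      then obtain x where x: "x \<in> S" "\<forall>y\<in>S. bump L y \<le> bump L x"
        using continuous_attains_sup[OF _ False continuous_on_bump[of S L]] by auto
      have "bump L x < 1" using x(1) \<delta>(1) by (intro bump_less_1[OF L]) (auto simp: S_def K_def)
      then show ?thesis using x bump_nonneg by blast
    qed
    then obtain s where s: "0 \<le> s" "s < 1" "\<And>x. x \<in> S \<Longrightarrow> bump L x \<le> s" by auto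
    \<comment> \<open>The midpoint of \<open>s\<close> and 1 is strictly above \<open>s\<close> and
      below 1, so \<open>(s / s') ^ n\<close> tends to 0.\<close>
    define s' where "s' = (1 + s) / 2"
    have s': "0 < s'" "s' < 1" "s < s'" using s by (auto simp: s'_def)
    obtain m where m: "m > 0" "\<And>n. m * s' ^ n \<le> ?J n" using lower[of s'] s' by auto
    define V where "V = measure M K"
    have bound: "norm ((LINT x|M. g x * of_real (bump L x ^ n)) / of_real (?J n) - g 0) \<le> e / 2 + C * V / m * (s / s') ^ n" for n
    proof -
      have i1: "integrable M (\<lambda>x. g x * of_real (bump L x ^ n))" "integrable M (\<lambda>x. bump L x ^ n)"
        "integrable M (\<lambda>x. g 0 * of_real (bump L x ^ n))" "integrable M (\<lambda>x. (g x - g 0) * of_real (bump L x ^ n))"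
        by (intro int continuous_intros cb cont)+
      have "(LINT x|M. g x * of_real (bump L x ^ n)) - g 0 * of_real (?J n) = (LINT x|M. (g x - g 0) * of_real (bump L x ^ n))"
        using i1 integral_complex_of_real[of M "\<lambda>x. bump L x ^ n"] by (simp add: left_diff_distrib)
      also have "norm \<dots> \<le> (LINT x|M. norm ((g x - g 0) * of_real (bump L x ^ n)))" by (rule integral_norm_bound)
      also have "\<dots> \<le> (LINT x|M. e / 2 * bump L x ^ n + C * s ^ n)"
      proof (rule integral_mono)
        show "integrable M (\<lambda>x. norm ((g x - g 0) * complex_of_real (bump L x ^ n)))" using i1 by simp
        show "integrable M (\<lambda>x. e / 2 * bump L x ^ n + C * s ^ n)" using i1 by simp
        fix x assume "x \<in> space M"
        then have xK: "x \<in> K" by (simp add: sp)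
        have p: "0 \<le> bump L x ^ n" by (simp add: bump_nonneg)
        have pe: "0 \<le> e / 2 * bump L x ^ n" using p e by simp
        have pc: "0 \<le> C * s ^ n" using C0 s(1) by simp
        have nm: "norm ((g x - g 0) * complex_of_real (bump L x ^ n)) = norm (g x - g 0) * bump L x ^ n"
          by (simp add: norm_mult norm_power bump_nonneg)
        show "norm ((g x - g 0) * complex_of_real (bump L x ^ n)) \<le> e / 2 * bump L x ^ n + C * s ^ n"
        proof (cases "x \<in> S")
          case True
          have "norm (g x - g 0) * bump L x ^ n \<le> C * s ^ n"
            using C[OF xK] s(3)[OF True] C0 by (intro mult_mono power_mono) (auto simp: bump_nonneg)
          then show ?thesis unfolding nm using pe by linarith
        next
          case False
          then have "norm (g x - g 0) \<le> e / 2" using \<delta>(2)[of x] xK by (auto simp: S_def)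
          then have "norm (g x - g 0) * bump L x ^ n \<le> e / 2 * bump L x ^ n" using p by (intro mult_right_mono)
          then show ?thesis unfolding nm using pc by linarith
        qed
      qed
      also have "\<dots> = e / 2 * ?J n + C * s ^ n * V" using i1 by (simp add: V_def sp mult.commute)
      finally have *: "norm ((LINT x|M. g x * of_real (bump L x ^ n)) - g 0 * of_real (?J n)) \<le> e / 2 * ?J n + C * s ^ n * V" .
      have "(LINT x|M. g x * of_real (bump L x ^ n)) / of_real (?J n) - g 0 = ((LINT x|M. g x * of_real (bump L x ^ n)) - g 0 * of_real (?J n)) / of_real (?J n)"
        using J[of n] by (simp add: diff_divide_distrib)
      then have "norm ((LINT x|M. g x * of_real (bump L x ^ n)) / of_real (?J n) - g 0) \<le> (e / 2 * ?J n + C * s ^ n * V) / ?J n"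
        using divide_right_mono[OF *, of "?J n"] J[of n] by (simp add: norm_divide)
      also have "\<dots> = e / 2 + C * s ^ n * V / ?J n" using J[of n] by (simp add: add_divide_distrib)
      also have "C * s ^ n * V / ?J n \<le> C * s ^ n * V / (m * s' ^ n)"
        using m s' C0 s(1) by (intro divide_left_mono) (auto simp: V_def J intro!: mult_pos_pos)
      also have "C * s ^ n * V / (m * s' ^ n) = C * V / m * (s / s') ^ n" by (simp add: power_divide)
      finally show ?thesis by simp
    qed
    have "(\<lambda>n. C * V / m * (s / s') ^ n) \<longlonglongrightarrow> C * V / m * 0"
      using s s' by (intro tendsto_mult_left LIMSEQ_realpow_zero) auto
    then have "\<forall>\<^sub>F n in sequentially. C * V / m * (s / s') ^ n < e / 2"
      using e by (intro order_tendstoD(2)) auto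
    then obtain n0 where n0: "\<And>n. n \<ge> n0 \<Longrightarrow> C * V / m * (s / s') ^ n < e / 2" unfolding eventually_sequentially by auto
    show "\<exists>n0. \<forall>n\<ge>n0. norm ((LINT x|M. g x * of_real (bump L x ^ n)) / of_real (?J n) - g 0) < e"
    proof (intro exI[of _ n0] allI impI)
      fix n assume "n \<ge> n0"
      then show "norm ((LINT x|M. g x * of_real (bump L x ^ n)) / of_real (?J n) - g 0) < e"
        using n0[of n] bound[of n] by linarith
    qed
  qed
qed

lemma trig_poly_sum_integral:
  assumes L: "L > 0" and f: "continuous_on UNIV f"
  shows "(LINT x|torus c L. (\<Sum>k\<in>F. of_real (a k) * wave k x) * f x) = (\<Sum>k\<in>F. of_real (a k) * (LINT x|torus c L. wave k x * f x))"
proof -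
  have i: "integrable (torus c L) (\<lambda>x. wave k x * f x)" for k
    by (intro integrable_torus continuous_intros f) (use L in simp)
  have "(LINT x|torus c L. (\<Sum>k\<in>F. of_real (a k) * wave k x) * f x) = (LINT x|torus c L. (\<Sum>k\<in>F. of_real (a k) * (wave k x * f x)))"
    by (intro Bochner_Integration.integral_cong refl) (simp add: sum_distrib_right mult.assoc)
  also have "\<dots> = (\<Sum>k\<in>F. LINT x|torus c L. of_real (a k) * (wave k x * f x))"
    by (intro Bochner_Integration.integral_sum integrable_mult_right i)
  also have "\<dots> = (\<Sum>k\<in>F. of_real (a k) * (LINT x|torus c L. wave k x * f x))" by simp
  finally show ?thesis .
qed

text \<open>Testing against the kernels \<open>bump L ^ n\<close>, whose coefficients are nonnegative and tend to one,
  bounds the partial sums of the coefficients from above and their total from below.\<close>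

lemma fourier_series_at_0:
  fixes f :: "real ^ 'd \<Rightarrow> real" and r :: "real ^ 'd \<Rightarrow> real"
  assumes L: "L > 0" and f: "continuous_on UNIV f" "periodic L f"
    and co: "\<And>k. k \<in> dual_lattice L \<Longrightarrow> (LINT x|torus c L. wave k x * of_real (f x)) = of_real (r k)"
    and nn: "\<And>k. k \<in> dual_lattice L \<Longrightarrow> 0 \<le> r k"
  shows "r summable_on dual_lattice L" "(\<Sum>\<^sub>\<infinity>k\<in>dual_lattice L. r k) = L ^ CARD('d) * f 0"
proof -
  let ?M = "centered L :: (real ^ 'd) measure" and ?D = "dual_lattice L :: (real ^ 'd) set"
  define V where "V = L ^ CARD('d)"
  have V: "V > 0" using L by (simp add: V_def)
  define J where "J n = (LINT x|?M. bump L x ^ n)" for n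
  have J: "0 < J n" for n unfolding J_def by (rule bump_approx_identity(1)[OF L continuous_on_const])
  have cob: "(LINT x|?M. wave k x * of_real (f x)) = of_real (r k)" if "k \<in> ?D" for k
  proof -
    have "periodic L (\<lambda>x. wave k x * of_real (f x))"
      using f(2) periodic_wave[OF L that] by (simp add: periodic_def)
    then show ?thesis unfolding co[OF that, symmetric]
      using integral_torus_shift[OF L, of "\<lambda>x. wave k x * of_real (f x)" _ 0 c]
      by (simp add: continuous_intros f)
  qed
  have "\<forall>n. \<exists>F a. finite F \<and> F \<subseteq> ?D \<and> (\<forall>k. 0 \<le> a k) \<and>
     (\<lambda>x :: real ^ 'd. complex_of_real (bump L x ^ n)) = (\<lambda>x. \<Sum>k\<in>F. of_real (a k) * wave k x)"
    using trig_poly_bump[OF L] unfolding trig_poly_def by blast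
  then obtain F a where Fa: "\<forall>n. finite (F n) \<and> F n \<subseteq> ?D \<and> (\<forall>k. 0 \<le> a n k) \<and>
     (\<lambda>x :: real ^ 'd. complex_of_real (bump L x ^ n)) = (\<lambda>x. \<Sum>k\<in>F n. of_real (a n k) * wave k x)"
    unfolding choice_iff by (elim exE)
  have F: "finite (F n)" "F n \<subseteq> ?D" and a: "0 \<le> a n k" for n k using Fa by auto
  have b: "complex_of_real (bump L x ^ n) = (\<Sum>k\<in>F n. of_real (a n k) * wave k x)" for x :: "real ^ 'd" and n
    using Fa by (metis (mono_tags, lifting))
  \<comment> \<open>The Fourier coefficients of the normalised kernel. They lie in [0, 1] because
    the kernel is nonnegative with total mass 1, and each tends to 1 because the kernel concentrates
    at 0.\<close>
  define q where "q n k = (if k \<in> F n then V * a n k / J n else 0)" for n k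
  have q0: "0 \<le> q n k" for n k using a J[of n] V by (simp add: q_def less_imp_le)
  have qint: "of_real (q n k) = (LINT x|?M. wave (- k) x * of_real (bump L x ^ n)) / of_real (J n)" if k: "k \<in> ?D" for n k
  proof -
    have "(LINT x|?M. wave (- k) x * of_real (bump L x ^ n)) = (LINT x|?M. (\<Sum>m\<in>F n. of_real (a n m) * wave m x) * wave (- k) x)"
      by (simp only: b mult.commute)
    also have "\<dots> = (\<Sum>m\<in>F n. of_real (a n m) * (LINT x|?M. wave m x * wave (- k) x))"
      by (rule trig_poly_sum_integral[OF L]) (intro continuous_intros)
    also have "\<dots> = (\<Sum>m\<in>F n. of_real (a n m) * (if m = k then of_real V else 0))"
    proof (intro sum.cong refl arg_cong2[where f = "(*)"])
      fix m assume "m \<in> F n"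
      then have "m + - k \<in> ?D" using F k by (intro dual_lattice_add dual_lattice_uminus) auto
      then show "(LINT x|?M. wave m x * wave (- k) x) = (if m = k then of_real V else 0)"
        using integral_wave[OF L, of "m + - k"] by (simp add: wave_add_left[symmetric] V_def)
    qed
    also have "\<dots> = (if k \<in> F n then of_real (a n k * V) else 0)"
      using F(1) by (simp add: if_distrib[of "\<lambda>x. _ * x"] cong: if_cong)
    finally show ?thesis using J[of n] by (simp add: q_def mult.commute)
  qed
  have q1: "q n k \<le> 1" if k: "k \<in> ?D" for n k
  proof -
    have "norm (LINT x|?M. wave (- k) x * of_real (bump L x ^ n)) \<le> (LINT x|?M. norm (wave (- k) x * of_real (bump L x ^ n)))"
      by (rule integral_norm_bound)
    also have "\<dots> = J n" unfolding J_def by (simp add: norm_mult norm_power bump_nonneg)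
    finally have "norm (complex_of_real (q n k)) \<le> 1"
      unfolding qint[OF k] using J[of n] by (simp add: norm_divide)
    then show ?thesis using q0 by simp
  qed
  have qlim: "(\<lambda>n. q n k) \<longlonglongrightarrow> 1" if k: "k \<in> ?D" for k
  proof -
    have *: "(\<lambda>n. complex_of_real (q n k)) \<longlonglongrightarrow> wave (- k) 0"
      unfolding qint[OF k] J_def by (rule bump_approx_identity(2)[OF L]) (intro continuous_intros)
    show ?thesis using tendsto_Re[OF *] by simp
  qed
  \<comment> \<open>The volume times the average of \<open>f\<close> against the normalised kernel,
    written on the Fourier side. Its limit is the claimed total, and each \<open>T n\<close> is a
    finite sum dominated by the coefficients \<open>r\<close>.\<close>
  define T where "T n = (\<Sum>k\<in>F n. q n k * r k)" for n
  have Tlim: "T \<longlonglongrightarrow> V * f 0"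
  proof -
    have T: "complex_of_real (T n) = of_real V * ((LINT x|?M. of_real (f x) * of_real (bump L x ^ n)) / of_real (J n))" for n
    proof -
      have "(LINT x|?M. of_real (f x) * of_real (bump L x ^ n)) = (LINT x|?M. (\<Sum>m\<in>F n. of_real (a n m) * wave m x) * complex_of_real (f x))"
        by (simp only: b mult.commute)
      also have "\<dots> = (\<Sum>m\<in>F n. of_real (a n m) * (LINT x|?M. wave m x * complex_of_real (f x)))"
        by (rule trig_poly_sum_integral[OF L]) (intro continuous_intros f)
      also have "\<dots> = (\<Sum>m\<in>F n. of_real (a n m) * of_real (r m))"
        using F(2)[of n] by (intro sum.cong refl arg_cong2[where f = "(*)"] cob) auto
      finally have eq: "(LINT x|?M. of_real (f x) * of_real (bump L x ^ n)) = (\<Sum>m\<in>F n. complex_of_real (a n m) * of_real (r m))" .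
      have "T n = (\<Sum>m\<in>F n. V * a n m / J n * r m)" unfolding T_def q_def by (intro sum.cong) auto
      then show ?thesis unfolding eq by (simp add: sum_divide_distrib sum_distrib_left mult_ac)
    qed
    have *: "(\<lambda>n. complex_of_real (T n)) \<longlonglongrightarrow> of_real V * of_real (f 0)"
      unfolding T J_def by (intro tendsto_mult_left bump_approx_identity(2)[OF L] continuous_intros f)
    show ?thesis using tendsto_Re[OF *] by simp
  qed
  have upper: "sum r G \<le> V * f 0" if G: "finite G" "G \<subseteq> ?D" for G
  proof (rule LIMSEQ_le)
    show "(\<lambda>n. \<Sum>k\<in>G. q n k * r k) \<longlonglongrightarrow> sum r G"
      using G by (intro tendsto_sum tendsto_mult[OF qlim tendsto_const, THEN tendsto_eq_rhs]) auto
    have "(\<Sum>k\<in>G. q n k * r k) \<le> T n" for n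
    proof -
      have "(\<Sum>k\<in>G. q n k * r k) = (\<Sum>k\<in>G \<inter> F n. q n k * r k)"
        using G by (intro sum.mono_neutral_right) (auto simp: q_def)
      also have "\<dots> \<le> T n" unfolding T_def
        using F[of n] nn q0 by (intro sum_mono2) auto
      finally show ?thesis .
    qed
    then show "\<exists>N. \<forall>n\<ge>N. (\<Sum>k\<in>G. q n k * r k) \<le> T n" by simp
  qed (rule Tlim)
  show summ: "r summable_on ?D"
    by (rule nonneg_bdd_above_summable_on) (use nn upper in \<open>auto intro!: bdd_aboveI2\<close>)
  show "(\<Sum>\<^sub>\<infinity>k\<in>?D. r k) = L ^ CARD('d) * f 0" unfolding V_def[symmetric]
  proof (rule antisym)
    show "infsum r ?D \<le> V * f 0" by (rule infsum_le_finite_sums[OF summ]) (use upper in auto)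
    have "T n \<le> infsum r ?D" for n
    proof -
      have "T n \<le> sum r (F n)" unfolding T_def
        using F[of n] q1 nn by (intro sum_mono mult_left_le_one_le q0) auto
      also have "\<dots> \<le> infsum r ?D" by (rule finite_sum_le_infsum[OF summ]) (use F nn in auto)
      finally show ?thesis .
    qed
    then show "V * f 0 \<le> infsum r ?D" using LIMSEQ_le_const2[OF Tlim] by auto
  qed
qed

text \<open>\<open>convolution_power c L f n\<close> is the \<open>(n + 1)\<close>-fold convolution of \<open>f\<close> on the torus.\<close>

fun convolution_power :: "real ^ 'd \<Rightarrow> real \<Rightarrow> (real ^ 'd \<Rightarrow> real) \<Rightarrow> nat \<Rightarrow> real ^ 'd \<Rightarrow> real" where
  "convolution_power c L f 0 = f"
| "convolution_power c L f (Suc n) = (\<lambda>x. LINT y|torus c L. convolution_power c L f n (x - y) * f y)"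

section \<open>Regularity and Fourier coefficients of convolution powers\<close>

lemma periodic_bounded:
  fixes f :: "real ^ 'd \<Rightarrow> real"
  assumes L: "L > 0" and f: "continuous_on UNIV f" "periodic L f"
  shows "\<exists>B. \<forall>x. \<bar>f x\<bar> \<le> B"
proof -
  have "compact (f ` box_at 0 L)"
    unfolding box_at_eq_cbox by (rule compact_continuous_image[OF continuous_on_subset[OF f(1)]]) auto
  then have "bounded (f ` box_at 0 L)" by (rule compact_imp_bounded)
  then obtain B where B: "\<forall>y\<in>f ` box_at 0 L. norm y \<le> B" unfolding bounded_iff ..
  have "\<bar>f x\<bar> \<le> B" for x
  proof -
    obtain z where z: "z \<in> int_lattice" "x - L *\<^sub>R z \<in> half_box 0 L"
      using ex1_implies_ex[OF ex1_half_box[OF L, of x 0]] by (elim exE conjE)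
    then have "x - L *\<^sub>R z \<in> box_at 0 L" by (auto simp: half_box_def box_at_def less_imp_le)
    then have "norm (f (x - L *\<^sub>R z)) \<le> B" using B by simp
    then show ?thesis using periodicD[OF f(2) z(1)] by simp
  qed
  then show ?thesis by (intro exI allI)
qed

lemma
  fixes f :: "real ^ 'd \<Rightarrow> real"
  assumes L: "L > 0" and f: "continuous_on UNIV f" "periodic L f" "\<And>x. 0 \<le> f x"
  shows continuous_convolution_power: "continuous_on UNIV (convolution_power c L f n)"
    and periodic_convolution_power: "periodic L (convolution_power c L f n)"
    and convolution_power_nonneg: "\<And>x. 0 \<le> convolution_power c L f n x"
proof -
  have "continuous_on UNIV (convolution_power c L f n) \<and> periodic L (convolution_power c L f n) \<and> (\<forall>x. 0 \<le> convolution_power c L f n x)"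
  proof (induction n)
    case 0 then show ?case using f by simp
  next
    case (Suc n)
    let ?g = "convolution_power c L f n"
    have g: "continuous_on UNIV ?g" "periodic L ?g" "\<And>x. 0 \<le> ?g x" using Suc by auto
    obtain B where B: "\<forall>x. \<bar>?g x\<bar> \<le> B" using periodic_bounded[OF L g(1,2)] ..
    have cx: "continuous_on UNIV (\<lambda>y. ?g (x - y))" for x
      by (rule continuous_on_compose2[OF g(1)]) (auto intro!: continuous_intros)
    have "isCont (convolution_power c L f (Suc n)) x" for x
      unfolding continuous_at_sequentially o_def convolution_power.simps
    proof (intro allI impI)
      fix X assume X: "X \<longlonglongrightarrow> x"
      show "(\<lambda>i. LINT y|torus c L. ?g (X i - y) * f y) \<longlonglongrightarrow> (LINT y|torus c L. ?g (x - y) * f y)"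
      proof (rule integral_dominated_convergence[where w = "\<lambda>y. B * f y"])
        show "(\<lambda>y. ?g (x - y) * f y) \<in> borel_measurable (torus c L)"
          by (intro borel_measurable_torus borel_measurable_continuous_onI continuous_intros cx f)
        show "(\<lambda>y. ?g (X i - y) * f y) \<in> borel_measurable (torus c L)" for i
          by (intro borel_measurable_torus borel_measurable_continuous_onI continuous_intros cx f)
        show "integrable (torus c L) (\<lambda>y. B * f y)"
          by (intro integrable_torus continuous_intros f) (use L in simp)
        have "(\<lambda>i. ?g (X i - y)) \<longlonglongrightarrow> ?g (x - y)" for y
          using g(1) X by (intro continuous_on_tendsto_compose[OF g(1)] tendsto_intros) auto
        then show "AE y in torus c L. (\<lambda>i. ?g (X i - y) * f y) \<longlonglongrightarrow> ?g (x - y) * f y"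
          by (intro AE_I2 tendsto_intros)
        show "AE y in torus c L. norm (?g (X i - y) * f y) \<le> B * f y" for i
          using B f(3) by (intro AE_I2) (auto simp: abs_mult intro!: mult_right_mono)
      qed
    qed
    then have "continuous_on UNIV (convolution_power c L f (Suc n))"
      by (simp add: continuous_on_eq_continuous_at del: convolution_power.simps)
    moreover have "periodic L (convolution_power c L f (Suc n))"
      unfolding periodic_def
    proof (intro allI ballI)
      fix x z :: "real ^ 'd" assume z: "z \<in> int_lattice"
      have "?g (x - L *\<^sub>R z - y) = ?g (x - y)" for y
        using periodicD[OF g(2) z, of "x - y"] by (simp add: algebra_simps)
      then show "convolution_power c L f (Suc n) (x - L *\<^sub>R z) = convolution_power c L f (Suc n) x" by simp
    qed
    moreover have "\<forall>x. 0 \<le> convolution_power c L f (Suc n) x"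
      using g(3) f(3) by (auto intro!: integral_nonneg_AE)
    ultimately show ?case by blast
  qed
  then show "continuous_on UNIV (convolution_power c L f n)" "periodic L (convolution_power c L f n)"
    "\<And>x. 0 \<le> convolution_power c L f n x" by auto
qed

text \<open>Translating by \<open>v\<close>, which periodicity allows, leaves a dependence on
  \<open>u - v\<close> only. This is how a position between two neighbours on a cycle disappears
  from the integral.\<close>

lemma nn_integral_convolution_power:
  fixes f :: "real ^ 'd \<Rightarrow> real"
  assumes L: "L > 0" and f: "continuous_on UNIV f" "periodic L f" "\<And>x. 0 \<le> f x"
  shows "(\<integral>\<^sup>+y. ennreal (convolution_power c L f n (u - y)) * ennreal (f (y - v)) \<partial>torus c L)
    = ennreal (convolution_power c L f (Suc n) (u - v))"
proof -
  let ?g = "convolution_power c L f n"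
  note g = continuous_convolution_power[OF L f, of c n] periodic_convolution_power[OF L f, of c n]
    convolution_power_nonneg[OF L f, of c n]
  let ?h = "\<lambda>y. ?g (u - v - y) * f y"
  have hc: "continuous_on UNIV ?h"
    by (intro continuous_intros f continuous_on_compose2[OF g(1)]) auto
  have hp: "periodic L (\<lambda>y. ennreal (?h y))"
    unfolding periodic_def
  proof (intro allI ballI)
    fix x z :: "real ^ 'd" assume z: "z \<in> int_lattice"
    have "?g (u - v - (x - L *\<^sub>R z)) = ?g (u - v - x)"
      using periodicD[OF g(2) int_lattice_uminus[OF z], of "u - v - x"] by (simp add: algebra_simps)
    then show "ennreal (?h (x - L *\<^sub>R z)) = ennreal (?h x)" using periodicD[OF f(2) z] by simp
  qed
  have "(\<integral>\<^sup>+y. ennreal (?g (u - y)) * ennreal (f (y - v)) \<partial>torus c L) = (\<integral>\<^sup>+y. ennreal (?h (y - v)) \<partial>torus c L)"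
    by (intro nn_integral_cong) (simp add: ennreal_mult[OF g(3) f(3)])
  also have "\<dots> = (\<integral>\<^sup>+y. ennreal (?h y) \<partial>torus c L)"
    using borel_measurable_continuous_onI[OF hc] by (intro nn_integral_torus_shift[OF L _ hp]) simp
  also have "\<dots> = ennreal (LINT y|torus c L. ?h y)"
    using hc g(3) f(3) L by (intro nn_integral_eq_integral integrable_torus) auto
  finally show ?thesis by simp
qed

text \<open>The convolution theorem. Fubini applies since both factors are bounded and the torus has
  finite measure. The exponent is \<open>Suc n\<close> because \<open>convolution_power\<close> with
  index 0 is \<open>f\<close> itself.\<close>

lemma fourier_convolution_power:
  fixes f :: "real ^ 'd \<Rightarrow> real"
  assumes L: "L > 0" and f: "continuous_on UNIV f" "periodic L f" "\<And>x. 0 \<le> f x" and k: "k \<in> dual_lattice L"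
  shows "(LINT x|torus c L. wave k x * of_real (convolution_power c L f n x))
    = (LINT x|torus c L. wave k x * of_real (f x)) ^ Suc n"
proof (induction n)
  case 0 then show ?case by simp
next
  case (Suc n)
  let ?g = "convolution_power c L f n" and ?M = "torus c L"
  note g = continuous_convolution_power[OF L f, of c n] periodic_convolution_power[OF L f, of c n]
    convolution_power_nonneg[OF L f, of c n]
  interpret finite_measure ?M by (rule finite_measure_torus) (use L in simp)
  interpret P: pair_sigma_finite ?M ?M ..
  interpret PF: finite_measure "?M \<Otimes>\<^sub>M ?M" by (rule finite_measure_pair_measure) unfold_locales
  obtain B where B: "\<forall>x. \<bar>?g x\<bar> \<le> B" using periodic_bounded[OF L g(1,2)] ..
  obtain C where C: "\<forall>x. \<bar>f x\<bar> \<le> C" using periodic_bounded[OF L f(1,2)] ..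
  let ?G = "\<lambda>x y. wave k x * of_real (?g (x - y) * f y)"
  let ?F = "\<lambda>(x, y). wave k x * of_real (?g (x - y) * f y)"
  have cF: "continuous_on UNIV ?F"
    unfolding split_beta
    by (intro continuous_intros continuous_on_compose2[OF g(1)] continuous_on_compose2[OF f(1)]) auto
  have "?F \<in> borel_measurable (borel \<Otimes>\<^sub>M borel)"
    unfolding borel_prod by (rule borel_measurable_continuous_onI[OF cF])
  moreover have id: "(\<lambda>x. x) \<in> ?M \<rightarrow>\<^sub>M borel" by (rule measurable_restrict_space1) simp
  have "(\<lambda>p. (fst p, snd p)) \<in> ?M \<Otimes>\<^sub>M ?M \<rightarrow>\<^sub>M borel \<Otimes>\<^sub>M borel"
    using measurable_compose[OF measurable_fst id] measurable_compose[OF measurable_snd id] by (rule measurable_Pair)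
  ultimately have mF: "?F \<in> borel_measurable (?M \<Otimes>\<^sub>M ?M)"
    using measurable_compose[of "\<lambda>p. (fst p, snd p)" "?M \<Otimes>\<^sub>M ?M" "borel \<Otimes>\<^sub>M borel" ?F borel] by simp
  have iF: "integrable (?M \<Otimes>\<^sub>M ?M) ?F"
  proof (rule PF.integrable_const_bound[OF _ mF])
    show "AE p in ?M \<Otimes>\<^sub>M ?M. norm (?F p) \<le> B * C"
      using B C by (intro AE_I2) (auto simp: norm_mult abs_mult split_beta intro!: mult_mono intro: order_trans[OF abs_ge_zero])
  qed
  have "(LINT x|?M. wave k x * of_real (convolution_power c L f (Suc n) x)) = (LINT x|?M. (LINT y|?M. ?G x y))"
    by (intro Bochner_Integration.integral_cong refl) (simp flip: integral_complex_of_real)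
  also have "\<dots> = (LINT y|?M. (LINT x|?M. ?G x y))"
    by (rule P.Fubini_integral[OF iF, symmetric])
  also have "\<dots> = (LINT y|?M. (LINT x|?M. wave k x * of_real (?g x)) * (wave k y * of_real (f y)))"
  proof (intro Bochner_Integration.integral_cong refl)
    fix y
    have "(LINT x|?M. ?G x y) = (LINT x|?M. (wave k (x - y) * of_real (?g (x - y))) * (wave k y * of_real (f y)))"
    proof (intro Bochner_Integration.integral_cong refl)
      fix x
      have "wave k x = wave k (x - y) * wave k y" using wave_add[of k "x - y" y] by simp
      then show "?G x y = (wave k (x - y) * of_real (?g (x - y))) * (wave k y * of_real (f y))"
        by (simp only: of_real_mult mult_ac)
    qed
    also have "\<dots> = (LINT x|?M. wave k (x - y) * of_real (?g (x - y))) * (wave k y * of_real (f y))" by simp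
    also have "(LINT x|?M. wave k (x - y) * of_real (?g (x - y))) = (LINT x|?M. wave k x * of_real (?g x))"
      using g(2) periodic_wave[OF L k]
      by (intro integral_torus_shift[OF L, of "\<lambda>x. wave k x * of_real (?g x)"]) (auto simp: periodic_def intro!: continuous_intros g)
    finally show "(LINT x|?M. ?G x y) = (LINT x|?M. wave k x * of_real (?g x)) * (wave k y * of_real (f y))" .
  qed
  also have "\<dots> = (LINT x|?M. wave k x * of_real (f x)) ^ Suc (Suc n)"
    using Suc by (simp add: mult.commute)
  finally show ?case .
qed

section \<open>Integrating out the positions\<close>

lemma product_sigma_finite_torus:
  "L \<ge> 0 \<Longrightarrow> product_sigma_finite (\<lambda>_ :: nat. torus c L)"
  unfolding product_sigma_finite_def
  using finite_measure.axioms(1)[OF finite_measure_torus] by (simp add: finite_measure_def)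

lemma measurable_torus_product:
  assumes "\<And>i. i \<in> A \<Longrightarrow> continuous_on UNIV (g i)" "\<And>i. i \<in> A \<Longrightarrow> p i \<in> A" "finite A"
  shows "(\<lambda>X. \<Prod>i\<in>A. ennreal (g i (X i - X (p i)))) \<in> borel_measurable (PiM A (\<lambda>_. torus c L))"
proof (rule borel_measurable_prod_ennreal)
  fix i assume i: "i \<in> A"
  have id: "(\<lambda>x. x) \<in> torus c L \<rightarrow>\<^sub>M borel" by (rule measurable_restrict_space1) simp
  have co: "(\<lambda>X. X j) \<in> borel_measurable (PiM A (\<lambda>_. torus c L))" if "j \<in> A" for j
    using measurable_compose[OF measurable_component_singleton[OF that, of "\<lambda>_. torus c L"] id] .
  have "(\<lambda>X. X i - X (p i)) \<in> borel_measurable (PiM A (\<lambda>_. torus c L))"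
    using co[OF i] co[OF assms(2)[OF i]] by simp
  then show "(\<lambda>X. ennreal (g i (X i - X (p i)))) \<in> borel_measurable (PiM A (\<lambda>_. torus c L))"
    using measurable_compose[OF _ borel_measurable_continuous_onI[OF assms(1)[OF i]]] by (intro measurable_compose[OF _ measurable_ennreal])
qed

text \<open>Integrating out the successor of a marked point \<open>x\<close> merges the two edges at it into one edge
  carrying a higher convolution power, so that the cycle of \<open>x\<close> shrinks to a loop.\<close>

lemma nn_integral_cycle_product:
  fixes f :: "real ^ 'd \<Rightarrow> real" and c :: "real ^ 'd" and A :: "nat set"
  assumes L: "L > 0" and f: "continuous_on UNIV f" "periodic L f" "\<And>x. 0 \<le> f x"
  defines "w \<equiv> \<lambda>n. ennreal (L ^ CARD('d) * convolution_power c L f (n - 1) 0)"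
  assumes "finite A" "p permutes A" "x \<in> A"
  shows "(\<integral>\<^sup>+X. (\<Prod>i\<in>A. ennreal (convolution_power c L f (if i = x then m else 0) (X i - X (p i)))) \<partial>PiM A (\<lambda>_. torus c L))
    = w (m + card (orbit p x)) * (\<Prod>C\<in>orbit p ` A - {orbit p x}. w (card C))"
  using assms(6-)
proof (induction "card A" arbitrary: A x m p)
  case 0 then show ?case by simp
next
  case (Suc n A x m p)
  interpret product_sigma_finite "\<lambda>_ :: nat. torus c L" by (rule product_sigma_finite_torus) (use L in simp)
  let ?cp = "convolution_power c L f"
  note cont = continuous_convolution_power[OF L f, of c] and cp0 = convolution_power_nonneg[OF L f, of c]
  have meas: "(\<lambda>X. \<Prod>i\<in>A. ennreal (?cp (if i = x then m else 0) (X i - X (p i)))) \<in> borel_measurable (PiM A (\<lambda>_. torus c L))"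
    by (rule measurable_torus_product) (use Suc.prems cont in \<open>auto simp: permutes_in_image\<close>)
  have em: "emeasure (torus c L) (space (torus c L)) = ennreal (L ^ CARD('d))"
    using emeasure_torus[of L c] L by simp
  show ?case
  proof (cases "p x = x")
    case True
    define B where "B = A - {x}"
    have fB: "finite B" and xB: "x \<notin> B" and A: "A = insert x B" and cB: "card B = n"
      using Suc.prems Suc.hyps(2) by (auto simp: B_def)
    have pB: "p permutes B" using permutes_superset[OF Suc.prems(2), of B] True by (auto simp: B_def)
    have pin: "p i \<in> B" if "i \<in> B" for i using permutes_in_image[OF pB] that by simp
    \<comment> \<open>A loop at \<open>x\<close> depends on no position, so \<open>x\<close>
      integrates to the volume. The remaining points carry no marked edge: the induction hypothesis
      is used with \<open>m = 0\<close> at an arbitrary point.\<close>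
    have rest: "(\<integral>\<^sup>+X. (\<Prod>i\<in>B. ennreal (f (X i - X (p i)))) \<partial>PiM B (\<lambda>_. torus c L)) = (\<Prod>C\<in>orbit p ` B. w (card C))"
    proof (cases "B = {}")
      case True then show ?thesis by (simp add: space_PiM nn_integral_empty)
    next
      case False
      then obtain y where y: "y \<in> B" by auto
      have "(\<integral>\<^sup>+X. (\<Prod>i\<in>B. ennreal (f (X i - X (p i)))) \<partial>PiM B (\<lambda>_. torus c L))
        = w (0 + card (orbit p y)) * (\<Prod>C\<in>orbit p ` B - {orbit p y}. w (card C))"
        using Suc.hyps(1)[of B p y 0] cB fB pB y by simp
      also have "\<dots> = (\<Prod>C\<in>orbit p ` B. w (card C))"
        using prod.remove[of "orbit p ` B" "orbit p y" "\<lambda>C. w (card C)"] fB y by simp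
      finally show ?thesis .
    qed
    have "(\<integral>\<^sup>+X. (\<Prod>i\<in>A. ennreal (?cp (if i = x then m else 0) (X i - X (p i)))) \<partial>PiM A (\<lambda>_. torus c L))
      = (\<integral>\<^sup>+X. (\<integral>\<^sup>+y. (\<Prod>i\<in>A. ennreal (?cp (if i = x then m else 0) ((X(x := y)) i - (X(x := y)) (p i)))) \<partial>torus c L) \<partial>PiM B (\<lambda>_. torus c L))"
      unfolding A by (rule product_nn_integral_insert[OF fB xB meas[unfolded A]])
    also have "\<dots> = (\<integral>\<^sup>+X. w (Suc m) * (\<Prod>i\<in>B. ennreal (f (X i - X (p i)))) \<partial>PiM B (\<lambda>_. torus c L))"
    proof (rule nn_integral_cong)
      fix X
      have "(\<Prod>i\<in>A. ennreal (?cp (if i = x then m else 0) ((X(x := y)) i - (X(x := y)) (p i)))) =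
        ennreal (?cp m 0) * (\<Prod>i\<in>B. ennreal (f (X i - X (p i))))" for y
      proof -
        have "(\<Prod>i\<in>B. ennreal (?cp (if i = x then m else 0) ((X(x := y)) i - (X(x := y)) (p i)))) = (\<Prod>i\<in>B. ennreal (f (X i - X (p i))))"
          by (intro prod.cong refl) (use pin xB in auto)
        then show ?thesis unfolding A using fB xB True by simp
      qed
      then show "(\<integral>\<^sup>+y. (\<Prod>i\<in>A. ennreal (?cp (if i = x then m else 0) ((X(x := y)) i - (X(x := y)) (p i)))) \<partial>torus c L)
        = w (Suc m) * (\<Prod>i\<in>B. ennreal (f (X i - X (p i))))"
        using L em by (simp add: w_def ennreal_mult cp0 mult_ac)
    qed
    also have "\<dots> = w (Suc m) * (\<Prod>C\<in>orbit p ` B. w (card C))"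
      unfolding rest[symmetric]
      by (rule nn_integral_cmult) (rule measurable_torus_product, use f fB pin in auto)
    also have "orbit p ` B = orbit p ` A - {orbit p x}"
      using orbits_fresh[OF pB xB fB] orbit_fresh[OF pB xB fB] unfolding A by auto
    also have "Suc m = m + card (orbit p x)" using orbit_fresh[OF pB xB fB] by simp
    finally show ?thesis .
  next
    case False
    define y where "y = p x"
    define b where "b = p y"
    define B where "B = A - {y}"
    \<comment> \<open>The permutation that bypasses \<open>y\<close>: it sends \<open>x\<close>
      directly to \<open>b\<close>, so the edges from \<open>x\<close> to \<open>y\<close> and from
      \<open>y\<close> to \<open>b\<close> merge, and \<open>m\<close> grows by one while the cycle
      shrinks by one.\<close>
    define p' where "p' = Transposition.transpose y b \<circ> p"
    have pinj: "p i = p j \<longleftrightarrow> i = j" for i j using permutes_inj[OF Suc.prems(2)] by (simp add: inj_eq)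
    have pA: "p i \<in> A \<longleftrightarrow> i \<in> A" for i using permutes_in_image[OF Suc.prems(2)] .
    have yA: "y \<in> A" and bA: "b \<in> A" using Suc.prems pA by (auto simp: y_def b_def)
    have yx: "y \<noteq> x" using False by (simp add: y_def)
    have bny: "b \<noteq> y" using pinj[of y x] yx by (simp add: y_def b_def)
    have fB: "finite B" and yB: "y \<notin> B" and A: "A = insert y B" and cB: "card B = n" and xB: "x \<in> B" and bB: "b \<in> B"
      using Suc.prems Suc.hyps(2) yA bA yx bny by (auto simp: B_def)
    have pB: "p' permutes B"
      unfolding p'_def b_def using Suc.prems(2) unfolding A by (rule permutes_insert_lemma)
    have p: "p = Transposition.transpose y b \<circ> p'"
      by (simp add: p'_def fun_eq_iff)
    have p'x: "p' x = b" by (simp add: p'_def y_def[symmetric])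
    have p'i: "p' i = p i" if "i \<in> B" "i \<noteq> x" for i
    proof -
      have "p i \<noteq> y" using pinj[of i x] that by (simp add: y_def)
      moreover have "p i \<noteq> b" using pinj[of i y] that yB by (auto simp: b_def)
      ultimately show ?thesis by (simp add: p'_def)
    qed
    have pin: "p i \<in> B" if "i \<in> B" "i \<noteq> x" for i using permutes_in_image[OF pB, of i] p'i[OF that] that by simp
    have bo: "b \<in> orbit p' x" using orbit.base[of p' x] p'x by simp
    have pp: "permutation p'" "permutation p" using pB fB Suc.prems by (auto intro: permutes_imp_permutation)
    have "orbit p x = insert y (orbit p' x)"
      unfolding p using orbit_transpose_comp[OF pB yB fB bB xB] bo by simp
    moreover have obx: "orbit p' b = orbit p' x" by (rule orbit_eq_orbit[OF pp(1) bo])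
    moreover have "orbit p y = orbit p x" by (rule orbit_eq_orbit[OF pp(2)]) (simp add: y_def orbit.base)
    ultimately have others: "orbit p ` A - {orbit p x} = orbit p' ` B - {orbit p' x}"
        and cardo: "card (orbit p x) = Suc (card (orbit p' x))"
      using orbits_transpose_comp_other[OF pB yB fB bB] card_orbit_transpose_comp[OF pB yB fB bB]
      unfolding p[symmetric] A[symmetric] by simp_all
    have "(\<integral>\<^sup>+X. (\<Prod>i\<in>A. ennreal (?cp (if i = x then m else 0) (X i - X (p i)))) \<partial>PiM A (\<lambda>_. torus c L))
      = (\<integral>\<^sup>+X. (\<integral>\<^sup>+z. (\<Prod>i\<in>A. ennreal (?cp (if i = x then m else 0) ((X(y := z)) i - (X(y := z)) (p i)))) \<partial>torus c L) \<partial>PiM B (\<lambda>_. torus c L))"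
      unfolding A by (rule product_nn_integral_insert[OF fB yB meas[unfolded A]])
    also have "\<dots> = (\<integral>\<^sup>+X. (\<Prod>i\<in>B. ennreal (?cp (if i = x then Suc m else 0) (X i - X (p' i)))) \<partial>PiM B (\<lambda>_. torus c L))"
    proof (rule nn_integral_cong)
      fix X
      let ?R = "\<Prod>i\<in>B - {x}. ennreal (f (X i - X (p i)))"
      have "(\<Prod>i\<in>A. ennreal (?cp (if i = x then m else 0) ((X(y := z)) i - (X(y := z)) (p i)))) =
        (ennreal (?cp m (X x - z)) * ennreal (f (z - X b))) * ?R" for z
      proof -
        let ?t = "\<lambda>i. ennreal (?cp (if i = x then m else 0) ((X(y := z)) i - (X(y := z)) (p i)))"
        have "prod ?t A = ?t y * (?t x * prod ?t (B - {x}))"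
          unfolding A using fB yB xB by (simp add: prod.remove[of B x])
        also have "prod ?t (B - {x}) = ?R"
          using yB by (intro prod.cong refl) (use pin yB in \<open>auto\<close>)
        also have "?t y = ennreal (f (z - X b))" using yx bny by (simp add: b_def[symmetric])
        also have "?t x = ennreal (?cp m (X x - z))" using yx by (simp add: y_def[symmetric])
        finally show ?thesis by (simp add: mult_ac)
      qed
      then have "(\<integral>\<^sup>+z. (\<Prod>i\<in>A. ennreal (?cp (if i = x then m else 0) ((X(y := z)) i - (X(y := z)) (p i)))) \<partial>torus c L)
        = (\<integral>\<^sup>+z. (ennreal (?cp m (X x - z)) * ennreal (f (z - X b))) * ?R \<partial>torus c L)" by simp
      also have "\<dots> = (\<integral>\<^sup>+z. ennreal (?cp m (X x - z)) * ennreal (f (z - X b)) \<partial>torus c L) * ?R"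
      proof (rule nn_integral_multc)
        have "continuous_on UNIV (\<lambda>z. ?cp m (X x - z))" "continuous_on UNIV (\<lambda>z. f (z - X b))"
          by (rule continuous_on_compose2[OF cont], auto intro!: continuous_intros)
             (rule continuous_on_compose2[OF f(1)], auto intro!: continuous_intros)
        from this[THEN borel_measurable_continuous_onI, THEN borel_measurable_torus]
        show "(\<lambda>z. ennreal (?cp m (X x - z)) * ennreal (f (z - X b))) \<in> borel_measurable (torus c L)" by simp
      qed
      also have "\<dots> = ennreal (?cp (Suc m) (X x - X b)) * ?R"
        unfolding nn_integral_convolution_power[OF L f] ..
      also have "?R = (\<Prod>i\<in>B - {x}. ennreal (?cp (if i = x then Suc m else 0) (X i - X (p' i))))"
        by (intro prod.cong refl) (use p'i in auto)
      also have "ennreal (?cp (Suc m) (X x - X b)) * \<dots> = (\<Prod>i\<in>B. ennreal (?cp (if i = x then Suc m else 0) (X i - X (p' i))))"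
        using prod.remove[OF fB xB, of "\<lambda>i. ennreal (?cp (if i = x then Suc m else 0) (X i - X (p' i)))"] p'x
        by (simp del: convolution_power.simps)
      finally show "(\<integral>\<^sup>+z. (\<Prod>i\<in>A. ennreal (?cp (if i = x then m else 0) ((X(y := z)) i - (X(y := z)) (p i)))) \<partial>torus c L)
        = (\<Prod>i\<in>B. ennreal (?cp (if i = x then Suc m else 0) (X i - X (p' i))))" .
    qed
    also have "\<dots> = w (Suc m + card (orbit p' x)) * (\<Prod>C\<in>orbit p' ` B - {orbit p' x}. w (card C))"
      by (rule Suc.hyps(1)) (use cB fB pB xB in auto)
    finally show ?thesis unfolding others cardo by simp
  qed
qed

lemma nn_integral_permutation_product:
  fixes f :: "real ^ 'd \<Rightarrow> real" and c :: "real ^ 'd" and A :: "nat set"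
  assumes L: "L > 0" and f: "continuous_on UNIV f" "periodic L f" "\<And>x. 0 \<le> f x"
    and p: "finite A" "p permutes A" and ne: "A \<noteq> {}"
  shows "(\<integral>\<^sup>+X. (\<Prod>i\<in>A. ennreal (f (X i - X (p i)))) \<partial>PiM A (\<lambda>_. torus c L))
    = ennreal (\<Prod>C\<in>orbit p ` A. L ^ CARD('d) * convolution_power c L f (card C - 1) 0)"
proof -
  obtain x where x: "x \<in> A" using ne by auto
  have "(\<integral>\<^sup>+X. (\<Prod>i\<in>A. ennreal (f (X i - X (p i)))) \<partial>PiM A (\<lambda>_. torus c L))
    = (\<Prod>C\<in>orbit p ` A. ennreal (L ^ CARD('d) * convolution_power c L f (card C - 1) 0))"
    using nn_integral_cycle_product[OF L f p x, of c 0]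
      prod.remove[of "orbit p ` A" "orbit p x" "\<lambda>C. ennreal (L ^ CARD('d) * convolution_power c L f (card C - 1) 0)"] p x by simp
  also have "\<dots> = ennreal (\<Prod>C\<in>orbit p ` A. L ^ CARD('d) * convolution_power c L f (card C - 1) 0)"
    using L convolution_power_nonneg[OF L f] by (intro prod_ennreal) auto
  finally show ?thesis .
qed

section \<open>Boltzmann weights of extended real energies\<close>

lemma exp_ereal_eq_top_iff: "exp_ereal y = top \<longleftrightarrow> y = \<infinity>"
  by (cases y) auto

lemma exp_ereal_minus_add:
  "a \<noteq> - \<infinity> \<Longrightarrow> b \<noteq> - \<infinity> \<Longrightarrow> exp_ereal (- (a + b)) = exp_ereal (- a) * exp_ereal (- b)"
  by (cases a; cases b) (auto simp: ennreal_mult[symmetric] exp_add[symmetric])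

lemma exp_ereal_minus_sum:
  assumes "finite A" "\<And>i. i \<in> A \<Longrightarrow> a i \<noteq> - \<infinity>"
  shows "exp_ereal (- (\<Sum>i\<in>A. a i)) = (\<Prod>i\<in>A. exp_ereal (- a i)) \<and> (\<Sum>i\<in>A. a i) \<noteq> - \<infinity>"
  using assms
proof (induction A rule: finite_induct)
  case empty
  show ?case using exp_ereal_simps(1)[of 0] by (simp add: zero_ereal_def)
next
  case (insert i A)
  then have 1: "exp_ereal (- (\<Sum>i\<in>A. a i)) = (\<Prod>i\<in>A. exp_ereal (- a i))" "(\<Sum>i\<in>A. a i) \<noteq> - \<infinity>" "a i \<noteq> - \<infinity>"
    by auto
  have "a i + (\<Sum>i\<in>A. a i) \<noteq> - \<infinity>" using 1(2,3) by (cases "a i"; cases "\<Sum>i\<in>A. a i") auto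
  then show ?case using insert.hyps 1 exp_ereal_minus_add[OF 1(3) 1(2)] by simp
qed

lemma sum_energy_cycles:
  assumes p: "\<pi> permutes {1..N}"
  shows "(\<Sum>l=1..N. \<alpha> l * real (cycle_count N \<pi> l)) = (\<Sum>C\<in>cycles_of N \<pi>. \<alpha> (card C))"
proof -
  have "(\<Sum>l=1..N. \<alpha> l * real (cycle_count N \<pi> l)) = (\<Sum>l=1..N. \<Sum>C\<in>{C \<in> cycles_of N \<pi>. card C = l}. \<alpha> (card C))"
    by (intro sum.cong refl) (simp add: cycle_count_def)
  also have "\<dots> = (\<Sum>C\<in>cycles_of N \<pi>. \<alpha> (card C))"
  proof (rule sum.group)
    have "card C \<le> N" if "C \<in> cycles_of N \<pi>" for C
    proof -
      have "C \<subseteq> {1..N}" using that permutes_orbit_subset[OF p] by (fastforce simp: cycles_of_def)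
      then have "card C \<le> card {1..N}" by (intro card_mono) auto
      then show ?thesis by simp
    qed
    then show "card ` cycles_of N \<pi> \<subseteq> {1..N}" using card_cycle_ge_1[OF p] by auto
  qed auto
  finally show ?thesis .
qed

lemma bij_betw_int_lattice_plus:
  assumes "w \<in> int_lattice" shows "bij_betw (\<lambda>z. z + w) int_lattice int_lattice"
  by (rule bij_betwI[where g = "\<lambda>z. z - w"]) (use assms in \<open>auto simp: int_lattice_def\<close>)

lemma periodized_nn_integral:
  "exp_ereal (- periodized \<xi> L x) = (\<integral>\<^sup>+z. exp_ereal (- \<xi> (x - L *\<^sub>R z)) \<partial>count_space int_lattice)"
  unfolding exp_ereal_periodized by (rule infsum_ennreal_eq_nn_integral) simp

text \<open>For positive \<open>n\<close> this is the trace of the n-th power of convolution with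
  \<open>exp (- periodized \<xi> L)\<close> on the torus, whose eigenvalues are the values of the
  transform on the dual lattice.\<close>

definition lattice_sum :: "(real ^ 'd \<Rightarrow> ereal) \<Rightarrow> real \<Rightarrow> nat \<Rightarrow> real" where
  "lattice_sum \<xi> L n = (\<Sum>\<^sub>\<infinity>k\<in>dual_lattice L. Re (fourier_weight \<xi> k) ^ n)"

locale jump =
  fixes \<xi> :: "real ^ 'd \<Rightarrow> ereal"
  assumes jump: "jump_function \<xi>"
begin

definition fw :: "real ^ 'd \<Rightarrow> real" where
  "fw k = Re (fourier_weight \<xi> k)"

lemma xi_ne: "\<forall>x. \<xi> x \<noteq> - \<infinity>"
  using jump unfolding jump_function_def by (elim conjE)

lemma xi_cont: "continuous_on UNIV (\<lambda>x. exp_ereal (- \<xi> x))"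
  using jump unfolding jump_function_def by (elim conjE)

lemma xi_int: "(\<integral>\<^sup>+x. exp_ereal (- \<xi> x) \<partial>lborel) = 1"
  using jump unfolding jump_function_def by (elim conjE)

lemma xi_fourier: "\<forall>k. fourier_weight \<xi> k \<in> \<real> \<and> 0 < Re (fourier_weight \<xi> k)"
  using jump unfolding jump_function_def by (elim conjE)

lemma fw_pos: "0 < fw k"
  using xi_fourier by (simp add: fw_def)

lemma fourier_weight_fw: "fourier_weight \<xi> k = of_real (fw k)"
  using xi_fourier by (simp add: fw_def)

lemma exp_dispersion: "exp (- dispersion \<xi> k) = fw k"
  using fw_pos[of k] by (simp add: dispersion_def fw_def)

lemma exp_dispersion_power: "exp (- (real n * dispersion \<xi> k)) = fw k ^ n"
  unfolding exp_dispersion[symmetric] exp_of_nat_mult[symmetric] by simp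

definition step_density :: "real ^ 'd \<Rightarrow> real" where
  "step_density x = enn2real (exp_ereal (- \<xi> x))"

lemma ennreal_step_density: "ennreal (step_density x) = exp_ereal (- \<xi> x)"
proof -
  have "exp_ereal (- \<xi> x) \<noteq> top"
    using xi_ne by (simp add: exp_ereal_eq_top_iff ereal_uminus_eq_reorder)
  then show ?thesis by (simp add: step_density_def less_top)
qed

lemma step_density_nonneg: "0 \<le> step_density x"
  by (simp add: step_density_def)

lemma continuous_step_density: "continuous_on UNIV step_density"
proof -
  have c: "continuous_on UNIV (\<lambda>x. ennreal (step_density x))"
    unfolding ennreal_step_density by (rule xi_cont)
  have "(step_density \<longlongrightarrow> step_density x) (at x)" for x
    using tendsto_enn2real[of "\<lambda>x. ennreal (step_density x)" "step_density x" "at x"] c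
    by (simp add: continuous_on_def step_density_nonneg)
  then show ?thesis by (simp add: continuous_on_def)
qed

lemma step_density_measurable [measurable]: "step_density \<in> borel_measurable borel"
  by (rule borel_measurable_continuous_onI[OF continuous_step_density])

lemma nn_integral_step_density: "(\<integral>\<^sup>+x. ennreal (step_density x) \<partial>lborel) = 1"
  unfolding ennreal_step_density by (rule xi_int)

lemma integrable_step_density: "integrable lborel step_density"
  by (rule integrableI_nonneg) (simp_all add: step_density_nonneg nn_integral_step_density)

lemma fourier_weight_wave: "fourier_weight \<xi> k = (LINT x|lborel. wave k x * of_real (step_density x))"
  by (simp add: fourier_weight_def wave_def step_density_def)

lemma integral_step_density: "(LINT x|lborel. step_density x) = 1"
  using integral_eq_nn_integral[of step_density lborel] nn_integral_step_density by (simp add: step_density_nonneg)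

lemma fw_0: "fw 0 = 1"
  unfolding fw_def fourier_weight_wave by (simp add: integral_step_density)

end

text \<open>The conditions on the periodized function hold only for large \<open>L\<close>; the
  locale fixes one such \<open>L\<close>, so that the exact identities need no limit.\<close>

locale jump_box = jump \<xi> for \<xi> :: "real ^ 'd \<Rightarrow> ereal" +
  fixes L :: real
  assumes L: "L > 0"
    and per_ne: "\<And>x. periodized \<xi> L x \<noteq> - \<infinity>"
    and per_cont: "continuous_on UNIV (\<lambda>x. exp_ereal (- periodized \<xi> L x))"
begin

definition torus_density :: "real ^ 'd \<Rightarrow> real" where
  "torus_density x = enn2real (exp_ereal (- periodized \<xi> L x))"

lemma ennreal_torus_density: "ennreal (torus_density x) = exp_ereal (- periodized \<xi> L x)"
proof -
  have "exp_ereal (- periodized \<xi> L x) \<noteq> top"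
    using per_ne by (simp add: exp_ereal_eq_top_iff ereal_uminus_eq_reorder)
  then show ?thesis by (simp add: torus_density_def less_top)
qed

lemma torus_density_nonneg: "0 \<le> torus_density x"
  by (simp add: torus_density_def)

lemma continuous_torus_density: "continuous_on UNIV torus_density"
proof -
  have c: "continuous_on UNIV (\<lambda>x. ennreal (torus_density x))"
    unfolding ennreal_torus_density by (rule per_cont)
  have "(torus_density \<longlongrightarrow> torus_density x) (at x)" for x
    using tendsto_enn2real[of "\<lambda>x. ennreal (torus_density x)" "torus_density x" "at x"] c
    by (simp add: continuous_on_def torus_density_nonneg)
  then show ?thesis by (simp add: continuous_on_def)
qed

lemma torus_density_measurable [measurable]: "torus_density \<in> borel_measurable borel"
  by (rule borel_measurable_continuous_onI[OF continuous_torus_density])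

lemma ennreal_torus_density_sum:
  "ennreal (torus_density x) = (\<integral>\<^sup>+z. ennreal (step_density (x - L *\<^sub>R z)) \<partial>count_space int_lattice)"
  unfolding ennreal_torus_density ennreal_step_density by (rule periodized_nn_integral)

lemma periodic_torus_density: "periodic L torus_density"
  unfolding periodic_def
proof (intro allI ballI)
  fix x w :: "real ^ 'd" assume w: "w \<in> int_lattice"
  have "ennreal (torus_density (x - L *\<^sub>R w)) = (\<integral>\<^sup>+z. ennreal (step_density (x - L *\<^sub>R (z + w))) \<partial>count_space int_lattice)"
    unfolding ennreal_torus_density_sum by (simp add: algebra_simps)
  also have "\<dots> = ennreal (torus_density x)"
    unfolding ennreal_torus_density_sum
    by (rule nn_integral_bij_count_space[OF bij_betw_int_lattice_plus[OF w], of "\<lambda>z. ennreal (step_density (x - L *\<^sub>R z))"])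
  finally show "torus_density (x - L *\<^sub>R w) = torus_density x" by (simp add: torus_density_nonneg)
qed

text \<open>Since \<open>1 + T\<close> is nonnegative, unfolding applies to it as a statement about
  \<open>ennreal\<close>. Subtracting the instance \<open>T = 0\<close> recovers
  \<open>T\<close>.\<close>

lemma integral_unfold:
  assumes T: "continuous_on UNIV T" "periodic L T" "\<And>x. \<bar>T x :: real\<bar> \<le> 1"
  shows "(LINT x|torus c L. T x * torus_density x) = (LINT x|lborel. T x * step_density x)"
proof -
  have *: "(LINT x|torus c L. (1 + T x) * torus_density x) = (LINT x|lborel. (1 + T x) * step_density x)"
    if T: "continuous_on UNIV T" "periodic L T" "\<And>x. \<bar>T x :: real\<bar> \<le> 1" for T
  proof -
    have T0: "0 \<le> 1 + T x" for x using T(3)[of x] by linarith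
    have Tm[measurable]: "T \<in> borel_measurable borel" by (rule borel_measurable_continuous_onI[OF T(1)])
    have "(\<integral>\<^sup>+x. ennreal ((1 + T x) * step_density x) \<partial>lborel)
      = (\<integral>\<^sup>+x. (\<integral>\<^sup>+z. ennreal ((1 + T (x - L *\<^sub>R z)) * step_density (x - L *\<^sub>R z)) \<partial>count_space int_lattice) \<partial>torus c L)"
      by (rule nn_integral_unfold_torus[OF L]) measurable
    also have "\<dots> = (\<integral>\<^sup>+x. ennreal ((1 + T x) * torus_density x) \<partial>torus c L)"
    proof (rule nn_integral_cong)
      fix x
      have "(\<integral>\<^sup>+z. ennreal ((1 + T (x - L *\<^sub>R z)) * step_density (x - L *\<^sub>R z)) \<partial>count_space int_lattice)
        = (\<integral>\<^sup>+z. ennreal (1 + T x) * ennreal (step_density (x - L *\<^sub>R z)) \<partial>count_space int_lattice)"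
        by (intro nn_integral_cong) (use periodicD[OF T(2)] T0 step_density_nonneg in \<open>simp add: ennreal_mult\<close>)
      also have "\<dots> = ennreal ((1 + T x) * torus_density x)"
        by (simp add: nn_integral_cmult ennreal_torus_density_sum[symmetric] ennreal_mult T0 torus_density_nonneg)
      finally show "(\<integral>\<^sup>+z. ennreal ((1 + T (x - L *\<^sub>R z)) * step_density (x - L *\<^sub>R z)) \<partial>count_space int_lattice)
        = ennreal ((1 + T x) * torus_density x)" .
    qed
    finally have eq: "(\<integral>\<^sup>+x. ennreal ((1 + T x) * step_density x) \<partial>lborel) = (\<integral>\<^sup>+x. ennreal ((1 + T x) * torus_density x) \<partial>torus c L)" .
    have "(LINT x|torus c L. (1 + T x) * torus_density x) = enn2real (\<integral>\<^sup>+x. ennreal ((1 + T x) * torus_density x) \<partial>torus c L)"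
      by (rule integral_eq_nn_integral) (auto intro!: borel_measurable_torus mult_nonneg_nonneg T0 torus_density_nonneg)
    also have "\<dots> = (LINT x|lborel. (1 + T x) * step_density x)"
      unfolding eq[symmetric]
      by (rule integral_eq_nn_integral[symmetric]) (auto intro!: mult_nonneg_nonneg T0 step_density_nonneg)
    finally show ?thesis .
  qed
  have Tm[measurable]: "T \<in> borel_measurable borel" by (rule borel_measurable_continuous_onI[OF T(1)])
  have i1: "integrable (torus c L) (\<lambda>x. T x * torus_density x)" "integrable (torus c L) torus_density"
    using L by (auto intro!: integrable_torus continuous_intros T continuous_torus_density)
  have i2: "integrable lborel (\<lambda>x. T x * step_density x)"
    by (rule Bochner_Integration.integrable_bound[OF integrable_step_density])
      (use T(3) in \<open>auto simp: abs_mult step_density_nonneg intro!: mult_left_le_one_le\<close>)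
  show ?thesis
    using *[OF T] *[of "\<lambda>_. 0"] i1 i2 integrable_step_density
    by (simp add: distrib_right periodic_def)
qed

text \<open>Waves of the dual lattice are periodic, so integrating against the periodized density
  over the box is integrating against the original one over the whole space. Real and imaginary
  parts are unfolded separately.\<close>

lemma fourier_torus_density:
  assumes k: "k \<in> dual_lattice L"
  shows "(LINT x|torus c L. wave k x * of_real (torus_density x)) = of_real (fw k)"
proof -
  have i1: "integrable (torus c L) (\<lambda>x. wave k x * of_real (torus_density x))"
    using L by (auto intro!: integrable_torus continuous_intros continuous_torus_density)
  have wm: "wave k \<in> borel_measurable borel"
    by (intro borel_measurable_continuous_onI continuous_intros)
  have i2: "integrable lborel (\<lambda>x. wave k x * of_real (step_density x))"
    by (rule Bochner_Integration.integrable_bound[OF integrable_step_density])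
      (use wm in \<open>auto simp: norm_mult step_density_nonneg\<close>)
  have "(LINT x|torus c L. wave k x * of_real (torus_density x)) = fourier_weight \<xi> k"
  proof (rule complex_eqI)
    have "(LINT x|torus c L. Re (wave k x) * torus_density x) = (LINT x|lborel. Re (wave k x) * step_density x)"
      by (rule integral_unfold)
        (use periodic_wave[OF L k] abs_Re_le_cmod[of "wave k _"] in \<open>auto simp: periodic_def intro!: continuous_intros\<close>)
    then show "Re (LINT x|torus c L. wave k x * of_real (torus_density x)) = Re (fourier_weight \<xi> k)"
      unfolding fourier_weight_wave using integral_Re[OF i1] integral_Re[OF i2] by simp
    have "(LINT x|torus c L. Im (wave k x) * torus_density x) = (LINT x|lborel. Im (wave k x) * step_density x)"
      by (rule integral_unfold)
        (use periodic_wave[OF L k] abs_Im_le_cmod[of "wave k _"] in \<open>auto simp: periodic_def intro!: continuous_intros\<close>)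
    then show "Im (LINT x|torus c L. wave k x * of_real (torus_density x)) = Im (fourier_weight \<xi> k)"
      unfolding fourier_weight_wave using integral_Im[OF i1] integral_Im[OF i2] by simp
  qed
  then show ?thesis by (simp add: fourier_weight_fw)
qed

lemmas td = continuous_torus_density periodic_torus_density torus_density_nonneg

text \<open>The Fourier series of a convolution power at 0: its coefficients are positive powers of
  positive numbers, so continuity alone yields summability and the value.\<close>

lemma
  shows summable_fw: "(\<lambda>k. fw k ^ Suc n) summable_on dual_lattice L"
    and lattice_sum_convolution: "lattice_sum \<xi> L (Suc n) = L ^ CARD('d) * convolution_power c L torus_density n 0"
proof -
  have co: "(LINT x|torus c L. wave k x * of_real (convolution_power c L torus_density n x)) = of_real (fw k ^ Suc n)"
    if "k \<in> dual_lattice L" for k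
    using fourier_convolution_power[OF L td that] fourier_torus_density[OF that] by simp
  note F = fourier_series_at_0[OF L continuous_convolution_power[OF L td] periodic_convolution_power[OF L td] co]
  show "(\<lambda>k. fw k ^ Suc n) summable_on dual_lattice L"
    by (rule F) (use fw_pos in \<open>auto simp: less_imp_le\<close>)
  show "lattice_sum \<xi> L (Suc n) = L ^ CARD('d) * convolution_power c L torus_density n 0"
    unfolding lattice_sum_def fw_def[symmetric] by (rule F) (use fw_pos in \<open>auto simp: less_imp_le\<close>)
qed

section \<open>The law of the permutation after integrating out the positions\<close>

lemma exp_hamiltonian:
  assumes p: "\<pi> permutes {1..N}"
  shows "exp_ereal (- hamiltonian \<xi> \<alpha> L N x \<pi>) =
    ennreal (\<Prod>C\<in>cycles_of N \<pi>. exp (- \<alpha> (card C))) * (\<Prod>i\<in>{1..N}. ennreal (torus_density (x i - x (\<pi> i))))"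
proof -
  have S: "exp_ereal (- (\<Sum>i=1..N. periodized \<xi> L (x i - x (\<pi> i)))) = (\<Prod>i=1..N. exp_ereal (- periodized \<xi> L (x i - x (\<pi> i))))
    \<and> (\<Sum>i=1..N. periodized \<xi> L (x i - x (\<pi> i))) \<noteq> - \<infinity>"
    by (rule exp_ereal_minus_sum) (auto simp: per_ne)
  have "exp_ereal (- hamiltonian \<xi> \<alpha> L N x \<pi>) =
    exp_ereal (- (\<Sum>i=1..N. periodized \<xi> L (x i - x (\<pi> i)))) * exp_ereal (- ereal (\<Sum>l=1..N. \<alpha> l * real (cycle_count N \<pi> l)))"
    unfolding hamiltonian_def using S by (intro exp_ereal_minus_add) auto
  also have "exp_ereal (- ereal (\<Sum>l=1..N. \<alpha> l * real (cycle_count N \<pi> l))) = ennreal (\<Prod>C\<in>cycles_of N \<pi>. exp (- \<alpha> (card C)))"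
    unfolding sum_energy_cycles[OF p] by (simp add: exp_sum[symmetric] sum_negf)
  finally show ?thesis using S by (simp add: ennreal_torus_density mult.commute)
qed

definition theta :: "(nat \<Rightarrow> real) \<Rightarrow> nat \<Rightarrow> real" where
  "theta \<alpha> l = exp (- \<alpha> l) * lattice_sum \<xi> L l"

lemma measurable_boltzmann:
  assumes p: "\<pi> permutes {1..N}"
  shows "(\<lambda>x. exp_ereal (- hamiltonian \<xi> \<alpha> L N x \<pi>)) \<in> borel_measurable (position_space c L N)"
proof -
  have "(\<lambda>x. \<Prod>i\<in>{1..N}. ennreal (torus_density (x i - x (\<pi> i)))) \<in> borel_measurable (position_space c L N)"
    unfolding position_space_def
    by (rule measurable_torus_product) (use permutes_in_image[OF p] in \<open>auto simp: continuous_torus_density\<close>)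
  then show ?thesis unfolding exp_hamiltonian[OF p] by simp
qed

lemma nn_integral_boltzmann:
  assumes p: "\<pi> permutes {1..N}" and N: "N \<ge> 1"
  shows "(\<integral>\<^sup>+x. exp_ereal (- hamiltonian \<xi> \<alpha> L N x \<pi>) \<partial>position_space c L N) = ennreal (cycle_weight (theta \<alpha>) N \<pi>)"
proof -
  have "(\<lambda>x. \<Prod>i\<in>{1..N}. ennreal (torus_density (x i - x (\<pi> i)))) \<in> borel_measurable (position_space c L N)"
    unfolding position_space_def
    by (rule measurable_torus_product) (use permutes_in_image[OF p] in \<open>auto simp: continuous_torus_density\<close>)
  then have "(\<integral>\<^sup>+x. exp_ereal (- hamiltonian \<xi> \<alpha> L N x \<pi>) \<partial>position_space c L N) =
    ennreal (\<Prod>C\<in>cycles_of N \<pi>. exp (- \<alpha> (card C))) * (\<integral>\<^sup>+x. (\<Prod>i\<in>{1..N}. ennreal (torus_density (x i - x (\<pi> i)))) \<partial>position_space c L N)"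
    unfolding exp_hamiltonian[OF p] by (rule nn_integral_cmult)
  also have "(\<integral>\<^sup>+x. (\<Prod>i\<in>{1..N}. ennreal (torus_density (x i - x (\<pi> i)))) \<partial>position_space c L N)
    = ennreal (\<Prod>C\<in>cycles_of N \<pi>. L ^ CARD('d) * convolution_power c L torus_density (card C - 1) 0)"
    unfolding position_space_def cycles_of_def
    by (rule nn_integral_permutation_product[OF L td]) (use p N in auto)
  also have "(\<Prod>C\<in>cycles_of N \<pi>. L ^ CARD('d) * convolution_power c L torus_density (card C - 1) 0) =
    (\<Prod>C\<in>cycles_of N \<pi>. lattice_sum \<xi> L (card C))"
  proof (rule prod.cong[OF refl])
    fix C assume "C \<in> cycles_of N \<pi>"
    then have "Suc (card C - 1) = card C" using card_cycle_ge_1[OF p] by (simp add: Suc_le_eq)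
    then show "L ^ CARD('d) * convolution_power c L torus_density (card C - 1) 0 = lattice_sum \<xi> L (card C)"
      using lattice_sum_convolution[of "card C - 1" c] by simp
  qed
  also have "ennreal (\<Prod>C\<in>cycles_of N \<pi>. exp (- \<alpha> (card C))) * ennreal (\<Prod>C\<in>cycles_of N \<pi>. lattice_sum \<xi> L (card C))
    = ennreal (cycle_weight (theta \<alpha>) N \<pi>)"
    unfolding cycle_weight_def theta_def prod.distrib by (intro ennreal_mult'[symmetric] prod_nonneg) simp
  finally show ?thesis .
qed

lemma lattice_sum_ge_1: "l \<ge> 1 \<Longrightarrow> 1 \<le> lattice_sum \<xi> L l"
  using finite_sum_le_infsum[OF summable_fw[of "l - 1"], of "{0}"] fw_pos fw_0
  by (simp add: lattice_sum_def fw_def[symmetric] less_imp_le)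

lemma theta_pos: "l \<ge> 1 \<Longrightarrow> 0 < theta \<alpha> l"
  using lattice_sum_ge_1[of l] by (simp add: theta_def)

lemma cyc_coeff_theta_pos: "0 < cyc_coeff (theta \<alpha>) n"
proof (cases "n = 0")
  case False
  have nn: "0 \<le> theta \<alpha> l" if "l \<ge> 1" for l using theta_pos[OF that] by (rule less_imp_le)
  have "0 < theta \<alpha> n * cyc_coeff (theta \<alpha>) (n - n)" using theta_pos[of n] False by simp
  also have "\<dots> \<le> (\<Sum>l=1..n. theta \<alpha> l * cyc_coeff (theta \<alpha>) (n - l))"
    by (rule member_le_sum) (use False nn in \<open>auto intro!: mult_nonneg_nonneg cyc_coeff_nonneg\<close>)
  also have "\<dots> = real n * cyc_coeff (theta \<alpha>) n" by (rule cyc_coeff_rec[symmetric])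
  finally show ?thesis using False by (simp add: zero_less_mult_iff)
qed simp

text \<open>Besides the value, this shows that the normalisation is finite and positive, so the
  \<open>ennreal\<close> quotient in the density is an ordinary real quotient.\<close>

lemma partition_function_eq:
  assumes N: "N \<ge> 1"
  shows "fact N * partition_function \<xi> \<alpha> c L N = ennreal (fact N * cyc_coeff (theta \<alpha>) N)"
proof -
  have nn: "0 \<le> theta \<alpha> l" if "l \<ge> 1" for l using theta_pos[OF that] by (rule less_imp_le)
  have fact: "(fact N :: ennreal) = ennreal (fact N)"
    by (metis ennreal_of_nat_eq_real_of_nat of_nat_fact)
  have "(\<Sum>\<pi> | \<pi> permutes {1..N}. \<integral>\<^sup>+x. exp_ereal (- hamiltonian \<xi> \<alpha> L N x \<pi>) \<partial>position_space c L N)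
    = (\<Sum>\<pi> | \<pi> permutes {1..N}. ennreal (cycle_weight (theta \<alpha>) N \<pi>))"
    by (intro sum.cong refl nn_integral_boltzmann N) simp
  also have "\<dots> = ennreal (fact N * cyc_coeff (theta \<alpha>) N)"
    unfolding sum_cycle_weight[symmetric] by (intro sum_ennreal cycle_weight_nonneg nn) auto
  finally have "partition_function \<xi> \<alpha> c L N = ennreal (fact N * cyc_coeff (theta \<alpha>) N / fact N)"
    unfolding partition_function_def fact
    using cyc_coeff_theta_pos[of \<alpha> N] by (simp add: divide_ennreal less_imp_le)
  then show ?thesis unfolding fact using cyc_coeff_theta_pos[of \<alpha> N] by (simp add: ennreal_mult' less_imp_le)
qed

lemma nn_integral_spatial_permutation:
  assumes N: "N \<ge> 1" and F: "\<And>\<pi>. 0 \<le> F \<pi>"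
  shows "(\<integral>\<^sup>+p. ennreal (F (snd p)) \<partial>spatial_permutation \<xi> \<alpha> c L N)
    = ennreal ((\<Sum>\<pi> | \<pi> permutes {1..N}. F \<pi> * cycle_weight (theta \<alpha>) N \<pi>) / (fact N * cyc_coeff (theta \<alpha>) N))"
proof -
  let ?S = "{\<pi>. \<pi> permutes {1..N}}" and ?P = "position_space c L N"
  define Z where "Z = fact N * cyc_coeff (theta \<alpha>) N"
  have Z: "Z > 0" using cyc_coeff_theta_pos[of \<alpha> N] by (simp add: Z_def)
  have nn: "0 \<le> theta \<alpha> l" if "l \<ge> 1" for l using theta_pos[OF that] by (rule less_imp_le)
  have fS: "finite ?S" by (rule finite_permutations) simp
  interpret C: sigma_finite_measure "count_space ?S" by (rule sigma_finite_measure_count_space_finite[OF fS])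
  let ?d = "\<lambda>(x, \<pi>). exp_ereal (- hamiltonian \<xi> \<alpha> L N x \<pi>) / (fact N * partition_function \<xi> \<alpha> c L N)"
  have dm: "?d \<in> borel_measurable (?P \<Otimes>\<^sub>M count_space ?S)"
  proof -
    have "(\<lambda>p. exp_ereal (- hamiltonian \<xi> \<alpha> L N (fst p) (snd p))) \<in> borel_measurable (?P \<Otimes>\<^sub>M count_space ?S)"
    proof (rule measurable_compose_countable'[where f = "\<lambda>\<pi> p. exp_ereal (- hamiltonian \<xi> \<alpha> L N (fst p) \<pi>)" and g = snd and I = ?S])
      fix \<pi> assume "\<pi> \<in> ?S"
      then show "(\<lambda>p. exp_ereal (- hamiltonian \<xi> \<alpha> L N (fst p) \<pi>)) \<in> borel_measurable (?P \<Otimes>\<^sub>M count_space ?S)"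
        using measurable_compose[OF measurable_fst measurable_boltzmann] by simp
    qed (use fS countable_finite in auto)
    then show ?thesis unfolding split_beta by simp
  qed
  have Fm: "(\<lambda>p. ennreal (F (snd p))) \<in> borel_measurable (?P \<Otimes>\<^sub>M count_space ?S)"
    by (rule measurable_compose[OF measurable_snd]) simp
  have "(\<integral>\<^sup>+p. ennreal (F (snd p)) \<partial>spatial_permutation \<xi> \<alpha> c L N)
    = (\<integral>\<^sup>+p. ?d p * ennreal (F (snd p)) \<partial>(?P \<Otimes>\<^sub>M count_space ?S))"
    unfolding spatial_permutation_def by (rule nn_integral_density[OF dm Fm])
  also have "\<dots> = (\<integral>\<^sup>+x. (\<integral>\<^sup>+\<pi>. ?d (x, \<pi>) * ennreal (F (snd (x, \<pi>))) \<partial>count_space ?S) \<partial>?P)"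
    using dm Fm by (intro C.nn_integral_fst[symmetric] borel_measurable_times_ennreal)
  also have "\<dots> = (\<integral>\<^sup>+x. (\<Sum>\<pi>\<in>?S. exp_ereal (- hamiltonian \<xi> \<alpha> L N x \<pi>) * ennreal (F \<pi> / Z)) \<partial>?P)"
  proof (rule nn_integral_cong)
    fix x
    show "(\<integral>\<^sup>+\<pi>. ?d (x, \<pi>) * ennreal (F (snd (x, \<pi>))) \<partial>count_space ?S)
      = (\<Sum>\<pi>\<in>?S. exp_ereal (- hamiltonian \<xi> \<alpha> L N x \<pi>) * ennreal (F \<pi> / Z))"
      using Z F unfolding nn_integral_count_space_finite[OF fS] partition_function_eq[OF N] Z_def[symmetric]
      by (simp add: divide_ennreal[symmetric] divide_ennreal_def mult_ac)
  qed
  also have "\<dots> = (\<Sum>\<pi>\<in>?S. \<integral>\<^sup>+x. exp_ereal (- hamiltonian \<xi> \<alpha> L N x \<pi>) * ennreal (F \<pi> / Z) \<partial>?P)"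
    using measurable_boltzmann by (intro nn_integral_sum borel_measurable_times_ennreal) auto
  also have "\<dots> = (\<Sum>\<pi>\<in>?S. ennreal (F \<pi> * cycle_weight (theta \<alpha>) N \<pi> / Z))"
  proof (rule sum.cong[OF refl])
    fix \<pi> assume "\<pi> \<in> ?S"
    then have p: "\<pi> permutes {1..N}" by simp
    have "(\<integral>\<^sup>+x. exp_ereal (- hamiltonian \<xi> \<alpha> L N x \<pi>) * ennreal (F \<pi> / Z) \<partial>?P) = ennreal (cycle_weight (theta \<alpha>) N \<pi>) * ennreal (F \<pi> / Z)"
      unfolding nn_integral_boltzmann[OF p N, where \<alpha> = \<alpha> and c = c, symmetric] by (rule nn_integral_multc[OF measurable_boltzmann[OF p]])
    then show "(\<integral>\<^sup>+x. exp_ereal (- hamiltonian \<xi> \<alpha> L N x \<pi>) * ennreal (F \<pi> / Z) \<partial>?P) = ennreal (F \<pi> * cycle_weight (theta \<alpha>) N \<pi> / Z)"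
      using cycle_weight_nonneg[OF nn p] F Z by (simp add: ennreal_mult[symmetric] mult_ac)
  qed
  also have "\<dots> = ennreal (\<Sum>\<pi>\<in>?S. F \<pi> * cycle_weight (theta \<alpha>) N \<pi> / Z)"
    using cycle_weight_nonneg[OF nn] F Z by (intro sum_ennreal) auto
  finally show ?thesis by (simp add: sum_divide_distrib Z_def)
qed

definition perm_prob :: "(nat \<Rightarrow> real) \<Rightarrow> nat \<Rightarrow> ((nat \<Rightarrow> nat) \<Rightarrow> bool) \<Rightarrow> real" where
  "perm_prob \<alpha> N E = (\<Sum>\<pi> | \<pi> permutes {1..N} \<and> E \<pi>. cycle_weight (theta \<alpha>) N \<pi>) / (fact N * cyc_coeff (theta \<alpha>) N)"

lemma measurable_snd_spatial:
  "(\<lambda>p. F (snd p)) \<in> borel_measurable (spatial_permutation \<xi> \<alpha> c L N)"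
  unfolding spatial_permutation_def by (simp, rule measurable_compose[OF measurable_snd]) simp

lemma integral_spatial_permutation:
  assumes N: "N \<ge> 1" and F: "\<And>\<pi>. 0 \<le> F \<pi>"
  shows "(LINT (x, \<pi>)|spatial_permutation \<xi> \<alpha> c L N. F \<pi>)
    = (\<Sum>\<pi> | \<pi> permutes {1..N}. F \<pi> * cycle_weight (theta \<alpha>) N \<pi>) / (fact N * cyc_coeff (theta \<alpha>) N)"
proof -
  have nn: "0 \<le> theta \<alpha> l" if "l \<ge> 1" for l using theta_pos[OF that] by (rule less_imp_le)
  have "(LINT p|spatial_permutation \<xi> \<alpha> c L N. F (snd p)) = enn2real (\<integral>\<^sup>+p. ennreal (F (snd p)) \<partial>spatial_permutation \<xi> \<alpha> c L N)"
    by (rule integral_eq_nn_integral) (auto intro!: measurable_snd_spatial F)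
  also have "\<dots> = (\<Sum>\<pi> | \<pi> permutes {1..N}. F \<pi> * cycle_weight (theta \<alpha>) N \<pi>) / (fact N * cyc_coeff (theta \<alpha>) N)"
    unfolding nn_integral_spatial_permutation[where F = F, OF N F]
    by (intro enn2real_ennreal divide_nonneg_nonneg sum_nonneg mult_nonneg_nonneg F)
      (use cyc_coeff_theta_pos[of \<alpha> N] cycle_weight_nonneg[OF nn] in auto)
  finally show ?thesis unfolding case_prod_unfold .
qed

lemma cdf_spatial_permutation:
  assumes N: "N \<ge> 1"
  shows "cdf (distr (spatial_permutation \<xi> \<alpha> c L N) borel (\<lambda>(x, \<pi>). X \<pi>)) y = perm_prob \<alpha> N (\<lambda>\<pi>. X \<pi> \<le> y)"
proof -
  let ?M = "spatial_permutation \<xi> \<alpha> c L N"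
  have m: "(\<lambda>p. X (snd p)) \<in> borel_measurable ?M" by (rule measurable_snd_spatial)
  have "cdf (distr ?M borel (\<lambda>(x, \<pi>). X \<pi>)) y = measure ?M ((\<lambda>p. X (snd p)) -` {..y} \<inter> space ?M)"
    unfolding cdf_def case_prod_unfold by (rule measure_distr[OF m]) simp
  also have "\<dots> = (LINT p|?M. indicator ((\<lambda>p. X (snd p)) -` {..y} \<inter> space ?M) p)"
    by simp
  also have "\<dots> = (LINT (x, \<pi>)|?M. (if X \<pi> \<le> y then 1 else 0))"
    by (intro Bochner_Integration.integral_cong refl) (auto simp: case_prod_unfold split: split_indicator)
  also have "\<dots> = (\<Sum>\<pi> | \<pi> permutes {1..N}. (if X \<pi> \<le> y then 1 else 0) * cycle_weight (theta \<alpha>) N \<pi>) / (fact N * cyc_coeff (theta \<alpha>) N)"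
    by (rule integral_spatial_permutation[OF N]) simp
  also have "(\<Sum>\<pi> | \<pi> permutes {1..N}. (if X \<pi> \<le> y then 1 else 0) * cycle_weight (theta \<alpha>) N \<pi>) =
    (\<Sum>\<pi>\<in>{\<pi>. \<pi> permutes {1..N}}. if X \<pi> \<le> y then cycle_weight (theta \<alpha>) N \<pi> else 0)"
    by (intro sum.cong) auto
  also have "\<dots> = (\<Sum>\<pi> | \<pi> permutes {1..N} \<and> X \<pi> \<le> y. cycle_weight (theta \<alpha>) N \<pi>)"
    by (subst sum.inter_filter[symmetric]) (auto simp: finite_permutations)
  finally show ?thesis unfolding perm_prob_def .
qed

end

section \<open>Lattice sums\<close>

text \<open>Rounding down to the dual lattice turns sums over that lattice into integrals over the
  whole space, so that sums for different \<open>L\<close> become functions on one measure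
  space.\<close>

definition round_lattice :: "real \<Rightarrow> real ^ 'd \<Rightarrow> real ^ 'd" where
  "round_lattice L x = (\<chi> i. of_int \<lfloor>L * x $ i\<rfloor> / L)"

lemma measurable_round_lattice [measurable]: "round_lattice L \<in> borel_measurable borel"
  by (subst borel_measurable_euclidean_space) (auto simp: Basis_vec_def inner_axis round_lattice_def)

lemma norm_round_lattice_diff:
  fixes x :: "real ^ 'd" assumes L: "L > 0"
  shows "norm (round_lattice L x - x) \<le> real CARD('d) / L"
proof -
  have "norm (round_lattice L x - x) \<le> (\<Sum>i\<in>UNIV. \<bar>(round_lattice L x - x) $ i\<bar>)" by (rule norm_le_l1_cart)
  also have "\<dots> \<le> (\<Sum>i\<in>(UNIV :: 'd set). 1 / L)"
  proof (rule sum_mono)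
    fix i
    have "(round_lattice L x - x) $ i = (of_int \<lfloor>L * x $ i\<rfloor> - L * x $ i) / L"
      using L by (simp add: round_lattice_def field_simps)
    moreover have "\<bar>of_int \<lfloor>L * x $ i\<rfloor> - L * x $ i\<bar> \<le> 1" by linarith
    ultimately show "\<bar>(round_lattice L x - x) $ i\<bar> \<le> 1 / L" using L by (simp add: divide_right_mono)
  qed
  finally show ?thesis by simp
qed

lemma AE_torus_half_box:
  fixes c :: "real ^ 'd" assumes "L \<ge> 0" shows "AE x in torus c L. x \<in> half_box c L"
  using AE_half_box[OF assms, of c] by (subst AE_restrict_space_iff) auto

text \<open>The rounded function is constant on half-open cells of side \<open>1 / L\<close>, each
  of which belongs to one lattice point. Unfolding with period \<open>1 / L\<close> collects the
  cells.\<close>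

lemma nn_integral_round_lattice:
  fixes F :: "real ^ 'd \<Rightarrow> ennreal"
  assumes L: "L > 0" and [measurable]: "F \<in> borel_measurable borel"
  shows "(\<integral>\<^sup>+x. F (round_lattice L x) \<partial>lborel) = (\<integral>\<^sup>+k. F k \<partial>count_space (dual_lattice L)) * ennreal (1 / L ^ CARD('d))"
proof -
  have L1: "1 / L > 0" using L by simp
  let ?I = "\<integral>\<^sup>+k. F k \<partial>count_space (dual_lattice L)"
  have "(\<integral>\<^sup>+x. F (round_lattice L x) \<partial>lborel) =
    (\<integral>\<^sup>+x. (\<integral>\<^sup>+z. F (round_lattice L (x - (1 / L) *\<^sub>R z)) \<partial>count_space int_lattice) \<partial>torus 0 (1 / L))"
    by (rule nn_integral_unfold_torus[OF L1]) measurable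
  also have "\<dots> = (\<integral>\<^sup>+x. ?I \<partial>torus (0 :: real ^ 'd) (1 / L))"
  proof (rule nn_integral_cong_AE, use AE_torus_half_box[of "1 / L" "0 :: real ^ 'd"] L in \<open>simp\<close>, elim AE_mp, intro AE_I2 impI)
    fix x :: "real ^ 'd" assume x: "x \<in> half_box 0 (1 / L)"
    \<comment> \<open>For \<open>x\<close> in the half-open cell at 0 the floor is exactly
      \<open>- z\<close>. The sign disappears because the lattice is symmetric.\<close>
    have rd: "round_lattice L (x - (1 / L) *\<^sub>R z) = (1 / L) *\<^sub>R (- z)" if "z \<in> int_lattice" for z
    proof (simp add: vec_eq_iff round_lattice_def, intro allI)
      fix i
      obtain n where n: "z $ i = of_int n" using \<open>z \<in> int_lattice\<close> by (auto simp: int_lattice_def elim: Ints_cases)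
      have "0 \<le> L * x $ i" "L * x $ i < 1" using x L by (auto simp: half_box_def field_simps)
      then have "\<lfloor>L * (x $ i - of_int n / L)\<rfloor> = - n" using L by (intro floor_unique) (auto simp: right_diff_distrib)
      then show "of_int \<lfloor>L * (x $ i - z $ i / L)\<rfloor> / L = - (z $ i / L)" using n by simp
    qed
    have "(\<integral>\<^sup>+z. F (round_lattice L (x - (1 / L) *\<^sub>R z)) \<partial>count_space int_lattice) = (\<integral>\<^sup>+z. F ((1 / L) *\<^sub>R (- z)) \<partial>count_space int_lattice)"
      by (rule nn_integral_cong) (use rd in simp)
    also have "\<dots> = (\<integral>\<^sup>+z. F ((1 / L) *\<^sub>R z) \<partial>count_space int_lattice)"
      using nn_integral_bij_count_space[OF bij_uminus_int_lattice, of "\<lambda>z. F ((1 / L) *\<^sub>R z)"] by simp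
    also have "\<dots> = ?I"
      by (rule nn_integral_bij_count_space) (use L in \<open>auto simp: bij_betw_def dual_lattice_def inj_on_def\<close>)
    finally show "(\<integral>\<^sup>+z. F (round_lattice L (x - (1 / L) *\<^sub>R z)) \<partial>count_space int_lattice) = ?I" .
  qed
  also have "\<dots> = ?I * ennreal (1 / L ^ CARD('d))"
    using emeasure_torus[of "1 / L" "0 :: real ^ 'd"] L by (simp add: power_one_over divide_inverse power_inverse)
  finally show ?thesis .
qed

section \<open>Sums of negative powers over lattice points\<close>

lemma sum_powr_le:
  assumes b: "0 < \<beta>" "\<beta> < 1" and M: "M \<ge> 1"
  shows "(\<Sum>j=1..M. real j powr (- \<beta>)) \<le> real M powr (1 - \<beta>) / (1 - \<beta>)"
  using M
proof (induction M rule: dec_induct)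
  case base
  then show ?case using b by simp
next
  case (step M)
  have "\<exists>z. real M < z \<and> z < real M + 1 \<and> (real M + 1) powr (1 - \<beta>) - real M powr (1 - \<beta>) = (real M + 1 - real M) * ((1 - \<beta>) * z powr (1 - \<beta> - 1))"
    by (rule MVT2) (use step in \<open>auto intro!: DERIV_fun_powr[where g = "\<lambda>x. x" and m = 1, simplified] DERIV_powr derivative_eq_intros\<close>)
  then obtain z where z: "real M < z" "z < real M + 1" "(real M + 1) powr (1 - \<beta>) - real M powr (1 - \<beta>) = (1 - \<beta>) * z powr (- \<beta>)" by auto
  have "(real M + 1) powr (- \<beta>) \<le> z powr (- \<beta>)"
    using z b step by (intro powr_mono2') auto
  also have "\<dots> = ((real M + 1) powr (1 - \<beta>) - real M powr (1 - \<beta>)) / (1 - \<beta>)" using z b by simp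
  finally have "(real M + 1) powr (- \<beta>) + real M powr (1 - \<beta>) / (1 - \<beta>) \<le> (real M + 1) powr (1 - \<beta>) / (1 - \<beta>)"
    by (simp add: diff_divide_distrib)
  then show ?case using step by (simp add: add.commute)
qed

text \<open>The \<open>max 1\<close> gives the term at \<open>j = 0\<close> the value 1, which is
  absorbed since \<open>L powr (1 - \<beta>)\<close> is at least 1; positive and negative indices
  give the factor 2.\<close>

lemma sum_symmetric_powr_le:
  assumes b: "0 < \<beta>" "\<beta> < 1" and L: "L \<ge> 1"
  shows "(\<Sum>j\<in>{- \<lfloor>L\<rfloor>..\<lfloor>L\<rfloor>}. real_of_int (max 1 \<bar>j\<bar>) powr (- \<beta>)) \<le> (1 + 2 / (1 - \<beta>)) * L powr (1 - \<beta>)"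
proof -
  define M where "M = nat \<lfloor>L\<rfloor>"
  have M: "\<lfloor>L\<rfloor> = int M" "M \<ge> 1" "real M \<le> L" using L by (auto simp: M_def le_nat_iff le_floor_iff)
  let ?h = "\<lambda>j. real_of_int (max 1 \<bar>j\<bar>) powr (- \<beta>)"
  have sp: "{- int M..int M} = insert 0 (int ` {1..M} \<union> (\<lambda>j. - int j) ` {1..M})"
  proof (intro set_eqI iffI)
    fix j assume j: "j \<in> {- int M..int M}"
    show "j \<in> insert 0 (int ` {1..M} \<union> (\<lambda>j. - int j) ` {1..M})"
    proof (cases "j = 0")
      case False
      then consider "j > 0" | "j < 0" by linarith
      then show ?thesis
      proof cases
        case 1
        then have "j \<in> int ` {1..M}" using j by (intro image_eqI[of j _ "nat j"]) auto
        then show ?thesis by simp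
      next
        case 2
        then have "j \<in> (\<lambda>j. - int j) ` {1..M}" using j by (intro image_eqI[of j _ "nat (- j)"]) auto
        then show ?thesis by simp
      qed
    qed simp
  qed auto
  have "(\<Sum>j\<in>{- \<lfloor>L\<rfloor>..\<lfloor>L\<rfloor>}. ?h j) = ?h 0 + ((\<Sum>j\<in>int ` {1..M}. ?h j) + (\<Sum>j\<in>(\<lambda>j. - int j) ` {1..M}. ?h j))"
    unfolding M sp by (subst sum.insert) (auto intro!: sum.union_disjoint)
  also have "(\<Sum>j\<in>int ` {1..M}. ?h j) = (\<Sum>j=1..M. real j powr (- \<beta>))"
    by (subst sum.reindex) (auto simp: inj_on_def max_def intro!: sum.cong)
  also have "(\<Sum>j\<in>(\<lambda>j. - int j) ` {1..M}. ?h j) = (\<Sum>j=1..M. real j powr (- \<beta>))"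
    by (subst sum.reindex) (auto simp: inj_on_def max_def intro!: sum.cong)
  also have "?h 0 = 1" by simp
  also have "(\<Sum>j=1..M. real j powr (- \<beta>)) \<le> L powr (1 - \<beta>) / (1 - \<beta>)"
    by (rule order_trans[OF sum_powr_le[OF b M(2)]]) (use b M in \<open>auto intro!: divide_right_mono powr_mono2\<close>)
  finally have "(\<Sum>j\<in>{- \<lfloor>L\<rfloor>..\<lfloor>L\<rfloor>}. ?h j) \<le> 1 + 2 * (L powr (1 - \<beta>) / (1 - \<beta>))" by simp
  moreover have "1 \<le> L powr (1 - \<beta>)" using L b by (intro ge_one_powr_ge_zero) auto
  ultimately show ?thesis by (simp add: algebra_simps)
qed

text \<open>For a nonzero integer point \<open>z\<close> one has \<open>\<Prod>i. max 1 \<bar>z i\<bar> \<le> \<parallel>z\<parallel> ^ d\<close>, which turns the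
  lattice sum into a product of one-dimensional sums.\<close>

lemma dual_lattice_powr_sum_le:
  fixes G :: "(real ^ 'd) set"
  assumes eta: "0 < \<eta>" "\<eta> < real CARD('d)" and L: "L \<ge> 1"
    and G: "finite G" "G \<subseteq> dual_lattice L" "\<And>k. k \<in> G \<Longrightarrow> k \<noteq> 0 \<and> norm k < 1"
  shows "(\<Sum>k\<in>G. norm k powr (- \<eta>)) \<le> (1 + 2 / (1 - \<eta> / real CARD('d))) ^ CARD('d) * L ^ CARD('d)"
proof -
  let ?d = "CARD('d)"
  \<comment> \<open>The exponent is shared equally among the coordinates; \<open>\<eta> < d\<close>
    is exactly \<open>\<beta> < 1\<close>, the case in which the one-dimensional sums grow like
    \<open>L powr (1 - \<beta>)\<close>.\<close>
  define \<beta> where "\<beta> = \<eta> / real ?d"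
  have b: "0 < \<beta>" "\<beta> < 1" using eta by (auto simp: \<beta>_def)
  have eb: "\<eta> = real ?d * \<beta>" by (simp add: \<beta>_def)
  let ?h = "\<lambda>j. real_of_int (max 1 \<bar>j\<bar>) powr (- \<beta>)"
  let ?z = "\<lambda>k i. \<lfloor>L * k $ i\<rfloor>"
  let ?S = "{- \<lfloor>L\<rfloor>..\<lfloor>L\<rfloor>}"
  have zint: "L * k $ i = of_int (?z k i)" if kd: "k \<in> dual_lattice L" for k i
  proof -
    obtain w where "w \<in> int_lattice" "k = (1 / L) *\<^sub>R w" using kd by (auto simp: dual_lattice_def)
    then have "L * k $ i \<in> \<int>" using L by (simp add: int_lattice_def)
    then show ?thesis by (auto elim: Ints_cases)
  qed
  have inj: "inj_on ?z G"
  proof (rule inj_onI)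
    fix k k' assume k: "k \<in> G" "k' \<in> G" and eq: "?z k = ?z k'"
    have "L * k $ i = L * k' $ i" for i
      using zint[of k i] zint[of k' i] k G(2) fun_cong[OF eq, of i] by (metis subsetD)
    then show "k = k'" using L by (simp add: vec_eq_iff)
  qed
  have trm: "norm k powr (- \<eta>) \<le> L powr \<eta> * (\<Prod>i\<in>UNIV. ?h (?z k i))" and rng: "?z k \<in> PiE UNIV (\<lambda>_. ?S)" if k: "k \<in> G" for k
  proof -
    have kd: "k \<in> dual_lattice L" and k0: "k \<noteq> 0" "norm k < 1" using G k by auto
    have comp: "\<bar>of_int (?z k i)\<bar> \<le> L * norm k" for i
      unfolding zint[OF kd, symmetric] abs_mult using L component_le_norm_cart[of k i] by (simp add: mult_left_mono)
    \<comment> \<open>A nonzero lattice point has a coordinate with integer part at least 1 in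
      modulus. Hence \<open>L * norm k\<close> is at least 1 and dominates \<open>max 1\<close> of
      every coordinate, also of the vanishing ones.\<close>
    obtain i0 where i0: "k $ i0 \<noteq> 0" using k0 by (auto simp: vec_eq_iff)
    then have "L * k $ i0 \<noteq> 0" using L by simp
    then have "?z k i0 \<noteq> 0" using zint[OF kd, of i0] by (metis of_int_0)
    then have "1 \<le> \<bar>of_int (?z k i0) :: real\<bar>" by linarith
    then have one: "1 \<le> L * norm k" using comp[of i0] by linarith
    have mx: "real_of_int (max 1 \<bar>?z k i\<bar>) \<le> L * norm k" for i using comp[of i] one by (simp add: of_int_max)
    have "(\<Prod>i\<in>(UNIV :: 'd set). (L * norm k) powr (- \<beta>)) \<le> (\<Prod>i\<in>UNIV. ?h (?z k i))"
      using mx b by (intro prod_mono conjI powr_mono2') auto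
    moreover have "(\<Prod>i\<in>(UNIV :: 'd set). (L * norm k) powr (- \<beta>)) = L powr (- \<eta>) * norm k powr (- \<eta>)"
    proof -
      have "(\<Prod>i\<in>(UNIV :: 'd set). (L * norm k) powr (- \<beta>)) = (L * norm k) powr (- \<eta>)"
        using L k0 by (simp add: eb powr_power mult.commute)
      also have "\<dots> = L powr (- \<eta>) * norm k powr (- \<eta>)" using L by (intro powr_mult)
      finally show ?thesis .
    qed
    ultimately have "L powr \<eta> * (L powr (- \<eta>) * norm k powr (- \<eta>)) \<le> L powr \<eta> * (\<Prod>i\<in>UNIV. ?h (?z k i))"
      by (intro mult_left_mono) auto
    moreover have "L powr \<eta> * L powr (- \<eta>) = 1" using L by (simp add: powr_add[symmetric])
    ultimately show "norm k powr (- \<eta>) \<le> L powr \<eta> * (\<Prod>i\<in>UNIV. ?h (?z k i))" by (simp add: mult.assoc[symmetric])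
    have "\<bar>?z k i\<bar> \<le> \<lfloor>L\<rfloor>" for i
    proof -
      have "\<bar>of_int (?z k i)\<bar> \<le> L" using comp[of i] k0(2) L mult_left_mono[of "norm k" 1 L] by linarith
      then have "of_int \<bar>?z k i\<bar> \<le> L" by simp
      then show ?thesis by (simp only: le_floor_iff)
    qed
    then show "?z k \<in> PiE UNIV (\<lambda>_. ?S)" by (auto simp: abs_le_iff PiE_def minus_le_iff)
  qed
  have "(\<Sum>k\<in>G. norm k powr (- \<eta>)) \<le> (\<Sum>k\<in>G. L powr \<eta> * (\<Prod>i\<in>UNIV. ?h (?z k i)))"
    by (intro sum_mono trm)
  also have "\<dots> = L powr \<eta> * (\<Sum>g\<in>?z ` G. \<Prod>i\<in>UNIV. ?h (g i))"
    by (simp only: sum.reindex[OF inj] o_def sum_distrib_left)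
  also have "\<dots> \<le> L powr \<eta> * (\<Sum>g\<in>PiE UNIV (\<lambda>_. ?S). \<Prod>i\<in>(UNIV :: 'd set). ?h (g i))"
  proof (rule mult_left_mono)
    show "(\<Sum>g\<in>?z ` G. \<Prod>i\<in>UNIV. ?h (g i)) \<le> (\<Sum>g\<in>PiE UNIV (\<lambda>_. ?S). \<Prod>i\<in>(UNIV :: 'd set). ?h (g i))"
    proof (rule sum_mono2)
      show "finite (PiE (UNIV :: 'd set) (\<lambda>_. ?S))" by (rule finite_PiE) auto
      show "?z ` G \<subseteq> PiE UNIV (\<lambda>_. ?S)" using rng by (rule image_subsetI)
      show "0 \<le> (\<Prod>i\<in>UNIV. ?h (g i))" for g :: "'d \<Rightarrow> int" by (rule prod_nonneg) simp
    qed
  qed simp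
  also have "(\<Sum>g\<in>PiE UNIV (\<lambda>_. ?S). \<Prod>i\<in>(UNIV :: 'd set). ?h (g i)) = (\<Sum>j\<in>?S. ?h j) ^ ?d"
    using prod_sum_PiE[of "UNIV :: 'd set" "\<lambda>_. ?S" "\<lambda>_. ?h"] by simp
  also have "\<dots> \<le> ((1 + 2 / (1 - \<beta>)) * L powr (1 - \<beta>)) ^ ?d"
    by (intro power_mono sum_symmetric_powr_le b L sum_nonneg) simp
  also have "L powr \<eta> * ((1 + 2 / (1 - \<beta>)) * L powr (1 - \<beta>)) ^ ?d = (1 + 2 / (1 - \<beta>)) ^ ?d * L ^ ?d"
  proof -
    have "(L powr (1 - \<beta>)) ^ ?d = L powr (real ?d * (1 - \<beta>))" using L by (simp add: powr_power mult.commute)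
    then have "L powr \<eta> * (L powr (1 - \<beta>)) ^ ?d = L powr (real ?d)" by (simp add: eb powr_add[symmetric] algebra_simps)
    also have "\<dots> = L ^ ?d" using L by (simp add: powr_realpow)
    finally show ?thesis by (simp add: power_mult_distrib mult.left_commute)
  qed
  finally show ?thesis unfolding \<beta>_def by (simp add: mult_left_mono)
qed

section \<open>Convergence of lattice sums per unit volume\<close>

context jump
begin

lemma continuous_fw: "continuous_on UNIV fw"
proof -
  have "uniformly_continuous_on UNIV (\<lambda>k. exp (- dispersion \<xi> k))"
    using jump unfolding jump_function_def by (elim conjE)
  then show ?thesis unfolding exp_dispersion by (rule uniformly_continuous_imp_continuous)
qed

lemma fw_measurable [measurable]: "fw \<in> borel_measurable borel"
  by (rule borel_measurable_continuous_onI[OF continuous_fw])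

lemma eventually_jump_box: "\<forall>\<^sub>F L in at_top. jump_box \<xi> L"
proof -
  have "\<forall>\<^sub>F L in at_top. (\<forall>x. periodized \<xi> L x \<noteq> - \<infinity>) \<and> continuous_on UNIV (\<lambda>x. exp_ereal (- periodized \<xi> L x))"
    using jump unfolding jump_function_def by (elim conjE)
  then show ?thesis using eventually_gt_at_top[of 0]
  proof eventually_elim
    case (elim L)
    then show ?case by unfold_locales auto
  qed
qed

lemma nn_integral_fw_round:
  assumes "jump_box \<xi> L" and n: "n \<ge> 1"
  shows "(\<integral>\<^sup>+x. ennreal (fw (round_lattice L x) ^ n) \<partial>lborel) = ennreal (lattice_sum \<xi> L n / L ^ CARD('d))"
proof -
  interpret jump_box \<xi> L by fact
  have f0: "0 \<le> fw k" for k using fw_pos[of k] by simp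
  have s: "(\<lambda>k. fw k ^ n) summable_on dual_lattice L" using summable_fw[of "n - 1"] n by simp
  have "lattice_sum \<xi> L n = enn2real (\<integral>\<^sup>+k. ennreal (fw k ^ n) \<partial>count_space (dual_lattice L))"
    unfolding lattice_sum_def fw_def[symmetric] by (rule infsum_eq_enn2real_nn_integral) (simp_all add: f0)
  moreover have "(\<integral>\<^sup>+k. ennreal (fw k ^ n) \<partial>count_space (dual_lattice L)) < \<infinity>"
    using summable_on_iff_nn_integral[of "dual_lattice L" "\<lambda>k. fw k ^ n"] s f0 by simp
  ultimately have "(\<integral>\<^sup>+k. ennreal (fw k ^ n) \<partial>count_space (dual_lattice L)) = ennreal (lattice_sum \<xi> L n)"
    by (simp add: less_top)
  moreover have "0 \<le> lattice_sum \<xi> L n" using lattice_sum_ge_1[OF n] by simp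
  ultimately show ?thesis using L
    by (subst nn_integral_round_lattice[OF L]) (auto simp: ennreal_mult[symmetric])
qed

lemma fw_round_tendsto:
  assumes "filterlim Ls at_top sequentially"
  shows "(\<lambda>n. fw (round_lattice (Ls n) x)) \<longlonglongrightarrow> fw x"
proof -
  have "(\<lambda>n. round_lattice (Ls n) x - x) \<longlonglongrightarrow> 0"
  proof (rule Lim_null_comparison)
    show "\<forall>\<^sub>F n in sequentially. norm (round_lattice (Ls n) x - x) \<le> real CARD('d) / Ls n"
      using filterlim_at_top_dense[THEN iffD1, OF assms, rule_format, of 0]
      by eventually_elim (rule norm_round_lattice_diff)
    show "(\<lambda>n. real CARD('d) / Ls n) \<longlonglongrightarrow> 0" using assms by (rule real_tendsto_divide_at_top[OF tendsto_const])
  qed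
  then have "(\<lambda>n. round_lattice (Ls n) x) \<longlonglongrightarrow> x" by (simp add: Lim_null[of _ x])
  then show ?thesis by (intro continuous_on_tendsto_compose[OF continuous_fw]) auto
qed

text \<open>The assumed limit is a Bochner integral, whose value would be the default 0 without
  integrability. Fatou's lemma along the rounded functions bounds the nonnegative integral by that
  limit and so supplies integrability.\<close>

lemma
  assumes lim: "filterlim Ls at_top sequentially"
  shows lattice_sum_1_tendsto: "(\<lambda>n. lattice_sum \<xi> (Ls n) 1 / Ls n ^ CARD('d)) \<longlonglongrightarrow> (LINT k|lborel. fw k)"
    and integrable_fw: "integrable lborel fw"
proof -
  have f0: "0 \<le> fw k" for k using fw_pos[of k] by simp
  have "((\<lambda>L. (\<Sum>\<^sub>\<infinity>k\<in>dual_lattice L. exp (- dispersion \<xi> k)) / L ^ CARD('d)) \<longlongrightarrow> (LINT k|lborel. exp (- dispersion \<xi> k))) at_top"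
    using jump unfolding jump_function_def by (elim conjE)
  then have "((\<lambda>L. lattice_sum \<xi> L 1 / L ^ CARD('d)) \<longlongrightarrow> (LINT k|lborel. fw k)) at_top"
    unfolding exp_dispersion by (simp add: lattice_sum_def fw_def)
  then show *: "(\<lambda>n. lattice_sum \<xi> (Ls n) 1 / Ls n ^ CARD('d)) \<longlonglongrightarrow> (LINT k|lborel. fw k)"
    using lim by (rule filterlim_compose)
  have ev: "\<forall>\<^sub>F n in sequentially. jump_box \<xi> (Ls n)" using lim eventually_jump_box by (simp add: filterlim_iff)
  have "(\<integral>\<^sup>+x. ennreal (fw x) \<partial>lborel) = (\<integral>\<^sup>+x. liminf (\<lambda>n. ennreal (fw (round_lattice (Ls n) x))) \<partial>lborel)"
    by (intro nn_integral_cong lim_imp_Liminf[symmetric] tendsto_ennrealI fw_round_tendsto[OF lim]) simp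
  also have "\<dots> \<le> liminf (\<lambda>n. \<integral>\<^sup>+x. ennreal (fw (round_lattice (Ls n) x)) \<partial>lborel)"
    by (rule nn_integral_liminf) measurable
  also have "\<dots> = ennreal (LINT k|lborel. fw k)"
  proof (rule lim_imp_Liminf)
    have "\<forall>\<^sub>F n in sequentially. ennreal (lattice_sum \<xi> (Ls n) 1 / Ls n ^ CARD('d)) = (\<integral>\<^sup>+x. ennreal (fw (round_lattice (Ls n) x)) \<partial>lborel)"
      using ev
    proof eventually_elim
      case (elim n) show ?case using nn_integral_fw_round[OF elim, of 1] by simp
    qed
    then show "(\<lambda>n. \<integral>\<^sup>+x. ennreal (fw (round_lattice (Ls n) x)) \<partial>lborel) \<longlonglongrightarrow> ennreal (LINT k|lborel. fw k)"
      using tendsto_ennrealI[OF *] by (rule Lim_transform_eventually[rotated])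
  qed simp
  also have "\<dots> < \<infinity>" by simp
  finally show "integrable lborel fw" using f0 by (intro integrableI_nonneg) auto
qed

lemma int_fw: "integrable lborel fw"
  by (rule integrable_fw[OF filterlim_real_sequentially])

lemma fw_le_1: "fw k \<le> 1"
proof -
  have "norm (fourier_weight \<xi> k) \<le> (LINT x|lborel. norm (wave k x * complex_of_real (step_density x)))"
    unfolding fourier_weight_wave by (rule integral_norm_bound)
  also have "\<dots> = 1" by (simp add: norm_mult step_density_nonneg integral_step_density)
  finally show ?thesis using abs_Re_le_cmod[of "fourier_weight \<xi> k"] by (simp add: fw_def)
qed

text \<open>The case \<open>l = 1\<close> says that the masses of the rounded functions converge.
  Together with pointwise convergence, Scheffe's lemma gives convergence in L1, and on [0, 1] the
  l-th power is Lipschitz with constant \<open>l\<close>.\<close>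

lemma lattice_sum_tendsto:
  assumes lim: "filterlim Ls at_top sequentially" and l: "l \<ge> 1"
  shows "(\<lambda>n. lattice_sum \<xi> (Ls n) l / Ls n ^ CARD('d)) \<longlonglongrightarrow> (LINT k|lborel. fw k ^ l)"
proof -
  have f0: "0 \<le> fw k" for k using fw_pos[of k] by simp
  have "\<forall>\<^sub>F n in sequentially. jump_box \<xi> (Ls n)" using lim eventually_jump_box by (simp add: filterlim_iff)
  then obtain n0 where n0: "\<And>n. n \<ge> n0 \<Longrightarrow> jump_box \<xi> (Ls n)" unfolding eventually_sequentially by auto
  \<comment> \<open>Shifting the index makes the box conditions hold for every term instead of
    eventually.\<close>
  define K where "K n = Ls (n + n0)" for n
  have K: "jump_box \<xi> (K n)" for n using n0 by (simp add: K_def)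
  have limK: "filterlim K at_top sequentially" unfolding K_def using lim by (rule filterlim_compose) (rule filterlim_add_const_nat_at_top)
  define F where "F n x = fw (round_lattice (K n) x)" for n x
  have nnF: "(\<integral>\<^sup>+x. ennreal (F n x ^ m) \<partial>lborel) = ennreal (lattice_sum \<xi> (K n) m / K n ^ CARD('d))" if "m \<ge> 1" for n m
    unfolding F_def by (rule nn_integral_fw_round[OF K that])
  have Fm[measurable]: "F n \<in> borel_measurable borel" for n unfolding F_def by measurable
  have iF: "integrable lborel (\<lambda>x. F n x ^ m)" if "m \<ge> 1" for n m
    using nnF[OF that] by (intro integrableI_nonneg) (auto simp: F_def f0)
  have iF1: "integrable lborel (F n)" for n using iF[of 1 n] by simp
  have ifl: "integrable lborel (\<lambda>x. fw x ^ l)"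
  proof (rule Bochner_Integration.integrable_bound[OF int_fw])
    show "AE x in lborel. norm (fw x ^ l) \<le> norm (fw x)"
      using l power_decreasing[of 1 l "fw _"] fw_le_1 f0 by (intro AE_I2) simp
  qed simp
  have intF: "(LINT x|lborel. F n x ^ l) = lattice_sum \<xi> (K n) l / K n ^ CARD('d)" for n
  proof -
    interpret jump_box \<xi> "K n" by (rule K)
    have "0 \<le> lattice_sum \<xi> (K n) l" using lattice_sum_ge_1[OF l] by simp
    then show ?thesis using integral_eq_nn_integral[of "\<lambda>x. F n x ^ l" lborel] nnF[OF l, of n] L by (simp add: F_def f0)
  qed
  have L1: "(\<lambda>n. \<integral>\<^sup>+x. norm (F n x - fw x) \<partial>lborel) \<longlonglongrightarrow> 0"
  proof (rule Scheffe_lemma1[OF iF1 int_fw])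
    show "AE x in lborel. (\<lambda>n. F n x) \<longlonglongrightarrow> fw x" unfolding F_def by (intro AE_I2 fw_round_tendsto[OF limK])
    have "(\<lambda>n. \<integral>\<^sup>+x. norm (F n x) \<partial>lborel) \<longlonglongrightarrow> (\<integral>\<^sup>+x. norm (fw x) \<partial>lborel)"
    proof -
      have "(\<lambda>n. ennreal (lattice_sum \<xi> (K n) 1 / K n ^ CARD('d))) \<longlonglongrightarrow> ennreal (LINT k|lborel. fw k)"
        by (intro tendsto_ennrealI lattice_sum_1_tendsto limK)
      also have "(\<lambda>n. ennreal (lattice_sum \<xi> (K n) 1 / K n ^ CARD('d))) = (\<lambda>n. \<integral>\<^sup>+x. norm (F n x) \<partial>lborel)"
        using nnF[of 1] by (simp add: F_def f0)
      also have "ennreal (LINT k|lborel. fw k) = (\<integral>\<^sup>+x. norm (fw x) \<partial>lborel)"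
        using nn_integral_eq_integral[OF int_fw] by (simp add: f0)
      finally show ?thesis .
    qed
    then show "limsup (\<lambda>n. \<integral>\<^sup>+x. norm (F n x) \<partial>lborel) \<le> (\<integral>\<^sup>+x. norm (fw x) \<partial>lborel)"
      using lim_imp_Limsup[OF sequentially_bot] by (metis order_refl)
  qed
  have powd: "\<bar>a ^ m - b ^ m\<bar> \<le> real m * \<bar>a - b\<bar>" if "0 \<le> a" "a \<le> 1" "0 \<le> b" "b \<le> 1" for a b :: real and m
  proof (induction m)
    case (Suc m)
    have "a ^ Suc m - b ^ Suc m = a ^ m * (a - b) + (a ^ m - b ^ m) * b" by (simp add: algebra_simps)
    also have "\<bar>\<dots>\<bar> \<le> a ^ m * \<bar>a - b\<bar> + \<bar>a ^ m - b ^ m\<bar> * b"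
      using that by (intro order_trans[OF abs_triangle_ineq]) (simp add: abs_mult)
    also have "\<dots> \<le> 1 * \<bar>a - b\<bar> + (real m * \<bar>a - b\<bar>) * 1"
      using that Suc by (intro add_mono mult_mono power_le_one) auto
    finally show ?case by (simp add: algebra_simps)
  qed simp
  have main: "(\<lambda>n. LINT x|lborel. F n x ^ l) \<longlonglongrightarrow> (LINT x|lborel. fw x ^ l)"
  proof (rule tendsto_L1_int)
    show "\<And>n. integrable lborel (\<lambda>x. F n x ^ l)" by (rule iF[OF l])
    show "integrable lborel (\<lambda>x. fw x ^ l)" by (rule ifl)
    show "((\<lambda>n. \<integral>\<^sup>+x. norm (F n x ^ l - fw x ^ l) \<partial>lborel) \<longlongrightarrow> 0) sequentially"
    proof (rule tendsto_sandwich[of "\<lambda>_. 0", OF always_eventually always_eventually])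
      have "(\<integral>\<^sup>+x. norm (F n x ^ l - fw x ^ l) \<partial>lborel) \<le> ennreal (real l) * (\<integral>\<^sup>+x. norm (F n x - fw x) \<partial>lborel)" for n
      proof -
        have "(\<integral>\<^sup>+x. norm (F n x ^ l - fw x ^ l) \<partial>lborel) \<le> (\<integral>\<^sup>+x. ennreal (real l) * ennreal (norm (F n x - fw x)) \<partial>lborel)"
          using powd f0 fw_le_1 by (intro nn_integral_mono) (simp add: F_def ennreal_mult[symmetric] ennreal_leI)
        also have "\<dots> = ennreal (real l) * (\<integral>\<^sup>+x. norm (F n x - fw x) \<partial>lborel)" by (rule nn_integral_cmult) measurable
        finally show ?thesis .
      qed
      then show "\<forall>n. (\<integral>\<^sup>+x. norm (F n x ^ l - fw x ^ l) \<partial>lborel) \<le> ennreal (real l) * (\<integral>\<^sup>+x. norm (F n x - fw x) \<partial>lborel)" ..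
      show "(\<lambda>n. ennreal (real l) * (\<integral>\<^sup>+x. norm (F n x - fw x) \<partial>lborel)) \<longlonglongrightarrow> 0"
        using ennreal_tendsto_cmult[OF _ L1, of "ennreal (real l)"] by simp
    qed (simp_all)
  qed
  then have "(\<lambda>n. lattice_sum \<xi> (Ls (n + n0)) l / Ls (n + n0) ^ CARD('d)) \<longlonglongrightarrow> (LINT k|lborel. fw k ^ l)"
    unfolding intF K_def .
  then show ?thesis by (rule LIMSEQ_offset)
qed

end

section \<open>The gap above the zero mode and bounds on the other modes\<close>

context jump
begin

text \<open>By uniform continuity a value at least \<open>s\<close> at \<open>k\<close> forces
  values at least \<open>s / 2\<close> on a ball of fixed radius. Such a ball far out would carry a
  fixed amount of mass, contradicting the vanishing tails of an integrable function.\<close>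

lemma fw_decay:
  assumes s: "s > 0"
  shows "\<exists>R. \<forall>k. R \<le> norm k \<longrightarrow> fw k < s"
proof -
  have uc: "uniformly_continuous_on UNIV fw"
  proof -
    have "uniformly_continuous_on UNIV (\<lambda>k. exp (- dispersion \<xi> k))"
      using jump unfolding jump_function_def by (elim conjE)
    then show ?thesis unfolding exp_dispersion .
  qed
  have f0: "0 \<le> fw k" for k using fw_pos[of k] by simp
  obtain r where r: "r > 0" "\<And>k k'. dist k' k < r \<Longrightarrow> dist (fw k') (fw k) < s / 2"
    using uc s unfolding uniformly_continuous_on_def by (metis UNIV_I half_gt_zero)
  define m where "m = measure lborel (ball (0 :: real ^ 'd) r)"
  have m: "m > 0" unfolding m_def using r(1) by (rule content_ball_pos)
  have mb: "measure lborel (ball k r) = m" for k :: "real ^ 'd"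
    unfolding m_def by (simp add: content_ball_conv_unit_ball[of r k] content_ball_conv_unit_ball[of r 0] r less_imp_le)
  have "(\<lambda>n. LINT x|lborel. fw x * indicator {x. real n \<le> norm x} x) \<longlonglongrightarrow> (LINT x|(lborel :: (real ^ 'd) measure). 0)"
  proof (rule integral_dominated_convergence[where w = fw])
    show "integrable lborel fw" by (rule int_fw)
    show "AE x in lborel. (\<lambda>n. fw x * indicator {x. real n \<le> norm x} x) \<longlonglongrightarrow> 0"
    proof (intro AE_I2)
      fix x :: "real ^ 'd"
      obtain n0 where "norm x < real n0" using reals_Archimedean2 by auto
      then have "\<forall>\<^sub>F n in sequentially. fw x * indicator {x. real n \<le> norm x} x = 0"
        by (intro eventually_sequentiallyI[of n0]) auto
      then show "(\<lambda>n. fw x * indicator {x. real n \<le> norm x} x) \<longlonglongrightarrow> 0" by (rule tendsto_eventually)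
    qed
    show "AE x in lborel. norm (fw x * indicator {x. real n \<le> norm x} x) \<le> fw x" for n
      using f0 by (intro AE_I2) (auto split: split_indicator)
  qed auto
  then have "\<forall>\<^sub>F n in sequentially. (LINT x|lborel. fw x * indicator {x. real n \<le> norm x} x) < s / 2 * m"
    using s m by (intro order_tendstoD(2)) auto
  then obtain n where n: "(LINT x|lborel. fw x * indicator {x. real n \<le> norm x} x) < s / 2 * m"
    by (auto simp: eventually_sequentially)
  have "fw k < s" if k: "real n + r \<le> norm k" for k
  proof (rule ccontr)
    assume "\<not> fw k < s"
    then have big: "s / 2 \<le> fw x" if "x \<in> ball k r" for x
    proof -
      have "\<bar>fw x - fw k\<bar> < s / 2" using r(2)[of x k] that by (simp add: dist_commute flip: dist_real_def)
      then show ?thesis using \<open>\<not> fw k < s\<close> by linarith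
    qed
    have sub: "ball k r \<subseteq> {x. real n \<le> norm x}"
    proof
      fix x assume "x \<in> ball k r"
      then have "norm (k - x) < r" by (simp add: dist_norm)
      then show "x \<in> {x. real n \<le> norm x}" using k norm_triangle_ineq2[of k x] by simp
    qed
    have "s / 2 * m = (LINT x|lborel. s / 2 * indicator (ball k r) x)" by (simp add: mb)
    also have "\<dots> \<le> (LINT x|lborel. fw x * indicator {x. real n \<le> norm x} x)"
    proof (rule integral_mono)
      show "integrable lborel (\<lambda>x. s / 2 * indicator (ball k r) x :: real)"
        by (intro integrable_mult_right integrable_real_indicator) (use emeasure_bounded_finite[of "ball k r"] in auto)
      show "integrable lborel (\<lambda>x. fw x * indicator {x. real n \<le> norm x} x)"
        by (intro integrable_real_mult_indicator int_fw) measurable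
      show "s / 2 * indicator (ball k r) x \<le> fw x * indicator {x. real n \<le> norm x} x" for x
        using big sub f0 s by (auto split: split_indicator)
    qed
    finally show False using n by simp
  qed
  then show ?thesis by (intro exI[of _ "real n + r"]) auto
qed

lemma wave_double: "Re (wave (2 *\<^sub>R k) x) = 2 * (Re (wave k x))\<^sup>2 - 1"
proof -
  have "Re (wave (2 *\<^sub>R k) x) = cos (2 * (2 * pi * (k \<bullet> x)))" by (simp add: wave_cis mult_ac)
  also have "\<dots> = 2 * (cos (2 * pi * (k \<bullet> x)))\<^sup>2 - 1" by (rule cos_double_cos)
  finally show ?thesis by (simp add: wave_cis)
qed

lemma fw_integral: "fw k = (LINT x|lborel. Re (wave k x) * step_density x)"
  and integrable_re_wave: "integrable lborel (\<lambda>x. Re (wave k x) * step_density x)"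
proof -
  have wm: "wave k \<in> borel_measurable borel" by (intro borel_measurable_continuous_onI continuous_intros)
  have i2: "integrable lborel (\<lambda>x. wave k x * of_real (step_density x))"
    by (rule Bochner_Integration.integrable_bound[OF integrable_step_density])
      (use wm in \<open>auto simp: norm_mult step_density_nonneg\<close>)
  show "fw k = (LINT x|lborel. Re (wave k x) * step_density x)"
    unfolding fw_def fourier_weight_wave using integral_Re[OF i2] by simp
  show "integrable lborel (\<lambda>x. Re (wave k x) * step_density x)" using integrable_Re[OF i2] by simp
qed

text \<open>\<open>1 - cos (2 t) \<le> 4 (1 - cos t)\<close>, so a value \<open>1\<close> away from the origin would propagate to infinity.\<close>

lemma fw_double: "1 - fw (2 *\<^sub>R k) \<le> 4 * (1 - fw k)"
proof -
  have "1 - fw (2 *\<^sub>R k) = (LINT x|lborel. (1 - Re (wave (2 *\<^sub>R k) x)) * step_density x)"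
    using integrable_re_wave[of "2 *\<^sub>R k"] integrable_step_density
    by (simp add: fw_integral left_diff_distrib integral_step_density)
  also have "\<dots> \<le> (LINT x|lborel. 4 * (1 - Re (wave k x)) * step_density x)"
  proof (rule integral_mono)
    show "integrable lborel (\<lambda>x. (1 - Re (wave (2 *\<^sub>R k) x)) * step_density x)"
      using integrable_re_wave[of "2 *\<^sub>R k"] integrable_step_density by (simp add: left_diff_distrib)
    have "integrable lborel (\<lambda>x. 4 * (step_density x - Re (wave k x) * step_density x))"
      using integrable_re_wave[of k] integrable_step_density by simp
    then show "integrable lborel (\<lambda>x. 4 * (1 - Re (wave k x)) * step_density x)" by (simp add: algebra_simps)
    fix x
    have "0 \<le> (1 - Re (wave k x))\<^sup>2" by simp
    then have "1 - Re (wave (2 *\<^sub>R k) x) \<le> 4 * (1 - Re (wave k x))"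
      unfolding wave_double by (simp add: power2_eq_square algebra_simps)
    then show "(1 - Re (wave (2 *\<^sub>R k) x)) * step_density x \<le> 4 * (1 - Re (wave k x)) * step_density x"
      by (rule mult_right_mono) (rule step_density_nonneg)
  qed
  also have "\<dots> = 4 * (1 - fw k)"
    using integrable_re_wave[of k] integrable_step_density
    by (simp add: fw_integral left_diff_distrib integral_step_density mult.assoc)
  finally show ?thesis .
qed

lemma fw_less_1:
  assumes k: "k \<noteq> 0" shows "fw k < 1"
proof (rule ccontr)
  assume "\<not> fw k < 1"
  then have k1: "1 \<le> fw k" by simp
  have *: "1 \<le> fw (2 ^ m *\<^sub>R k)" for m :: nat
  proof (induction m)
    case (Suc m)
    then show ?case using fw_double[of "2 ^ m *\<^sub>R k"] by simp
  qed (use k1 in simp)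
  obtain R where R: "\<forall>k. R \<le> norm k \<longrightarrow> fw k < 1" using fw_decay[of 1] by auto
  obtain m where "R / norm k < 2 ^ m" using real_arch_pow[of 2 "R / norm k"] by auto
  then have "R \<le> norm (2 ^ m *\<^sub>R k)" using k by (simp add: field_simps)
  then show False using R *[of m] by (metis not_le)
qed

text \<open>Decay settles large \<open>k\<close>; on the remaining compact shell the maximum is
  attained and is below 1.\<close>

lemma fw_gap:
  assumes \<delta>: "\<delta> > 0"
  shows "\<exists>s. 0 < s \<and> s < 1 \<and> (\<forall>k. \<delta> \<le> norm k \<longrightarrow> fw k \<le> s)"
proof -
  obtain R where R: "\<forall>k. R \<le> norm k \<longrightarrow> fw k < 1 / 2" using fw_decay[of "1 / 2"] by auto
  define S where "S = cball (0 :: real ^ 'd) R - ball 0 \<delta>"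
  have "compact S" unfolding S_def by (intro compact_diff) auto
  have "\<exists>s. 0 < s \<and> s < 1 \<and> (\<forall>k\<in>S. fw k \<le> s)"
  proof (cases "S = {}")
    case True then show ?thesis by (intro exI[of _ "1 / 2"]) simp
  next
    case False
    obtain k where k: "k \<in> S" "\<forall>y\<in>S. fw y \<le> fw k"
      using continuous_attains_sup[OF \<open>compact S\<close> False continuous_on_subset[OF continuous_fw]] by auto
    have "fw k < 1" using k(1) \<delta> by (intro fw_less_1) (auto simp: S_def)
    then show ?thesis using k(2) fw_pos[of k] by (intro exI[of _ "fw k"]) simp
  qed
  then obtain s where s: "0 < s" "s < 1" "\<forall>k\<in>S. fw k \<le> s" by auto
  have "fw k \<le> max s (1 / 2)" if "\<delta> \<le> norm k" for k
  proof (cases "R \<le> norm k")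
    case True
    then have "fw k < 1 / 2" using R by simp
    then show ?thesis by simp
  next
    case False
    then have "k \<in> S" using that by (simp add: S_def)
    then have "fw k \<le> s" using s by simp
    then show ?thesis by simp
  qed
  then show ?thesis using s by (intro exI[of _ "max s (1 / 2)"]) auto
qed

text \<open>The hypothesis admits exponents that are not positive. Raising the exponent to at least
  \<open>d / 2\<close> makes it positive and keeps it below \<open>d\<close>; for
  \<open>norm k < 1\<close> a larger exponent only weakens the bound, hence \<delta> is cut at
  1.\<close>

lemma dispersion_lower:
  "\<exists>a \<eta> \<delta>. 0 < a \<and> 0 < \<eta> \<and> \<eta> < real CARD('d) \<and> 0 < \<delta> \<and> \<delta> \<le> 1 \<and>
    (\<forall>k. norm k < \<delta> \<longrightarrow> a * norm k powr \<eta> \<le> dispersion \<xi> k)"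
proof -
  have "\<exists>a>0. \<exists>\<eta><real CARD('d). \<exists>\<delta>>0. \<forall>k. norm k < \<delta> \<longrightarrow> a * norm k powr \<eta> \<le> dispersion \<xi> k"
    using jump unfolding jump_function_def by (elim conjE)
  then obtain a \<eta> \<delta> where a: "a > 0" "\<eta> < real CARD('d)" "\<delta> > 0"
    "\<And>k. norm k < \<delta> \<Longrightarrow> a * norm k powr \<eta> \<le> dispersion \<xi> k" by auto
  let ?e = "max \<eta> (real CARD('d) / 2)"
  have "a * norm k powr ?e \<le> dispersion \<xi> k" if k: "norm k < min \<delta> 1" for k
  proof -
    have "norm k powr ?e \<le> norm k powr \<eta>"
    proof (cases "k = 0")
      case False
      have "?e \<ge> \<eta>" by simp
      then show ?thesis using False k by (intro powr_mono') auto
    qed simp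
    then have "a * norm k powr ?e \<le> a * norm k powr \<eta>" using a(1) by simp
    also have "\<dots> \<le> dispersion \<xi> k" using a(4) k by simp
    finally show ?thesis .
  qed
  then show ?thesis using a
    by (rule_tac exI[of _ a], rule_tac exI[of _ ?e], rule_tac exI[of _ "min \<delta> 1"]) (auto simp: less_max_iff_disj)
qed

text \<open>The \<open>- 1\<close> removes the zero mode, where \<open>fw 0 = 1\<close>, so uniform
  bounds over finite sets of nonzero modes pass to the infinite sum.\<close>

lemma sum_lattice_sum_le:
  assumes "jump_box \<xi> L" and A: "finite A" "\<And>l. l \<in> A \<Longrightarrow> l \<ge> 1"
    and B: "\<And>G. finite G \<Longrightarrow> G \<subseteq> dual_lattice L - {0} \<Longrightarrow> (\<Sum>k\<in>G. \<Sum>l\<in>A. fw k ^ l) \<le> B"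
  shows "(\<Sum>l\<in>A. lattice_sum \<xi> L l - 1) \<le> B"
proof -
  interpret jump_box \<xi> L by fact
  let ?D = "dual_lattice L :: (real ^ 'd) set"
  have lim: "(sum (\<lambda>k. fw k ^ l) \<longlongrightarrow> lattice_sum \<xi> L l) (finite_subsets_at_top ?D)" if "l \<in> A" for l
    using has_sum_infsum[OF summable_fw[of "l - 1"]] A(2)[OF that]
    unfolding has_sum_def lattice_sum_def fw_def[symmetric] by simp
  have "((\<lambda>G. \<Sum>l\<in>A. (\<Sum>k\<in>G. fw k ^ l) - 1) \<longlongrightarrow> (\<Sum>l\<in>A. lattice_sum \<xi> L l - 1)) (finite_subsets_at_top ?D)"
    by (intro tendsto_sum tendsto_diff lim tendsto_const)
  moreover have "\<forall>\<^sub>F G in finite_subsets_at_top ?D. (\<Sum>l\<in>A. (\<Sum>k\<in>G. fw k ^ l) - 1) \<le> B"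
    unfolding eventually_finite_subsets_at_top
  proof (intro exI[of _ "{0}"] conjI allI impI)
    fix G assume G: "finite G \<and> {0} \<subseteq> G \<and> G \<subseteq> ?D"
    then have "(\<Sum>k\<in>G. fw k ^ l) - 1 = (\<Sum>k\<in>G - {0}. fw k ^ l)" for l
      using sum.remove[of G 0 "\<lambda>k. fw k ^ l"] by (simp add: fw_0)
    then have "(\<Sum>l\<in>A. (\<Sum>k\<in>G. fw k ^ l) - 1) = (\<Sum>k\<in>G - {0}. \<Sum>l\<in>A. fw k ^ l)"
      using sum.swap[of "\<lambda>k l. fw k ^ l" A "G - {0}"] by simp
    also have "\<dots> \<le> B" using G by (intro B) auto
    finally show "(\<Sum>l\<in>A. (\<Sum>k\<in>G. fw k ^ l) - 1) \<le> B" .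
  qed auto
  ultimately show ?thesis by (rule tendsto_upperbound) simp
qed

lemma sum_powers_le:
  fixes x :: real assumes "0 < x" "x < 1"
  shows "(\<Sum>l=1..R. x ^ l) \<le> x / (1 - x)"
proof -
  have "(1 - x) * (\<Sum>l=1..R. x ^ l) = x - x ^ Suc R"
  proof (induction R)
    case (Suc R)
    have "(1 - x) * (\<Sum>l=1..Suc R. x ^ l) = (1 - x) * (\<Sum>l=1..R. x ^ l) + (1 - x) * x ^ Suc R"
      by (simp add: distrib_left)
    also have "\<dots> = x - x ^ Suc (Suc R)" unfolding Suc by (simp add: algebra_simps)
    finally show ?case .
  qed simp
  also have "\<dots> \<le> x" using assms by simp
  finally show ?thesis using assms by (simp add: field_simps)
qed

text \<open>Summing the geometric series over \<open>l\<close> first leaves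
  \<open>fw k / (1 - fw k)\<close>. Away from 0 the gap bounds it by a multiple of
  \<open>fw k\<close>; near 0 it is at most \<open>norm k powr (- \<eta>) / a\<close>, and
  \<open>\<eta> < d\<close> makes the lattice sum proportional to the volume. For the decay, nonzero
  modes have norm at least \<open>1 / L\<close>, so each factor \<open>fw k\<close> is at most
  \<open>exp (- c * L powr (- \<eta>))\<close>.\<close>

lemma
  shows sum_lattice_sum_bound: "\<exists>C. \<forall>\<^sub>F L in at_top. \<forall>R. (\<Sum>l=1..R. lattice_sum \<xi> L l - 1) \<le> C * L ^ CARD('d)"
    and lattice_sum_exp_decay: "\<exists>C c \<eta>. 0 < c \<and> 0 < \<eta> \<and> \<eta> < real CARD('d) \<and>
      (\<forall>\<^sub>F L in at_top. \<forall>l\<ge>1. lattice_sum \<xi> L l - 1 \<le> C * L ^ CARD('d) * exp (- (c * L powr (- \<eta>)) * real (l - 1)))"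
proof -
  obtain a \<eta> \<delta> where a: "0 < a" "0 < \<eta>" "\<eta> < real CARD('d)" "0 < \<delta>" "\<delta> \<le> 1"
    "\<And>k. norm k < \<delta> \<Longrightarrow> a * norm k powr \<eta> \<le> dispersion \<xi> k" using dispersion_lower by auto
  obtain s where s: "0 < s" "s < 1" "\<And>k. \<delta> \<le> norm k \<Longrightarrow> fw k \<le> s" using fw_gap[OF a(4)] by auto
  define I where "I = (LINT k|lborel. fw k) + 1"
  have lim1: "((\<lambda>L. lattice_sum \<xi> L 1 / L ^ CARD('d)) \<longlongrightarrow> (LINT k|lborel. fw k)) at_top"
  proof -
    have "((\<lambda>L. (\<Sum>\<^sub>\<infinity>k\<in>dual_lattice L. exp (- dispersion \<xi> k)) / L ^ CARD('d)) \<longlongrightarrow> (LINT k|lborel. exp (- dispersion \<xi> k))) at_top"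
      using jump unfolding jump_function_def by (elim conjE)
    then show ?thesis unfolding exp_dispersion by (simp add: lattice_sum_def fw_def)
  qed
  have "\<forall>\<^sub>F L in at_top. lattice_sum \<xi> L 1 / L ^ CARD('d) < I"
    by (rule order_tendstoD(2)[OF lim1]) (simp add: I_def)
  then have good: "\<forall>\<^sub>F L in at_top. jump_box \<xi> L \<and> 1 \<le> L \<and> lattice_sum \<xi> L 1 \<le> I * L ^ CARD('d)"
    using eventually_jump_box eventually_ge_at_top[of 1]
  proof eventually_elim
    case (elim L)
    then have "L ^ CARD('d) > 0" by simp
    then show ?case using elim by (simp add: divide_less_eq less_imp_le)
  qed
  have I0: "I \<ge> 0" unfolding I_def using fw_pos by (intro add_nonneg_nonneg integral_nonneg_AE) (auto simp: less_imp_le)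
  have fin1: "sum fw G \<le> lattice_sum \<xi> L 1" if "jump_box \<xi> L" "finite G" "G \<subseteq> dual_lattice L" for L G
  proof -
    interpret jump_box \<xi> L by fact
    show ?thesis using finite_sum_le_infsum[OF summable_fw[of 0] that(2,3)] fw_pos
      by (simp add: lattice_sum_def fw_def[symmetric] less_imp_le)
  qed
  have disp: "fw k = exp (- dispersion \<xi> k)" for k by (simp add: exp_dispersion)
  define C where "C = (1 / (1 - s)) * I + (1 / a) * (1 + 2 / (1 - \<eta> / real CARD('d))) ^ CARD('d)"
  have "\<forall>\<^sub>F L in at_top. \<forall>R. (\<Sum>l=1..R. lattice_sum \<xi> L l - 1) \<le> C * L ^ CARD('d)"
    using good
  proof eventually_elim
    case (elim L)
    have L1: "L \<ge> 1" using elim by simp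
    show ?case
    proof (intro allI sum_lattice_sum_le)
      show "jump_box \<xi> L" using elim by simp
      fix R and G :: "(real ^ 'd) set" assume G: "finite G" "G \<subseteq> dual_lattice L - {0}"
      let ?G1 = "{k \<in> G. \<delta> \<le> norm k}" and ?G2 = "{k \<in> G. norm k < \<delta>}"
      have k1: "(\<Sum>l=1..R. fw k ^ l) \<le> (1 / (1 - s)) * fw k" if "k \<in> ?G1" for k
      proof -
        have "fw k \<le> s" using s(3) that by simp
        then have "(\<Sum>l=1..R. fw k ^ l) \<le> fw k / (1 - fw k)" using s fw_pos by (intro sum_powers_le) auto
        also have "\<dots> \<le> fw k / (1 - s)" using \<open>fw k \<le> s\<close> s fw_pos[of k] by (intro divide_left_mono) auto
        finally show ?thesis by simp
      qed
      have k2: "(\<Sum>l=1..R. fw k ^ l) \<le> (1 / a) * norm k powr (- \<eta>)" if "k \<in> ?G2" for k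
      proof -
        have k0: "k \<noteq> 0" and kd: "norm k < \<delta>" using that G by auto
        have "0 < a * norm k powr \<eta>" using a(1) k0 by simp
        also have le: "\<dots> \<le> dispersion \<xi> k" using a(6)[OF kd] .
        finally have d0: "0 < dispersion \<xi> k" .
        have "(\<Sum>l=1..R. fw k ^ l) \<le> fw k / (1 - fw k)" using fw_pos fw_less_1[OF k0] by (intro sum_powers_le)
        also have "\<dots> \<le> 1 / dispersion \<xi> k"
        proof -
          \<comment> \<open>From \<open>1 + x \<le> exp x\<close>: dividing gives
            \<open>exp (- x) / (1 - exp (- x)) \<le> 1 / x\<close>, the bound on the geometric
            series by the inverse dispersion.\<close>
          have "dispersion \<xi> k * exp (- dispersion \<xi> k) \<le> 1 - exp (- dispersion \<xi> k)"
          proof -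
            have "(1 + dispersion \<xi> k) * exp (- dispersion \<xi> k) \<le> exp (dispersion \<xi> k) * exp (- dispersion \<xi> k)"
              by (intro mult_right_mono exp_ge_add_one_self) simp
            then show ?thesis by (simp add: exp_minus algebra_simps)
          qed
          then show ?thesis using d0 fw_less_1[OF k0] unfolding disp by (simp add: divide_simps mult.commute)
        qed
        also have "\<dots> \<le> 1 / (a * norm k powr \<eta>)"
          using le d0 a(1) k0 by (intro divide_left_mono) auto
        finally show ?thesis by (simp add: powr_minus divide_simps)
      qed
      have "(\<Sum>k\<in>G. \<Sum>l=1..R. fw k ^ l) = (\<Sum>k\<in>?G1. \<Sum>l=1..R. fw k ^ l) + (\<Sum>k\<in>?G2. \<Sum>l=1..R. fw k ^ l)"
        using G by (subst sum.union_disjoint[symmetric]) (auto intro!: sum.cong)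
      also have "\<dots> \<le> (\<Sum>k\<in>?G1. (1 / (1 - s)) * fw k) + (\<Sum>k\<in>?G2. (1 / a) * norm k powr (- \<eta>))"
        by (intro add_mono sum_mono k1 k2)
      also have "\<dots> = (1 / (1 - s)) * sum fw ?G1 + (1 / a) * (\<Sum>k\<in>?G2. norm k powr (- \<eta>))"
        by (simp only: sum_distrib_left)
      also have "\<dots> \<le> (1 / (1 - s)) * (I * L ^ CARD('d)) + (1 / a) * ((1 + 2 / (1 - \<eta> / real CARD('d))) ^ CARD('d) * L ^ CARD('d))"
      proof (intro add_mono mult_left_mono)
        have "?G1 \<subseteq> dual_lattice L" using G by auto
        then show "sum fw ?G1 \<le> I * L ^ CARD('d)"
          using fin1[of L ?G1] elim G(1) by (auto intro: order_trans)
        show "(\<Sum>k\<in>?G2. norm k powr (- \<eta>)) \<le> (1 + 2 / (1 - \<eta> / real CARD('d))) ^ CARD('d) * L ^ CARD('d)"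
          by (rule dual_lattice_powr_sum_le[OF a(2,3) L1]) (use G a(5) in auto)
      qed (use s a in auto)
      also have "\<dots> = C * L ^ CARD('d)" by (simp add: C_def algebra_simps)
      finally show "(\<Sum>k\<in>G. \<Sum>l=1..R. fw k ^ l) \<le> C * L ^ CARD('d)" .
    qed auto
  qed
  then show "\<exists>C. \<forall>\<^sub>F L in at_top. \<forall>R. (\<Sum>l=1..R. lattice_sum \<xi> L l - 1) \<le> C * L ^ CARD('d)" ..
  \<comment> \<open>Small nonzero modes decay at the rate \<open>a\<close>, those beyond \<delta> at
    the rate \<open>- ln s\<close>; the minimum serves both because \<open>L powr (- \<eta>)\<close>
    is at most 1.\<close>
  define c where "c = min a (- ln s)"
  have c: "0 < c" using a(1) s by (simp add: c_def)
  have "\<forall>\<^sub>F L in at_top. \<forall>l\<ge>1. lattice_sum \<xi> L l - 1 \<le> I * L ^ CARD('d) * exp (- (c * L powr (- \<eta>)) * real (l - 1))"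
    using good
  proof eventually_elim
    case (elim L)
    have L1: "L \<ge> 1" using elim by simp
    let ?q = "exp (- (c * L powr (- \<eta>)))"
    have q: "fw k \<le> ?q" if k: "k \<in> dual_lattice L" "k \<noteq> 0" for k
    proof (cases "norm k < \<delta>")
      case True
      obtain z where z: "z \<in> int_lattice" "k = (1 / L) *\<^sub>R z" using k by (auto simp: dual_lattice_def)
      have "z \<noteq> 0" using k z by auto
      then obtain i where i: "z $ i \<noteq> 0" by (auto simp: vec_eq_iff)
      obtain n where n: "z $ i = of_int n" using z by (auto simp: int_lattice_def elim: Ints_cases)
      have "1 \<le> \<bar>z $ i\<bar>" using i n by simp
      also have "\<dots> \<le> norm z" by (rule component_le_norm_cart)
      finally have "1 / L \<le> norm k" using z L1 by (simp add: divide_right_mono)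
      then have "(1 / L) powr \<eta> \<le> norm k powr \<eta>" using L1 a(2) by (intro powr_mono2) auto
      moreover have "(1 / L) powr \<eta> = L powr (- \<eta>)" using L1 by (simp add: powr_divide powr_minus_divide)
      ultimately have "L powr (- \<eta>) \<le> norm k powr \<eta>" by simp
      then have "c * L powr (- \<eta>) \<le> a * norm k powr \<eta>" using c a(1) by (intro mult_mono) (auto simp: c_def)
      also have "\<dots> \<le> dispersion \<xi> k" by (rule a(6)[OF True])
      finally show ?thesis unfolding disp by simp
    next
      case False
      have "L powr (- \<eta>) \<le> L powr 0" using L1 a(2) by (intro powr_mono) auto
      then have "c * L powr (- \<eta>) \<le> c * 1" using c L1 by (intro mult_left_mono) auto
      also have "\<dots> \<le> - ln s" by (simp add: c_def)
      finally have "ln s \<le> - (c * L powr (- \<eta>))" by simp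
      then have "s \<le> ?q" using s(1) by (metis exp_le_cancel_iff exp_ln)
      then show ?thesis using s(3)[of k] False by simp
    qed
    show ?case
    proof (intro allI impI)
      fix l :: nat assume l: "l \<ge> 1"
      have "(\<Sum>l\<in>{l}. lattice_sum \<xi> L l - 1) \<le> I * L ^ CARD('d) * exp (- (c * L powr (- \<eta>)) * real (l - 1))"
      proof (rule sum_lattice_sum_le)
        fix G :: "(real ^ 'd) set" assume G: "finite G" "G \<subseteq> dual_lattice L - {0}"
        \<comment> \<open>One factor \<open>fw k\<close> is kept in order to sum over the modes;
          only the other \<open>l - 1\<close> factors are estimated by the gap.\<close>
        have "(\<Sum>k\<in>G. \<Sum>l\<in>{l}. fw k ^ l) = (\<Sum>k\<in>G. fw k * fw k ^ (l - 1))"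
          using l by (simp add: power_Suc[symmetric] del: power_Suc)
        also have "\<dots> \<le> (\<Sum>k\<in>G. fw k * ?q ^ (l - 1))"
          using G q fw_pos by (intro sum_mono mult_left_mono power_mono) (auto simp: less_imp_le)
        also have "\<dots> = sum fw G * ?q ^ (l - 1)" by (simp add: sum_distrib_right)
        also have "\<dots> \<le> I * L ^ CARD('d) * ?q ^ (l - 1)"
        proof (rule mult_right_mono)
          have "G \<subseteq> dual_lattice L" using G by auto
          then show "sum fw G \<le> I * L ^ CARD('d)" using fin1[of L G] G(1) elim by (auto intro: order_trans)
        qed simp
        also have "?q ^ (l - 1) = exp (- (c * L powr (- \<eta>)) * real (l - 1))"
          by (simp add: exp_of_nat_mult[symmetric] mult.commute)
        finally show "(\<Sum>k\<in>G. \<Sum>l\<in>{l}. fw k ^ l) \<le> I * L ^ CARD('d) * exp (- (c * L powr (- \<eta>)) * real (l - 1))" .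
      qed (use elim l in auto)
      then show "lattice_sum \<xi> L l - 1 \<le> I * L ^ CARD('d) * exp (- (c * L powr (- \<eta>)) * real (l - 1))" by simp
    qed
  qed
  then show "\<exists>C c \<eta>. 0 < c \<and> 0 < \<eta> \<and> \<eta> < real CARD('d) \<and>
      (\<forall>\<^sub>F L in at_top. \<forall>l\<ge>1. lattice_sum \<xi> L l - 1 \<le> C * L ^ CARD('d) * exp (- (c * L powr (- \<eta>)) * real (l - 1)))"
    using c a(2,3) by (rule_tac exI[of _ I], rule_tac exI[of _ c], rule_tac exI[of _ \<eta>]) auto
qed

end

section \<open>Asymptotics of cycle weights\<close>

lemma cyc_coeff_scale: "cyc_coeff (\<lambda>l. c l * z ^ l) n = cyc_coeff c n * z ^ n"
proof (induction n rule: less_induct)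
  case (less n)
  show ?case
  proof (cases "n = 0")
    case False
    have "real n * cyc_coeff (\<lambda>l. c l * z ^ l) n = (\<Sum>l=1..n. (c l * z ^ l) * (cyc_coeff c (n - l) * z ^ (n - l)))"
      unfolding cyc_coeff_rec by (intro sum.cong refl arg_cong2[where f = "(*)"] less) auto
    also have "\<dots> = (\<Sum>l=1..n. (c l * cyc_coeff c (n - l)) * z ^ n)"
    proof (intro sum.cong refl)
      fix l assume "l \<in> {1..n}"
      then have "z ^ n = z ^ l * z ^ (n - l)" by (simp add: power_add[symmetric])
      then show "(c l * z ^ l) * (cyc_coeff c (n - l) * z ^ (n - l)) = (c l * cyc_coeff c (n - l)) * z ^ n" by simp
    qed
    also have "\<dots> = real n * (cyc_coeff c n * z ^ n)"
      unfolding sum_distrib_right[symmetric] cyc_coeff_rec[symmetric] by (rule mult.assoc)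
    finally show ?thesis using False by simp
  qed simp
qed

text \<open>The left side is the contribution of the permutations with one cycle, the term
  \<open>l = n\<close> of the recursion.\<close>

lemma cyc_coeff_ge_single:
  assumes nn: "\<And>l. l \<ge> 1 \<Longrightarrow> 0 \<le> c l" and n: "n \<ge> 1"
  shows "c n / real n \<le> cyc_coeff c n"
proof -
  have "c n * cyc_coeff c (n - n) \<le> (\<Sum>l=1..n. c l * cyc_coeff c (n - l))"
    by (rule member_le_sum) (use n nn in \<open>auto intro!: mult_nonneg_nonneg cyc_coeff_nonneg\<close>)
  then show ?thesis using n unfolding cyc_coeff_rec[symmetric] by (simp add: divide_le_eq mult.commute)
qed

text \<open>Divided by the exponential, the coefficients truncated at \<open>N\<close> form a
  probability distribution whose mean is at most the sum of the \<open>c l\<close>: it is the total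
  size of independent Poisson numbers of cycles. Markov's inequality bounds the part above
  \<open>N\<close>.\<close>

lemma sum_cyc_coeff_markov:
  assumes nn: "\<And>l. l \<ge> 1 \<Longrightarrow> 0 \<le> c l" and N: "N \<ge> 1"
  shows "exp (\<Sum>l=1..N. c l / l) * (1 - (\<Sum>l=1..N. c l) / N) \<le> (\<Sum>n=0..N. cyc_coeff c n)"
proof -
  let ?h = "cyc_coeff (\<lambda>l. if l \<le> N then c l else 0)"
  define E where "E = exp (\<Sum>l=1..N. c l / l)"
  define S where "S = (\<Sum>l=1..N. c l)"
  have h0: "0 \<le> ?h n" for n by (rule cyc_coeff_nonneg) (use nn in auto)
  have sm: "?h sums E" using cyc_coeff_trunc_sums[where \<theta> = c and y = 1 and M = N] nn by (simp add: E_def)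
  have part: "sum ?h F \<le> E" if "finite F" for F
    using sum_le_suminf[of ?h F] sm that h0 by (simp add: sums_iff)
  have S0: "0 \<le> S" unfolding S_def by (intro sum_nonneg) (use nn in auto)
  \<comment> \<open>The recursion expresses \<open>n * ?h n\<close> as a convolution, so its partial
    sums are bounded by the mean times the total mass. Partial sums avoid a separate proof that the
    mean exists.\<close>
  have mean: "(\<Sum>n=1..R. real n * ?h n) \<le> S * E" for R
  proof -
    have "(\<Sum>n=1..R. real n * ?h n) = (\<Sum>n=1..R. \<Sum>l=1..n. (if l \<le> N then c l else 0) * ?h (n - l))"
      unfolding cyc_coeff_rec ..
    also have "\<dots> \<le> (\<Sum>n=1..R. \<Sum>l=1..N. c l * (if l \<le> n then ?h (n - l) else 0))"
    proof (rule sum_mono)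
      fix n
      have "(\<Sum>l=1..n. (if l \<le> N then c l else 0) * ?h (n - l)) = (\<Sum>l\<in>{1..n} \<inter> {1..N}. c l * (if l \<le> n then ?h (n - l) else 0))"
        by (intro sum.mono_neutral_cong_right) auto
      also have "\<dots> \<le> (\<Sum>l=1..N. c l * (if l \<le> n then ?h (n - l) else 0))"
        by (intro sum_mono2) (use nn h0 in auto)
      finally show "(\<Sum>l=1..n. (if l \<le> N then c l else 0) * ?h (n - l)) \<le> (\<Sum>l=1..N. c l * (if l \<le> n then ?h (n - l) else 0))" .
    qed
    also have "\<dots> = (\<Sum>l=1..N. c l * (\<Sum>n=1..R. if l \<le> n then ?h (n - l) else 0))"
      by (subst sum.swap) (simp add: sum_distrib_left)
    also have "\<dots> \<le> (\<Sum>l=1..N. c l * E)"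
    proof (intro sum_mono mult_left_mono)
      fix l assume l: "l \<in> {1..N}"
      have "(\<Sum>n=1..R. if l \<le> n then ?h (n - l) else 0) = (\<Sum>n\<in>{l..R}. ?h (n - l))"
        using l by (intro sum.mono_neutral_cong_right) auto
      also have "\<dots> = (\<Sum>m\<in>(\<lambda>n. n - l) ` {l..R}. ?h m)"
        by (subst sum.reindex) (auto simp: inj_on_def)
      also have "\<dots> \<le> E" by (rule part) simp
      finally show "(\<Sum>n=1..R. if l \<le> n then ?h (n - l) else 0) \<le> E" .
    qed (use nn in auto)
    finally show ?thesis by (simp add: S_def sum_distrib_right)
  qed
  have tail: "sum ?h {..<R} \<le> (\<Sum>n=0..N. ?h n) + S * E / N" for R
  proof -
    have "sum ?h {..<R} \<le> sum ?h ({0..N} \<union> {n \<in> {..<R}. N < n})" by (rule sum_mono2) (use h0 in auto)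
    also have "\<dots> = (\<Sum>n=0..N. ?h n) + (\<Sum>n | n \<in> {..<R} \<and> N < n. ?h n)" by (rule sum.union_disjoint) auto
    also have "(\<Sum>n | n \<in> {..<R} \<and> N < n. ?h n) \<le> (\<Sum>n | n \<in> {..<R} \<and> N < n. real n * ?h n / N)"
    proof (rule sum_mono)
      fix n assume n: "n \<in> {n. n \<in> {..<R} \<and> N < n}"
      then have "real N * ?h n \<le> real n * ?h n" by (intro mult_right_mono h0) simp
      then show "?h n \<le> real n * ?h n / N" using N by (simp add: field_simps)
    qed
    also have "\<dots> \<le> (\<Sum>n=1..R. real n * ?h n / N)" by (intro sum_mono2) (use h0 in auto)
    also have "\<dots> \<le> S * E / N" unfolding sum_divide_distrib[symmetric] by (intro divide_right_mono mean) simp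
    finally show ?thesis by simp
  qed
  have "E \<le> (\<Sum>n=0..N. ?h n) + S * E / N"
    using sm tail unfolding sums_def by (intro LIMSEQ_le_const2) auto
  also have "(\<Sum>n=0..N. ?h n) = (\<Sum>n=0..N. cyc_coeff c n)" by (intro sum.cong refl cyc_coeff_cong) auto
  finally have "E * (1 - S / N) \<le> (\<Sum>n=0..N. cyc_coeff c n)" by (simp add: algebra_simps)
  then show ?thesis unfolding E_def S_def .
qed

lemma exp_minus_le:
  fixes t :: real assumes "t \<ge> 0" "l \<ge> 1" "l \<le> K"
  shows "(exp (- (t * real l)) - 1) / real l \<le> - t + t\<^sup>2 * real K / 2"
proof -
  define x where "x = t * real l"
  have x: "x \<ge> 0" using assms by (simp add: x_def)
  have "exp (- x) \<le> 1 - x + x\<^sup>2 / 2"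
  proof -
    \<comment> \<open>The product equals \<open>1 + x ^ 4 / 4\<close>, so the quadratic polynomial
      for \<open>exp (- x)\<close> bounds it from above once the one for \<open>exp x\<close> bounds
      that from below.\<close>
    have "1 \<le> (1 - x + x\<^sup>2 / 2) * (1 + x + x\<^sup>2 / 2)" using x by (simp add: algebra_simps power2_eq_square)
    also have "\<dots> \<le> (1 - x + x\<^sup>2 / 2) * exp x"
    proof (rule mult_left_mono)
      show "1 + x + x\<^sup>2 / 2 \<le> exp x" using exp_lower_Taylor_quadratic[OF x] .
      have "0 \<le> (1 - x)\<^sup>2 + 1" by simp
      then show "0 \<le> 1 - x + x\<^sup>2 / 2" by (simp add: power2_eq_square algebra_simps)
    qed
    finally show ?thesis by (simp add: exp_minus field_simps)
  qed
  then have "exp (- x) - 1 \<le> real l * (- t + t\<^sup>2 * real l / 2)" by (simp add: x_def power2_eq_square algebra_simps)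
  then have "(exp (- x) - 1) / real l \<le> - t + t\<^sup>2 * real l / 2" using assms by (simp add: divide_le_eq mult.commute)
  also have "\<dots> \<le> - t + t\<^sup>2 * real K / 2" using assms by (simp add: mult_left_mono)
  finally show ?thesis by (simp add: x_def)
qed

text \<open>The exponent of the Chernoff bound: the linear term is the expected number of points in
  short cycles, and since only \<open>l \<le> K\<close> is tilted, the quadratic error carries the
  factor \<open>K\<close>.\<close>

lemma sum_tilted_le:
  assumes nn: "\<And>l. l \<ge> 1 \<Longrightarrow> 0 \<le> c l" and t: "t \<ge> 0" and K: "K \<le> N"
  shows "(\<Sum>l=1..N. (if l \<le> K then c l * exp (- (t * real l)) else c l) / real l)
    \<le> (\<Sum>l=1..N. c l / real l) + (- t + t\<^sup>2 * real K / 2) * (\<Sum>l=1..K. c l)"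
proof -
  have "(\<Sum>l=1..N. (if l \<le> K then c l * exp (- (t * real l)) else c l) / real l) \<le>
    (\<Sum>l=1..N. c l / real l + (if l \<le> K then (- t + t\<^sup>2 * real K / 2) * c l else 0))"
  proof (rule sum_mono)
    fix l assume l: "l \<in> {1..N}"
    show "(if l \<le> K then c l * exp (- (t * real l)) else c l) / real l \<le> c l / real l + (if l \<le> K then (- t + t\<^sup>2 * real K / 2) * c l else 0)"
    proof (cases "l \<le> K")
      case True
      have "c l * ((exp (- (t * real l)) - 1) / real l) \<le> c l * (- t + t\<^sup>2 * real K / 2)"
        using l nn True by (intro mult_left_mono exp_minus_le t) auto
      then show ?thesis using True by (simp add: right_diff_distrib diff_divide_distrib mult.commute)
    qed simp
  qed
  also have "\<dots> = (\<Sum>l=1..N. c l / real l) + (\<Sum>l=1..N. if l \<le> K then (- t + t\<^sup>2 * real K / 2) * c l else 0)"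
    by (rule sum.distrib)
  also have "(\<Sum>l=1..N. if l \<le> K then (- t + t\<^sup>2 * real K / 2) * c l else 0) = (\<Sum>l=1..K. (- t + t\<^sup>2 * real K / 2) * c l)"
    using K by (intro sum.mono_neutral_cong_right) auto
  finally show ?thesis by (simp add: sum_distrib_left)
qed

text \<open>A Chernoff bound with \<open>y = exp (- t)\<close>. Lengths above \<open>K\<close> are
  left undamped, which loses nothing that is used later and keeps the quadratic error controlled by
  \<open>K\<close>.\<close>

lemma cyc_coeff_lower_tail:
  assumes nn: "\<And>l. l \<ge> 1 \<Longrightarrow> 0 \<le> c l" and t: "t \<ge> 0" and K: "K \<le> N" and F: "F \<subseteq> {..N}" "\<And>n. n \<in> F \<Longrightarrow> real n \<le> x"
  shows "(\<Sum>n\<in>F. cyc_coeff c n) \<le> exp (t * x + (\<Sum>l=1..N. c l / real l) + (- t + t\<^sup>2 * real K / 2) * (\<Sum>l=1..K. c l))"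
proof -
  let ?y = "exp (- t)"
  have yl: "?y ^ l = exp (- (t * real l))" for l by (simp add: exp_of_nat_mult[symmetric] mult.commute)
  have "(\<Sum>n\<in>F. cyc_coeff c n) \<le> (\<Sum>n\<in>F. exp (t * x) * (cyc_coeff c n * ?y ^ n))"
  proof (rule sum_mono)
    fix n assume "n \<in> F"
    then have "t * real n \<le> t * x" using F t by (intro mult_left_mono) auto
    then have "1 \<le> exp (t * x + - (t * real n))" by simp
    then have "1 * cyc_coeff c n \<le> exp (t * x + - (t * real n)) * cyc_coeff c n"
      by (intro mult_right_mono cyc_coeff_nonneg nn)
    then show "cyc_coeff c n \<le> exp (t * x) * (cyc_coeff c n * ?y ^ n)" unfolding yl exp_add by (simp add: mult_ac)
  qed
  also have "\<dots> = exp (t * x) * (\<Sum>n\<in>F. cyc_coeff c n * ?y ^ n)" by (simp add: sum_distrib_left)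
  also have "\<dots> \<le> exp (t * x) * exp (\<Sum>l=1..N. c l * ?y ^ l / l)"
    by (intro mult_left_mono sum_cyc_coeff_le_exp nn F) auto
  also have "(\<Sum>l=1..N. c l * ?y ^ l / l) \<le> (\<Sum>l=1..N. (if l \<le> K then c l * exp (- (t * real l)) else c l) / real l)"
  proof (rule sum_mono)
    fix l assume l: "l \<in> {1..N}"
    have "c l * exp (- (t * real l)) \<le> c l" using nn[of l] l t by (simp add: mult_left_le)
    then show "c l * ?y ^ l / l \<le> (if l \<le> K then c l * exp (- (t * real l)) else c l) / real l"
      unfolding yl by (simp add: divide_right_mono)
  qed
  also have "\<dots> \<le> (\<Sum>l=1..N. c l / real l) + (- t + t\<^sup>2 * real K / 2) * (\<Sum>l=1..K. c l)"
    by (rule sum_tilted_le[OF nn t K])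
  finally show ?thesis by (simp add: exp_add mult.assoc)
qed

lemma exp_minus_1_le: "(exp (x::real) - 1) \<le> x * exp x" if "x \<ge> 0"
proof -
  have "(1 - x) * exp x \<le> exp (- x) * exp x"
    using exp_ge_add_one_self[of "- x"] by (intro mult_right_mono) auto
  then show ?thesis by (simp add: exp_minus algebra_simps)
qed

text \<open>An upper tilt. Up to the cutoff \<open>y\<close> the increment is linearised, at the
  cost of \<open>exp (t * y)\<close>; beyond it only the bound \<open>B\<close> on
  \<open>c l / l\<close> is available. The application takes \<open>t\<close> so small that
  \<open>t * y\<close> vanishes although \<open>t * N\<close> does not.\<close>

lemma sum_exp_tilt_le:
  assumes nn: "\<And>l. l \<ge> 1 \<Longrightarrow> 0 \<le> c l" and t: "t \<ge> 0" and M: "M \<le> N"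
    and big: "\<And>l. l \<ge> 1 \<Longrightarrow> y < real l \<Longrightarrow> l \<le> N \<Longrightarrow> c l / real l \<le> B" and B: "B \<ge> 0"
  shows "(\<Sum>l=1..M. c l * exp (t * real l) / real l) \<le> (\<Sum>l=1..N. c l / real l) + t * exp (t * y) * (\<Sum>l=1..N. c l) + real N * B * exp (t * real M)"
proof -
  have "(\<Sum>l=1..M. c l * exp (t * real l) / real l) \<le> (\<Sum>l=1..M. c l / real l + t * exp (t * y) * c l + B * exp (t * real M))"
  proof (rule sum_mono)
    fix l assume l: "l \<in> {1..M}"
    have c0: "0 \<le> c l" using nn l by simp
    show "c l * exp (t * real l) / real l \<le> c l / real l + t * exp (t * y) * c l + B * exp (t * real M)"
    proof (cases "y < real l")
      case True
      have "c l * exp (t * real l) / real l = (c l / real l) * exp (t * real l)" by simp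
      also have "\<dots> \<le> B * exp (t * real M)"
        using big[of l] True l M t B c0 by (intro mult_mono) (auto intro: mult_left_mono)
      finally show ?thesis using c0 t by (simp add: add_increasing)
    next
      case False
      have "c l * exp (t * real l) / real l - c l / real l = c l * ((exp (t * real l) - 1) / real l)"
        by (simp add: right_diff_distrib diff_divide_distrib)
      also have "\<dots> \<le> c l * (t * exp (t * y))"
      proof (rule mult_left_mono[OF _ c0])
        have "(exp (t * real l) - 1) / real l \<le> (t * real l * exp (t * real l)) / real l"
          using t by (intro divide_right_mono exp_minus_1_le) auto
        also have "\<dots> = t * exp (t * real l)" using l by simp
        also have "\<dots> \<le> t * exp (t * y)" using False t by (intro mult_left_mono) (auto intro: mult_left_mono)
        finally show "(exp (t * real l) - 1) / real l \<le> t * exp (t * y)" .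
      qed
      finally have "c l * exp (t * real l) / real l \<le> c l / real l + t * exp (t * y) * c l" by (simp add: mult_ac)
      moreover have "0 \<le> B * exp (t * real M)" using B by simp
      ultimately show ?thesis by linarith
    qed
  qed
  also have "\<dots> = (\<Sum>l=1..M. c l / real l) + t * exp (t * y) * (\<Sum>l=1..M. c l) + real M * (B * exp (t * real M))"
    by (simp add: sum.distrib sum_distrib_left)
  also have "\<dots> \<le> (\<Sum>l=1..N. c l / real l) + t * exp (t * y) * (\<Sum>l=1..N. c l) + real N * (B * exp (t * real M))"
    using nn M t B by (intro add_mono mult_left_mono mult_right_mono sum_mono2) auto
  finally show ?thesis by (simp add: mult.assoc)
qed

lemma powr_small: "\<gamma> > 0 \<Longrightarrow> e > 0 \<Longrightarrow> \<exists>K\<ge>1. \<forall>l>K. real l powr (- \<gamma>) * C \<le> (e::real)"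
proof -
  assume g: "\<gamma> > 0" "e > 0"
  have "(\<lambda>l. real l powr (- \<gamma>) * C) \<longlonglongrightarrow> 0 * C"
    by (intro tendsto_mult_right tendsto_neg_powr filterlim_real_sequentially) (use g in simp)
  then have "\<forall>\<^sub>F l in sequentially. real l powr (- \<gamma>) * C < e" using g by (intro order_tendstoD(2)) auto
  then obtain K where "\<And>l. l \<ge> K \<Longrightarrow> real l powr (- \<gamma>) * C < e" unfolding eventually_sequentially by auto
  then show ?thesis by (intro exI[of _ "max K 1"]) (auto intro: less_imp_le)
qed

text \<open>The decay of \<open>l powr - \<gamma>\<close> makes the tails uniformly small although only the plain sums of
  \<open>v N\<close> are controlled.\<close>

lemma weighted_mean_tendsto:
  fixes v :: "nat \<Rightarrow> nat \<Rightarrow> real" and J :: "nat \<Rightarrow> real" and \<gamma> C z :: real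
  assumes g: "\<gamma> > 0" and v0: "\<And>N l. 0 \<le> v N l" and J0: "\<And>l. 0 \<le> J l"
    and v2: "\<And>l. l \<ge> 1 \<Longrightarrow> (\<lambda>N. v N l / N) \<longlonglongrightarrow> J l"
    and v3: "\<forall>\<^sub>F N in sequentially. (\<Sum>l=1..N. v N l) \<le> C * N"
    and sm: "summable (\<lambda>j. real (Suc j) powr (- \<gamma>) * J (Suc j))" and z: "0 \<le> z" "z \<le> 1"
  shows "(\<lambda>N. (\<Sum>l=1..N. real l powr (- \<gamma>) * v N l * z ^ l) / N) \<longlonglongrightarrow> (\<Sum>j. real (Suc j) powr (- \<gamma>) * J (Suc j) * z ^ Suc j)"
    and "summable (\<lambda>j. real (Suc j) powr (- \<gamma>) * J (Suc j) * z ^ Suc j)"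
proof -
  let ?f = "\<lambda>j. real (Suc j) powr (- \<gamma>) * J (Suc j) * z ^ Suc j"
  have zl: "0 \<le> z ^ l" "z ^ l \<le> 1" for l using z by (auto intro: power_le_one)
  show sf: "summable ?f"
  proof (rule summable_comparison_test'[OF sm, of 0])
    fix j show "norm (?f j) \<le> real (Suc j) powr (- \<gamma>) * J (Suc j)"
      using J0[of "Suc j"] zl[of "Suc j"] by (simp add: abs_mult mult_left_le del: power_Suc)
  qed
  show "(\<lambda>N. (\<Sum>l=1..N. real l powr (- \<gamma>) * v N l * z ^ l) / N) \<longlonglongrightarrow> suminf ?f"
  proof (rule LIMSEQ_I)
    fix e :: real assume e: "e > 0"
    obtain K1 where K1: "\<And>l. l > K1 \<Longrightarrow> real l powr (- \<gamma>) * C \<le> e / 4" using powr_small[of \<gamma> "e / 4" C] g e by auto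
    obtain K2 where K2: "\<And>n. n \<ge> K2 \<Longrightarrow> norm (sum ?f {..<n} - suminf ?f) < e / 4"
      using LIMSEQ_D[OF summable_LIMSEQ[OF sf], of "e / 4"] e by auto
    define K where "K = max K1 K2"
    have "(\<lambda>N. \<Sum>l=1..K. real l powr (- \<gamma>) * (v N l / N) * z ^ l) \<longlonglongrightarrow> (\<Sum>l=1..K. real l powr (- \<gamma>) * J l * z ^ l)"
      by (intro tendsto_sum tendsto_mult_left tendsto_mult_right v2) simp
    also have "(\<Sum>l=1..K. real l powr (- \<gamma>) * J l * z ^ l) = sum ?f {..<K}"
      by (rule sum.reindex_bij_witness[of _ Suc "\<lambda>l. l - 1"]) auto
    finally obtain N1 where N1: "\<And>N. N \<ge> N1 \<Longrightarrow> norm ((\<Sum>l=1..K. real l powr (- \<gamma>) * (v N l / N) * z ^ l) - sum ?f {..<K}) < e / 4"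
      using e by (meson LIMSEQ_D divide_pos_pos zero_less_numeral)
    obtain N2 where N2: "\<And>N. N \<ge> N2 \<Longrightarrow> (\<Sum>l=1..N. v N l) \<le> C * N" using v3 unfolding eventually_sequentially by auto
    show "\<exists>n0. \<forall>N\<ge>n0. norm ((\<Sum>l=1..N. real l powr (- \<gamma>) * v N l * z ^ l) / N - suminf ?f) < e"
    proof (intro exI[of _ "max (max N1 N2) (Suc K)"] allI impI)
      fix N assume N: "N \<ge> max (max N1 N2) (Suc K)"
      let ?t = "\<lambda>l. real l powr (- \<gamma>) * v N l * z ^ l"
      have Npos: "real N > 0" using N by simp
      have "sum ?t {1..N} = sum ?t {1..K} + sum ?t {Suc K..N}"
        using sum.ub_add_nat[of 1 K ?t "N - K"] N by simp
      then have split: "sum ?t {1..N} / N = (\<Sum>l=1..K. real l powr (- \<gamma>) * (v N l / N) * z ^ l) + sum ?t {Suc K..N} / N"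
        by (simp add: add_divide_distrib sum_divide_distrib)
      have t0: "0 \<le> sum ?t {Suc K..N}" using v0 zl by (intro sum_nonneg mult_nonneg_nonneg) auto
      have "sum ?t {Suc K..N} \<le> (\<Sum>l=Suc K..N. real (Suc K) powr (- \<gamma>) * v N l)"
      proof (rule sum_mono)
        fix l assume l: "l \<in> {Suc K..N}"
        have "real l powr (- \<gamma>) \<le> real (Suc K) powr (- \<gamma>)" using l g by (intro powr_mono2') auto
        then have "real l powr (- \<gamma>) * v N l * z ^ l \<le> real (Suc K) powr (- \<gamma>) * v N l * 1"
          using v0 zl by (intro mult_mono) auto
        then show "?t l \<le> real (Suc K) powr (- \<gamma>) * v N l" by simp
      qed
      also have "\<dots> = real (Suc K) powr (- \<gamma>) * (\<Sum>l=Suc K..N. v N l)" by (simp add: sum_distrib_left)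
      also have "\<dots> \<le> real (Suc K) powr (- \<gamma>) * (C * N)"
      proof (rule mult_left_mono)
        have "(\<Sum>l=Suc K..N. v N l) \<le> (\<Sum>l=1..N. v N l)" by (intro sum_mono2) (use v0 in auto)
        then show "(\<Sum>l=Suc K..N. v N l) \<le> C * N" using N2[of N] N by simp
      qed simp
      also have "\<dots> = (real (Suc K) powr (- \<gamma>) * C) * N" by simp
      also have "\<dots> \<le> e / 4 * N" using K1[of "Suc K"] by (intro mult_right_mono) (auto simp: K_def)
      finally have "sum ?t {Suc K..N} / N \<le> e / 4" using Npos by (simp add: divide_le_eq)
      moreover have "0 \<le> sum ?t {Suc K..N} / N" using t0 by simp
      moreover have "norm ((\<Sum>l=1..K. real l powr (- \<gamma>) * (v N l / N) * z ^ l) - sum ?f {..<K}) < e / 4" using N1 N by simp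
      moreover have "norm (sum ?f {..<K} - suminf ?f) < e / 4" using K2[of K] by (simp add: K_def)
      ultimately show "norm (sum ?t {1..N} / N - suminf ?f) < e" unfolding split real_norm_def by linarith
    qed
  qed
qed

text \<open>The abstract model: \<open>v N l\<close> stands for the sum over nonzero modes and
  \<open>J l\<close> for its limiting density per point. The last two bounds on \<open>v\<close> say
  that the total over all lengths is linear in N, and that beyond length
  \<open>N powr (1 - \<kappa>)\<close> the nonzero modes weigh no more than the zero mode.\<close>

locale cycle_weights =
  fixes \<gamma> C \<kappa> :: real and v :: "nat \<Rightarrow> nat \<Rightarrow> real" and J :: "nat \<Rightarrow> real"
  assumes g: "\<gamma> > 0" and kap: "\<kappa> > 0"
    and v0: "\<And>N l. 0 \<le> v N l"
    and v2: "\<And>l. l \<ge> 1 \<Longrightarrow> (\<lambda>N. v N l / N) \<longlonglongrightarrow> J l"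
    and v3: "\<forall>\<^sub>F N in sequentially. \<forall>R. (\<Sum>l=1..R. v N l) \<le> C * N"
    and v4: "\<forall>\<^sub>F N in sequentially. \<forall>l. real N powr (1 - \<kappa>) \<le> real l \<longrightarrow> v N l \<le> 1"
    and J0: "\<And>l. 0 \<le> J l"
begin

definition \<theta> :: "nat \<Rightarrow> nat \<Rightarrow> real" where "\<theta> N l = real l powr (- \<gamma>) * (1 + v N l)"
definition b :: "nat \<Rightarrow> nat \<Rightarrow> real" where "b N l = real l powr (- \<gamma>) * v N l"
definition a :: "nat \<Rightarrow> real" where "a l = real l powr (- \<gamma>)"

text \<open>The density of the nonzero modes at fugacity \<open>z\<close>, in units of the actual
  density. Thus \<open>r 1\<close> is the ratio of critical to actual density, and
  \<open>r 1 < 1\<close> is the supercritical case.\<close>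

definition r :: "real \<Rightarrow> real" where "r z = (\<Sum>j. real (Suc j) powr (- \<gamma>) * J (Suc j) * z ^ Suc j)"
definition rK :: "nat \<Rightarrow> real \<Rightarrow> real" where "rK K z = (\<Sum>l=1..K. real l powr (- \<gamma>) * J l * z ^ l)"

lemma a0: "0 \<le> a l" and b0: "0 \<le> b N l" and th0: "0 \<le> \<theta> N l" and th: "\<theta> N = (\<lambda>l. a l + b N l)"
  using v0[of N l] by (auto simp: a_def b_def \<theta>_def distrib_left)

lemma sum_J_le: "(\<Sum>l=1..R. J l) \<le> C"
proof (rule LIMSEQ_le_const2)
  show "(\<lambda>N. \<Sum>l=1..R. v N l / N) \<longlonglongrightarrow> (\<Sum>l=1..R. J l)" by (intro tendsto_sum v2) simp
  have "\<forall>\<^sub>F N in sequentially. (\<Sum>l=1..R. v N l / N) \<le> C"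
    using v3 eventually_gt_at_top[of 0]
  proof eventually_elim
    case (elim N)
    then show ?case by (simp add: sum_divide_distrib[symmetric] divide_le_eq)
  qed
  then show "\<exists>N. \<forall>n\<ge>N. (\<Sum>l=1..R. v n l / n) \<le> C" unfolding eventually_sequentially .
qed

lemma summable_J: "summable (\<lambda>j. J (Suc j))"
proof (rule summableI_nonneg_bounded)
  fix n
  have "(\<Sum>j<n. J (Suc j)) = (\<Sum>l=1..n. J l)"
    by (rule sum.reindex_bij_witness[of _ "\<lambda>l. l - 1" Suc]) auto
  then show "(\<Sum>j<n. J (Suc j)) \<le> C" using sum_J_le[of n] by simp
qed (rule J0)

lemma powr_le_1: "real l powr (- \<gamma>) \<le> 1"
proof (cases "l = 0")
  case False
  have "real l powr (- \<gamma>) \<le> real l powr 0" using False g by (intro powr_mono) auto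
  then show ?thesis using False by simp
qed simp

lemma summable_rc: "summable (\<lambda>j. real (Suc j) powr (- \<gamma>) * J (Suc j))"
proof (rule summable_comparison_test'[OF summable_J, of 0])
  fix j show "norm (real (Suc j) powr (- \<gamma>) * J (Suc j)) \<le> J (Suc j)"
    using J0[of "Suc j"] powr_le_1[of "Suc j"] by (simp add: abs_mult mult_right_le_one_le mult.commute)
qed

lemma v3': "\<forall>\<^sub>F N in sequentially. (\<Sum>l=1..N. v N l) \<le> C * N"
  using v3 by eventually_elim simp

lemma v3'': "\<forall>\<^sub>F N in sequentially. (\<Sum>l=1..N. 1 + v N l) \<le> (C + 1) * N"
  using v3' by eventually_elim (simp add: sum.distrib algebra_simps)

lemma v2'': "l \<ge> 1 \<Longrightarrow> (\<lambda>N. (1 + v N l) / N) \<longlonglongrightarrow> J l"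
  using tendsto_add[OF lim_1_over_n v2, of l] by (simp add: add_divide_distrib)

text \<open>Including the zero mode replaces \<open>v\<close> by \<open>1 + v\<close>, which has the
  same limits after division by N. Hence both means have one limit: before condensation the zero
  mode carries no macroscopic mass.\<close>

lemma
  assumes z: "0 \<le> z" "z \<le> 1"
  shows sum_b_tendsto: "(\<lambda>N. (\<Sum>l=1..N. b N l * z ^ l) / N) \<longlonglongrightarrow> r z"
    and sum_theta_tendsto: "(\<lambda>N. (\<Sum>l=1..N. \<theta> N l * z ^ l) / N) \<longlonglongrightarrow> r z"
    and summable_r: "summable (\<lambda>j. real (Suc j) powr (- \<gamma>) * J (Suc j) * z ^ Suc j)"
  using weighted_mean_tendsto[where v = v, OF g v0 J0 v2 v3' summable_rc z]
    weighted_mean_tendsto(1)[where v = "\<lambda>N l. 1 + v N l", OF g _ J0 v2'' v3'' summable_rc z] v0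
  by (simp_all add: b_def \<theta>_def r_def)

lemma
  shows sum_b_K_tendsto: "(\<lambda>N. (\<Sum>l=1..K. b N l * z ^ l) / N) \<longlonglongrightarrow> rK K z"
    and sum_theta_K_tendsto: "(\<lambda>N. (\<Sum>l=1..K. \<theta> N l * z ^ l) / N) \<longlonglongrightarrow> rK K z"
proof -
  have "(\<lambda>N. \<Sum>l=1..K. real l powr (- \<gamma>) * (v N l / N) * z ^ l) \<longlonglongrightarrow> rK K z"
    unfolding rK_def by (intro tendsto_sum tendsto_mult_left tendsto_mult_right v2) simp
  then show "(\<lambda>N. (\<Sum>l=1..K. b N l * z ^ l) / N) \<longlonglongrightarrow> rK K z" by (simp add: b_def sum_divide_distrib)
  have "(\<lambda>N. \<Sum>l=1..K. real l powr (- \<gamma>) * ((1 + v N l) / N) * z ^ l) \<longlonglongrightarrow> rK K z"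
    unfolding rK_def by (intro tendsto_sum tendsto_mult_left tendsto_mult_right v2'') simp
  then show "(\<lambda>N. (\<Sum>l=1..K. \<theta> N l * z ^ l) / N) \<longlonglongrightarrow> rK K z" by (simp add: \<theta>_def sum_divide_distrib)
qed

lemma rK_tendsto: "0 \<le> z \<Longrightarrow> z \<le> 1 \<Longrightarrow> (\<lambda>K. rK K z) \<longlonglongrightarrow> r z"
proof -
  assume z: "0 \<le> z" "z \<le> 1"
  have "rK K z = (\<Sum>j<K. real (Suc j) powr (- \<gamma>) * J (Suc j) * z ^ Suc j)" for K
    unfolding rK_def by (rule sum.reindex_bij_witness[of _ Suc "\<lambda>l. l - 1"]) auto
  then show ?thesis unfolding r_def using summable_LIMSEQ[OF summable_r[OF z]] by simp
qed

lemma rK_nonneg: "0 \<le> z \<Longrightarrow> 0 \<le> rK K z"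
  unfolding rK_def by (intro sum_nonneg mult_nonneg_nonneg J0) auto

text \<open>One zero-mode cycle of length \<open>m\<close> contributes
  \<open>m powr (- \<gamma> - 1)\<close>. This is where the polynomial cost of absorbing missing
  points comes from; no missing points cost nothing.\<close>

lemma cyc_coeff_a_ge: "1 \<le> N \<Longrightarrow> m \<le> N \<Longrightarrow> real N powr (- \<gamma> - 1) \<le> cyc_coeff a m"
proof (cases "m = 0")
  case True
  assume "1 \<le> N"
  then have "real N powr (- \<gamma> - 1) \<le> real N powr 0" using g by (intro powr_mono) auto
  then show ?thesis using True \<open>1 \<le> N\<close> by simp
next
  case False
  assume N: "1 \<le> N" "m \<le> N"
  have "real N powr (- \<gamma> - 1) \<le> real m powr (- \<gamma> - 1)" using False N g by (intro powr_mono2') auto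
  also have "\<dots> = a m / real m" using False by (simp add: a_def powr_diff)
  also have "\<dots> \<le> cyc_coeff a m" by (rule cyc_coeff_ge_single) (use False a0 in auto)
  finally show ?thesis .
qed

text \<open>Any number \<open>n\<close> of points in nonzero modes can be completed to N by
  zero-mode cycles at a cost uniform in \<open>n\<close>. The set \<open>F\<close> selects the range
  of \<open>n\<close> that is kept.\<close>

lemma cyc_coeff_theta_ge:
  assumes N: "1 \<le> N" and F: "F \<subseteq> {0..N}"
  shows "real N powr (- \<gamma> - 1) * (\<Sum>n\<in>F. cyc_coeff (b N) n) \<le> cyc_coeff (\<theta> N) N"
proof -
  have ca: "0 \<le> cyc_coeff a n" and cb: "0 \<le> cyc_coeff (b N) n" for n using a0 b0 by (auto intro: cyc_coeff_nonneg)
  have "real N powr (- \<gamma> - 1) * (\<Sum>n\<in>F. cyc_coeff (b N) n) \<le> (\<Sum>n\<in>F. cyc_coeff (b N) n * cyc_coeff a (N - n))"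
    unfolding sum_distrib_left
  proof (rule sum_mono)
    fix n
    have "real N powr (- \<gamma> - 1) * cyc_coeff (b N) n \<le> cyc_coeff a (N - n) * cyc_coeff (b N) n"
      by (intro mult_right_mono cyc_coeff_a_ge N cb) simp
    then show "real N powr (- \<gamma> - 1) * cyc_coeff (b N) n \<le> cyc_coeff (b N) n * cyc_coeff a (N - n)"
      by (simp only: mult.commute)
  qed
  also have "\<dots> \<le> (\<Sum>n=0..N. cyc_coeff (b N) n * cyc_coeff a (N - n))"
    by (intro sum_mono2) (use F ca cb in auto)
  also have "\<dots> = cyc_coeff (\<theta> N) N" unfolding th cyc_coeff_add[symmetric] by (simp add: add.commute)
  finally show ?thesis .
qed

text \<open>Here \<gamma> > 0 enters through the convergence of the sum of
  \<open>l powr (- \<gamma> - 1)\<close>: with and without the zero mode the exponential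
  normalisations differ by a bounded factor, uniformly in N and in the fugacity.\<close>

lemma sum_a_le: "\<exists>A. \<forall>N z. 0 \<le> z \<longrightarrow> z \<le> 1 \<longrightarrow> (\<Sum>l=1..N. a l * z ^ l / real l) \<le> A"
proof -
  have sm: "summable (\<lambda>l. real l powr (- \<gamma> - 1))" using g by (subst summable_real_powr_iff) auto
  have "(\<Sum>l=1..N. a l * z ^ l / real l) \<le> (\<Sum>l. real l powr (- \<gamma> - 1))" if z: "0 \<le> z" "z \<le> 1" for N z
  proof -
    have "(\<Sum>l=1..N. a l * z ^ l / real l) \<le> (\<Sum>l=1..N. real l powr (- \<gamma> - 1))"
    proof (rule sum_mono)
      fix l assume l: "l \<in> {1..N}"
      have "a l * z ^ l / real l \<le> a l * 1 / real l" using z a0 by (intro divide_right_mono mult_left_mono power_le_one) auto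
      also have "\<dots> = real l powr (- \<gamma> - 1)" using l by (simp add: a_def powr_diff)
      finally show "a l * z ^ l / real l \<le> real l powr (- \<gamma> - 1)" .
    qed
    also have "\<dots> \<le> (\<Sum>l. real l powr (- \<gamma> - 1))" by (intro sum_le_suminf sm) auto
    finally show ?thesis .
  qed
  then show ?thesis by blast
qed

text \<open>The logarithm of the normalisation of the ensemble with free particle number at fugacity
  \<open>z\<close>, truncated to lengths up to N.\<close>

definition Lam :: "nat \<Rightarrow> real \<Rightarrow> real" where "Lam N z = (\<Sum>l=1..N. \<theta> N l * z ^ l / real l)"
definition LamB :: "nat \<Rightarrow> real \<Rightarrow> real" where "LamB N z = (\<Sum>l=1..N. b N l * z ^ l / real l)"

lemma Lam_le: "\<exists>A. \<forall>N z. 0 \<le> z \<longrightarrow> z \<le> 1 \<longrightarrow> Lam N z \<le> LamB N z + A"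
proof -
  obtain A where A: "\<And>N z. 0 \<le> z \<Longrightarrow> z \<le> 1 \<Longrightarrow> (\<Sum>l=1..N. a l * z ^ l / real l) \<le> A" using sum_a_le by auto
  have "Lam N z = LamB N z + (\<Sum>l=1..N. a l * z ^ l / real l)" for N z
    unfolding Lam_def LamB_def th by (simp add: sum.distrib[symmetric] add_divide_distrib distrib_right add.commute)
  then show ?thesis using A by (intro exI[of _ A]) auto
qed

text \<open>All missing mass is put into one macroscopic cycle of the zero mode.\<close>

lemma cyc_coeff_theta_lower_sup:
  assumes rc: "r 1 < 1"
  shows "\<exists>c>0. \<forall>\<^sub>F N in sequentially. c * real N powr (- \<gamma> - 1) * exp (Lam N 1) \<le> cyc_coeff (\<theta> N) N"
proof -
  obtain A where A: "\<And>N z. 0 \<le> z \<Longrightarrow> z \<le> 1 \<Longrightarrow> Lam N z \<le> LamB N z + A" using Lam_le by auto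
  \<comment> \<open>\<open>exp (- A)\<close> pays for replacing \<open>LamB\<close> by
    \<open>Lam\<close>; \<open>(1 - r 1) / 2\<close> is what Markov's inequality leaves once the
    mean is below the midpoint of \<open>r 1\<close> and 1.\<close>
  define c where "c = exp (- A) * (1 - r 1) / 2"
  have c: "c > 0" using rc by (simp add: c_def)
  have "\<forall>\<^sub>F N in sequentially. (\<Sum>l=1..N. b N l * 1 ^ l) / N < (1 + r 1) / 2"
    using rc by (intro order_tendstoD(2)[OF sum_b_tendsto]) auto
  then have "\<forall>\<^sub>F N in sequentially. c * real N powr (- \<gamma> - 1) * exp (Lam N 1) \<le> cyc_coeff (\<theta> N) N"
    using eventually_ge_at_top[of 1]
  proof eventually_elim
    case (elim N)
    have "c * exp (Lam N 1) \<le> c * (exp (LamB N 1) * exp A)"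
      using A[of 1 N] c by (simp add: exp_add[symmetric])
    also have "\<dots> = exp (LamB N 1) * ((1 - r 1) / 2)" by (simp add: c_def exp_minus)
    also have "\<dots> \<le> exp (LamB N 1) * (1 - (\<Sum>l=1..N. b N l) / N)" using elim by (intro mult_left_mono) auto
    also have "\<dots> \<le> (\<Sum>n=0..N. cyc_coeff (b N) n)"
      using sum_cyc_coeff_markov[of "b N" N] b0 elim by (simp add: LamB_def)
    finally have "real N powr (- \<gamma> - 1) * (c * exp (Lam N 1)) \<le> real N powr (- \<gamma> - 1) * (\<Sum>n=0..N. cyc_coeff (b N) n)"
      by (intro mult_left_mono) auto
    also have "\<dots> \<le> cyc_coeff (\<theta> N) N" by (rule cyc_coeff_theta_ge) (use elim in auto)
    finally show ?case by (simp add: mult_ac)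
  qed
  then show ?thesis using c by blast
qed

lemma exp_small: "c > 0 \<Longrightarrow> (\<lambda>N. exp (- (c * real N))) \<longlonglongrightarrow> 0"
  by real_asymp

text \<open>At a fugacity with \<open>r z\<close> just below 1, Markov's inequality bounds the
  probability of more than N points in nonzero modes and a Chernoff bound that of fewer than
  \<open>(1 - \<delta>) * N\<close>. With positive probability at most \<open>\<delta> * N\<close>
  points are missing, and the zero mode supplies them at the fugacity cost
  \<open>z powr (\<delta> * N)\<close>.\<close>

lemma cyc_coeff_theta_lower_sub:
  assumes z: "0 < z" "z \<le> 1" and d: "0 < \<delta>" "\<delta> < 1" and rz: "1 - \<delta> < r z" "r z < 1"
  shows "\<exists>c>0. \<forall>\<^sub>F N in sequentially. c * real N powr (- \<gamma> - 1) * z powr (\<delta> * N) * exp (Lam N z) \<le> cyc_coeff (\<theta> N) N * z ^ N"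
proof -
  obtain A where A: "\<And>N z. 0 \<le> z \<Longrightarrow> z \<le> 1 \<Longrightarrow> Lam N z \<le> LamB N z + A" using Lam_le by auto
  \<comment> \<open>A quarter of the margin: one unit is lost in truncating at \<open>K\<close>, and
    the remaining three dominate the quadratic term of the Chernoff exponent.\<close>
  define \<epsilon> where "\<epsilon> = (r z - (1 - \<delta>)) / 4"
  have e: "\<epsilon> > 0" using rz by (simp add: \<epsilon>_def)
  have "\<forall>\<^sub>F K in sequentially. r z - \<epsilon> < rK K z"
    using rK_tendsto[of z] z e by (intro order_tendstoD(1)) auto
  then obtain K where K: "r z - \<epsilon> < rK K z" by (auto simp: eventually_sequentially)
  define B where "B = rK K z + 1"
  have B: "B > 0" using rK_nonneg[of z K] z by (simp add: B_def)
  \<comment> \<open>Chosen so that the quadratic term \<open>t\<^sup>2 * K / 2\<close> times a mass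
    below \<open>B * N\<close> is at most half of the unit
    \<open>t * \<epsilon> * N\<close>.\<close>
  define t where "t = \<epsilon> / (B * (real K + 1))"
  have t: "t > 0" using e B by (simp add: t_def)
  have tK: "t * real K * B \<le> \<epsilon>"
  proof -
    have "t * real K * B = \<epsilon> * (real K / (real K + 1))" using B by (simp add: t_def)
    also have "\<dots> \<le> \<epsilon> * 1" using e by (intro mult_left_mono) auto
    finally show ?thesis by simp
  qed
  \<comment> \<open>Markov's inequality leaves \<open>(1 - r z) / 2\<close>, the lower tail removes
    at most half of it, and \<open>exp (- A)\<close> accounts for the zero mode.\<close>
  define c where "c = exp (- A) * (1 - r z) / 4"
  have c: "c > 0" using rz by (simp add: c_def)
  have z': "0 \<le> z" "z \<le> 1" using z by auto
  have "\<forall>\<^sub>F N in sequentially. (\<Sum>l=1..N. b N l * z ^ l) / N < (1 + r z) / 2"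
    using rz by (intro order_tendstoD(2)[OF sum_b_tendsto[OF z']]) auto
  moreover have "\<forall>\<^sub>F N in sequentially. r z - \<epsilon> < (\<Sum>l=1..K. b N l * z ^ l) / N"
    by (rule order_tendstoD(1)[OF sum_b_K_tendsto]) (use K in auto)
  moreover have "\<forall>\<^sub>F N in sequentially. (\<Sum>l=1..K. b N l * z ^ l) / N < B"
    by (rule order_tendstoD(2)[OF sum_b_K_tendsto]) (simp add: B_def)
  moreover have "\<forall>\<^sub>F N in sequentially. exp (- (t * \<epsilon> * real N)) < (1 - r z) / 4"
    using exp_small[of "t * \<epsilon>"] rz t e by (intro order_tendstoD(2)) auto
  ultimately have "\<forall>\<^sub>F N in sequentially. c * real N powr (- \<gamma> - 1) * z powr (\<delta> * N) * exp (Lam N z) \<le> cyc_coeff (\<theta> N) N * z ^ N"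
    using eventually_ge_at_top[of "Suc K"]
  proof eventually_elim
    case (elim N)
    have N: "1 \<le> N" "K \<le> N" "real N > 0" using elim by auto
    let ?c = "\<lambda>l. b N l * z ^ l"
    have c0: "0 \<le> ?c l" for l using b0[of N l] z by simp
    define T where "T = (\<Sum>l=1..K. ?c l)"
    have T: "(r z - \<epsilon>) * N < T" "T < B * N" using elim N by (auto simp: T_def field_simps)
    have T0: "T \<ge> 0" unfolding T_def by (intro sum_nonneg c0)
    let ?lo = "{n \<in> {..N}. real n \<le> (1 - \<delta>) * N}" and ?hi = "{n \<in> {0..N}. (1 - \<delta>) * N < real n}"
    have "(\<Sum>n\<in>?lo. cyc_coeff ?c n) \<le> exp (t * ((1 - \<delta>) * N) + (\<Sum>l=1..N. ?c l / real l) + (- t + t\<^sup>2 * real K / 2) * T)"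
      unfolding T_def by (rule cyc_coeff_lower_tail) (use c0 t N in auto)
    also have "\<dots> \<le> exp (LamB N z - t * \<epsilon> * N)"
    proof -
      have "t\<^sup>2 * real K / 2 * T \<le> t\<^sup>2 * real K / 2 * (B * N)" using T t by (intro mult_left_mono) auto
      also have "\<dots> = t * (t * real K * B) * N / 2" by (simp add: power2_eq_square)
      also have "\<dots> \<le> t * \<epsilon> * N / 2" using tK t N by (intro divide_right_mono mult_right_mono mult_left_mono) auto
      finally have 1: "t\<^sup>2 * real K / 2 * T \<le> t * \<epsilon> * N / 2" .
      have "t * ((r z - \<epsilon>) * N) \<le> t * T" using T t by (intro mult_left_mono) auto
      moreover have rze: "r z - \<epsilon> = (1 - \<delta>) + 3 * \<epsilon>" by (simp add: \<epsilon>_def field_simps)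
      have "t * ((1 - \<delta>) * N) + 3 * (t * \<epsilon> * N) = t * ((r z - \<epsilon>) * N)" unfolding rze by (simp add: algebra_simps)
      ultimately have 2: "t * ((1 - \<delta>) * N) + 3 * (t * \<epsilon> * N) \<le> t * T" by linarith
      have 3: "0 \<le> t * \<epsilon> * N" using t e by simp
      have "t * ((1 - \<delta>) * N) + (\<Sum>l=1..N. ?c l / real l) + (- t + t\<^sup>2 * real K / 2) * T
        = LamB N z + (t * ((1 - \<delta>) * N) - t * T + t\<^sup>2 * real K / 2 * T)"
        by (simp add: LamB_def algebra_simps)
      also have "\<dots> \<le> LamB N z - t * \<epsilon> * N" using 1 2 3 by linarith
      finally show ?thesis by simp
    qed
    also have "\<dots> = exp (LamB N z) * exp (- (t * \<epsilon> * N))" by (simp add: exp_diff exp_minus divide_inverse)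
    also have "\<dots> \<le> exp (LamB N z) * ((1 - r z) / 4)" using elim by (intro mult_left_mono) auto
    finally have lo: "(\<Sum>n\<in>?lo. cyc_coeff ?c n) \<le> exp (LamB N z) * ((1 - r z) / 4)" .
    have "exp (LamB N z) * ((1 - r z) / 2) \<le> exp (LamB N z) * (1 - (\<Sum>l=1..N. ?c l) / N)"
      using elim by (intro mult_left_mono) auto
    also have "\<dots> \<le> (\<Sum>n=0..N. cyc_coeff ?c n)" unfolding LamB_def by (rule sum_cyc_coeff_markov[OF c0 N(1)])
    also have "\<dots> = (\<Sum>n\<in>?lo \<union> ?hi. cyc_coeff ?c n)" by (intro sum.cong) auto
    also have "\<dots> = (\<Sum>n\<in>?lo. cyc_coeff ?c n) + (\<Sum>n\<in>?hi. cyc_coeff ?c n)" by (intro sum.union_disjoint) auto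
    finally have hi: "exp (LamB N z) * ((1 - r z) / 4) \<le> (\<Sum>n\<in>?hi. cyc_coeff ?c n)" using lo by (simp add: field_simps)
    \<comment> \<open>At most \<open>\<delta> * N\<close> powers of \<open>z \<le> 1\<close> are
      missing between \<open>z ^ n\<close> and \<open>z ^ N\<close>.\<close>
    have up: "z powr (\<delta> * N) * cyc_coeff ?c n \<le> z ^ N * cyc_coeff (b N) n" if "n \<in> ?hi" for n
    proof -
      have n: "n \<le> N" "(1 - \<delta>) * N < real n" using that by auto
      have "z powr (\<delta> * N) \<le> z powr real (N - n)" using z n by (intro powr_mono') (auto simp: of_nat_diff algebra_simps)
      also have "\<dots> = z ^ (N - n)" using z by (simp add: powr_realpow)
      finally have "z powr (\<delta> * N) * z ^ n \<le> z ^ (N - n) * z ^ n" using z by (intro mult_right_mono) auto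
      also have "\<dots> = z ^ N" using n by (simp add: power_add[symmetric])
      finally have "(z powr (\<delta> * N) * z ^ n) * cyc_coeff (b N) n \<le> z ^ N * cyc_coeff (b N) n"
        by (intro mult_right_mono cyc_coeff_nonneg b0)
      then show ?thesis unfolding cyc_coeff_scale by (simp add: mult_ac)
    qed
    have "c * exp (Lam N z) \<le> c * (exp (LamB N z) * exp A)"
      using A[of z N] z c by (simp add: exp_add[symmetric])
    also have "\<dots> = exp (LamB N z) * ((1 - r z) / 4)" by (simp add: c_def exp_minus)
    also note hi
    finally have "z powr (\<delta> * N) * (c * exp (Lam N z)) \<le> z powr (\<delta> * N) * (\<Sum>n\<in>?hi. cyc_coeff ?c n)"
      by (intro mult_left_mono) auto
    also have "\<dots> \<le> z ^ N * (\<Sum>n\<in>?hi. cyc_coeff (b N) n)"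
      unfolding sum_distrib_left by (intro sum_mono up)
    finally have "real N powr (- \<gamma> - 1) * (z powr (\<delta> * N) * (c * exp (Lam N z))) \<le> real N powr (- \<gamma> - 1) * (z ^ N * (\<Sum>n\<in>?hi. cyc_coeff (b N) n))"
      by (intro mult_left_mono) auto
    also have "\<dots> = z ^ N * (real N powr (- \<gamma> - 1) * (\<Sum>n\<in>?hi. cyc_coeff (b N) n))" by simp
    also have "\<dots> \<le> z ^ N * cyc_coeff (\<theta> N) N"
      using z by (intro mult_left_mono cyc_coeff_theta_ge N) auto
    finally show ?case by (simp add: mult_ac)
  qed
  then show ?thesis using c by blast
qed

end

section \<open>Probabilities for short cycles and for the longest cycle\<close>

context cycle_weights
begin

definition weight_prob :: "nat \<Rightarrow> ((nat \<Rightarrow> nat) \<Rightarrow> bool) \<Rightarrow> real" where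
  "weight_prob N E = (\<Sum>\<pi> | \<pi> permutes {1..N} \<and> E \<pi>. cycle_weight (\<theta> N) N \<pi>) / (fact N * cyc_coeff (\<theta> N) N)"

lemma cyc_coeff_theta_pos: "N \<ge> 1 \<Longrightarrow> 0 < cyc_coeff (\<theta> N) N"
proof -
  assume N: "N \<ge> 1"
  have "0 < \<theta> N N / real N" using N v0[of N N] by (simp add: \<theta>_def add_pos_nonneg)
  also have "\<dots> \<le> cyc_coeff (\<theta> N) N" by (rule cyc_coeff_ge_single[OF th0 N])
  finally show ?thesis .
qed

lemma cyc_coeff_theta_nonneg: "0 \<le> cyc_coeff (\<theta> N) n"
  by (rule cyc_coeff_nonneg) (rule th0)

lemma weight_prob_nonneg: "0 \<le> weight_prob N E"
  unfolding weight_prob_def by (intro divide_nonneg_nonneg sum_nonneg mult_nonneg_nonneg cyc_coeff_theta_nonneg)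
    (auto intro: cycle_weight_nonneg th0)

lemma weight_prob_mono: "(\<And>\<pi>. \<pi> permutes {1..N} \<Longrightarrow> E \<pi> \<Longrightarrow> F \<pi>) \<Longrightarrow> weight_prob N E \<le> weight_prob N F"
  unfolding weight_prob_def by (intro divide_right_mono sum_mono2 mult_nonneg_nonneg cyc_coeff_theta_nonneg)
    (auto intro: cycle_weight_nonneg th0 finite_subset[OF _ finite_permutations[of "{1..N}"]])

lemma weight_prob_disj_le: "weight_prob N (\<lambda>\<pi>. E \<pi> \<or> F \<pi>) \<le> weight_prob N E + weight_prob N F"
proof -
  let ?S = "\<lambda>E. {\<pi>. \<pi> permutes {1..N} \<and> E \<pi>}" and ?w = "cycle_weight (\<theta> N) N"
  have fin: "finite (?S E)" for E by (rule finite_subset[OF _ finite_permutations[of "{1..N}"]]) auto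
  have "sum ?w (?S (\<lambda>\<pi>. E \<pi> \<or> F \<pi>)) = sum ?w (?S E \<union> ?S F)" by (intro sum.cong) auto
  also have "\<dots> \<le> sum ?w (?S E) + sum ?w (?S F)"
    using fin cycle_weight_nonneg[OF th0] by (subst sum_Un) (auto intro!: sum_nonneg)
  finally show ?thesis unfolding weight_prob_def add_divide_distrib[symmetric]
    by (intro divide_right_mono mult_nonneg_nonneg cyc_coeff_theta_nonneg) auto
qed

text \<open>The numerator bound and the lower bound on the normalisation share the factor
  \<open>exp L\<close>. After cancellation the gain \<open>P\<close> has to beat only the loss
  \<open>q\<close>.\<close>

lemma weight_prob_leI:
  assumes "N \<ge> 1" "(\<Sum>\<pi> | \<pi> permutes {1..N} \<and> E \<pi>. cycle_weight (\<theta> N) N \<pi>) \<le> fact N * X"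
    and X: "X \<le> P * exp L" and c: "c > 0" "c * q * exp L \<le> cyc_coeff (\<theta> N) N" and q: "q > 0" and P: "P \<ge> 0"
  shows "weight_prob N E \<le> P / (c * q)"
proof -
  have "weight_prob N E \<le> fact N * (P * exp L) / (fact N * cyc_coeff (\<theta> N) N)"
    unfolding weight_prob_def using assms(2) X cyc_coeff_theta_nonneg
    by (intro divide_right_mono) (auto intro: order_trans mult_left_mono)
  also have "\<dots> = P * exp L / cyc_coeff (\<theta> N) N" by simp
  also have "\<dots> \<le> P * exp L / (c * q * exp L)"
    using c q P cyc_coeff_theta_pos[OF assms(1)] by (intro divide_left_mono) auto
  finally show ?thesis by simp
qed

lemma powr_exp_tendsto_0: "d > 0 \<Longrightarrow> (\<lambda>N. real N powr p * exp (- (d * real N)) / c) \<longlonglongrightarrow> 0"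
proof -
  assume d: "d > 0"
  have "(\<lambda>N. real N powr p * exp (- (d * real N))) \<longlonglongrightarrow> 0" using d by real_asymp
  then show ?thesis by (rule tendsto_divide_zero)
qed

text \<open>An exponential budget in units of \<open>t * \<epsilon> / 4\<close> per point: the
  deviation gains at least three, the quadratic term costs at most one, and the fugacity price
  \<open>lm\<close> costs at most one. The remaining unit beats the polynomial loss.\<close>

lemma short_cycles_lower:
  fixes z c lm \<epsilon> t :: real
  assumes z: "0 < z" "z \<le> 1" and c: "c > 0"
    and lower: "\<forall>\<^sub>F N in sequentially. c * real N powr (- \<gamma> - 1) * exp (- (lm * N)) * exp (Lam N z) \<le> cyc_coeff (\<theta> N) N * z ^ N"
    and e: "\<epsilon> > 0" and t: "t > 0" and tK: "t * real K * (rK K z + 1) \<le> \<epsilon> / 2" and lam: "lm \<le> t * \<epsilon> / 4"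
  shows "(\<lambda>N. weight_prob N (\<lambda>\<pi>. real N - real (points_in_long_cycles N \<pi> K) \<le> (rK K z - \<epsilon>) * N)) \<longlonglongrightarrow> 0"
proof (rule Lim_null_comparison)
  let ?d = "t * \<epsilon> / 4"
  show "(\<lambda>N. real N powr (\<gamma> + 1) * exp (- (?d * real N)) / c) \<longlonglongrightarrow> 0"
    by (rule powr_exp_tendsto_0) (use t e in simp)
  have "\<forall>\<^sub>F N in sequentially. rK K z - \<epsilon> / 4 < (\<Sum>l=1..K. \<theta> N l * z ^ l) / N"
    by (rule order_tendstoD(1)[OF sum_theta_K_tendsto]) (use e in auto)
  moreover have "\<forall>\<^sub>F N in sequentially. (\<Sum>l=1..K. \<theta> N l * z ^ l) / N < rK K z + 1"
    by (rule order_tendstoD(2)[OF sum_theta_K_tendsto]) auto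
  ultimately show "\<forall>\<^sub>F N in sequentially. norm (weight_prob N (\<lambda>\<pi>. real N - real (points_in_long_cycles N \<pi> K) \<le> (rK K z - \<epsilon>) * N))
      \<le> real N powr (\<gamma> + 1) * exp (- (?d * real N)) / c"
    using lower eventually_ge_at_top[of "Suc K"]
  proof eventually_elim
    case (elim N)
    have N: "1 \<le> N" "K \<le> N" "real N > 0" using elim by auto
    let ?y = "(rK K z - \<epsilon>) * N" and ?c = "\<lambda>l. \<theta> N l * z ^ l"
    let ?t = "\<lambda>l. if l \<le> K then \<theta> N l * exp (- (t * real l)) else \<theta> N l"
    have c0: "0 \<le> ?c l" for l using th0[of N l] z by simp
    have t0: "0 \<le> ?t l" for l using th0[of N l] by simp
    define T where "T = sum ?c {1..K}"
    have T: "(rK K z - \<epsilon> / 4) * N < T" "T < (rK K z + 1) * N" using elim N by (auto simp: T_def field_simps)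
    have "cyc_coeff ?t N * z ^ N \<le> exp (\<Sum>l=1..N. ?t l * z ^ l / real l)"
      using sum_cyc_coeff_le_exp[of ?t z "{N}" N] t0 z by simp
    also have "(\<Sum>l=1..N. ?t l * z ^ l / real l) = (\<Sum>l=1..N. (if l \<le> K then ?c l * exp (- (t * real l)) else ?c l) / real l)"
      by (intro sum.cong) auto
    also have "\<dots> \<le> Lam N z + (- t + t\<^sup>2 * real K / 2) * T"
      unfolding Lam_def T_def by (rule sum_tilted_le) (use c0 t N in auto)
    finally have up: "cyc_coeff ?t N * z ^ N \<le> exp (Lam N z + (- t + t\<^sup>2 * real K / 2) * T)" by simp
    have "(\<Sum>\<pi> | \<pi> permutes {1..N} \<and> real N - real (points_in_long_cycles N \<pi> K) \<le> ?y. cycle_weight (\<theta> N) N \<pi>)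
      \<le> exp (t * ?y) * (fact N * cyc_coeff ?t N)"
      by (rule sum_cycle_weight_short_le) (use th0 t in auto)
    then have s: "(\<Sum>\<pi> | \<pi> permutes {1..N} \<and> real N - real (points_in_long_cycles N \<pi> K) \<le> ?y. cycle_weight (\<theta> N) N \<pi>)
      \<le> fact N * (exp (t * ?y) * cyc_coeff ?t N)" by (simp add: mult_ac)
    have zN: "z ^ N > 0" using z by simp
    let ?P = "exp (t * ?y + (- t + t\<^sup>2 * real K / 2) * T) / z ^ N"
    have "weight_prob N (\<lambda>\<pi>. real N - real (points_in_long_cycles N \<pi> K) \<le> ?y) \<le> ?P / (c * (real N powr (- \<gamma> - 1) * exp (- (lm * N)) / z ^ N))"
    proof (rule weight_prob_leI[OF N(1) s _ c])
      have "cyc_coeff ?t N \<le> exp (Lam N z + (- t + t\<^sup>2 * real K / 2) * T) / z ^ N" using up zN by (simp add: pos_le_divide_eq)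
      then have "exp (t * ?y) * cyc_coeff ?t N \<le> exp (t * ?y) * (exp (Lam N z + (- t + t\<^sup>2 * real K / 2) * T) / z ^ N)"
        by (intro mult_left_mono) auto
      then show "exp (t * ?y) * cyc_coeff ?t N \<le> ?P * exp (Lam N z)" by (simp add: exp_add mult_ac)
      show "c * (real N powr (- \<gamma> - 1) * exp (- (lm * N)) / z ^ N) * exp (Lam N z) \<le> cyc_coeff (\<theta> N) N"
        using elim zN by (simp add: divide_le_eq mult_ac)
    qed (use N zN in auto)
    also have "\<dots> = exp (t * ?y + (- t + t\<^sup>2 * real K / 2) * T + lm * N) * real N powr (\<gamma> + 1) / c"
    proof -
      have "real N powr (- \<gamma> - 1) * real N powr (\<gamma> + 1) = 1" using N by (simp add: powr_add[symmetric])
      then have q: "real N powr (- \<gamma> - 1) = 1 / real N powr (\<gamma> + 1)" using N by (simp add: nonzero_eq_divide_eq)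
      have "exp X / z ^ N / (c * (1 / real N powr (\<gamma> + 1) * exp (- (lm * N)) / z ^ N)) = exp (X + lm * N) * real N powr (\<gamma> + 1) / c" for X
        using zN z(1) by (simp add: exp_add exp_minus field_simps)
      then show ?thesis unfolding q .
    qed
    also have "\<dots> \<le> exp (- (?d * real N)) * real N powr (\<gamma> + 1) / c"
    proof -
      have "t\<^sup>2 * real K / 2 * T \<le> t\<^sup>2 * real K / 2 * ((rK K z + 1) * N)" using T t by (intro mult_left_mono) auto
      also have "\<dots> = t * (t * real K * (rK K z + 1)) * N / 2" by (simp add: power2_eq_square)
      also have "\<dots> \<le> t * (\<epsilon> / 2) * N / 2" using tK t N by (intro divide_right_mono mult_right_mono mult_left_mono) auto
      finally have 1: "t\<^sup>2 * real K / 2 * T \<le> ?d * N" by simp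
      have "t * ((rK K z - \<epsilon> / 4) * N) \<le> t * T" using T t by (intro mult_left_mono) auto
      then have 2: "t * ?y + 3 * (?d * N) \<le> t * T" by (simp add: algebra_simps)
      have 3: "lm * N \<le> ?d * N" using lam by (intro mult_right_mono) auto
      have "t * ?y + (- t + t\<^sup>2 * real K / 2) * T + lm * N = t * ?y - t * T + t\<^sup>2 * real K / 2 * T + lm * N"
        by (simp add: algebra_simps)
      also have "\<dots> \<le> - (?d * N)" using 1 2 3 by linarith
      finally show ?thesis using c by (intro divide_right_mono mult_right_mono) auto
    qed
    finally show ?case using weight_prob_nonneg by (simp add: mult_ac)
  qed
qed

lemma short_cycles_lower_sup:
  fixes \<epsilon> :: real
  assumes rc: "r 1 < 1" and e: "\<epsilon> > 0"
  shows "(\<lambda>N. weight_prob N (\<lambda>\<pi>. real N - real (points_in_long_cycles N \<pi> K) \<le> (rK K 1 - \<epsilon>) * N)) \<longlonglongrightarrow> 0"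
proof -
  obtain c where c: "c > 0" "\<forall>\<^sub>F N in sequentially. c * real N powr (- \<gamma> - 1) * exp (Lam N 1) \<le> cyc_coeff (\<theta> N) N"
    using cyc_coeff_theta_lower_sup[OF rc] by auto
  let ?B = "rK K 1 + 1"
  have B: "?B > 0" using rK_nonneg[of 1 K] by simp
  show ?thesis
  proof (rule short_cycles_lower[of 1 c 0 \<epsilon> "\<epsilon> / (2 * (real K + 1) * ?B)"])
    have "\<epsilon> / (2 * (real K + 1) * ?B) * real K * ?B = \<epsilon> / 2 * (real K / (real K + 1))"
      using B by (simp add: divide_simps)
    also have "\<dots> \<le> \<epsilon> / 2 * 1" using e by (intro mult_left_mono) auto
    finally show "\<epsilon> / (2 * (real K + 1) * ?B) * real K * ?B \<le> \<epsilon> / 2" by simp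
  qed (use c e B in auto)
qed

text \<open>Continuity up to and including \<open>z = 1\<close> allows the intermediate value
  theorem to place \<open>r z\<close> just below 1, also at the critical point.\<close>

lemma continuous_r: "continuous_on {0..1} r"
proof -
  have "uniform_limit {0..1} (\<lambda>n z. \<Sum>j<n. real (Suc j) powr (- \<gamma>) * J (Suc j) * z ^ Suc j) r sequentially"
    unfolding r_def
  proof (rule Weierstrass_m_test[OF _ summable_rc])
    fix j and z :: real assume "z \<in> {0..1}"
    then have "0 \<le> z ^ Suc j" "z ^ Suc j \<le> 1" by (auto intro: power_le_one simp del: power_Suc)
    then show "norm (real (Suc j) powr (- \<gamma>) * J (Suc j) * z ^ Suc j) \<le> real (Suc j) powr (- \<gamma>) * J (Suc j)"
      using J0[of "Suc j"] by (simp add: abs_mult mult_left_le del: power_Suc)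
  qed
  then show ?thesis
    by (rule uniform_limit_theorem[rotated]) (auto intro!: always_eventually continuous_intros)
qed

lemma rK_mono: "0 \<le> z \<Longrightarrow> z \<le> z' \<Longrightarrow> rK K z \<le> rK K z'"
  unfolding rK_def by (intro sum_mono mult_left_mono power_mono mult_nonneg_nonneg J0) auto

text \<open>The order of choices matters. A fugacity \<open>z0\<close> fixes the truncation
  \<open>K\<close>, and \<open>K\<close> fixes the tilt \<open>t\<close>; only then is \<delta>
  chosen, small enough for the fugacity price to stay below the gain of the tilt; \<open>z\<close>
  comes last. Requiring \<open>z \<ge> z0\<close> keeps \<open>K\<close> valid and bounds
  \<open>- ln z\<close> independently of \<delta>.\<close>

lemma short_cycles_lower_sub:
  fixes \<epsilon> :: real
  assumes rc: "1 \<le> r 1" and e: "\<epsilon> > 0" "\<epsilon> < 1"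
  shows "\<exists>K. (\<lambda>N. weight_prob N (\<lambda>\<pi>. real N - real (points_in_long_cycles N \<pi> K) \<le> (1 - \<epsilon>) * N)) \<longlonglongrightarrow> 0"
proof -
  have r0: "r 0 = 0" by (simp add: r_def)
  obtain z0 where z0: "0 \<le> z0" "z0 \<le> 1" "r z0 = 1 - \<epsilon> / 4"
    using IVT'[of r 0 "1 - \<epsilon> / 4" 1] continuous_r r0 rc e by auto
  have z0pos: "z0 > 0" using z0 r0 e by (cases "z0 = 0") auto
  have "\<forall>\<^sub>F K in sequentially. 1 - \<epsilon> / 2 < rK K z0"
    using rK_tendsto[of z0] z0 e by (intro order_tendstoD(1)) auto
  then obtain K where K: "1 - \<epsilon> / 2 < rK K z0" by (auto simp: eventually_sequentially)
  let ?B = "rK K 1 + 1"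
  have B: "?B > 0" using rK_nonneg[of 1 K] by simp
  define t where "t = (\<epsilon> / 2) / (2 * (real K + 1) * ?B)"
  have t: "t > 0" using e B by (simp add: t_def)
  have l0: "0 \<le> - ln z0" using z0 z0pos by simp
  \<comment> \<open>The price per point is \<open>\<delta> * (- ln z)\<close>, at most
    \<open>\<delta> * (1 - ln z0)\<close>; the added 1 keeps the denominator positive when
    \<open>z0 = 1\<close>.\<close>
  define \<delta> where "\<delta> = min (\<epsilon> / 4) (t * (\<epsilon> / 2) / 4 / (1 - ln z0))"
  have dpos: "0 < \<delta>" using e t l0 by (auto simp: \<delta>_def)
  have dl: "\<delta> * (1 - ln z0) \<le> t * (\<epsilon> / 2) / 4"
  proof -
    define w where "w = 1 - ln z0"
    have w: "w > 0" using l0 by (simp add: w_def)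
    have "\<delta> * w \<le> (t * (\<epsilon> / 2) / 4 / w) * w"
      using w by (intro mult_right_mono) (auto simp: \<delta>_def w_def)
    then show ?thesis using w unfolding w_def[symmetric] by simp
  qed
  have d1: "\<delta> \<le> \<epsilon> / 4" unfolding \<delta>_def by (rule min.cobounded1)
  \<comment> \<open>The value \<open>1 - \<delta> / 2\<close> lies strictly between
    \<open>1 - \<delta>\<close> and 1, as the lower bound on the normalisation requires.\<close>
  obtain z where z: "z0 \<le> z" "z \<le> 1" "r z = 1 - \<delta> / 2"
    using IVT'[of r z0 "1 - \<delta> / 2" 1] continuous_on_subset[OF continuous_r, of "{z0..1}"] z0 d1 dpos rc by auto
  have zpos: "0 < z" using z z0pos by simp
  obtain c where c: "c > 0" "\<forall>\<^sub>F N in sequentially. c * real N powr (- \<gamma> - 1) * z powr (\<delta> * N) * exp (Lam N z) \<le> cyc_coeff (\<theta> N) N * z ^ N"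
    using cyc_coeff_theta_lower_sub[OF zpos z(2) dpos] z(3) dpos d1 e by auto
  define lm where "lm = - \<delta> * ln z"
  have zl: "z powr (\<delta> * real N) = exp (- (lm * real N))" for N using zpos by (simp add: powr_def lm_def mult_ac)
  have KB: "rK K z \<le> rK K 1" using z zpos by (intro rK_mono) auto
  have lim: "(\<lambda>N. weight_prob N (\<lambda>\<pi>. real N - real (points_in_long_cycles N \<pi> K) \<le> (rK K z - \<epsilon> / 2) * N)) \<longlonglongrightarrow> 0"
  proof (rule short_cycles_lower[of z c lm "\<epsilon> / 2" t])
    show "\<forall>\<^sub>F N in sequentially. c * real N powr (- \<gamma> - 1) * exp (- (lm * real N)) * exp (Lam N z) \<le> cyc_coeff (\<theta> N) N * z ^ N"
      using c(2) unfolding zl .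
    have "t * real K * (rK K z + 1) \<le> t * real K * ?B" using KB t by (intro mult_left_mono) auto
    also have "\<dots> = \<epsilon> / 2 / 2 * (real K / (real K + 1))" using B by (simp add: t_def divide_simps)
    also have "\<dots> \<le> \<epsilon> / 2 / 2 * 1" using e by (intro mult_left_mono) auto
    finally show "t * real K * (rK K z + 1) \<le> \<epsilon> / 2 / 2" by simp
    have "ln z0 \<le> ln z" using z z0pos by simp
    then have "\<delta> * (- ln z) \<le> \<delta> * (1 - ln z0)" using dpos by (intro mult_left_mono) auto
    then have "lm \<le> \<delta> * (1 - ln z0)" by (simp add: lm_def)
    then show "lm \<le> t * (\<epsilon> / 2) / 4" using dl by linarith
  qed (use zpos z c e t in auto)
  have "1 - \<epsilon> \<le> rK K z - \<epsilon> / 2" using rK_mono[OF z0(1) z(1), of K] K by linarith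
  then have le: "(1 - \<epsilon>) * real N \<le> (rK K z - \<epsilon> / 2) * real N" for N by (intro mult_right_mono) auto
  have "(\<lambda>N. weight_prob N (\<lambda>\<pi>. real N - real (points_in_long_cycles N \<pi> K) \<le> (1 - \<epsilon>) * N)) \<longlonglongrightarrow> 0"
  proof (rule Lim_null_comparison[OF _ lim], intro always_eventually allI)
    fix N
    have "weight_prob N (\<lambda>\<pi>. real N - real (points_in_long_cycles N \<pi> K) \<le> (1 - \<epsilon>) * N)
      \<le> weight_prob N (\<lambda>\<pi>. real N - real (points_in_long_cycles N \<pi> K) \<le> (rK K z - \<epsilon> / 2) * N)"
      by (rule weight_prob_mono) (use le[of N] in linarith)
    then show "norm (weight_prob N (\<lambda>\<pi>. real N - real (points_in_long_cycles N \<pi> K) \<le> (1 - \<epsilon>) * N))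
      \<le> weight_prob N (\<lambda>\<pi>. real N - real (points_in_long_cycles N \<pi> K) \<le> (rK K z - \<epsilon> / 2) * N)"
      using weight_prob_nonneg by simp
  qed
  then show ?thesis ..
qed

lemma theta_div_le:
  assumes "v N l \<le> 1" "0 < y" "y \<le> real l" shows "\<theta> N l / real l \<le> 2 * y powr (- \<gamma> - 1)"
proof -
  have l: "real l > 0" using assms by linarith
  have "\<theta> N l / real l = real l powr (- \<gamma> - 1) * (1 + v N l)" using l by (simp add: \<theta>_def powr_diff)
  also have "\<dots> \<le> real l powr (- \<gamma> - 1) * 2" using assms(1) by (intro mult_left_mono) auto
  also have "\<dots> \<le> y powr (- \<gamma> - 1) * 2" using assms g by (intro mult_right_mono powr_mono2') auto
  finally show ?thesis by simp
qed

text \<open>The two ranges need different tilts: of order \<open>ln N / N\<close> below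
  \<open>\<eta> * N\<close>, where a power of N must be gained, and of order \<open>1 / N\<close>
  above it, where the powers already match and only a small constant is wanted.\<close>

lemma longest_cycle_lower:
  fixes \<delta> :: real
  assumes rc: "r 1 < 1" and d: "\<delta> > 0"
  shows "(\<lambda>N. weight_prob N (\<lambda>\<pi>. real (longest_cycle N \<pi>) \<le> (1 - r 1 - \<delta>) * N)) \<longlonglongrightarrow> 0"
proof -
  define \<nu> where "\<nu> = 1 - r 1"
  have nu: "\<nu> > 0" using rc by (simp add: \<nu>_def)
  obtain c where c: "c > 0" "\<forall>\<^sub>F N in sequentially. c * real N powr (- \<gamma> - 1) * exp (Lam N 1) \<le> cyc_coeff (\<theta> N) N"
    using cyc_coeff_theta_lower_sup[OF rc] by auto
  \<comment> \<open>With \<open>exp (t * N) = N powr s\<close>, the deficit \<nu> gains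
    \<open>N powr (- s * \<nu> / 2)\<close>, half of \<nu> being spent on the error in the mean.
    This value makes the gain \<open>N powr (- (\<gamma> + 2))\<close>, one power better than the
    lower bound on the normalisation.\<close>
  define s where "s = 2 * (\<gamma> + 2) / \<nu>"
  have s: "s > 0" using nu g by (simp add: s_def)
  \<comment> \<open>At length \<open>\<eta> * N\<close> the tilt multiplies a weight by at most
    \<open>N powr (s * \<eta>)\<close>, which is kept below
    \<open>N powr (\<gamma> / 3)\<close>.\<close>
  define \<eta> where "\<eta> = min 1 (\<gamma> / (3 * s))"
  have eta: "0 < \<eta>" "\<eta> \<le> 1" "s * \<eta> \<le> \<gamma> / 3"
  proof -
    show "0 < \<eta>" "\<eta> \<le> 1" using g s by (auto simp: \<eta>_def)
    have "s * \<eta> \<le> s * (\<gamma> / (3 * s))" using s by (intro mult_left_mono) (auto simp: \<eta>_def)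
    then show "s * \<eta> \<le> \<gamma> / 3" using s by simp
  qed
  \<comment> \<open>The cutoff is \<open>N powr (1 - k)\<close>. Beyond it
    \<open>k \<le> \<kappa>\<close> bounds the nonzero modes, and
    \<open>k * (\<gamma> + 1) \<le> \<gamma> / 3\<close> leaves total exponent at most
    \<open>- \<gamma> + \<gamma> / 3 + \<gamma> / 3\<close> for the error from long lengths.\<close>
  define k where "k = min \<kappa> (\<gamma> / (3 * (\<gamma> + 1)))"
  have k: "0 < k" "k \<le> \<kappa>" "k * (\<gamma> + 1) \<le> \<gamma> / 3" "k < 1"
  proof -
    show "0 < k" "k \<le> \<kappa>" using g kap by (auto simp: k_def)
    have "k * (\<gamma> + 1) \<le> (\<gamma> / (3 * (\<gamma> + 1))) * (\<gamma> + 1)" using g by (intro mult_right_mono) (auto simp: k_def)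
    also have "\<dots> = \<gamma> / 3" using g by (simp add: divide_simps)
    finally show 1: "k * (\<gamma> + 1) \<le> \<gamma> / 3" .
    have "k \<le> \<gamma> / (3 * (\<gamma> + 1))" by (simp add: k_def)
    also have "\<dots> < 1" using g by (simp add: divide_less_eq)
    finally show "k < 1" .
  qed
  define y where "y N = real N powr (1 - k)" for N
  define B where "B N = 2 * y N powr (- \<gamma> - 1)" for N
  define T where "T N = (\<Sum>l=1..N. \<theta> N l)" for N
  define M where "M N = nat \<lfloor>\<eta> * real N\<rfloor>" for N
  have Tlim: "(\<lambda>N. T N / N) \<longlonglongrightarrow> 1 - \<nu>" using sum_theta_tendsto[of 1] by (simp add: T_def \<nu>_def)
  have vbig: "\<forall>\<^sub>F N in sequentially. \<forall>l. y N \<le> real l \<longrightarrow> v N l \<le> 1"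
    using v4 eventually_ge_at_top[of 1]
  proof eventually_elim
    case (elim N)
    have "real N powr (1 - \<kappa>) \<le> y N" unfolding y_def using k elim by (intro powr_mono) auto
    then show ?case using elim by (meson order_trans)
  qed
  \<comment> \<open>Stated uniformly in \<open>t\<close> and \<open>M\<close> because it serves both
    ranges: truncated lengths with the logarithmic tilt, and all lengths up to N with the tilt
    \<open>\<tau> / N\<close>.\<close>
  have chern: "\<forall>\<^sub>F N in sequentially. \<forall>t\<ge>0. \<forall>M\<le>N. (\<Sum>l=1..M. \<theta> N l * exp (t * real l) / real l)
      \<le> Lam N 1 + t * exp (t * y N) * T N + real N * B N * exp (t * real M)"
    using vbig eventually_ge_at_top[of 1]
  proof eventually_elim
    case (elim N)
    have y0: "0 < y N" using elim by (simp add: y_def)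
    show ?case
    proof (intro allI impI)
      fix t :: real and M assume t: "0 \<le> t" "M \<le> N"
      have "(\<Sum>l=1..M. \<theta> N l * exp (t * real l) / real l) \<le> (\<Sum>l=1..N. \<theta> N l / real l) + t * exp (t * y N) * (\<Sum>l=1..N. \<theta> N l) + real N * B N * exp (t * real M)"
      proof (rule sum_exp_tilt_le)
        fix l assume "y N < real l"
        then show "\<theta> N l / real l \<le> B N" unfolding B_def using elim y0 by (intro theta_div_le) auto
      qed (use t th0 in \<open>auto simp: B_def\<close>)
      then show "(\<Sum>l=1..M. \<theta> N l * exp (t * real l) / real l) \<le> Lam N 1 + t * exp (t * y N) * T N + real N * B N * exp (t * real M)"
        by (simp add: Lam_def T_def)
    qed
  qed
  have NB: "real N * B N * real N powr p = 2 * real N powr (1 - (1 - k) * (\<gamma> + 1) + p)" if "N \<ge> 1" for N p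
  proof -
    have "real N * B N * real N powr p = 2 * (real N powr 1 * real N powr ((1 - k) * (- \<gamma> - 1)) * real N powr p)"
      using that by (simp add: B_def y_def powr_powr)
    also have "\<dots> = 2 * real N powr (1 + (1 - k) * (- \<gamma> - 1) + p)" by (simp only: powr_add mult.assoc)
    also have "1 + (1 - k) * (- \<gamma> - 1) + p = 1 - (1 - k) * (\<gamma> + 1) + p" by (simp add: algebra_simps)
    finally show ?thesis .
  qed
  have expo: "1 - (1 - k) * (\<gamma> + 1) + p \<le> - (\<gamma> / 3)" if "p \<le> \<gamma> / 3" for p
    using k(3) that by (simp add: algebra_simps)
  have g3: "(\<lambda>N. 2 * real N powr (- (\<gamma> / 3))) \<longlonglongrightarrow> 0"
    using tendsto_mult_left[OF tendsto_neg_powr[OF _ filterlim_real_sequentially, of "- (\<gamma> / 3)"], of 2] g by simp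
  have MN: "M N \<le> N" for N
  proof -
    have "\<eta> * real N \<le> 1 * real N" using eta by (intro mult_right_mono) auto
    then show ?thesis unfolding M_def by (simp add: nat_le_iff floor_le_iff)
  qed
  have qpos: "real N powr (- \<gamma> - 1) > 0" if "N \<ge> 1" for N using that by simp
  \<comment> \<open>All cycles short: the truncated coefficient is bounded at \<open>exp t\<close>
    with \<open>t = s * ln N / N\<close>. As \<open>t * y N\<close> tends to 0, the linear part of
    the exponent is at most \<open>s * ln N * (1 - \<nu> / 2)\<close> and the error from long
    lengths is at most 1.\<close>
  have part1: "(\<lambda>N. weight_prob N (\<lambda>\<pi>. longest_cycle N \<pi> \<le> M N)) \<longlonglongrightarrow> 0"
  proof (rule Lim_null_comparison)
    show "(\<lambda>N. exp 1 / c * (1 / real N)) \<longlonglongrightarrow> 0" using tendsto_mult_left[OF lim_1_over_n, of "exp 1 / c"] by simp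
    have "(\<lambda>N. s * ln (real N) / real N * y N) \<longlonglongrightarrow> 0"
    proof -
      have "(\<lambda>N. s * ln (real N) / real N * real N powr (1 - k)) \<longlonglongrightarrow> 0" using k(1) by real_asymp
      then show ?thesis by (simp add: y_def)
    qed
    then have "(\<lambda>N. exp (s * ln (real N) / real N * y N) * (T N / N)) \<longlonglongrightarrow> exp 0 * (1 - \<nu>)"
      by (intro tendsto_mult tendsto_exp Tlim)
    then have "\<forall>\<^sub>F N in sequentially. exp (s * ln (real N) / real N * y N) * (T N / N) < 1 - \<nu> / 2"
      using nu by (intro order_tendstoD(2)) auto
    moreover have "\<forall>\<^sub>F N in sequentially. 2 * real N powr (- (\<gamma> / 3)) < 1" by (rule order_tendstoD(2)[OF g3]) simp
    ultimately show "\<forall>\<^sub>F N in sequentially. norm (weight_prob N (\<lambda>\<pi>. longest_cycle N \<pi> \<le> M N)) \<le> exp 1 / c * (1 / real N)"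
      using chern c(2) eventually_ge_at_top[of 2]
    proof eventually_elim
      case (elim N)
      have N: "N \<ge> 1" "real N > 0" "real N \<ge> 1" "ln (real N) > 0" using elim by auto
      define t where "t = s * ln (real N) / real N"
      have t: "t \<ge> 0" using s N by (simp add: t_def)
      have tN: "exp (t * real N) = real N powr s" using N by (simp add: t_def powr_def)
      let ?th = "\<lambda>l. if l \<le> M N then \<theta> N l else 0"
      have th0': "0 \<le> ?th l" for l using th0 by simp
      have el: "exp t ^ l = exp (t * real l)" for l by (simp add: exp_of_nat_mult[symmetric] mult.commute)
      have "cyc_coeff ?th N * exp t ^ N \<le> exp (\<Sum>l=1..N. ?th l * exp t ^ l / real l)"
        using sum_cyc_coeff_le_exp[of ?th "exp t" "{N}" N] th0' by simp
      also have "(\<Sum>l=1..N. ?th l * exp t ^ l / real l) = (\<Sum>l=1..M N. \<theta> N l * exp (t * real l) / real l)"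
        unfolding el using MN[of N] by (intro sum.mono_neutral_cong_right) auto
      also have "\<dots> \<le> Lam N 1 + t * exp (t * y N) * T N + real N * B N * exp (t * real (M N))"
        using elim t MN by simp
      also have "t * exp (t * y N) * T N \<le> s * ln (real N) * (1 - \<nu> / 2)"
      proof -
        have "t * exp (t * y N) * T N = s * ln (real N) * (exp (s * ln (real N) / real N * y N) * (T N / N))"
          by (simp add: t_def)
        also have "\<dots> \<le> s * ln (real N) * (1 - \<nu> / 2)" using elim s N by (intro mult_left_mono) auto
        finally show ?thesis .
      qed
      also have "real N * B N * exp (t * real (M N)) \<le> 1"
      proof -
        have "real (M N) \<le> \<eta> * real N" using eta by (simp add: M_def)
        then have "t * real (M N) \<le> t * (\<eta> * real N)" using t by (intro mult_left_mono)
        also have "\<dots> = s * \<eta> * ln (real N)" using N by (simp add: t_def)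
        finally have "exp (t * real (M N)) \<le> real N powr (s * \<eta>)" using N by (simp add: powr_def)
        then have "real N * B N * exp (t * real (M N)) \<le> real N * B N * real N powr (s * \<eta>)"
          by (intro mult_left_mono) (auto simp: B_def)
        also have "\<dots> = 2 * real N powr (1 - (1 - k) * (\<gamma> + 1) + s * \<eta>)" by (rule NB[OF N(1)])
        also have "\<dots> \<le> 2 * real N powr (- (\<gamma> / 3))" using N eta expo by (intro mult_left_mono powr_mono) auto
        finally show ?thesis using elim by simp
      qed
      finally have "cyc_coeff ?th N * exp t ^ N \<le> exp (Lam N 1 + s * ln (real N) * (1 - \<nu> / 2) + 1)" by simp
      then have "cyc_coeff ?th N * real N powr s \<le> exp (Lam N 1) * real N powr (s * (1 - \<nu> / 2)) * exp 1"
        unfolding el tN using N by (simp add: exp_add powr_def mult_ac)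
      then have X: "cyc_coeff ?th N \<le> (exp 1 * real N powr (s * (1 - \<nu> / 2)) / real N powr s) * exp (Lam N 1)"
        using N by (simp add: pos_le_divide_eq mult_ac)
      have PR: "real N powr (s * (1 - \<nu> / 2)) / real N powr s = real N powr (- (\<gamma> + 2))"
      proof -
        have "s * (1 - \<nu> / 2) - s = - (\<gamma> + 2)" using nu by (simp add: s_def field_simps)
        then show ?thesis by (simp add: powr_diff[symmetric])
      qed
      then have X: "cyc_coeff ?th N \<le> (exp 1 * real N powr (- (\<gamma> + 2))) * exp (Lam N 1)" using X unfolding PR[symmetric] by simp
      have "weight_prob N (\<lambda>\<pi>. longest_cycle N \<pi> \<le> M N) \<le> (exp 1 * real N powr (- (\<gamma> + 2))) / (c * real N powr (- \<gamma> - 1))"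
      proof (rule weight_prob_leI[OF N(1) _ X c(1) _ qpos[OF N(1)]])
        show "(\<Sum>\<pi> | \<pi> permutes {1..N} \<and> longest_cycle N \<pi> \<le> M N. cycle_weight (\<theta> N) N \<pi>) \<le> fact N * cyc_coeff ?th N"
          by (rule sum_cycle_weight_longest_le[OF th0 N(1)])
      qed (use elim in auto)
      also have "\<dots> = exp 1 / c * (real N powr (- (\<gamma> + 2)) / real N powr (- \<gamma> - 1))" by simp
      also have "real N powr (- (\<gamma> + 2)) / real N powr (- \<gamma> - 1) = 1 / real N"
        using N by (simp add: powr_diff[symmetric] powr_minus_divide)
      finally show ?case using weight_prob_nonneg by simp
    qed
  qed
  define Jl where "Jl N = {l. M N < l \<and> real l \<le> (\<nu> - \<delta>) * N}" for N
  define D where "D = 2 * \<eta> powr (- \<gamma> - 1) / c"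
  have D: "D > 0" using eta c by (simp add: D_def)
  \<comment> \<open>The weight of one macroscopic cycle and the lower bound both have order
    \<open>N powr (- \<gamma> - 1)\<close>; their ratio is absorbed in \<open>D\<close>. What must
    be small is the chance that the other points number at least
    \<open>(1 - \<nu> + \<delta>) * N\<close>. The tilt \<open>\<tau> / N\<close> bounds it by about
    \<open>exp (- \<tau> * \<delta>)\<close>, and \<tau> is free.\<close>
  have part2: "(\<lambda>N. weight_prob N (\<lambda>\<pi>. longest_cycle N \<pi> \<in> Jl N)) \<longlonglongrightarrow> 0"
  proof (rule LIMSEQ_I)
    fix e :: real assume e: "e > 0"
    \<comment> \<open>Large enough for \<open>D * exp (- \<tau> * \<delta>) < e\<close>; the added 1
      makes this strict, and the maximum with 1 keeps \<tau> positive.\<close>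
    define \<tau> where "\<tau> = max 1 ((ln (D / e) + 1) / \<delta>)"
    have tau: "\<tau> > 0" by (simp add: \<tau>_def)
    have De: "D * exp (- (\<tau> * \<delta>)) < e"
    proof -
      have "(ln (D / e) + 1) / \<delta> \<le> \<tau>" by (simp add: \<tau>_def)
      then have "ln (D / e) < \<tau> * \<delta>" using d by (simp add: divide_le_eq)
      then have "exp (ln (D / e)) < exp (\<tau> * \<delta>)" by (simp only: exp_less_cancel_iff)
      then have "D / e < exp (\<tau> * \<delta>)" using D e by simp
      then show ?thesis using e by (simp add: exp_minus field_simps)
    qed
    have EL: "(\<lambda>N. exp (\<tau> / real N * y N) * (T N / N)) \<longlonglongrightarrow> exp 0 * (1 - \<nu>)"
    proof (intro tendsto_mult tendsto_exp Tlim)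
      have "(\<lambda>N. \<tau> / real N * real N powr (1 - k)) \<longlonglongrightarrow> 0" using k(1) by real_asymp
      then show "(\<lambda>N. \<tau> / real N * y N) \<longlonglongrightarrow> 0" by (simp add: y_def)
    qed
    have "(\<lambda>N. D * exp (- (\<tau> * (1 - \<nu> + \<delta>)) + \<tau> * (exp (\<tau> / real N * y N) * (T N / N)) + (2 * real N powr (- (\<gamma> / 3))) * exp \<tau>))
       \<longlonglongrightarrow> D * exp (- (\<tau> * (1 - \<nu> + \<delta>)) + \<tau> * (exp 0 * (1 - \<nu>)) + 0 * exp \<tau>)"
      by (intro tendsto_mult_left tendsto_exp tendsto_add tendsto_const EL tendsto_mult_right[OF g3])
    also have "D * exp (- (\<tau> * (1 - \<nu> + \<delta>)) + \<tau> * (exp 0 * (1 - \<nu>)) + 0 * exp \<tau>) = D * exp (- (\<tau> * \<delta>))"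
      by (simp add: algebra_simps)
    finally have "\<forall>\<^sub>F N in sequentially. D * exp (- (\<tau> * (1 - \<nu> + \<delta>)) + \<tau> * (exp (\<tau> / real N * y N) * (T N / N)) + (2 * real N powr (- (\<gamma> / 3))) * exp \<tau>) < e"
      using De by (rule order_tendstoD(2))
    moreover have "\<forall>\<^sub>F N in sequentially. y N \<le> \<eta> * real N"
    proof -
      have "(\<lambda>N. real N powr (1 - k) / real N) \<longlonglongrightarrow> 0" using k(1) by real_asymp
      then have "\<forall>\<^sub>F N in sequentially. real N powr (1 - k) / real N < \<eta>" using eta by (intro order_tendstoD(2)) auto
      then show ?thesis using eventually_ge_at_top[of 1]
        by eventually_elim (simp add: y_def divide_less_eq less_imp_le)
    qed
    ultimately have "\<forall>\<^sub>F N in sequentially. weight_prob N (\<lambda>\<pi>. longest_cycle N \<pi> \<in> Jl N) < e"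
      using chern vbig c(2) eventually_ge_at_top[of 1]
    proof eventually_elim
      case (elim N)
      have N: "N \<ge> 1" "real N > 0" "real N \<ge> 1" using elim by auto
      let ?h = "cyc_coeff (\<theta> N)"
      define x where "x = (1 - \<nu> + \<delta>) * N"
      define t where "t = \<tau> / real N"
      have t: "t \<ge> 0" "t * real N = \<tau>" "t * x = \<tau> * (1 - \<nu> + \<delta>)" using tau N by (auto simp: t_def x_def)
      let ?F = "{n \<in> {..N}. x \<le> real n}"
      have el: "exp t ^ l = exp (t * real l)" for l by (simp add: exp_of_nat_mult[symmetric] mult.commute)
      have yN: "0 < \<eta> * real N" using eta N by simp
      \<comment> \<open>Above \<open>\<eta> * N\<close>, which eventually exceeds the cutoff, every
        weight \<open>\<theta> N l / l\<close> is at most twice the same power. What remains is a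
        sum of coefficients over the complementary sizes \<open>N - l\<close>, all at least
        \<open>x\<close>.\<close>
      have sumJ: "(\<Sum>l\<in>{1..N} \<inter> Jl N. \<theta> N l / l * ?h (N - l)) \<le> 2 * (\<eta> * real N) powr (- \<gamma> - 1) * (\<Sum>n\<in>?F. ?h n)"
      proof -
        have "(\<Sum>l\<in>{1..N} \<inter> Jl N. \<theta> N l / l * ?h (N - l)) \<le> (\<Sum>l\<in>{1..N} \<inter> Jl N. 2 * (\<eta> * real N) powr (- \<gamma> - 1) * ?h (N - l))"
        proof (intro sum_mono mult_right_mono cyc_coeff_theta_nonneg)
          fix l assume l: "l \<in> {1..N} \<inter> Jl N"
          then have "nat \<lfloor>\<eta> * real N\<rfloor> < l" by (simp add: Jl_def M_def)
          then have le: "\<eta> * real N \<le> real l" by linarith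
          then have "v N l \<le> 1" using elim by auto
          then show "\<theta> N l / l \<le> 2 * (\<eta> * real N) powr (- \<gamma> - 1)" using yN le by (rule theta_div_le)
        qed
        also have "\<dots> = 2 * (\<eta> * real N) powr (- \<gamma> - 1) * (\<Sum>l\<in>{1..N} \<inter> Jl N. ?h (N - l))" by (simp add: sum_distrib_left)
        also have "(\<Sum>l\<in>{1..N} \<inter> Jl N. ?h (N - l)) = (\<Sum>n\<in>(\<lambda>l. N - l) ` ({1..N} \<inter> Jl N). ?h n)"
          by (subst sum.reindex) (auto simp: inj_on_def)
        also have "\<dots> \<le> (\<Sum>n\<in>?F. ?h n)"
        proof (rule sum_mono2)
          show "(\<lambda>l. N - l) ` ({1..N} \<inter> Jl N) \<subseteq> ?F"
          proof (rule image_subsetI)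
            fix l assume l: "l \<in> {1..N} \<inter> Jl N"
            then have "real (N - l) = real N - real l" "real l \<le> (\<nu> - \<delta>) * N" by (auto simp: Jl_def of_nat_diff)
            then show "N - l \<in> ?F" by (simp add: x_def algebra_simps)
          qed
        qed (auto intro: cyc_coeff_theta_nonneg)
        finally show ?thesis by (simp add: mult_left_mono)
      qed
      have "(\<Sum>n\<in>?F. ?h n) \<le> (\<Sum>n\<in>?F. exp (- (t * x)) * (?h n * exp t ^ n))"
      proof (rule sum_mono)
        fix n assume "n \<in> ?F"
        then have "t * x \<le> t * real n" using t by (intro mult_left_mono) auto
        then have "1 \<le> exp (- (t * x) + t * real n)" by simp
        then have "1 * ?h n \<le> exp (- (t * x) + t * real n) * ?h n" by (intro mult_right_mono cyc_coeff_theta_nonneg)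
        then show "?h n \<le> exp (- (t * x)) * (?h n * exp t ^ n)" unfolding el exp_add by (simp add: mult_ac)
      qed
      also have "\<dots> = exp (- (t * x)) * (\<Sum>n\<in>?F. ?h n * exp t ^ n)" by (simp add: sum_distrib_left)
      also have "\<dots> \<le> exp (- (t * x)) * exp (\<Sum>l=1..N. \<theta> N l * exp t ^ l / l)"
        by (intro mult_left_mono sum_cyc_coeff_le_exp th0) auto
      also have "(\<Sum>l=1..N. \<theta> N l * exp t ^ l / l) \<le> Lam N 1 + t * exp (t * y N) * T N + real N * B N * exp (t * real N)"
        unfolding el by (rule elim(3)[rule_format, OF t(1) order_refl])
      also have "real N * B N * exp (t * real N) \<le> (2 * real N powr (- (\<gamma> / 3))) * exp \<tau>"
      proof -
        have "real N * B N = 2 * real N powr (1 - (1 - k) * (\<gamma> + 1) + 0)" using NB[OF N(1), of 0] N by simp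
        also have "\<dots> \<le> 2 * real N powr (- (\<gamma> / 3))" using N g by (intro mult_left_mono powr_mono expo) auto
        finally show ?thesis unfolding t(2) by (intro mult_right_mono) auto
      qed
      also have "t * exp (t * y N) * T N = \<tau> * (exp (\<tau> / real N * y N) * (T N / N))" by (simp add: t_def)
      finally have hF: "(\<Sum>n\<in>?F. ?h n) \<le> exp (- (t * x)) * exp (Lam N 1 + \<tau> * (exp (\<tau> / real N * y N) * (T N / N)) + (2 * real N powr (- (\<gamma> / 3))) * exp \<tau>)"
        by simp
      define Q where "Q = exp (- (\<tau> * (1 - \<nu> + \<delta>)) + \<tau> * (exp (\<tau> / real N * y N) * (T N / N)) + (2 * real N powr (- (\<gamma> / 3))) * exp \<tau>)"
      have hF': "(\<Sum>n\<in>?F. ?h n) \<le> Q * exp (Lam N 1)"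
        using hF unfolding Q_def t(3) exp_add[symmetric] by (simp add: algebra_simps)
      have "weight_prob N (\<lambda>\<pi>. longest_cycle N \<pi> \<in> Jl N) \<le> (2 * (\<eta> * real N) powr (- \<gamma> - 1) * Q) / (c * real N powr (- \<gamma> - 1))"
      proof (rule weight_prob_leI[OF N(1) _ _ c(1) _ qpos[OF N(1)]])
        show "(\<Sum>\<pi> | \<pi> permutes {1..N} \<and> longest_cycle N \<pi> \<in> Jl N. cycle_weight (\<theta> N) N \<pi>)
          \<le> fact N * (\<Sum>l\<in>{1..N} \<inter> Jl N. \<theta> N l / l * ?h (N - l))"
          by (rule sum_cycle_weight_longest_in_le[OF th0 N(1)])
        have "2 * (\<eta> * real N) powr (- \<gamma> - 1) * (\<Sum>n\<in>?F. ?h n) \<le> 2 * (\<eta> * real N) powr (- \<gamma> - 1) * (Q * exp (Lam N 1))"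
          by (intro mult_left_mono hF') simp
        then show "(\<Sum>l\<in>{1..N} \<inter> Jl N. \<theta> N l / l * ?h (N - l)) \<le> 2 * (\<eta> * real N) powr (- \<gamma> - 1) * Q * exp (Lam N 1)"
          using sumJ by (simp add: mult.assoc)
      qed (use elim in \<open>auto simp: Q_def\<close>)
      also have "\<dots> = D * Q" using N eta by (simp add: D_def powr_mult)
      also have "\<dots> < e" using elim by (simp add: Q_def)
      finally show ?case .
    qed
    then show "\<exists>n0. \<forall>n\<ge>n0. norm (weight_prob n (\<lambda>\<pi>. longest_cycle n \<pi> \<in> Jl n) - 0) < e"
      using weight_prob_nonneg unfolding eventually_sequentially by simp
  qed
  show ?thesis
  proof (rule Lim_null_comparison)
    show "(\<lambda>N. weight_prob N (\<lambda>\<pi>. longest_cycle N \<pi> \<le> M N) + weight_prob N (\<lambda>\<pi>. longest_cycle N \<pi> \<in> Jl N)) \<longlonglongrightarrow> 0"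
      using tendsto_add[OF part1 part2] by simp
    show "\<forall>\<^sub>F N in sequentially. norm (weight_prob N (\<lambda>\<pi>. real (longest_cycle N \<pi>) \<le> (1 - r 1 - \<delta>) * N))
      \<le> weight_prob N (\<lambda>\<pi>. longest_cycle N \<pi> \<le> M N) + weight_prob N (\<lambda>\<pi>. longest_cycle N \<pi> \<in> Jl N)"
    proof (intro always_eventually allI)
      fix N
      have "weight_prob N (\<lambda>\<pi>. real (longest_cycle N \<pi>) \<le> (1 - r 1 - \<delta>) * N) \<le> weight_prob N (\<lambda>\<pi>. longest_cycle N \<pi> \<le> M N \<or> longest_cycle N \<pi> \<in> Jl N)"
        by (rule weight_prob_mono) (auto simp: Jl_def \<nu>_def)
      then show "norm (weight_prob N (\<lambda>\<pi>. real (longest_cycle N \<pi>) \<le> (1 - r 1 - \<delta>) * N))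
        \<le> weight_prob N (\<lambda>\<pi>. longest_cycle N \<pi> \<le> M N) + weight_prob N (\<lambda>\<pi>. longest_cycle N \<pi> \<in> Jl N)"
        using weight_prob_disj_le[of N "\<lambda>\<pi>. longest_cycle N \<pi> \<le> M N" "\<lambda>\<pi>. longest_cycle N \<pi> \<in> Jl N"] weight_prob_nonneg by simp
    qed
  qed
qed

end

section \<open>Thermodynamic limit\<close>

lemma eventually_less_linear: "0 < c \<Longrightarrow> \<forall>\<^sub>F N in sequentially. real K < c * real N"
  by real_asymp

section \<open>Expected fractions and distribution functions in the abstract model\<close>

context cycle_weights
begin

definition weight_mean :: "nat \<Rightarrow> ((nat \<Rightarrow> nat) \<Rightarrow> real) \<Rightarrow> real" where
  "weight_mean N F = (\<Sum>\<pi> | \<pi> permutes {1..N}. F \<pi> * cycle_weight (\<theta> N) N \<pi>) / (fact N * cyc_coeff (\<theta> N) N)"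

lemma weight_mean_mono:
  assumes "\<And>\<pi>. \<pi> permutes {1..N} \<Longrightarrow> F \<pi> \<le> G \<pi>" shows "weight_mean N F \<le> weight_mean N G"
  unfolding weight_mean_def
  by (intro divide_right_mono sum_mono mult_right_mono mult_nonneg_nonneg cyc_coeff_theta_nonneg cycle_weight_nonneg th0)
    (use assms in auto)

lemma weight_mean_indicator: "weight_mean N (\<lambda>\<pi>. if E \<pi> then 1 else 0) = weight_prob N E"
proof -
  have "(\<Sum>\<pi> | \<pi> permutes {1..N}. (if E \<pi> then 1 else 0) * cycle_weight (\<theta> N) N \<pi>) =
    (\<Sum>\<pi>\<in>{\<pi>. \<pi> permutes {1..N}}. if E \<pi> then cycle_weight (\<theta> N) N \<pi> else 0)"
    by (intro sum.cong) auto
  also have "\<dots> = (\<Sum>\<pi> | \<pi> permutes {1..N} \<and> E \<pi>. cycle_weight (\<theta> N) N \<pi>)"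
    by (subst sum.inter_filter[symmetric]) (auto simp: finite_permutations)
  finally show ?thesis unfolding weight_mean_def weight_prob_def by simp
qed

lemma weight_mean_add: "weight_mean N (\<lambda>\<pi>. F \<pi> + G \<pi>) = weight_mean N F + weight_mean N G"
  unfolding weight_mean_def by (simp add: distrib_right sum.distrib add_divide_distrib)

lemma weight_mean_cmult: "weight_mean N (\<lambda>\<pi>. c * F \<pi>) = c * weight_mean N F"
  unfolding weight_mean_def by (simp add: sum_distrib_left mult.assoc)

lemma weight_mean_const: "N \<ge> 1 \<Longrightarrow> weight_mean N (\<lambda>\<pi>. c) = c"
  using cyc_coeff_theta_pos[of N] unfolding weight_mean_def sum_distrib_left[symmetric] sum_cycle_weight by simp

lemma weight_mean_le:
  assumes "N \<ge> 1" "\<And>\<pi>. \<pi> permutes {1..N} \<Longrightarrow> F \<pi> \<le> 1" "\<And>\<pi>. \<pi> permutes {1..N} \<Longrightarrow> \<not> E \<pi> \<Longrightarrow> F \<pi> \<le> u" "0 \<le> u"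
  shows "weight_mean N F \<le> u + weight_prob N E"
proof -
  have "weight_mean N F \<le> weight_mean N (\<lambda>\<pi>. u + (if E \<pi> then 1 else 0))"
  proof (rule weight_mean_mono)
    fix \<pi> assume p: "\<pi> permutes {1..N}"
    show "F \<pi> \<le> u + (if E \<pi> then 1 else 0)"
      using assms(2)[OF p] assms(3)[OF p] assms(4) by (cases "E \<pi>") auto
  qed
  then show ?thesis using assms(1) by (simp add: weight_mean_add weight_mean_const weight_mean_indicator)
qed

lemma weight_mean_ge:
  assumes "N \<ge> 1" "\<And>\<pi>. \<pi> permutes {1..N} \<Longrightarrow> 0 \<le> F \<pi>" "\<And>\<pi>. \<pi> permutes {1..N} \<Longrightarrow> \<not> E \<pi> \<Longrightarrow> u \<le> F \<pi>"
  shows "u - u * weight_prob N E \<le> weight_mean N F"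
proof -
  have "weight_mean N (\<lambda>\<pi>. u + (- u) * (if E \<pi> then 1 else 0)) \<le> weight_mean N F"
    by (rule weight_mean_mono) (use assms in auto)
  then show ?thesis using assms(1) unfolding weight_mean_add weight_mean_cmult weight_mean_indicator by (simp add: weight_mean_const)
qed

lemma weight_prob_compl: "N \<ge> 1 \<Longrightarrow> weight_prob N E = 1 - weight_prob N (\<lambda>\<pi>. \<not> E \<pi>)"
proof -
  assume N: "N \<ge> 1"
  have "(\<lambda>\<pi>. (if E \<pi> then 1 else 0) + (if \<not> E \<pi> then 1 else 0)) = (\<lambda>\<pi> :: nat \<Rightarrow> nat. 1 :: real)" by auto
  then show ?thesis
    using weight_mean_add[of N "\<lambda>\<pi>. if E \<pi> then 1 else 0" "\<lambda>\<pi>. if \<not> E \<pi> then 1 else 0"] weight_mean_const[OF N, of 1]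
    unfolding weight_mean_indicator by simp
qed

abbreviation long_fraction :: "nat \<Rightarrow> nat \<Rightarrow> real" where
  "long_fraction K N \<equiv> weight_mean N (\<lambda>\<pi>. real (points_in_long_cycles N \<pi> K) / real N)"

lemma long_fraction_le:
  fixes u :: real
  assumes "(\<lambda>N. weight_prob N (\<lambda>\<pi>. real N - real (points_in_long_cycles N \<pi> K) \<le> (1 - u) * N)) \<longlonglongrightarrow> 0" "0 \<le> u"
  shows "liminf (\<lambda>N. ereal (long_fraction K N)) \<le> ereal u"
proof -
  have "\<forall>\<^sub>F N in sequentially. long_fraction K N \<le> u + weight_prob N (\<lambda>\<pi>. real N - real (points_in_long_cycles N \<pi> K) \<le> (1 - u) * N)"
    using eventually_ge_at_top[of 1]
  proof eventually_elim
    case (elim N)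
    show ?case
    proof (rule weight_mean_le)
      fix \<pi> assume p: "\<pi> permutes {1..N}"
      show "real (points_in_long_cycles N \<pi> K) / real N \<le> 1"
        using points_in_long_cycles_le[OF p, of K] elim by simp
      assume "\<not> real N - real (points_in_long_cycles N \<pi> K) \<le> (1 - u) * N"
      then show "real (points_in_long_cycles N \<pi> K) / real N \<le> u" using elim by (simp add: divide_le_eq algebra_simps)
    qed (use elim assms in auto)
  qed
  then have "liminf (\<lambda>N. ereal (long_fraction K N)) \<le> liminf (\<lambda>N. ereal (u + weight_prob N (\<lambda>\<pi>. real N - real (points_in_long_cycles N \<pi> K) \<le> (1 - u) * N)))"
    by (intro Liminf_mono) simp
  also have "\<dots> = ereal (u + 0)"
    by (intro lim_imp_Liminf tendsto_intros assms) simp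
  finally show ?thesis by simp
qed

lemma long_fraction_mono: "K \<le> K' \<Longrightarrow> long_fraction K' N \<le> long_fraction K N"
proof (rule weight_mean_mono)
  fix \<pi> assume "K \<le> K'"
  then have "points_in_long_cycles N \<pi> K' \<le> points_in_long_cycles N \<pi> K"
    unfolding points_in_long_cycles_eq by (intro sum_mono2) auto
  then show "real (points_in_long_cycles N \<pi> K') / real N \<le> real (points_in_long_cycles N \<pi> K) / real N"
    by (intro divide_right_mono) auto
qed

lemma long_fraction_nonneg: "0 \<le> long_fraction K N"
  unfolding weight_mean_def by (intro divide_nonneg_nonneg sum_nonneg mult_nonneg_nonneg cyc_coeff_theta_nonneg cycle_weight_nonneg th0) auto

text \<open>Above criticality the longest cycle alone supplies the lower bound for every
  \<open>K\<close>, since its length eventually exceeds \<open>K\<close>; the upper bound is the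
  mass that short cycles must hold. Otherwise short cycles hold almost everything, and monotonicity
  in \<open>K\<close> extends this from one \<open>K\<close> to all larger ones.\<close>

lemma long_fraction_limit: "(\<lambda>K. liminf (\<lambda>N. ereal (long_fraction K N))) \<longlonglongrightarrow> ereal (max 0 (1 - r 1))"
proof (cases "r 1 < 1")
  case True
  have lower: "ereal (1 - r 1) \<le> liminf (\<lambda>N. ereal (long_fraction K N))" for K
  proof (rule ereal_le_epsilon2)
    fix e :: real assume e: "0 < e"
    \<comment> \<open>Capped at half of \<open>1 - r 1\<close> so that the threshold stays positive
      and a cycle above it is eventually longer than \<open>K\<close>.\<close>
    define \<delta> where "\<delta> = min e ((1 - r 1) / 2)"
    have d: "\<delta> > 0" "\<delta> \<le> e" "\<delta> < 1 - r 1" using e True by (auto simp: \<delta>_def min_def field_simps)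
    let ?b = "1 - r 1 - \<delta>"
    note P = longest_cycle_lower[OF True d(1)]
    have "\<forall>\<^sub>F N in sequentially. real K < ?b * real N" by (rule eventually_less_linear) (use d in simp)
    then have "\<forall>\<^sub>F N in sequentially. ?b - ?b * weight_prob N (\<lambda>\<pi>. real (longest_cycle N \<pi>) \<le> ?b * N) \<le> long_fraction K N"
      using eventually_ge_at_top[of 1]
    proof eventually_elim
      case (elim N)
      show ?case
      proof (rule weight_mean_ge)
        fix \<pi> assume p: "\<pi> permutes {1..N}" and "\<not> real (longest_cycle N \<pi>) \<le> ?b * N"
        then have l: "?b * N < real (longest_cycle N \<pi>)" by simp
        then have "K < longest_cycle N \<pi>" using elim by linarith
        then have "real (longest_cycle N \<pi>) \<le> real (points_in_long_cycles N \<pi> K)"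
          using longest_cycle_le_points_in_long_cycles[OF p, of K] elim by simp
        then show "?b \<le> real (points_in_long_cycles N \<pi> K) / real N" using l elim by (simp add: le_divide_eq)
      qed (use elim in auto)
    qed
    then have "liminf (\<lambda>N. ereal (?b - ?b * weight_prob N (\<lambda>\<pi>. real (longest_cycle N \<pi>) \<le> ?b * N))) \<le> liminf (\<lambda>N. ereal (long_fraction K N))"
      by (intro Liminf_mono) simp
    moreover have "liminf (\<lambda>N. ereal (?b - ?b * weight_prob N (\<lambda>\<pi>. real (longest_cycle N \<pi>) \<le> ?b * N))) = ereal (?b - ?b * 0)"
      by (intro lim_imp_Liminf tendsto_intros P) simp
    ultimately have "ereal ?b \<le> liminf (\<lambda>N. ereal (long_fraction K N))" by simp
    then have "ereal ?b + ereal e \<le> liminf (\<lambda>N. ereal (long_fraction K N)) + ereal e" by (rule add_right_mono)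
    moreover have "ereal (1 - r 1) \<le> ereal ?b + ereal e" using d by simp
    ultimately show "ereal (1 - r 1) \<le> liminf (\<lambda>N. ereal (long_fraction K N)) + ereal e" by (rule order_trans[rotated])
  qed
  \<comment> \<open>The deviation \<open>1 / (K + 1)\<close> is positive for each \<open>K\<close>
    and vanishes in the limit, so one statement covers all \<open>K\<close>.\<close>
  have upper: "liminf (\<lambda>N. ereal (long_fraction K N)) \<le> ereal (1 - rK K 1 + 1 / (real K + 1))" for K
  proof (rule long_fraction_le)
    have "rK K 1 \<le> r 1"
    proof (rule incseq_le)
      show "incseq (\<lambda>K. rK K 1)" unfolding rK_def by (intro incseq_SucI) (simp add: J0)
      show "(\<lambda>K. rK K 1) \<longlonglongrightarrow> r 1" by (rule rK_tendsto) simp_all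
    qed
    then show "0 \<le> 1 - rK K 1 + 1 / (real K + 1)" using True by (simp add: add_nonneg_nonneg)
    have "1 - (1 - rK K 1 + 1 / (real K + 1)) = rK K 1 - 1 / (real K + 1)" by simp
    then show "(\<lambda>N. weight_prob N (\<lambda>\<pi>. real N - real (points_in_long_cycles N \<pi> K) \<le> (1 - (1 - rK K 1 + 1 / (real K + 1))) * N)) \<longlonglongrightarrow> 0"
      using short_cycles_lower_sup[OF True, of "1 / (real K + 1)" K] by simp
  qed
  have lim: "(\<lambda>K. ereal (1 - rK K 1 + 1 / (real K + 1))) \<longlonglongrightarrow> ereal (1 - r 1)"
  proof -
    have "(\<lambda>K. 1 / (real K + 1)) \<longlonglongrightarrow> 0" by real_asymp
    then have "(\<lambda>K. 1 - rK K 1 + 1 / (real K + 1)) \<longlonglongrightarrow> 1 - r 1 + 0" using rK_tendsto[of 1] by (intro tendsto_intros) auto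
    then show ?thesis by simp
  qed
  have "(\<lambda>K. liminf (\<lambda>N. ereal (long_fraction K N))) \<longlonglongrightarrow> ereal (1 - r 1)"
    by (rule tendsto_sandwich[of "\<lambda>_. ereal (1 - r 1)", OF always_eventually always_eventually _ lim]) (use lower upper in auto)
  then show ?thesis using True by simp
next
  case False
  have nn: "0 \<le> liminf (\<lambda>N. ereal (long_fraction K N))" for K
    by (rule Liminf_bounded) (simp add: long_fraction_nonneg)
  have "(\<lambda>K. liminf (\<lambda>N. ereal (long_fraction K N))) \<longlonglongrightarrow> 0"
  proof (rule order_tendstoI)
    fix x :: ereal assume "x < 0"
    then show "\<forall>\<^sub>F K in sequentially. x < liminf (\<lambda>N. ereal (long_fraction K N))"
      using nn by (intro always_eventually allI) (rule less_le_trans)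
  next
    fix x :: ereal assume x: "0 < x"
    obtain e where e: "0 < e" "e < 1" "ereal e < x"
    proof -
      obtain e' :: real where e': "0 < ereal e'" "ereal e' < x" using ereal_dense2[OF x] by auto
      have "ereal (min e' (1 / 2)) \<le> ereal e'" by simp
      then have "ereal (min e' (1 / 2)) < x" using e'(2) by (rule le_less_trans)
      then show ?thesis using e'(1) by (intro that[of "min e' (1 / 2)"]) auto
    qed
    obtain K where K: "(\<lambda>N. weight_prob N (\<lambda>\<pi>. real N - real (points_in_long_cycles N \<pi> K) \<le> (1 - e) * N)) \<longlonglongrightarrow> 0"
      using short_cycles_lower_sub[of e] False e by auto
    have "liminf (\<lambda>N. ereal (long_fraction K' N)) < x" if "K \<le> K'" for K'
    proof -
      have "liminf (\<lambda>N. ereal (long_fraction K' N)) \<le> liminf (\<lambda>N. ereal (long_fraction K N))"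
        using long_fraction_mono[OF that] by (intro Liminf_mono always_eventually allI) simp
      also have "\<dots> \<le> ereal e" by (rule long_fraction_le[OF K]) (use e in simp)
      finally show ?thesis using e(3) by (rule le_less_trans)
    qed
    then show "\<forall>\<^sub>F K in sequentially. liminf (\<lambda>N. ereal (long_fraction K N)) < x"
      by (rule eventually_sequentiallyI)
  qed
  then show ?thesis using False by (simp add: zero_ereal_def)
qed

text \<open>Below 1 this is the lower bound on the longest cycle. Above 1, a longest cycle exceeding
  \<open>x * \<nu> * N\<close> would itself put more points into long cycles than the short ones
  leave.\<close>

lemma longest_cycle_cdf_limit:
  assumes rc: "r 1 < 1"
  defines "\<nu> \<equiv> 1 - r 1"
  shows "x < 1 \<Longrightarrow> (\<lambda>N. weight_prob N (\<lambda>\<pi>. real (longest_cycle N \<pi>) / (\<nu> * real N) \<le> x)) \<longlonglongrightarrow> 0"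
    and "1 < x \<Longrightarrow> (\<lambda>N. weight_prob N (\<lambda>\<pi>. real (longest_cycle N \<pi>) / (\<nu> * real N) \<le> x)) \<longlonglongrightarrow> 1"
proof -
  have nu: "\<nu> > 0" using rc by (simp add: \<nu>_def)
  assume x: "x < 1"
  have "(\<lambda>N. weight_prob N (\<lambda>\<pi>. real (longest_cycle N \<pi>) \<le> (1 - r 1 - \<nu> * (1 - x)) * N)) \<longlonglongrightarrow> 0"
    by (rule longest_cycle_lower[OF rc]) (use nu x in simp)
  moreover have "1 - r 1 - \<nu> * (1 - x) = x * \<nu>" by (simp add: \<nu>_def algebra_simps)
  ultimately have *: "(\<lambda>N. weight_prob N (\<lambda>\<pi>. real (longest_cycle N \<pi>) \<le> x * \<nu> * N)) \<longlonglongrightarrow> 0" by simp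
  have "\<forall>\<^sub>F N in sequentially. weight_prob N (\<lambda>\<pi>. real (longest_cycle N \<pi>) \<le> x * \<nu> * N) = weight_prob N (\<lambda>\<pi>. real (longest_cycle N \<pi>) / (\<nu> * real N) \<le> x)"
    using eventually_ge_at_top[of 1]
    by eventually_elim (use nu in \<open>simp add: pos_divide_le_eq mult.assoc\<close>)
  then show "(\<lambda>N. weight_prob N (\<lambda>\<pi>. real (longest_cycle N \<pi>) / (\<nu> * real N) \<le> x)) \<longlonglongrightarrow> 0"
    using * by (rule Lim_transform_eventually[rotated])
next
  have nu: "\<nu> > 0" using rc by (simp add: \<nu>_def)
  assume x: "1 < x"
  \<comment> \<open>Half of the excess: one \<epsilon> pays for replacing \<open>r 1\<close> by
    \<open>rK K 1\<close>, the other is the deviation of the short cycles.\<close>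
  define \<epsilon> where "\<epsilon> = (x - 1) * \<nu> / 2"
  have e: "\<epsilon> > 0" using x nu by (simp add: \<epsilon>_def)
  have "\<forall>\<^sub>F K in sequentially. r 1 - \<epsilon> < rK K 1"
    using rK_tendsto[of 1] e by (intro order_tendstoD(1)) auto
  then obtain K where K: "r 1 - \<epsilon> < rK K 1" by (auto simp: eventually_sequentially)
  have xn: "1 - x * \<nu> \<le> rK K 1 - \<epsilon>" using K by (simp add: \<epsilon>_def \<nu>_def field_simps)
  note P = short_cycles_lower_sup[OF rc e, of K]
  have "(\<lambda>N. weight_prob N (\<lambda>\<pi>. \<not> real (longest_cycle N \<pi>) / (\<nu> * real N) \<le> x)) \<longlonglongrightarrow> 0"
  proof (rule Lim_null_comparison[OF _ P])
    have "\<forall>\<^sub>F N in sequentially. real K < x * \<nu> * real N" by (rule eventually_less_linear) (use x nu in simp)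
    then show "\<forall>\<^sub>F N in sequentially. norm (weight_prob N (\<lambda>\<pi>. \<not> real (longest_cycle N \<pi>) / (\<nu> * real N) \<le> x))
      \<le> weight_prob N (\<lambda>\<pi>. real N - real (points_in_long_cycles N \<pi> K) \<le> (rK K 1 - \<epsilon>) * real N)"
      using eventually_ge_at_top[of 1]
    proof eventually_elim
      case (elim N)
      have "weight_prob N (\<lambda>\<pi>. \<not> real (longest_cycle N \<pi>) / (\<nu> * real N) \<le> x) \<le> weight_prob N (\<lambda>\<pi>. real N - real (points_in_long_cycles N \<pi> K) \<le> (rK K 1 - \<epsilon>) * real N)"
      proof (rule weight_prob_mono)
        fix \<pi> assume p: "\<pi> permutes {1..N}" and "\<not> real (longest_cycle N \<pi>) / (\<nu> * real N) \<le> x"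
        then have l: "x * \<nu> * N < real (longest_cycle N \<pi>)" using nu elim by (simp add: pos_divide_le_eq mult.assoc)
        then have "K < longest_cycle N \<pi>" using elim by linarith
        then have "real (longest_cycle N \<pi>) \<le> real (points_in_long_cycles N \<pi> K)"
          using longest_cycle_le_points_in_long_cycles[OF p, of K] elim by simp
        then have "real N - real (points_in_long_cycles N \<pi> K) \<le> (1 - x * \<nu>) * N" using l by (simp add: algebra_simps)
        also have "\<dots> \<le> (rK K 1 - \<epsilon>) * N" by (intro mult_right_mono xn) simp
        finally show "real N - real (points_in_long_cycles N \<pi> K) \<le> (rK K 1 - \<epsilon>) * N" .
      qed
      then show ?case using weight_prob_nonneg by simp
    qed
  qed
  then have *: "(\<lambda>N. 1 - weight_prob N (\<lambda>\<pi>. \<not> real (longest_cycle N \<pi>) / (\<nu> * real N) \<le> x)) \<longlonglongrightarrow> 1 - 0" by (intro tendsto_intros)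
  have "\<forall>\<^sub>F N in sequentially. 1 - weight_prob N (\<lambda>\<pi>. \<not> real (longest_cycle N \<pi>) / (\<nu> * real N) \<le> x) = weight_prob N (\<lambda>\<pi>. real (longest_cycle N \<pi>) / (\<nu> * real N) \<le> x)"
    using eventually_ge_at_top[of 1] by eventually_elim (rule weight_prob_compl[symmetric])
  then show "(\<lambda>N. weight_prob N (\<lambda>\<pi>. real (longest_cycle N \<pi>) / (\<nu> * real N) \<le> x)) \<longlonglongrightarrow> 1"
    using * by (simp add: Lim_transform_eventually)
qed

end

section \<open>Convergence in distribution to a constant\<close>

lemma cdf_return_borel: "cdf (return borel a) x = (if a \<le> x then 1 else 0)"
  for a x :: real
  by (simp add: cdf_def measure_return indicator_def)

text \<open>Weak convergence tests only continuity points of the limit. The distribution function of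
  a point mass jumps at \<open>a\<close>, as the sequence \<open>a - 1 / (n + 1)\<close> shows, so
  only the two sides of \<open>a\<close> need to be checked.\<close>

lemma weak_conv_m_returnI:
  fixes a :: real
  assumes "\<And>x. x < a \<Longrightarrow> (\<lambda>n. cdf (M n) x) \<longlonglongrightarrow> 0" "\<And>x. a < x \<Longrightarrow> (\<lambda>n. cdf (M n) x) \<longlonglongrightarrow> 1"
  shows "weak_conv_m M (return borel a)"
  unfolding weak_conv_m_def weak_conv_def
proof (intro allI impI)
  fix x assume c: "isCont (cdf (return borel a)) x"
  have "x \<noteq> a"
  proof
    assume "x = a"
    have "(\<lambda>n. 1 / real (Suc n)) \<longlonglongrightarrow> 0"
      using LIMSEQ_inverse_real_of_nat by (simp only: inverse_eq_divide)
    from tendsto_diff[OF tendsto_const[of a] this]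
    have X: "(\<lambda>n. a - 1 / real (Suc n)) \<longlonglongrightarrow> a" by (simp only: diff_zero)
    have "isCont (cdf (return borel a)) a" using c by (simp only: \<open>x = a\<close>)
    from isCont_tendsto_compose[OF this X]
    have "(\<lambda>n :: nat. 0 :: real) \<longlonglongrightarrow> 1" by (simp add: cdf_return_borel)
    then have "(0 :: real) = 1" by (rule LIMSEQ_unique[OF tendsto_const])
    then show False by simp
  qed
  then show "(\<lambda>n. cdf (M n) x) \<longlonglongrightarrow> cdf (return borel a) x"
    using assms[of x] by (cases "x < a") (auto simp: cdf_return_borel)
qed

lemma stretched_exp_tendsto_0:
  "c > 0 \<Longrightarrow> q > 0 \<Longrightarrow> (\<lambda>N. C * real N * exp (- (c * (real N powr q - 1)))) \<longlonglongrightarrow> 0"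
proof -
  assume "c > 0" "q > 0"
  then have "(\<lambda>N. real N * exp (- (c * (real N powr q - 1)))) \<longlonglongrightarrow> 0" by real_asymp
  then have "(\<lambda>N. C * (real N * exp (- (c * (real N powr q - 1))))) \<longlonglongrightarrow> 0" by (rule tendsto_mult_right_zero)
  then show ?thesis by (simp add: mult.assoc)
qed

section \<open>The spatial model as an instance of the abstract weights\<close>

locale thermo = jump \<xi> for \<xi> :: "real ^ 'd \<Rightarrow> ereal" +
  fixes \<rho> \<gamma> :: real and \<alpha> :: "nat \<Rightarrow> real" and c :: "real \<Rightarrow> real ^ 'd"
  assumes rho: "\<rho> > 0" and gam: "\<gamma> > 0" and alpha: "\<And>j. j \<ge> 1 \<Longrightarrow> \<alpha> j = \<gamma> * ln (real j)"
begin

definition side :: "nat \<Rightarrow> real" where "side N = root CARD('d) (real N / \<rho>)"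

text \<open>Cutting at 0 secures nonnegativity for every N, also when the box is too small for the
  trace formula. Eventually the cut is inactive, because the zero mode contributes 1 to the lattice
  sum.\<close>

definition excited_sum :: "nat \<Rightarrow> nat \<Rightarrow> real" where "excited_sum N l = max 0 (lattice_sum \<xi> (side N) l - 1)"

text \<open>Lattice sums scale with the volume, whereas the abstract model divides by the number of
  points; the ratio of the two is \<rho>.\<close>

definition excited_density :: "nat \<Rightarrow> real" where "excited_density l = (LINT k|lborel. fw k ^ l) / \<rho>"

lemma side_power: "side N ^ CARD('d) = real N / \<rho>"
  unfolding side_def using rho by (intro real_root_pow_pos2) auto

lemma side_powr: "N \<ge> 1 \<Longrightarrow> side N = (real N / \<rho>) powr (1 / real CARD('d))"
  unfolding side_def using rho by (intro root_powr_inverse) auto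

lemma side_at_top: "filterlim side at_top sequentially"
proof -
  have "filterlim (\<lambda>N. (real N / \<rho>) powr (1 / real CARD('d))) at_top sequentially"
  proof -
    have "1 / real CARD('d) > 0" by simp
    then show ?thesis using rho by real_asymp
  qed
  then show ?thesis
    by (rule filterlim_mono_eventually[OF _ order_refl order_refl])
      (use side_powr in \<open>auto simp: eventually_sequentially intro!: exI[of _ 1]\<close>)
qed

lemma eventually_side: "(\<forall>\<^sub>F L in at_top. P L) \<Longrightarrow> \<forall>\<^sub>F N in sequentially. P (side N)"
  using side_at_top by (simp add: filterlim_iff)

lemma eventually_box: "\<forall>\<^sub>F N in sequentially. jump_box \<xi> (side N)"
  by (rule eventually_side[OF eventually_jump_box])

lemma eventually_excited_sum: "\<forall>\<^sub>F N in sequentially. \<forall>l\<ge>1. excited_sum N l = lattice_sum \<xi> (side N) l - 1"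
  using eventually_box
proof eventually_elim
  case (elim N)
  then show ?case using jump_box.lattice_sum_ge_1[OF elim] by (auto simp: excited_sum_def)
qed

lemma excited_sum_mean_tendsto: "l \<ge> 1 \<Longrightarrow> (\<lambda>N. excited_sum N l / N) \<longlonglongrightarrow> excited_density l"
proof -
  assume l: "l \<ge> 1"
  have "(\<lambda>N. lattice_sum \<xi> (side N) l / side N ^ CARD('d) / \<rho> - 1 / real N) \<longlonglongrightarrow> excited_density l - 0"
    unfolding excited_density_def by (intro tendsto_diff tendsto_divide lattice_sum_tendsto[OF side_at_top l] tendsto_const lim_1_over_n) (use rho in simp)
  moreover have "\<forall>\<^sub>F N in sequentially. lattice_sum \<xi> (side N) l / side N ^ CARD('d) / \<rho> - 1 / real N = excited_sum N l / N"
    using eventually_excited_sum eventually_ge_at_top[of 1]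
  proof eventually_elim
    case (elim N)
    then show ?case using l rho by (simp add: side_power diff_divide_distrib)
  qed
  ultimately show ?thesis by (simp add: Lim_transform_eventually)
qed

lemma excited_sum_sum_bound: "\<exists>C :: real. \<forall>\<^sub>F N in sequentially. \<forall>R. (\<Sum>l=1..R. excited_sum N l) \<le> C * N"
proof -
  obtain C where C: "\<forall>\<^sub>F L in at_top. \<forall>R. (\<Sum>l=1..R. lattice_sum \<xi> L l - 1) \<le> C * L ^ CARD('d)"
    using sum_lattice_sum_bound ..
  have "\<forall>\<^sub>F N in sequentially. \<forall>R. (\<Sum>l=1..R. excited_sum N l) \<le> C / \<rho> * N"
    using eventually_side[OF C] eventually_excited_sum
  proof eventually_elim
    case (elim N)
    show ?case
    proof
      fix R
      have "(\<Sum>l=1..R. excited_sum N l) = (\<Sum>l=1..R. lattice_sum \<xi> (side N) l - 1)" using elim by (intro sum.cong) auto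
      also have "\<dots> \<le> C * side N ^ CARD('d)" using elim by blast
      finally show "(\<Sum>l=1..R. excited_sum N l) \<le> C / \<rho> * N" by (simp add: side_power)
    qed
  qed
  then show ?thesis ..
qed

text \<open>The gap is of order \<open>N powr (- \<beta>)\<close> with
  \<open>\<beta> = \<eta> / d < 1\<close>. With \<open>q = (1 - \<beta>) / 2\<close>, a length of at
  least \<open>N powr (1 - q)\<close> makes gap times length at least of order
  \<open>N powr q\<close>, and the stretched exponential beats the linear prefactor.\<close>

lemma excited_sum_decay: "\<exists>\<kappa>>0. \<forall>\<^sub>F N in sequentially. \<forall>l. real N powr (1 - \<kappa>) \<le> real l \<longrightarrow> excited_sum N l \<le> 1"
proof -
  obtain C c' \<eta> where e: "0 < c'" "0 < \<eta>" "\<eta> < real CARD('d)"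
    and dec: "\<forall>\<^sub>F L in at_top. \<forall>l\<ge>1. lattice_sum \<xi> L l - 1 \<le> C * L ^ CARD('d) * exp (- (c' * L powr (- \<eta>)) * real (l - 1))"
    using lattice_sum_exp_decay by (elim exE conjE)
  define \<beta> where "\<beta> = \<eta> / real CARD('d)"
  have b: "0 < \<beta>" "\<beta> < 1" using e by (auto simp: \<beta>_def)
  define q where "q = (1 - \<beta>) / 2"
  have q: "q > 0" using b by (simp add: q_def)
  define c1 where "c1 = c' * (1 / \<rho>) powr (- \<beta>)"
  have c1: "c1 > 0" using e rho by (simp add: c1_def)
  have "\<forall>\<^sub>F N in sequentially. \<bar>C\<bar> / \<rho> * real N * exp (- (c1 * (real N powr q - 1))) < 1"
    by (rule order_tendstoD(2)[OF stretched_exp_tendsto_0[OF c1 q]]) simp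
  then have "\<forall>\<^sub>F N in sequentially. \<forall>l. real N powr (1 - q) \<le> real l \<longrightarrow> excited_sum N l \<le> 1"
    using eventually_side[OF dec] eventually_excited_sum eventually_ge_at_top[of 1]
  proof eventually_elim
    case (elim N)
    have N: "real N \<ge> 1" using elim by simp
    have sl: "side N powr (- \<eta>) = real N powr (- \<beta>) * (1 / \<rho>) powr (- \<beta>)"
    proof -
      have "side N powr (- \<eta>) = (real N * (1 / \<rho>)) powr (- \<beta>)"
        using side_powr[of N] elim by (simp add: powr_powr \<beta>_def)
      also have "\<dots> = real N powr (- \<beta>) * (1 / \<rho>) powr (- \<beta>)" using rho by (intro powr_mult)
      finally show ?thesis .
    qed
    show ?case
    proof (intro allI impI)
      fix l :: nat assume l: "real N powr (1 - q) \<le> real l"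
      have "1 \<le> real N powr (1 - q)" using N b by (intro ge_one_powr_ge_zero) (auto simp: q_def)
      then have l1: "l \<ge> 1" using l by simp
      have "real N powr q - 1 \<le> real N powr (- \<beta>) * real (l - 1)"
      proof -
        have "real N powr q = real N powr (- \<beta>) * real N powr (1 - q)"
          unfolding powr_add[symmetric] by (simp add: q_def field_simps)
        also have "\<dots> \<le> real N powr (- \<beta>) * (real (l - 1) + 1)" using l l1 by (intro mult_left_mono) auto
        also have "\<dots> = real N powr (- \<beta>) * real (l - 1) + real N powr (- \<beta>)" by (simp add: algebra_simps)
        finally have "real N powr q \<le> real N powr (- \<beta>) * real (l - 1) + real N powr (- \<beta>)" .
        moreover have "real N powr (- \<beta>) \<le> real N powr 0" using N b by (intro powr_mono) auto
        then have "real N powr (- \<beta>) \<le> 1" using N by simp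
        ultimately show ?thesis by linarith
      qed
      then have "c1 * (real N powr q - 1) \<le> c1 * (real N powr (- \<beta>) * real (l - 1))" using c1 by (intro mult_left_mono) auto
      also have "\<dots> = c' * side N powr (- \<eta>) * real (l - 1)" unfolding sl c1_def by (simp add: mult_ac)
      finally have weight_mean: "exp (- (c' * side N powr (- \<eta>)) * real (l - 1)) \<le> exp (- (c1 * (real N powr q - 1)))" by simp
      have "excited_sum N l = lattice_sum \<xi> (side N) l - 1" using elim l1 by blast
      also have "\<dots> \<le> C * side N ^ CARD('d) * exp (- (c' * side N powr (- \<eta>)) * real (l - 1))" using elim l1 by blast
      also have "\<dots> \<le> (\<bar>C\<bar> / \<rho> * real N) * exp (- (c1 * (real N powr q - 1)))"
      proof (rule mult_mono[OF _ weight_mean])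
        have "C * (real N / \<rho>) \<le> \<bar>C\<bar> * (real N / \<rho>)" using rho by (intro mult_right_mono) auto
        then show "C * side N ^ CARD('d) \<le> \<bar>C\<bar> / \<rho> * real N" by (simp add: side_power)
      qed (use rho in auto)
      finally show "excited_sum N l \<le> 1" using elim by simp
    qed
  qed
  then show ?thesis using q by blast
qed

lemma cycle_weights_ex: "\<exists>C \<kappa>. cycle_weights \<gamma> C \<kappa> excited_sum excited_density"
proof -
  obtain C :: real where C: "\<forall>\<^sub>F N in sequentially. \<forall>R. (\<Sum>l=1..R. excited_sum N l) \<le> C * N" using excited_sum_sum_bound ..
  obtain \<kappa> where k: "\<kappa> > 0" "\<forall>\<^sub>F N in sequentially. \<forall>l. real N powr (1 - \<kappa>) \<le> real l \<longrightarrow> excited_sum N l \<le> 1"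
    using excited_sum_decay by auto
  have "cycle_weights \<gamma> C \<kappa> excited_sum excited_density"
  proof
    show "0 \<le> excited_density l" for l unfolding excited_density_def using rho fw_pos
      by (intro divide_nonneg_nonneg integral_nonneg_AE) (auto simp: less_imp_le)
    show "0 \<le> excited_sum N l" for N l by (simp add: excited_sum_def)
  qed (rule gam k C excited_sum_mean_tendsto; assumption?)+
  then show ?thesis by blast
qed

lemma thermo_measure_eq: "thermo_measure \<xi> \<alpha> c \<rho> N = spatial_permutation \<xi> \<alpha> (c (side N)) (side N) N"
  by (simp add: thermo_measure_def side_def Let_def)

end

text \<open>The constants \<open>C\<close> and \<kappa> come from an existence statement, so they
  are parameters here and are fixed only after being obtained for the given model.\<close>

locale thermo_weights = thermo \<xi> \<rho> \<gamma> \<alpha> c + cycle_weights \<gamma> C \<kappa> excited_sum excited_density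
  for \<xi> :: "real ^ 'd \<Rightarrow> ereal" and \<rho> \<gamma> \<alpha> c C \<kappa>
begin

lemma theta_eq:
  assumes "jump_box \<xi> (side N)" and l: "l \<ge> 1"
  shows "jump_box.theta \<xi> (side N) \<alpha> l = \<theta> N l"
proof -
  have "exp (- \<alpha> l) = real l powr (- \<gamma>)" using alpha[OF l] l by (simp add: powr_def)
  moreover have "lattice_sum \<xi> (side N) l = 1 + excited_sum N l"
    using jump_box.lattice_sum_ge_1[OF assms] by (simp add: excited_sum_def)
  ultimately show ?thesis by (simp add: jump_box.theta_def[OF assms(1)] \<theta>_def)
qed

lemma cycle_weight_eq:
  assumes "jump_box \<xi> (side N)" and p: "\<pi> permutes {1..N}"
  shows "cycle_weight (jump_box.theta \<xi> (side N) \<alpha>) N \<pi> = cycle_weight (\<theta> N) N \<pi>"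
  unfolding cycle_weight_def by (intro prod.cong refl theta_eq[OF assms(1)] card_cycle_ge_1[OF p])

lemma cyc_coeff_eq:
  assumes "jump_box \<xi> (side N)"
  shows "cyc_coeff (jump_box.theta \<xi> (side N) \<alpha>) N = cyc_coeff (\<theta> N) N"
  by (intro cyc_coeff_cong theta_eq[OF assms])

lemma cdf_thermo:
  assumes "jump_box \<xi> (side N)" "N \<ge> 1"
  shows "cdf (distr (thermo_measure \<xi> \<alpha> c \<rho> N) borel (\<lambda>(x, \<pi>). X \<pi>)) y = weight_prob N (\<lambda>\<pi>. X \<pi> \<le> y)"
  unfolding thermo_measure_eq jump_box.cdf_spatial_permutation[OF assms] jump_box.perm_prob_def[OF assms(1)] weight_prob_def cyc_coeff_eq[OF assms(1)]
  by (intro arg_cong2[where f = "(/)"] refl sum.cong cycle_weight_eq[OF assms(1)]) simp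

lemma integral_thermo:
  assumes "jump_box \<xi> (side N)" "N \<ge> 1" "\<And>\<pi>. 0 \<le> F \<pi>"
  shows "(LINT (x, \<pi>)|thermo_measure \<xi> \<alpha> c \<rho> N. F \<pi>) = weight_mean N F"
  unfolding thermo_measure_eq jump_box.integral_spatial_permutation[where F = F, OF assms] weight_mean_def cyc_coeff_eq[OF assms(1)]
  by (intro arg_cong2[where f = "(/)"] refl sum.cong arg_cong2[where f = "(*)"] cycle_weight_eq[OF assms(1)]) simp

lemma fraction_above_eq: "fraction_above \<xi> \<alpha> c \<rho> K = liminf (\<lambda>N. ereal (long_fraction K N))"
  unfolding fraction_above_def
proof (rule Liminf_eq)
  show "\<forall>\<^sub>F N in sequentially. ereal (LINT (x, \<pi>)|thermo_measure \<xi> \<alpha> c \<rho> N. real (points_in_long_cycles N \<pi> K) / real N) = ereal (long_fraction K N)"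
    using eventually_box eventually_ge_at_top[of 1]
    by eventually_elim (simp add: integral_thermo)
qed

text \<open>The factor \<open>1 / \<rho>\<close> leaves the series only once the undivided series is
  known to converge; this follows from the summability of \<open>r\<close> at 1.\<close>

lemma r_1_eq: "r 1 = critical_density \<xi> \<alpha> / \<rho>"
proof -
  have t: "real (Suc j) powr (- \<gamma>) * excited_density (Suc j) * 1 ^ Suc j = exp (- \<alpha> (Suc j)) * (LINT k|lborel. exp (- (real (Suc j) * dispersion \<xi> k))) / \<rho>" for j
    unfolding excited_density_def exp_dispersion_power using alpha[of "Suc j"] by (simp add: powr_def del: power_Suc of_nat_Suc)
  have "summable (\<lambda>j. (real (Suc j) powr (- \<gamma>) * excited_density (Suc j) * 1 ^ Suc j) * \<rho>)"
    by (intro summable_mult2 summable_r) auto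
  then have "summable (\<lambda>j. exp (- \<alpha> (Suc j)) * (LINT k|lborel. exp (- (real (Suc j) * dispersion \<xi> k))))"
    unfolding t using rho by simp
  then show ?thesis unfolding r_def t critical_density_def by (rule suminf_divide)
qed

lemma fraction_infinite_eq: "fraction_infinite \<xi> \<alpha> c \<rho> = ereal (max 0 (1 - critical_density \<xi> \<alpha> / \<rho>))"
  unfolding fraction_infinite_def
  using long_fraction_limit unfolding fraction_above_eq[symmetric] r_1_eq by (intro limI)

lemma longest_cycle_weak_conv:
  assumes "critical_density \<xi> \<alpha> < \<rho>"
  shows "weak_conv_m (\<lambda>N. distr (thermo_measure \<xi> \<alpha> c \<rho> N) borel
    (\<lambda>(x, \<pi>). real (longest_cycle N \<pi>) / ((1 - critical_density \<xi> \<alpha> / \<rho>) * real N))) (return borel 1)"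
proof -
  have rc: "r 1 < 1" using assms rho by (simp add: r_1_eq)
  have ev: "\<forall>\<^sub>F N in sequentially. weight_prob N (\<lambda>\<pi>. real (longest_cycle N \<pi>) / ((1 - r 1) * real N) \<le> x) =
    cdf (distr (thermo_measure \<xi> \<alpha> c \<rho> N) borel (\<lambda>(y, \<pi>). real (longest_cycle N \<pi>) / ((1 - r 1) * real N))) x" for x
    using eventually_box eventually_ge_at_top[of 1]
    by eventually_elim (rule cdf_thermo[symmetric])
  show ?thesis unfolding r_1_eq[symmetric]
    by (rule weak_conv_m_returnI; rule Lim_transform_eventually[OF _ ev]; rule longest_cycle_cdf_limit[OF rc])
qed

end

theorem theorem2p2:
  fixes \<xi> :: "real ^ 'd \<Rightarrow> ereal" and c :: "real \<Rightarrow> real ^ 'd"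
    and \<rho> \<gamma> \<rho>\<^sub>c :: real and \<alpha> :: "nat \<Rightarrow> real" and \<nu> :: ereal
  assumes "jump_function \<xi>"
    and "\<rho> > 0" and "\<gamma> > 0"
    and "\<And>j. j \<ge> 1 \<Longrightarrow> \<alpha> j = \<gamma> * ln (real j)"
  defines "\<rho>\<^sub>c \<equiv> critical_density \<xi> \<alpha>"
    and "\<nu> \<equiv> fraction_infinite \<xi> \<alpha> c \<rho>"
  shows "\<nu> = ereal (max 0 (1 - \<rho>\<^sub>c / \<rho>)) \<and>
    (0 < \<nu> \<longleftrightarrow> \<rho>\<^sub>c < \<rho>) \<and>
    (0 < \<nu> \<longrightarrow>
      weak_conv_m
        (\<lambda>N. distr (thermo_measure \<xi> \<alpha> c \<rho> N) borel
               (\<lambda>(x, \<pi>). real (longest_cycle N \<pi>) / (real_of_ereal \<nu> * real N)))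
        (return borel 1))"
proof -
  interpret thermo \<xi> \<rho> \<gamma> \<alpha> c
    using assms(1-4) by unfold_locales auto
  obtain C \<kappa> where "cycle_weights \<gamma> C \<kappa> excited_sum excited_density" using cycle_weights_ex by auto
  then interpret cycle_weights \<gamma> C \<kappa> excited_sum excited_density .
  interpret thermo_weights \<xi> \<rho> \<gamma> \<alpha> c C \<kappa> ..
  have nu: "\<nu> = ereal (max 0 (1 - \<rho>\<^sub>c / \<rho>))"
    unfolding \<nu>_def \<rho>\<^sub>c_def by (rule fraction_infinite_eq)
  have pos: "0 < \<nu> \<longleftrightarrow> \<rho>\<^sub>c < \<rho>"
    using assms(2) unfolding nu by (simp add: less_max_iff_disj)
  have "weak_conv_m
        (\<lambda>N. distr (thermo_measure \<xi> \<alpha> c \<rho> N) borel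
               (\<lambda>(x, \<pi>). real (longest_cycle N \<pi>) / (real_of_ereal \<nu> * real N)))
        (return borel 1)" if "\<rho>\<^sub>c < \<rho>"
  proof -
    have "real_of_ereal \<nu> = 1 - critical_density \<xi> \<alpha> / \<rho>"
      using that assms(2) unfolding nu \<rho>\<^sub>c_def by simp
    then show ?thesis using longest_cycle_weak_conv that unfolding \<rho>\<^sub>c_def by simp
  qed
  then show ?thesis using nu pos by blast
qed

end
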